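(* Let $A$ be a unital $C^*$-algebra, $H$ a finite dimensional $C^*$-Hopf algebra with dual $C^*$-Hopf algebra $H^0$, and let $1^0$ be the unit of $H^0$. Let $\rho$ and $\sigma$ be coactions of $H^0$ on $A$ which are exterior equivalent. Suppose that $\rho$ has the Rohlin property. Then there is a unitary element $x\in A$ such that $$\sigma=\mathrm{Ad}(x\otimes 1^0)\circ\rho\circ\mathrm{Ad}(x^* ).$$
   Context: $\mathrm{Ad}(v)(y)=vyv^*$ for a unitary $v$. Homomorphism means $*$-homomorphism. Hopf algebras. A finite dimensional $C^*$-Hopf algebra $K$ is a finite dimensional $C^*$-algebra with a Hopf algebra structure whose comultiplication $\Delta_K$ and counit $\epsilon_K$ are $*$-homomorphisms and whose antipode $S_K$ satisfies $S_K(S_K(k)^* )^*=k$. Sweedler notation: $\Delta_K(k)=k_{(1)}\otimes k_{(2)}$. The dual $C^*$-Hopf algebra $K^0$ is the dual space of $K$ with $(\phi\psi)(k)=\phi(k_{(1)})\psi(k_{(2)})$, unit $\epsilon_K$, comultiplication given by $\Delta_{K^0}(\phi)(k\otimes l)=\phi(kl)$, counit $\phi\mapsto\phi(1)$, antipode $\phi\mapsto\phi\circ S_K$, involution $\phi^*(k)=\overline{\phi(S_K(k)^* )}$. We identify $(K^0)^0=K$. For $H$ the structure maps are $\Delta,\epsilon,S$; for $H^0$ they are $\Delta^0,\epsilon^0,S^0$. Coactions. A weak coaction of $K$ on a unital $C^*$-algebra $A$ is a unital $*$-homomorphism $\rho:A\to A\otimes K$ with $(\mathrm{id}\otimes\epsilon_K)\circ\rho=\mathrm{id}$;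 it is a coaction if $(\rho\otimes\mathrm{id})\circ\rho=(\mathrm{id}\otimes\Delta_K)\circ\rho$. Coactions $\rho,\sigma$ of $K$ on $A$ are exterior equivalent if there is a unitary $v\in A\otimes K$ with $\sigma=\mathrm{Ad}(v)\circ\rho$ and $(v\otimes1)(\rho\otimes\mathrm{id})(v)=(\mathrm{id}\otimes\Delta_K)(v)$. Crossed product and dual coaction. A coaction $\rho$ of $K$ on $A$ gives an action of $K^0$ on $A$ by $\phi\cdot a=(\mathrm{id}\otimes\phi)(\rho(a))$. The crossed product $A\rtimes_\rho K^0$ is the unital $C^*$-algebra with underlying space $A\otimes K^0$ (elements $a\rtimes\phi$), product $(a\rtimes\phi)(b\rtimes\psi)=a[\phi_{(1)}\cdot b]\rtimes\phi_{(2)}\psi$ and involution $(a\rtimes\phi)^*=[\phi_{(1)}^*\cdot a^*]\rtimes\phi_{(2)}^*$. The dual coaction $\widehat\rho$ of $K^0$ on $A\rtimes_\rho K^0$ is $\widehat\rho(a\rtimes\phi)=(a\rtimes\phi_{(1)})\otimes\phi_{(2)}$. Rohlin property. For a unital $C^*$-algebra $B$, $B^\infty=l^\infty(\mathbb N,B)/c_0(B)$, and $B\subset B^\infty$ via constant sequences. For a coaction $\beta$ of $K$ on $B$, $\beta^\infty((b_n))=(\beta(b_n))$ is a coaction of $K$ on $B^\infty$. A coaction $\beta$ of $K$ on $B$ is approximately representable if there is a unitary $w\in B^\infty\otimes K$ such that (1) $\beta(b)=w(b\otimes1)w^*$ for all $b\in B$; (2) $(w\otimes1)(\iota\otimes\mathrm{id})(w)=(\mathrm{id}\otimes\Delta_K)(w)$,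 where $\iota:B^\infty\to B^\infty\otimes K$, $\iota(b)=b\otimes1$; (3) $(\beta^\infty\otimes\mathrm{id})(w)(w\otimes1)=(\mathrm{id}\otimes\Delta_K)(w)$. A coaction $\rho$ of $H^0$ on $A$ has the Rohlin property if the dual coaction $\widehat\rho$ of $H$ on $A\rtimes_\rho H$ is approximately representable. *)

theory Defs
  imports Complex_Main "HOL-Algebra.Module" "HOL-Algebra.QuotRing"
begin

section \<open>\<open>C\<^sup>*\<close>-algebras\<close>

record 'a star_alg = "(complex, 'a) module" +
  star :: "'a \<Rightarrow> 'a"

definition complex_alg :: "complex star_alg" where
  "complex_alg = \<lparr>carrier = UNIV, mult = (*), one = 1, zero = 0, add = (+), smult = (*), star = cnj\<rparr>"

locale star_algebra = ring A + module complex_alg A for A (structure) +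
  assumes smult_mult_left:
      "\<lbrakk>x \<in> carrier A; y \<in> carrier A\<rbrakk> \<Longrightarrow> (c \<odot> x) \<otimes> y = c \<odot> (x \<otimes> y)"
    and smult_mult_right:
      "\<lbrakk>x \<in> carrier A; y \<in> carrier A\<rbrakk> \<Longrightarrow> x \<otimes> (c \<odot> y) = c \<odot> (x \<otimes> y)"
    and star_closed: "x \<in> carrier A \<Longrightarrow> star A x \<in> carrier A"
    and star_add:
      "\<lbrakk>x \<in> carrier A; y \<in> carrier A\<rbrakk> \<Longrightarrow> star A (x \<oplus> y) = star A x \<oplus> star A y"
    and star_smult: "x \<in> carrier A \<Longrightarrow> star A (c \<odot> x) = cnj c \<odot> star A x"
    and star_mult:
      "\<lbrakk>x \<in> carrier A; y \<in> carrier A\<rbrakk> \<Longrightarrow> star A (x \<otimes> y) = star A y \<otimes> star A x"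
    and star_star: "x \<in> carrier A \<Longrightarrow> star A (star A x) = x"

locale cstar_algebra = star_algebra A for A (structure) +
  fixes nrm :: "'a \<Rightarrow> real"
  assumes nrm_nonneg: "x \<in> carrier A \<Longrightarrow> 0 \<le> nrm x"
    and nrm_eq_0: "x \<in> carrier A \<Longrightarrow> nrm x = 0 \<longleftrightarrow> x = \<zero>"
    and nrm_triangle:
      "\<lbrakk>x \<in> carrier A; y \<in> carrier A\<rbrakk> \<Longrightarrow> nrm (x \<oplus> y) \<le> nrm x + nrm y"
    and nrm_smult: "x \<in> carrier A \<Longrightarrow> nrm (c \<odot> x) = cmod c * nrm x"
    and nrm_mult:
      "\<lbrakk>x \<in> carrier A; y \<in> carrier A\<rbrakk> \<Longrightarrow> nrm (x \<otimes> y) \<le> nrm x * nrm y"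
    and cstar_identity: "x \<in> carrier A \<Longrightarrow> nrm (star A x \<otimes> x) = (nrm x)\<^sup>2"
    and complete:
      "\<lbrakk>\<And>n. X n \<in> carrier A;
        \<And>e. e > 0 \<Longrightarrow> \<exists>M. \<forall>m\<ge>M. \<forall>n\<ge>M. nrm (X m \<ominus> X n) < e\<rbrakk>
       \<Longrightarrow> \<exists>x\<in>carrier A. (\<lambda>n. nrm (X n \<ominus> x)) \<longlonglongrightarrow> 0"

definition star_hom ::
  "('a, 'm) star_alg_scheme \<Rightarrow> ('b, 'n) star_alg_scheme \<Rightarrow> ('a \<Rightarrow> 'b) \<Rightarrow> bool" where
  "star_hom A B f \<longleftrightarrow>
     f \<in> ring_hom A B \<and>
     (\<forall>c. \<forall>x\<in>carrier A. f (c \<odot>\<^bsub>A\<^esub> x) = c \<odot>\<^bsub>B\<^esub> f x) \<and>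
     (\<forall>x\<in>carrier A. f (star A x) = star B (f x))"

definition unitary :: "('a, 'm) star_alg_scheme \<Rightarrow> 'a \<Rightarrow> bool" where
  "unitary A u \<longleftrightarrow> u \<in> carrier A \<and> star A u \<otimes>\<^bsub>A\<^esub> u = \<one>\<^bsub>A\<^esub> \<and> u \<otimes>\<^bsub>A\<^esub> star A u = \<one>\<^bsub>A\<^esub>"

definition Ad :: "('a, 'm) star_alg_scheme \<Rightarrow> 'a \<Rightarrow> 'a \<Rightarrow> 'a" where
  "Ad A v y = v \<otimes>\<^bsub>A\<^esub> y \<otimes>\<^bsub>A\<^esub> star A v"

definition list_sum :: "('a, 'm) ring_scheme \<Rightarrow> 'a list \<Rightarrow> 'a" where
  "list_sum A xs = foldr (\<lambda>x s. x \<oplus>\<^bsub>A\<^esub> s) xs \<zero>\<^bsub>A\<^esub>"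

section \<open>Tensor products\<close>

text \<open>
  The tensor product of two complex vector spaces is the quotient of the formal finite sums
  \<open>a\<^sub>1 \<otimes> k\<^sub>1 + \<dots> + a\<^sub>n \<otimes> k\<^sub>n\<close>, written as lists of pairs, by the congruence generated by
  bilinearity; a tensor is the set of all lists that represent it.  Since one factor will always
  be finite dimensional, the algebraic tensor product is already the \<open>C\<^sup>*\<close>-tensor product, and as a
  *-algebra it does not depend on a choice of norm.
\<close>

inductive tensor_eq ::
  "(complex, 'a, 'm) module_scheme \<Rightarrow> (complex, 'k, 'n) module_scheme \<Rightarrow>
   ('a \<times> 'k) list \<Rightarrow> ('a \<times> 'k) list \<Rightarrow> bool" for A K where
  refl: "set xs \<subseteq> carrier A \<times> carrier K \<Longrightarrow> tensor_eq A K xs xs"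
| sym: "tensor_eq A K xs ys \<Longrightarrow> tensor_eq A K ys xs"
| trans: "\<lbrakk>tensor_eq A K xs ys; tensor_eq A K ys zs\<rbrakk> \<Longrightarrow> tensor_eq A K xs zs"
| append: "\<lbrakk>tensor_eq A K xs xs'; tensor_eq A K ys ys'\<rbrakk> \<Longrightarrow> tensor_eq A K (xs @ ys) (xs' @ ys')"
| commute: "\<lbrakk>set xs \<subseteq> carrier A \<times> carrier K; set ys \<subseteq> carrier A \<times> carrier K\<rbrakk>
    \<Longrightarrow> tensor_eq A K (xs @ ys) (ys @ xs)"
| add_left: "\<lbrakk>a \<in> carrier A; b \<in> carrier A; k \<in> carrier K\<rbrakk>
    \<Longrightarrow> tensor_eq A K [(a \<oplus>\<^bsub>A\<^esub> b, k)] [(a, k), (b, k)]"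
| add_right: "\<lbrakk>a \<in> carrier A; k \<in> carrier K; l \<in> carrier K\<rbrakk>
    \<Longrightarrow> tensor_eq A K [(a, k \<oplus>\<^bsub>K\<^esub> l)] [(a, k), (a, l)]"
| scalar: "\<lbrakk>a \<in> carrier A; k \<in> carrier K\<rbrakk>
    \<Longrightarrow> tensor_eq A K [(c \<odot>\<^bsub>A\<^esub> a, k)] [(a, c \<odot>\<^bsub>K\<^esub> k)]"
| zero: "k \<in> carrier K \<Longrightarrow> tensor_eq A K [(\<zero>\<^bsub>A\<^esub>, k)] []"

definition tclass ::
  "(complex, 'a, 'm) module_scheme \<Rightarrow> (complex, 'k, 'n) module_scheme \<Rightarrow>
   ('a \<times> 'k) list \<Rightarrow> ('a \<times> 'k) list set" where
  "tclass A K xs = {ys. tensor_eq A K xs ys}"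

definition tens ::
  "(complex, 'a, 'm) module_scheme \<Rightarrow> (complex, 'k, 'n) module_scheme \<Rightarrow>
   'a \<Rightarrow> 'k \<Rightarrow> ('a \<times> 'k) list set" where
  "tens A K a k = tclass A K [(a, k)]"

text \<open>
  A representing finite sum.  Maps on tensor products are defined below by a formula on elementary
  tensors, summed over \<open>terms x\<close>; each formula is balanced and biadditive in the two components,
  so that the value does not depend on the choice of the representative.
\<close>

definition terms :: "('a \<times> 'k) list set \<Rightarrow> ('a \<times> 'k) list" where
  "terms x = (SOME xs. xs \<in> x)"

definition tensor ::
  "('a, 'm) star_alg_scheme \<Rightarrow> ('k, 'n) star_alg_scheme \<Rightarrow> ('a \<times> 'k) list set star_alg" where
  "tensor A K =
    \<lparr>carrier = {tclass A K xs | xs. set xs \<subseteq> carrier A \<times> carrier K},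
     mult = (\<lambda>x y. tclass A K [(a \<otimes>\<^bsub>A\<^esub> b, k \<otimes>\<^bsub>K\<^esub> l). (a, k) \<leftarrow> terms x, (b, l) \<leftarrow> terms y]),
     one = tens A K \<one>\<^bsub>A\<^esub> \<one>\<^bsub>K\<^esub>,
     zero = tclass A K [],
     add = (\<lambda>x y. tclass A K (terms x @ terms y)),
     smult = (\<lambda>c x. tclass A K [(c \<odot>\<^bsub>A\<^esub> a, k). (a, k) \<leftarrow> terms x]),
     star = (\<lambda>x. tclass A K [(star A a, star K k). (a, k) \<leftarrow> terms x])\<rparr>"

text \<open>The map \<open>f \<otimes> g\<close> with values in \<open>A \<otimes> K\<close>.\<close>

definition tmap ::
  "(complex, 'b, 'm) module_scheme \<Rightarrow> (complex, 'l, 'n) module_scheme \<Rightarrow>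
   ('a \<Rightarrow> 'b) \<Rightarrow> ('k \<Rightarrow> 'l) \<Rightarrow> ('a \<times> 'k) list set \<Rightarrow> ('b \<times> 'l) list set" where
  "tmap A K f g x = tclass A K [(f a, g k). (a, k) \<leftarrow> terms x]"

text \<open>The slice map \<open>id \<otimes> \<phi> : A \<otimes> K \<rightarrow> A\<close>.\<close>

definition slice ::
  "(complex, 'a, 'm) module_scheme \<Rightarrow> ('k \<Rightarrow> complex) \<Rightarrow> ('a \<times> 'k) list set \<Rightarrow> 'a" where
  "slice A \<phi> x = list_sum A [\<phi> k \<odot>\<^bsub>A\<^esub> a. (a, k) \<leftarrow> terms x]"

text \<open>The canonical identification \<open>(A \<otimes> K) \<otimes> L \<rightarrow> A \<otimes> (K \<otimes> L)\<close>.\<close>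

definition tassoc ::
  "('a, 'm) star_alg_scheme \<Rightarrow> ('k, 'n) star_alg_scheme \<Rightarrow> ('l, 'o) star_alg_scheme \<Rightarrow>
   (('a \<times> 'k) list set \<times> 'l) list set \<Rightarrow> ('a \<times> ('k \<times> 'l) list set) list set" where
  "tassoc A K L x =
     tclass A (tensor K L) [(a, tens K L k l). (t, l) \<leftarrow> terms x, (a, k) \<leftarrow> terms t]"

section \<open>Finite dimensional \<open>C\<^sup>*\<close>-Hopf algebras\<close>

record 'k hopf = "'k star_alg" +
  comult :: "'k \<Rightarrow> ('k \<times> 'k) list set"
  counit :: "'k \<Rightarrow> complex"
  antipode :: "'k \<Rightarrow> 'k"

locale cstar_hopf_algebra = cstar_algebra K nrm for K :: "('k, 'm) hopf_scheme" (structure) and nrm +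
  assumes finite_dim:
      "\<exists>n e. (\<forall>i<(n::nat). e i \<in> carrier K) \<and>
             (\<forall>x\<in>carrier K. \<exists>c. x = (\<Oplus>i\<in>{..<n}. c i \<odot> e i))"
    and comult_hom: "star_hom K (tensor K K) (comult K)"
    and counit_hom: "star_hom K complex_alg (counit K)"
    and coassoc: "k \<in> carrier K \<Longrightarrow>
      tassoc K K K (tmap (tensor K K) K (comult K) id (comult K k))
        = tmap K (tensor K K) id (comult K) (comult K k)"
    and counit_left: "k \<in> carrier K \<Longrightarrow>
      list_sum K [counit K k1 \<odot> k2. (k1, k2) \<leftarrow> terms (comult K k)] = k"
    and counit_right: "k \<in> carrier K \<Longrightarrow>
      list_sum K [counit K k2 \<odot> k1. (k1, k2) \<leftarrow> terms (comult K k)] = k"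
    and antipode_closed: "k \<in> carrier K \<Longrightarrow> antipode K k \<in> carrier K"
    and antipode_add: "\<lbrakk>k \<in> carrier K; l \<in> carrier K\<rbrakk> \<Longrightarrow>
      antipode K (k \<oplus> l) = antipode K k \<oplus> antipode K l"
    and antipode_smult: "k \<in> carrier K \<Longrightarrow> antipode K (c \<odot> k) = c \<odot> antipode K k"
    and antipode_left: "k \<in> carrier K \<Longrightarrow>
      list_sum K [antipode K k1 \<otimes> k2. (k1, k2) \<leftarrow> terms (comult K k)] = counit K k \<odot> \<one>"
    and antipode_right: "k \<in> carrier K \<Longrightarrow>
      list_sum K [k1 \<otimes> antipode K k2. (k1, k2) \<leftarrow> terms (comult K k)] = counit K k \<odot> \<one>"
    and antipode_star: "k \<in> carrier K \<Longrightarrow> star K (antipode K (star K (antipode K k))) = k"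

definition functionals :: "(complex, 'k, 'm) module_scheme \<Rightarrow> ('k \<Rightarrow> complex) set" where
  "functionals K = {\<phi> \<in> extensional (carrier K).
     (\<forall>k\<in>carrier K. \<forall>l\<in>carrier K. \<phi> (k \<oplus>\<^bsub>K\<^esub> l) = \<phi> k + \<phi> l) \<and>
     (\<forall>c. \<forall>k\<in>carrier K. \<phi> (c \<odot>\<^bsub>K\<^esub> k) = c * \<phi> k)}"

definition dual_star_alg :: "('k, 'm) hopf_scheme \<Rightarrow> ('k \<Rightarrow> complex) star_alg" where
  "dual_star_alg K =
    \<lparr>carrier = functionals K,
     mult = (\<lambda>\<phi> \<psi>. \<lambda>k\<in>carrier K. \<Sum>(k1, k2) \<leftarrow> terms (comult K k). \<phi> k1 * \<psi> k2),
     one = restrict (counit K) (carrier K),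
     zero = (\<lambda>k\<in>carrier K. 0),
     add = (\<lambda>\<phi> \<psi>. \<lambda>k\<in>carrier K. \<phi> k + \<psi> k),
     smult = (\<lambda>c \<phi>. \<lambda>k\<in>carrier K. c * \<phi> k),
     star = (\<lambda>\<phi>. \<lambda>k\<in>carrier K. cnj (\<phi> (star K (antipode K k))))\<rparr>"

text \<open>
  The comultiplication of the dual is the transpose of the multiplication; the tensor in the
  description exists and is unique because \<open>K\<close> is finite dimensional.
\<close>

definition dual :: "('k, 'm) hopf_scheme \<Rightarrow> ('k \<Rightarrow> complex) hopf" where
  "dual K = star_alg.extend (dual_star_alg K)
    (hopf.fields
      (\<lambda>\<phi>. THE t. t \<in> carrier (tensor (dual_star_alg K) (dual_star_alg K)) \<and>
         (\<forall>k\<in>carrier K. \<forall>l\<in>carrier K.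
            (\<Sum>(\<alpha>, \<beta>) \<leftarrow> terms t. \<alpha> k * \<beta> l) = \<phi> (k \<otimes>\<^bsub>K\<^esub> l)))
      (\<lambda>\<phi>. \<phi> \<one>\<^bsub>K\<^esub>)
      (\<lambda>\<phi>. \<lambda>k\<in>carrier K. \<phi> (antipode K k)))"

section \<open>Coactions\<close>

definition coaction ::
  "('a, 'm) star_alg_scheme \<Rightarrow> ('k, 'n) hopf_scheme \<Rightarrow> ('a \<Rightarrow> ('a \<times> 'k) list set) \<Rightarrow> bool" where
  "coaction A K \<rho> \<longleftrightarrow>
     star_hom A (tensor A K) \<rho> \<and>
     (\<forall>a\<in>carrier A. slice A (counit K) (\<rho> a) = a) \<and>
     (\<forall>a\<in>carrier A. tassoc A K K (tmap (tensor A K) K \<rho> id (\<rho> a))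
                      = tmap A (tensor K K) id (comult K) (\<rho> a))"

definition exterior_equivalent ::
  "('a, 'm) star_alg_scheme \<Rightarrow> ('k, 'n) hopf_scheme \<Rightarrow>
   ('a \<Rightarrow> ('a \<times> 'k) list set) \<Rightarrow> ('a \<Rightarrow> ('a \<times> 'k) list set) \<Rightarrow> bool" where
  "exterior_equivalent A K \<rho> \<sigma> \<longleftrightarrow>
     (\<exists>v. unitary (tensor A K) v \<and>
        (\<forall>a\<in>carrier A. \<sigma> a = Ad (tensor A K) v (\<rho> a)) \<and>
        tassoc A K K
          (tens (tensor A K) K v \<one>\<^bsub>K\<^esub> \<otimes>\<^bsub>tensor (tensor A K) K\<^esub> tmap (tensor A K) K \<rho> id v)
          = tmap A (tensor K K) id (comult K) v)"

section \<open>Crossed products\<close>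

text \<open>
  Here \<open>\<rho>\<close> is a coaction on \<open>A\<close> of the dual of \<open>H\<close>.  An element \<open>h\<close> of \<open>H\<close>, regarded as an element
  of the bidual, is the functional \<open>\<phi> \<mapsto> \<phi> h\<close>.
\<close>

definition action ::
  "('a, 'm) star_alg_scheme \<Rightarrow> ('a \<Rightarrow> ('a \<times> ('h \<Rightarrow> complex)) list set) \<Rightarrow> 'h \<Rightarrow> 'a \<Rightarrow> 'a" where
  "action A \<rho> h a = slice A (\<lambda>\<phi>. \<phi> h) (\<rho> a)"

definition crossed_product ::
  "('a, 'm) star_alg_scheme \<Rightarrow> ('h, 'n) hopf_scheme \<Rightarrow>
   ('a \<Rightarrow> ('a \<times> ('h \<Rightarrow> complex)) list set) \<Rightarrow> ('a \<times> 'h) list set star_alg" where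
  "crossed_product A H \<rho> = (tensor A H)
    \<lparr>mult := (\<lambda>x y. tclass A H
       [(a \<otimes>\<^bsub>A\<^esub> action A \<rho> h1 b, h2 \<otimes>\<^bsub>H\<^esub> g).
          (a, h) \<leftarrow> terms x, (b, g) \<leftarrow> terms y, (h1, h2) \<leftarrow> terms (comult H h)]),
     star := (\<lambda>x. tclass A H
       [(action A \<rho> (star H h1) (star A a), star H h2).
          (a, h) \<leftarrow> terms x, (h1, h2) \<leftarrow> terms (comult H h)])\<rparr>"

definition dual_coaction ::
  "('a, 'm) star_alg_scheme \<Rightarrow> ('h, 'n) hopf_scheme \<Rightarrow>
   ('a \<Rightarrow> ('a \<times> ('h \<Rightarrow> complex)) list set) \<Rightarrow>
   ('a \<times> 'h) list set \<Rightarrow> (('a \<times> 'h) list set \<times> 'h) list set" where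
  "dual_coaction A H \<rho> x = tclass (crossed_product A H \<rho>) H
     [(tens A H a h1, h2). (a, h) \<leftarrow> terms x, (h1, h2) \<leftarrow> terms (comult H h)]"

section \<open>Sequence algebras and the Rohlin property\<close>

definition linf :: "('b, 'm) star_alg_scheme \<Rightarrow> ('b \<Rightarrow> real) \<Rightarrow> (nat \<Rightarrow> 'b) star_alg" where
  "linf B nrm =
    \<lparr>carrier = {s. (\<forall>n. s n \<in> carrier B) \<and> (\<exists>C. \<forall>n. nrm (s n) \<le> C)},
     mult = (\<lambda>s t n. s n \<otimes>\<^bsub>B\<^esub> t n),
     one = (\<lambda>n. \<one>\<^bsub>B\<^esub>),
     zero = (\<lambda>n. \<zero>\<^bsub>B\<^esub>),
     add = (\<lambda>s t n. s n \<oplus>\<^bsub>B\<^esub> t n),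
     smult = (\<lambda>c s n. c \<odot>\<^bsub>B\<^esub> s n),
     star = (\<lambda>s n. star B (s n))\<rparr>"

definition c0 :: "('b, 'm) star_alg_scheme \<Rightarrow> ('b \<Rightarrow> real) \<Rightarrow> (nat \<Rightarrow> 'b) set" where
  "c0 B nrm = {s. (\<forall>n. s n \<in> carrier B) \<and> (\<lambda>n. nrm (s n)) \<longlonglongrightarrow> 0}"

definition seq_class ::
  "('b, 'm) star_alg_scheme \<Rightarrow> ('b \<Rightarrow> real) \<Rightarrow> (nat \<Rightarrow> 'b) \<Rightarrow> (nat \<Rightarrow> 'b) set" where
  "seq_class B nrm s = c0 B nrm +>\<^bsub>linf B nrm\<^esub> s"

text \<open>The quotient ring \<open>l\<^sup>\<infinity>(B) / c\<^sub>0(B)\<close> with the induced scalar multiplication and involution.\<close>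

definition seq_alg :: "('b, 'm) star_alg_scheme \<Rightarrow> ('b \<Rightarrow> real) \<Rightarrow> (nat \<Rightarrow> 'b) set star_alg" where
  "seq_alg B nrm = ring.extend (linf B nrm Quot c0 B nrm)
    \<lparr>smult = (\<lambda>c S. \<Union>s\<in>S. seq_class B nrm (c \<odot>\<^bsub>linf B nrm\<^esub> s)),
     star = (\<lambda>S. \<Union>s\<in>S. seq_class B nrm (star (linf B nrm) s))\<rparr>"

text \<open>
  The map induced by \<open>\<beta> : B \<rightarrow> B \<otimes> K\<close> on classes of sequences takes the class of \<open>(b\<^sub>n)\<close> to the
  class of \<open>(\<beta> b\<^sub>n)\<close> in \<open>(B \<otimes> K)\<^sup>\<infinity>\<close>, which is identified with \<open>B\<^sup>\<infinity> \<otimes> K\<close> as follows: \<open>K\<close> being finite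
  dimensional, every bounded sequence in \<open>B \<otimes> K\<close> consists of the values at \<open>n\<close> of a unique element
  \<open>T\<close> of \<open>l\<^sup>\<infinity>(B) \<otimes> K\<close>, and the class of the sequence corresponds to the image of \<open>T\<close> in \<open>B\<^sup>\<infinity> \<otimes> K\<close>.
\<close>

definition seq_coaction ::
  "('b, 'm) star_alg_scheme \<Rightarrow> ('b \<Rightarrow> real) \<Rightarrow> ('k, 'n) hopf_scheme \<Rightarrow>
   ('b \<Rightarrow> ('b \<times> 'k) list set) \<Rightarrow> (nat \<Rightarrow> 'b) set \<Rightarrow> ((nat \<Rightarrow> 'b) set \<times> 'k) list set" where
  "seq_coaction B nrm K \<beta> S =
    (THE t. \<exists>b\<in>S. \<exists>T\<in>carrier (tensor (linf B nrm) K).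
       (\<forall>n. tmap B K (\<lambda>s. s n) id T = \<beta> (b n)) \<and>
       t = tmap (seq_alg B nrm) K (seq_class B nrm) id T)"

definition approximately_representable ::
  "('b, 'm) star_alg_scheme \<Rightarrow> ('b \<Rightarrow> real) \<Rightarrow> ('k, 'n) hopf_scheme \<Rightarrow>
   ('b \<Rightarrow> ('b \<times> 'k) list set) \<Rightarrow> bool" where
  "approximately_representable B nrm K \<beta> \<longleftrightarrow>
    (let Binf = seq_alg B nrm;
         const = (\<lambda>b. seq_class B nrm (\<lambda>n. b));
         BK = tensor Binf K;
         BKK = tensor BK K
     in \<exists>w. unitary BK w \<and>
          (\<forall>b\<in>carrier B. tmap Binf K const id (\<beta> b) = Ad BK w (tens Binf K (const b) \<one>\<^bsub>K\<^esub>)) \<and>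
          tassoc Binf K K
            (tens BK K w \<one>\<^bsub>K\<^esub> \<otimes>\<^bsub>BKK\<^esub> tmap BK K (\<lambda>x. tens Binf K x \<one>\<^bsub>K\<^esub>) id w)
            = tmap Binf (tensor K K) id (comult K) w \<and>
          tassoc Binf K K
            (tmap BK K (seq_coaction B nrm K \<beta>) id w \<otimes>\<^bsub>BKK\<^esub> tens BK K w \<one>\<^bsub>K\<^esub>)
            = tmap Binf (tensor K K) id (comult K) w)"

text \<open>
  The norm of the crossed product is its \<open>C\<^sup>*\<close>-norm; it exists, and it is unique since a complete
  \<open>C\<^sup>*\<close>-norm is determined by the *-algebra.
\<close>

definition rohlin_property ::
  "('a, 'm) star_alg_scheme \<Rightarrow> ('h, 'n) hopf_scheme \<Rightarrow>
   ('a \<Rightarrow> ('a \<times> ('h \<Rightarrow> complex)) list set) \<Rightarrow> bool" where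
  "rohlin_property A H \<rho> \<longleftrightarrow>
    (\<exists>nrm. cstar_algebra (crossed_product A H \<rho>) nrm \<and>
       approximately_representable (crossed_product A H \<rho>) nrm H (dual_coaction A H \<rho>))"

end

theory Submission
  imports Defs
begin

text \<open>
  Let \<open>B = A \<rtimes> H\<close>, let \<open>B\<^sup>\<infinity>\<close> be its sequence algebra, and let \<open>v\<close> be the unitary with \<open>\<sigma> = Ad(v) \<rho>\<close>.  It
  suffices to find a unitary \<open>x\<close> of \<open>A\<close> with \<open>v \<rho>(x) = x \<otimes> 1\<close>, because then \<open>v = (x \<otimes> 1) \<rho>(x\<^sup>*)\<close>
  (\<open>Ad_trivialized\<close>).  Write \<open>v(h)\<close> for the slice of \<open>v\<close> at \<open>h\<close>.  Besides \<open>h \<mapsto> 1 \<rtimes> h\<close>, also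
  \<open>h \<mapsto> v(h\<^sub>1) \<rtimes> h\<^sub>2\<close> is a representation of \<open>H\<close> in \<open>B\<close>, by the cocycle identity of \<open>v\<close>, and
  \<open>v \<rho>(x) = x \<otimes> 1\<close> says that \<open>x\<close> intertwines the two (\<open>intertwiner_iff\<close>).  So a unitary intertwiner in
  \<open>A\<close> is wanted.

  The unitary \<open>w\<close> that represents the dual coaction is, through its slices \<open>W(\<phi>)\<close>, a *-representation of
  the algebra \<open>H\<^sup>0\<close> in \<open>B\<^sup>\<infinity>\<close>, covariant with respect to both representations of \<open>H\<close> (\<open>W_rep\<close>).  It is
  faithful unless \<open>B = 0\<close>, and since \<open>b\<^sup>*b = 0\<close> forces \<open>b = 0\<close> in \<open>B\<^sup>\<infinity>\<close>, this makes \<open>H\<^sup>0\<close> contain a Haar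
  functional \<open>\<tau>\<close> (\<open>exists_haar\<close>).  The form \<open>\<tau>(xy)\<close> is nondegenerate and gives dual bases
  \<open>e\<^sub>k, e'\<^sub>k\<close> of \<open>H\<close>.  The projection \<open>p = W(\<tau>)\<close> is the Rohlin projection: it is invariant by the second
  cocycle identity of \<open>w\<close>, hence a class of a sequence in \<open>A\<close> (\<open>p_sequence\<close>); it compresses each of the two
  representations to \<open>\<tau>\<close> (\<open>p_rep_p\<close>); and \<open>\<Sum> R(e\<^sub>k) p R(e'\<^sub>k) = 1\<close> for each of them (\<open>casimir_sum_p\<close>).
  Therefore \<open>\<Sum> R\<^sub>v(e\<^sub>k) p R\<^sub>1(e'\<^sub>k)\<close> is a unitary intertwiner in \<open>B\<^sup>\<infinity>\<close> (\<open>casimir_sum_unitary\<close>).  For a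
  finite group this is the familiar sum \<open>\<Sum> v\<^sub>g p\<^sub>g\<close> over a Rohlin partition of unity.

  The same sum with \<open>a \<in> A\<close> in place of \<open>p\<close> lies in \<open>A\<close> and intertwines exactly (\<open>casimir_sum_ja\<close>).  So
  the intertwiner is represented by exact intertwiners in \<open>A\<close> that are almost unitary.  Newton's iteration
  for the unitary part keeps the intertwining relation and converges from a late term of the sequence
  (\<open>unitary_from_sequence\<close>); its limit belongs to \<open>A\<close>, the fixed points of the expectation given by \<open>\<tau>\<close>.
\<close>

section \<open>Complex vector spaces, linear maps and sums over lists\<close>

lemma complex_alg_sel [simp]:
  "carrier complex_alg = UNIV" "mult complex_alg = (*)" "one complex_alg = 1"
  "zero complex_alg = 0" "add complex_alg = (+)" "smult complex_alg = (*)" "star complex_alg = cnj"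
  by (simp_all add: complex_alg_def)

lemma cring_complex_alg: "cring complex_alg"
  by (rule cringI[OF abelian_groupI comm_monoidI])
    (auto simp: algebra_simps intro: exI[of _ "- x" for x])

locale cspace = module complex_alg M for M (structure)
begin

lemma scale_closed: "x \<in> carrier M \<Longrightarrow> c \<odot> x \<in> carrier M"
  by simp

lemma scale_add_left: "x \<in> carrier M \<Longrightarrow> (a + b) \<odot> x = a \<odot> x \<oplus> b \<odot> x"
  using smult_l_distr[of a b x] by simp

lemma scale_add_right:
  "x \<in> carrier M \<Longrightarrow> y \<in> carrier M \<Longrightarrow> c \<odot> (x \<oplus> y) = c \<odot> x \<oplus> c \<odot> y"
  using smult_r_distr[of c x y] by simp

lemma scale_scale: "x \<in> carrier M \<Longrightarrow> a \<odot> (b \<odot> x) = (a * b) \<odot> x"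
  using smult_assoc1[of a b x] by simp

lemma scale_one: "x \<in> carrier M \<Longrightarrow> 1 \<odot> x = x"
  using smult_one[of x] by simp

lemma scale_zero: "x \<in> carrier M \<Longrightarrow> 0 \<odot> x = \<zero>"
  using smult_l_null[of x] by simp

lemma scale_zero_right: "c \<odot> \<zero> = \<zero>"
  using smult_r_null[of c] by simp

lemma scale_minus: "x \<in> carrier M \<Longrightarrow> (- 1) \<odot> x = \<ominus> x"
proof -
  assume x: "x \<in> carrier M"
  have "(-1) \<odot> x \<oplus> x = (-1 + 1) \<odot> x"
    using x by (simp only: scale_add_left scale_one)
  also have "\<dots> = \<zero>" using x by (simp add: scale_zero)
  finally show ?thesis using x M.minus_equality by fastforce
qed

end

abbreviation lsum where "lsum M f xs \<equiv> list_sum M (map f xs)"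

lemma list_sum_Nil [simp]: "list_sum M [] = \<zero>\<^bsub>M\<^esub>"
  and list_sum_Cons [simp]: "list_sum M (x # xs) = x \<oplus>\<^bsub>M\<^esub> list_sum M xs"
  by (simp_all add: list_sum_def)

lemma list_sum_complex: "list_sum complex_alg xs = sum_list xs"
  by (induction xs) simp_all

lemma lsum_cong:
  "(\<And>x. x \<in> set xs \<Longrightarrow> f x = g x) \<Longrightarrow> lsum M f xs = lsum M g xs"
  by (metis map_cong)

lemma lsum_cong_upt:
  "(\<And>i. i < n \<Longrightarrow> f i = g i) \<Longrightarrow> lsum M f [0..<n] = lsum M g [0..<n]"
  by (rule lsum_cong) simp

definition lin ::
  "(complex, 'a, 'm) module_scheme \<Rightarrow> (complex, 'b, 'n) module_scheme \<Rightarrow> ('a \<Rightarrow> 'b) \<Rightarrow> bool" where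
  "lin M N f \<longleftrightarrow> (\<forall>x\<in>carrier M. f x \<in> carrier N) \<and>
     (\<forall>x\<in>carrier M. \<forall>y\<in>carrier M. f (x \<oplus>\<^bsub>M\<^esub> y) = f x \<oplus>\<^bsub>N\<^esub> f y) \<and>
     (\<forall>c. \<forall>x\<in>carrier M. f (c \<odot>\<^bsub>M\<^esub> x) = c \<odot>\<^bsub>N\<^esub> f x)"

definition bil ::
  "(complex, 'a, 'm) module_scheme \<Rightarrow> (complex, 'k, 'n) module_scheme \<Rightarrow>
   (complex, 'b, 'o) module_scheme \<Rightarrow> ('a \<Rightarrow> 'k \<Rightarrow> 'b) \<Rightarrow> bool" where
  "bil A K M f \<longleftrightarrow> (\<forall>a\<in>carrier A. lin K M (f a)) \<and> (\<forall>k\<in>carrier K. lin A M (\<lambda>a. f a k))"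

lemma linI:
  assumes "\<And>x. x \<in> carrier M \<Longrightarrow> f x \<in> carrier N"
    and "\<And>x y. x \<in> carrier M \<Longrightarrow> y \<in> carrier M \<Longrightarrow> f (x \<oplus>\<^bsub>M\<^esub> y) = f x \<oplus>\<^bsub>N\<^esub> f y"
    and "\<And>c x. x \<in> carrier M \<Longrightarrow> f (c \<odot>\<^bsub>M\<^esub> x) = c \<odot>\<^bsub>N\<^esub> f x"
  shows "lin M N f"
  using assms by (simp add: lin_def)

lemma linD:
  assumes "lin M N f"
  shows "x \<in> carrier M \<Longrightarrow> f x \<in> carrier N"
    and "x \<in> carrier M \<Longrightarrow> y \<in> carrier M \<Longrightarrow> f (x \<oplus>\<^bsub>M\<^esub> y) = f x \<oplus>\<^bsub>N\<^esub> f y"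
    and "x \<in> carrier M \<Longrightarrow> f (c \<odot>\<^bsub>M\<^esub> x) = c \<odot>\<^bsub>N\<^esub> f x"
  using assms by (auto simp: lin_def)

lemma bilI:
  assumes "\<And>a. a \<in> carrier A \<Longrightarrow> lin K M (\<lambda>k. f a k)"
    and "\<And>k. k \<in> carrier K \<Longrightarrow> lin A M (\<lambda>a. f a k)"
  shows "bil A K M f"
  using assms by (simp add: bil_def)

lemma bilD:
  assumes "bil A K M f"
  shows "a \<in> carrier A \<Longrightarrow> lin K M (f a)" and "k \<in> carrier K \<Longrightarrow> lin A M (\<lambda>a. f a k)"
    and "a \<in> carrier A \<Longrightarrow> k \<in> carrier K \<Longrightarrow> f a k \<in> carrier M"
  using assms by (auto simp: bil_def lin_def)

lemma lin_id: "lin M M (\<lambda>x. x)"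
  by (rule linI) auto

lemma lin_comp: "lin N P g \<Longrightarrow> lin M N f \<Longrightarrow> lin M P (\<lambda>x. g (f x))"
  by (auto simp: lin_def)

lemma lin_zero:
  assumes "cspace M" "cspace N" "lin M N f"
  shows "f \<zero>\<^bsub>M\<^esub> = \<zero>\<^bsub>N\<^esub>"
proof -
  interpret M: cspace M by fact
  interpret N: cspace N by fact
  have "f \<zero>\<^bsub>M\<^esub> = f (0 \<odot>\<^bsub>M\<^esub> \<zero>\<^bsub>M\<^esub>)" by (simp only: M.scale_zero_right)
  also have "\<dots> = 0 \<odot>\<^bsub>N\<^esub> f \<zero>\<^bsub>M\<^esub>" by (rule linD(3)[OF assms(3)]) simp
  also have "\<dots> = \<zero>\<^bsub>N\<^esub>" by (rule N.scale_zero) (simp add: linD(1)[OF assms(3)])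
  finally show ?thesis .
qed

context cspace
begin

lemma list_sum_closed: "set xs \<subseteq> carrier M \<Longrightarrow> list_sum M xs \<in> carrier M"
  by (induction xs) auto

lemma lsum_closed: "(\<And>x. x \<in> set xs \<Longrightarrow> f x \<in> carrier M) \<Longrightarrow> lsum M f xs \<in> carrier M"
  by (rule list_sum_closed) auto

lemma list_sum_append:
  "set xs \<subseteq> carrier M \<Longrightarrow> set ys \<subseteq> carrier M \<Longrightarrow>
    list_sum M (xs @ ys) = list_sum M xs \<oplus> list_sum M ys"
  by (induction xs) (auto simp: list_sum_closed M.a_assoc)

lemma lsum_add:
  "(\<And>x. x \<in> set xs \<Longrightarrow> f x \<in> carrier M) \<Longrightarrow> (\<And>x. x \<in> set xs \<Longrightarrow> g x \<in> carrier M) \<Longrightarrow>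
    lsum M (\<lambda>x. f x \<oplus> g x) xs = lsum M f xs \<oplus> lsum M g xs"
proof (induction xs)
  case (Cons x xs)
  have "lsum M f xs \<in> carrier M" "lsum M g xs \<in> carrier M"
    using Cons.prems by (auto intro!: lsum_closed)
  then show ?case using Cons by (simp add: M.add.m_ac)
qed simp

lemma lsum_zero: "lsum M (\<lambda>x. \<zero>) xs = \<zero>"
  by (induction xs) auto

lemma lsum_scale:
  "(\<And>x. x \<in> set xs \<Longrightarrow> f x \<in> carrier M) \<Longrightarrow> lsum M (\<lambda>x. c \<odot> f x) xs = c \<odot> lsum M f xs"
  by (induction xs) (auto simp: scale_zero_right scale_add_right lsum_closed)

lemma lsum_swap:
  "(\<And>x y. x \<in> set xs \<Longrightarrow> y \<in> set ys \<Longrightarrow> f x y \<in> carrier M) \<Longrightarrow>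
    lsum M (\<lambda>x. lsum M (\<lambda>y. f x y) ys) xs = lsum M (\<lambda>y. lsum M (\<lambda>x. f x y) xs) ys"
proof (induction xs)
  case Nil
  then show ?case by (simp add: lsum_zero)
next
  case (Cons x xs)
  then show ?case by (simp add: lsum_add lsum_closed)
qed

lemma lsum_scale_left:
  "x \<in> carrier M \<Longrightarrow> lsum M (\<lambda>y. c y \<odot> x) ys = (\<Sum>y\<leftarrow>ys. c y) \<odot> x"
  by (induction ys) (auto simp: scale_zero scale_add_left)

lemma lsum_single:
  assumes "distinct xs" "i \<in> set xs" "\<And>j. j \<in> set xs \<Longrightarrow> f j \<in> carrier M"
  shows "lsum M (\<lambda>j. (if j = i then 1 else 0) \<odot> f j) xs = f i"
  using assms
proof (induction xs)
  case (Cons x xs)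
  have *: "lsum M (\<lambda>j. (if j = i then 1 else 0) \<odot> f j) xs = \<zero>" if "i \<notin> set xs"
  proof -
    have "lsum M (\<lambda>j. (if j = i then 1 else 0) \<odot> f j) xs = lsum M (\<lambda>j. \<zero>) xs"
      using that Cons.prems by (intro lsum_cong) (auto simp: scale_zero)
    then show ?thesis by (simp add: lsum_zero)
  qed
  show ?case
  proof (cases "x = i")
    case True
    then show ?thesis using Cons.prems * by (auto simp: scale_one)
  next
    case False
    then show ?thesis using Cons by (auto simp: scale_zero)
  qed
qed simp

end

lemma lin_lsum_apply:
  assumes "cspace M" "cspace N" "lin M N F" "\<And>x. x \<in> set xs \<Longrightarrow> f x \<in> carrier M"
  shows "F (lsum M f xs) = lsum N (\<lambda>x. F (f x)) xs"
  using assms(4)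
proof (induction xs)
  case Nil
  then show ?case using assms by (simp add: lin_zero)
next
  case (Cons x xs)
  interpret M: cspace M by fact
  show ?case using Cons assms(3) by (simp add: linD M.lsum_closed)
qed

section \<open>Tensor products\<close>

text \<open>
  A map on a tensor product given by a balanced formula on elementary tensors, summed over a
  representing list.  All maps on tensor products have this form, and they are handled through it:
  \<open>teval M f\<close> is the linear map that the universal property attaches to the bilinear map \<open>f\<close>.
\<close>

definition teval :: "('b, 'm) ring_scheme \<Rightarrow> ('a \<Rightarrow> 'k \<Rightarrow> 'b) \<Rightarrow> ('a \<times> 'k) list set \<Rightarrow> 'b" where
  "teval M f t = lsum M (\<lambda>(a, k). f a k) (terms t)"

lemma teval_cong:
  "(\<And>a k. (a, k) \<in> set (terms t) \<Longrightarrow> f a k = g a k) \<Longrightarrow> teval M f t = teval M g t"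
  unfolding teval_def by (intro lsum_cong) auto

lemma tensor_eq_subset:
  assumes "cspace A" "cspace K"
  shows "tensor_eq A K xs ys \<Longrightarrow>
    set xs \<subseteq> carrier A \<times> carrier K \<and> set ys \<subseteq> carrier A \<times> carrier K"
proof (induction rule: tensor_eq.induct)
  interpret A: cspace A by fact
  interpret K: cspace K by fact
  note clo = A.M.a_closed K.M.a_closed A.M.zero_closed A.scale_closed K.scale_closed
  {
    case (add_left a b k)
    then show ?case using clo by auto
  next
    case (add_right a k l)
    then show ?case using clo by auto
  next
    case (scalar a k c)
    then show ?case using clo by auto
  next
    case (zero k)
    then show ?case using clo by auto
  }
qed auto

lemma tensor_eq_lsum:
  assumes A: "cspace A" and K: "cspace K" and M: "cspace M" and f: "bil A K M f"
  shows "tensor_eq A K xs ys \<Longrightarrow> lsum M (\<lambda>(a, k). f a k) xs = lsum M (\<lambda>(a, k). f a k) ys"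
proof (induction rule: tensor_eq.induct)
  interpret A: cspace A by fact
  interpret K: cspace K by fact
  interpret M: cspace M by fact
  have clo: "f a k \<in> carrier M" if "a \<in> carrier A" "k \<in> carrier K" for a k
    using f that by (rule bilD)
  have sub: "set (map (\<lambda>(a, k). f a k) xs) \<subseteq> carrier M"
    if "set xs \<subseteq> carrier A \<times> carrier K" for xs
    using that by (auto intro: clo)
  have sum_app: "lsum M (\<lambda>(a, k). f a k) (xs @ ys)
      = lsum M (\<lambda>(a, k). f a k) xs \<oplus>\<^bsub>M\<^esub> lsum M (\<lambda>(a, k). f a k) ys"
    if "set xs \<subseteq> carrier A \<times> carrier K" "set ys \<subseteq> carrier A \<times> carrier K" for xs ys
    using M.list_sum_append[OF sub sub, OF that] by simp
  note fl = linD[OF bilD(1)[OF f]] and fr = linD[OF bilD(2)[OF f]]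
  {
    case (append xs xs' ys ys')
    then show ?case
      using tensor_eq_subset[OF A K append.hyps(1)] tensor_eq_subset[OF A K append.hyps(2)]
        sum_app[of xs ys] sum_app[of xs' ys'] by metis
  next
    case (commute xs ys)
    show ?case
      unfolding sum_app[OF commute] sum_app[OF commute(2,1)]
      by (intro M.M.a_comm M.list_sum_closed sub commute)
  next
    case (add_left a b k)
    then show ?case using fr by (simp add: clo)
  next
    case (add_right a k l)
    then show ?case using fl by (simp add: clo)
  next
    case (scalar a k c)
    then show ?case using fl fr by (simp add: clo)
  next
    case (zero k)
    then show ?case using lin_zero[OF A M bilD(2)[OF f]] by (simp add: clo)
  }
qed auto

lemma tclass_eq_iff:
  assumes "cspace A" "cspace K" "set xs \<subseteq> carrier A \<times> carrier K"
  shows "tclass A K xs = tclass A K ys \<longleftrightarrow> tensor_eq A K xs ys"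
proof
  assume "tclass A K xs = tclass A K ys"
  moreover have "xs \<in> tclass A K xs" using tensor_eq.refl[OF assms(3)] by (simp add: tclass_def)
  ultimately have "tensor_eq A K ys xs" by (simp add: tclass_def)
  then show "tensor_eq A K xs ys" by (rule tensor_eq.sym)
next
  assume e: "tensor_eq A K xs ys"
  have "tensor_eq A K xs zs \<longleftrightarrow> tensor_eq A K ys zs" for zs
    using tensor_eq.trans[OF e] tensor_eq.trans[OF tensor_eq.sym[OF e]] by blast
  then show "tclass A K xs = tclass A K ys" by (simp add: tclass_def)
qed

lemma tensor_eq_terms:
  assumes "cspace A" "cspace K" "set xs \<subseteq> carrier A \<times> carrier K"
  shows "tensor_eq A K xs (terms (tclass A K xs))"
proof -
  have "terms (tclass A K xs) \<in> tclass A K xs"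
    unfolding terms_def by (rule someI[of _ xs]) (simp add: tclass_def tensor_eq.refl[OF assms(3)])
  then show ?thesis by (simp add: tclass_def)
qed

lemma tensor_sel:
  "carrier (tensor A K) = {tclass A K xs | xs. set xs \<subseteq> carrier A \<times> carrier K}"
  "\<zero>\<^bsub>tensor A K\<^esub> = tclass A K []" "\<one>\<^bsub>tensor A K\<^esub> = tens A K \<one>\<^bsub>A\<^esub> \<one>\<^bsub>K\<^esub>"
  by (simp_all add: tensor_def)

lemma tclass_closed:
  "set xs \<subseteq> carrier A \<times> carrier K \<Longrightarrow> tclass A K xs \<in> carrier (tensor A K)"
  by (auto simp: tensor_sel)

lemma terms_subset:
  assumes "cspace A" "cspace K" "t \<in> carrier (tensor A K)"
  shows "set (terms t) \<subseteq> carrier A \<times> carrier K" "tclass A K (terms t) = t"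
proof -
  obtain xs where xs: "t = tclass A K xs" "set xs \<subseteq> carrier A \<times> carrier K"
    using assms(3) by (auto simp: tensor_sel)
  have e: "tensor_eq A K xs (terms t)" using tensor_eq_terms[OF assms(1,2) xs(2)] xs(1) by simp
  show "set (terms t) \<subseteq> carrier A \<times> carrier K"
    using tensor_eq_subset[OF assms(1,2) e] by simp
  show "tclass A K (terms t) = t"
    unfolding xs(1) using e[unfolded xs(1)]
    by (rule tclass_eq_iff[OF assms(1,2) xs(2), THEN iffD2, symmetric])
qed

lemma teval_tclass:
  assumes "cspace A" "cspace K" "cspace M" "bil A K M f" "set xs \<subseteq> carrier A \<times> carrier K"
  shows "teval M f (tclass A K xs) = lsum M (\<lambda>(a, k). f a k) xs"
  unfolding teval_def
  by (rule tensor_eq_lsum[OF assms(1-4) tensor_eq_terms[OF assms(1,2,5)], symmetric])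

lemma teval_tens:
  assumes "cspace A" "cspace K" "cspace M" "bil A K M f" "a \<in> carrier A" "k \<in> carrier K"
  shows "teval M f (tens A K a k) = f a k"
proof -
  interpret cspace M by fact
  show ?thesis using teval_tclass[OF assms(1-4), of "[(a, k)]"] assms(5,6) bilD(3)[OF assms(4)]
    by (simp add: tens_def)
qed

lemma tclass_add:
  assumes "cspace A" "cspace K" "set xs \<subseteq> carrier A \<times> carrier K" "set ys \<subseteq> carrier A \<times> carrier K"
  shows "tclass A K xs \<oplus>\<^bsub>tensor A K\<^esub> tclass A K ys = tclass A K (xs @ ys)"
proof -
  have "tensor_eq A K (xs @ ys) (terms (tclass A K xs) @ terms (tclass A K ys))"
    using tensor_eq_terms[OF assms(1,2,3)] tensor_eq_terms[OF assms(1,2,4)]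
    by (rule tensor_eq.append)
  then show ?thesis
    using tclass_eq_iff[OF assms(1,2), of "xs @ ys", THEN iffD2, symmetric] assms(3,4)
    by (simp add: tensor_def)
qed

lemma tensor_eq_scale:
  assumes A: "cspace A" and K: "cspace K"
  shows "tensor_eq A K xs ys \<Longrightarrow>
    tensor_eq A K (map (\<lambda>(a, k). (c \<odot>\<^bsub>A\<^esub> a, k)) xs) (map (\<lambda>(a, k). (c \<odot>\<^bsub>A\<^esub> a, k)) ys)"
proof (induction rule: tensor_eq.induct)
  interpret A: cspace A by fact
  interpret K: cspace K by fact
  have sub: "set (map (\<lambda>(a, k). (c \<odot>\<^bsub>A\<^esub> a, k)) xs) \<subseteq> carrier A \<times> carrier K"
    if "set xs \<subseteq> carrier A \<times> carrier K" for xs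
    using that by auto
  {
    case (refl xs)
    show ?case by (rule tensor_eq.refl) (rule sub[OF refl])
  next
    case (sym xs ys)
    then show ?case by (blast intro: tensor_eq.sym)
  next
    case (trans xs ys zs)
    then show ?case by (blast intro: tensor_eq.trans)
  next
    case (append xs xs' ys ys')
    then show ?case by (simp add: tensor_eq.append)
  next
    case (commute xs ys)
    show ?case
      using tensor_eq.commute[OF sub sub, OF commute] by simp
  next
    case (add_left a b k)
    then show ?case by (simp add: A.scale_add_right tensor_eq.add_left)
  next
    case (add_right a k l)
    then show ?case by (simp add: tensor_eq.add_right)
  next
    case (scalar a k d)
    have "c \<odot>\<^bsub>A\<^esub> (d \<odot>\<^bsub>A\<^esub> a) = d \<odot>\<^bsub>A\<^esub> (c \<odot>\<^bsub>A\<^esub> a)"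
      using scalar by (simp add: A.scale_scale mult.commute)
    then show ?case using scalar tensor_eq.scalar[of "c \<odot>\<^bsub>A\<^esub> a" A k K d] by simp
  next
    case (zero k)
    then show ?case by (simp add: A.scale_zero_right tensor_eq.zero)
  }
qed

lemma tclass_scale:
  assumes "cspace A" "cspace K" "set xs \<subseteq> carrier A \<times> carrier K"
  shows "c \<odot>\<^bsub>tensor A K\<^esub> tclass A K xs = tclass A K (map (\<lambda>(a, k). (c \<odot>\<^bsub>A\<^esub> a, k)) xs)"
proof -
  have sub: "set (map (\<lambda>(a, k). (c \<odot>\<^bsub>A\<^esub> a, k)) xs) \<subseteq> carrier A \<times> carrier K"
    using assms by (auto simp: cspace.scale_closed)
  have "tensor_eq A K (map (\<lambda>(a, k). (c \<odot>\<^bsub>A\<^esub> a, k)) xs)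
      (map (\<lambda>(a, k). (c \<odot>\<^bsub>A\<^esub> a, k)) (terms (tclass A K xs)))"
    by (rule tensor_eq_scale[OF assms(1,2) tensor_eq_terms[OF assms]])
  then show ?thesis
    using tclass_eq_iff[OF assms(1,2) sub, THEN iffD2, symmetric] by (simp add: tensor_def)
qed

lemma cspaceI:
  assumes "\<And>x y. x \<in> carrier M \<Longrightarrow> y \<in> carrier M \<Longrightarrow> x \<oplus>\<^bsub>M\<^esub> y \<in> carrier M"
    and "\<zero>\<^bsub>M\<^esub> \<in> carrier M"
    and "\<And>x y z. x \<in> carrier M \<Longrightarrow> y \<in> carrier M \<Longrightarrow> z \<in> carrier M \<Longrightarrow>
      (x \<oplus>\<^bsub>M\<^esub> y) \<oplus>\<^bsub>M\<^esub> z = x \<oplus>\<^bsub>M\<^esub> (y \<oplus>\<^bsub>M\<^esub> z)"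
    and "\<And>x y. x \<in> carrier M \<Longrightarrow> y \<in> carrier M \<Longrightarrow> x \<oplus>\<^bsub>M\<^esub> y = y \<oplus>\<^bsub>M\<^esub> x"
    and "\<And>x. x \<in> carrier M \<Longrightarrow> \<zero>\<^bsub>M\<^esub> \<oplus>\<^bsub>M\<^esub> x = x"
    and "\<And>c x. x \<in> carrier M \<Longrightarrow> c \<odot>\<^bsub>M\<^esub> x \<in> carrier M"
    and "\<And>x. x \<in> carrier M \<Longrightarrow> 0 \<odot>\<^bsub>M\<^esub> x = \<zero>\<^bsub>M\<^esub>"
    and "\<And>a b x. x \<in> carrier M \<Longrightarrow> (a + b) \<odot>\<^bsub>M\<^esub> x = a \<odot>\<^bsub>M\<^esub> x \<oplus>\<^bsub>M\<^esub> b \<odot>\<^bsub>M\<^esub> x"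
    and "\<And>c x y. x \<in> carrier M \<Longrightarrow> y \<in> carrier M \<Longrightarrow>
      c \<odot>\<^bsub>M\<^esub> (x \<oplus>\<^bsub>M\<^esub> y) = c \<odot>\<^bsub>M\<^esub> x \<oplus>\<^bsub>M\<^esub> c \<odot>\<^bsub>M\<^esub> y"
    and "\<And>a b x. x \<in> carrier M \<Longrightarrow> (a * b) \<odot>\<^bsub>M\<^esub> x = a \<odot>\<^bsub>M\<^esub> (b \<odot>\<^bsub>M\<^esub> x)"
    and "\<And>x. x \<in> carrier M \<Longrightarrow> 1 \<odot>\<^bsub>M\<^esub> x = x"
  shows "cspace M"
  unfolding cspace_def
proof (rule moduleI)
  show "abelian_group M"
  proof (rule abelian_groupI)
    fix x assume x: "x \<in> carrier M"
    have "(-1) \<odot>\<^bsub>M\<^esub> x \<oplus>\<^bsub>M\<^esub> x = (-1 + 1) \<odot>\<^bsub>M\<^esub> x"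
      by (simp only: assms(8)[OF x] assms(11)[OF x])
    also have "\<dots> = \<zero>\<^bsub>M\<^esub>" using x by (simp add: assms(7))
    finally show "\<exists>y\<in>carrier M. y \<oplus>\<^bsub>M\<^esub> x = \<zero>\<^bsub>M\<^esub>"
      using x assms(6) by blast
  qed (use assms in auto)
qed (use assms in \<open>auto simp: cring_complex_alg\<close>)

lemma cspace_tensor:
  assumes A: "cspace A" and K: "cspace K"
  shows "cspace (tensor A K)"
proof (rule cspaceI)
  interpret A: cspace A by fact
  interpret K: cspace K by fact
  let ?T = "tensor A K"
  let ?G = "\<lambda>xs. set xs \<subseteq> carrier A \<times> carrier K"
  have T: "\<exists>xs. x = tclass A K xs \<and> ?G xs" if "x \<in> carrier ?T" for x
    using that by (auto simp: tensor_sel)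
  note add = tclass_add[OF A K] and sc = tclass_scale[OF A K]
  note eq = tclass_eq_iff[OF A K, THEN iffD2]
  have sub: "?G (map (\<lambda>(a, k). (c \<odot>\<^bsub>A\<^esub> a, k)) xs)" if "?G xs" for xs c
    using that by auto
  show "x \<oplus>\<^bsub>?T\<^esub> y \<in> carrier ?T" if xy: "x \<in> carrier ?T" "y \<in> carrier ?T" for x y
  proof -
    obtain xs ys where xs: "x = tclass A K xs" "?G xs" and ys: "y = tclass A K ys" "?G ys"
      using T[OF xy(1)] T[OF xy(2)] by auto
    show ?thesis
      unfolding xs(1) ys(1) add[OF xs(2) ys(2)] using xs(2) ys(2) by (intro tclass_closed) simp
  qed
  show "\<zero>\<^bsub>?T\<^esub> \<in> carrier ?T" by (auto simp: tensor_sel intro: exI[of _ "[]"])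
  show "x \<oplus>\<^bsub>?T\<^esub> y \<oplus>\<^bsub>?T\<^esub> z = x \<oplus>\<^bsub>?T\<^esub> (y \<oplus>\<^bsub>?T\<^esub> z)"
    if "x \<in> carrier ?T" "y \<in> carrier ?T" "z \<in> carrier ?T" for x y z
    using T[OF that(1)] T[OF that(2)] T[OF that(3)] by (auto simp: add)
  show "x \<oplus>\<^bsub>?T\<^esub> y = y \<oplus>\<^bsub>?T\<^esub> x" if xy: "x \<in> carrier ?T" "y \<in> carrier ?T" for x y
  proof -
    obtain xs ys where xs: "x = tclass A K xs" "?G xs" and ys: "y = tclass A K ys" "?G ys"
      using T[OF xy(1)] T[OF xy(2)] by auto
    show ?thesis
      unfolding xs(1) ys(1) add[OF xs(2) ys(2)] add[OF ys(2) xs(2)] using xs(2) ys(2)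
      by (intro eq tensor_eq.commute) simp_all
  qed
  show "\<zero>\<^bsub>?T\<^esub> \<oplus>\<^bsub>?T\<^esub> x = x" if "x \<in> carrier ?T" for x
    using T[OF that] by (auto simp: tensor_sel(2) add)
  show "c \<odot>\<^bsub>?T\<^esub> x \<in> carrier ?T" if x: "x \<in> carrier ?T" for c x
    using T[OF x] by (metis sc sub tclass_closed)
  have zero: "tensor_eq A K (map (\<lambda>(a, k). (0 \<odot>\<^bsub>A\<^esub> a, k)) xs) []" if "?G xs" for xs
    using that
  proof (induction xs)
    case (Cons p xs)
    obtain a k where p: "p = (a, k)" by force
    have "tensor_eq A K ([(\<zero>\<^bsub>A\<^esub>, k)] @ map (\<lambda>(a, k). (0 \<odot>\<^bsub>A\<^esub> a, k)) xs) ([] @ [])"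
      using Cons p by (intro tensor_eq.append tensor_eq.zero) auto
    then show ?case using Cons.prems p by (simp add: A.scale_zero)
  qed (auto intro: tensor_eq.refl)
  show "0 \<odot>\<^bsub>?T\<^esub> x = \<zero>\<^bsub>?T\<^esub>" if x: "x \<in> carrier ?T" for x
  proof -
    obtain xs where xs: "x = tclass A K xs" "?G xs" using T[OF x] by auto
    show ?thesis unfolding xs(1) sc[OF xs(2)] tensor_sel(2)
      by (rule eq[OF sub[OF xs(2)] zero[OF xs(2)]])
  qed
  have dist: "tensor_eq A K (map (\<lambda>(a, k). ((c + d) \<odot>\<^bsub>A\<^esub> a, k)) xs)
      (map (\<lambda>(a, k). (c \<odot>\<^bsub>A\<^esub> a, k)) xs @ map (\<lambda>(a, k). (d \<odot>\<^bsub>A\<^esub> a, k)) xs)"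
    if "?G xs" for xs c d
    using that
  proof (induction xs)
    case Nil
    then show ?case by (auto intro: tensor_eq.refl)
  next
    case (Cons p xs)
    obtain a k where p: "p = (a, k)" "a \<in> carrier A" "k \<in> carrier K" "?G xs"
      using Cons.prems by (cases p) auto
    let ?s = "\<lambda>c. map (\<lambda>(a, k). (c \<odot>\<^bsub>A\<^esub> a, k)) xs"
    have "tensor_eq A K ([((c + d) \<odot>\<^bsub>A\<^esub> a, k)] @ ?s (c + d))
        ([(c \<odot>\<^bsub>A\<^esub> a, k), (d \<odot>\<^bsub>A\<^esub> a, k)] @ (?s c @ ?s d))"
      using Cons.IH p by (intro tensor_eq.append) (simp_all add: A.scale_add_left tensor_eq.add_left)
    moreover have "tensor_eq A K ([(c \<odot>\<^bsub>A\<^esub> a, k)] @ (([(d \<odot>\<^bsub>A\<^esub> a, k)] @ ?s c) @ ?s d))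
        ([(c \<odot>\<^bsub>A\<^esub> a, k)] @ ((?s c @ [(d \<odot>\<^bsub>A\<^esub> a, k)]) @ ?s d))"
      using p sub by (intro tensor_eq.append tensor_eq.commute tensor_eq.refl) auto
    ultimately show ?case using p(1) by (auto intro: tensor_eq.trans)
  qed
  show "(c + d) \<odot>\<^bsub>?T\<^esub> x = c \<odot>\<^bsub>?T\<^esub> x \<oplus>\<^bsub>?T\<^esub> d \<odot>\<^bsub>?T\<^esub> x" if x: "x \<in> carrier ?T" for c d x
  proof -
    obtain xs where xs: "x = tclass A K xs" "?G xs" using T[OF x] by auto
    show ?thesis unfolding xs(1) sc[OF xs(2)] add[OF sub sub, OF xs(2) xs(2)]
      by (rule eq[OF sub[OF xs(2)] dist[OF xs(2)]])
  qed
  show "c \<odot>\<^bsub>?T\<^esub> (x \<oplus>\<^bsub>?T\<^esub> y) = c \<odot>\<^bsub>?T\<^esub> x \<oplus>\<^bsub>?T\<^esub> c \<odot>\<^bsub>?T\<^esub> y"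
    if xy: "x \<in> carrier ?T" "y \<in> carrier ?T" for c x y
  proof -
    obtain xs ys where xs: "x = tclass A K xs" "?G xs" and ys: "y = tclass A K ys" "?G ys"
      using T[OF xy(1)] T[OF xy(2)] by auto
    have g: "?G (xs @ ys)" using xs ys by auto
    show ?thesis
      unfolding xs(1) ys(1) add[OF xs(2) ys(2)] sc[OF g] sc[OF xs(2)] sc[OF ys(2)]
        add[OF sub sub, OF xs(2) ys(2)] by simp
  qed
  show "(c * d) \<odot>\<^bsub>?T\<^esub> x = c \<odot>\<^bsub>?T\<^esub> (d \<odot>\<^bsub>?T\<^esub> x)" if x: "x \<in> carrier ?T" for c d x
  proof -
    obtain xs where xs: "x = tclass A K xs" "?G xs" using T[OF x] by auto
    have e: "map (\<lambda>(a, k). ((c * d) \<odot>\<^bsub>A\<^esub> a, k)) xs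
        = map (\<lambda>(a, k). (c \<odot>\<^bsub>A\<^esub> a, k)) (map (\<lambda>(a, k). (d \<odot>\<^bsub>A\<^esub> a, k)) xs)"
      using xs(2) by (auto simp: A.scale_scale)
    show ?thesis unfolding xs(1) sc[OF xs(2)] sc[OF sub[OF xs(2)]] e ..
  qed
  show "1 \<odot>\<^bsub>?T\<^esub> x = x" if x: "x \<in> carrier ?T" for x
  proof -
    obtain xs where xs: "x = tclass A K xs" "?G xs" using T[OF x] by auto
    have "map (\<lambda>(a, k). (1 \<odot>\<^bsub>A\<^esub> a, k)) xs = xs"
      using xs(2) by (induction xs) (auto simp: A.scale_one)
    then show ?thesis using xs by (simp add: sc)
  qed
qed

lemma tens_closed: "a \<in> carrier A \<Longrightarrow> k \<in> carrier K \<Longrightarrow> tens A K a k \<in> carrier (tensor A K)"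
  unfolding tens_def by (rule tclass_closed) auto

lemma bil_tens:
  assumes A: "cspace A" and K: "cspace K"
  shows "bil A K (tensor A K) (tens A K)"
proof (rule bilI; rule linI)
  interpret A: cspace A by fact
  interpret K: cspace K by fact
  note eq = tclass_eq_iff[OF A K, THEN iffD2]
  fix a k assume a: "a \<in> carrier A" and k: "k \<in> carrier K"
  {
    fix l assume l: "l \<in> carrier K"
    show "tens A K a l \<in> carrier (tensor A K)" using a l by (rule tens_closed)
    show "tens A K a (c \<odot>\<^bsub>K\<^esub> l) = c \<odot>\<^bsub>tensor A K\<^esub> tens A K a l" for c
      unfolding tens_def using a l
      by (subst tclass_scale[OF A K]) (auto intro!: eq tensor_eq.sym[OF tensor_eq.scalar])
    show "tens A K a (k \<oplus>\<^bsub>K\<^esub> l) = tens A K a k \<oplus>\<^bsub>tensor A K\<^esub> tens A K a l"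
      unfolding tens_def using a k l
      by (subst tclass_add[OF A K]) (auto intro!: eq tensor_eq.add_right)
  next
    fix b assume b: "b \<in> carrier A"
    show "tens A K b k \<in> carrier (tensor A K)" using b k by (rule tens_closed)
    show "tens A K (c \<odot>\<^bsub>A\<^esub> b) k = c \<odot>\<^bsub>tensor A K\<^esub> tens A K b k" for c
      unfolding tens_def using b k by (subst tclass_scale[OF A K]) auto
    show "tens A K (a \<oplus>\<^bsub>A\<^esub> b) k = tens A K a k \<oplus>\<^bsub>tensor A K\<^esub> tens A K b k"
      unfolding tens_def using a b k
      by (subst tclass_add[OF A K]) (auto intro!: eq tensor_eq.add_left)
  }
qed

lemma tclass_as_sum:
  assumes A: "cspace A" and K: "cspace K"
  shows "set xs \<subseteq> carrier A \<times> carrier K \<Longrightarrow>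
    tclass A K xs = lsum (tensor A K) (\<lambda>(a, k). tens A K a k) xs"
proof (induction xs)
  case Nil
  then show ?case by (simp add: tensor_sel)
next
  case (Cons p xs)
  then show ?case using tclass_add[OF A K, of "[p]" xs] by (cases p) (simp add: tens_def)
qed

lemma tclass_concat:
  assumes A: "cspace A" and K: "cspace K"
    and "\<And>x. x \<in> set xs \<Longrightarrow> set (g x) \<subseteq> carrier A \<times> carrier K"
  shows "tclass A K (concat (map g xs)) = lsum (tensor A K) (\<lambda>x. tclass A K (g x)) xs"
  using assms(3)
proof (induction xs)
  case Nil
  then show ?case by (simp add: tensor_sel)
next
  case (Cons x xs)
  have "set (concat (map g xs)) \<subseteq> carrier A \<times> carrier K" using Cons.prems by auto
  then show ?case using Cons tclass_add[OF A K, of "g x" "concat (map g xs)"] by simp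
qed

text \<open>The universal property of the tensor product, in two halves.\<close>

lemma lin_teval:
  assumes A: "cspace A" and K: "cspace K" and M: "cspace M" and f: "bil A K M f"
  shows "lin (tensor A K) M (teval M f)"
proof (rule linI)
  interpret A: cspace A by fact
  interpret K: cspace K by fact
  interpret M: cspace M by fact
  let ?T = "tensor A K"
  let ?G = "\<lambda>xs. set xs \<subseteq> carrier A \<times> carrier K"
  have T: "\<exists>xs. x = tclass A K xs \<and> ?G xs" if "x \<in> carrier ?T" for x
    using that by (auto simp: tensor_sel)
  note ev = teval_tclass[OF assms]
  have clo: "f a k \<in> carrier M" if "a \<in> carrier A" "k \<in> carrier K" for a k
    using f that by (rule bilD)
  have sub: "set (map (\<lambda>(a, k). f a k) xs) \<subseteq> carrier M" if "?G xs" for xs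
    using that by (auto intro: clo)
  fix x assume "x \<in> carrier ?T"
  then obtain xs where xs: "x = tclass A K xs" "?G xs" using T by blast
  show "teval M f x \<in> carrier M"
    unfolding xs(1) ev[OF xs(2)] using sub[OF xs(2)] by (rule M.list_sum_closed)
  show "teval M f (c \<odot>\<^bsub>?T\<^esub> x) = c \<odot>\<^bsub>M\<^esub> teval M f x" for c
  proof -
    have g: "?G (map (\<lambda>(a, k). (c \<odot>\<^bsub>A\<^esub> a, k)) xs)" using xs by auto
    have "lsum M (\<lambda>p. (\<lambda>(a, k). f a k) ((\<lambda>(a, k). (c \<odot>\<^bsub>A\<^esub> a, k)) p)) xs
        = lsum M (\<lambda>p. c \<odot>\<^bsub>M\<^esub> (\<lambda>(a, k). f a k) p) xs"
      using xs(2) linD[OF bilD(2)[OF f]] by (intro lsum_cong) auto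
    also have "\<dots> = c \<odot>\<^bsub>M\<^esub> lsum M (\<lambda>(a, k). f a k) xs"
      using xs(2) clo by (intro M.lsum_scale) auto
    finally show ?thesis
      unfolding xs(1) tclass_scale[OF A K xs(2)] ev[OF g] ev[OF xs(2)] by (simp add: comp_def)
  qed
  fix y assume "y \<in> carrier ?T"
  then obtain ys where ys: "y = tclass A K ys" "?G ys" using T by blast
  have g: "?G (xs @ ys)" using xs ys by auto
  show "teval M f (x \<oplus>\<^bsub>?T\<^esub> y) = teval M f x \<oplus>\<^bsub>M\<^esub> teval M f y"
    unfolding xs(1) ys(1) tclass_add[OF A K xs(2) ys(2)] ev[OF g] ev[OF xs(2)] ev[OF ys(2)]
    using M.list_sum_append[OF sub sub, OF xs(2) ys(2)] by simp
qed

lemma tensor_ext: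
  assumes A: "cspace A" and K: "cspace K" and M: "cspace M"
    and F: "lin (tensor A K) M F" and G: "lin (tensor A K) M G"
    and eq: "\<And>a k. a \<in> carrier A \<Longrightarrow> k \<in> carrier K \<Longrightarrow> F (tens A K a k) = G (tens A K a k)"
    and t: "t \<in> carrier (tensor A K)"
  shows "F t = G t"
proof -
  note sub = terms_subset[OF A K t]
  have t': "t = lsum (tensor A K) (\<lambda>(a, k). tens A K a k) (terms t)"
    using tclass_as_sum[OF A K sub(1)] sub(2) by simp
  have clo: "(\<lambda>(a, k). tens A K a k) p \<in> carrier (tensor A K)" if "p \<in> set (terms t)" for p
    using that sub(1) by (auto intro: tens_closed)
  have "F t = lsum M (\<lambda>p. F ((\<lambda>(a, k). tens A K a k) p)) (terms t)"
    by (subst t') (rule lin_lsum_apply[OF cspace_tensor[OF A K] M F clo])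
  also have "\<dots> = lsum M (\<lambda>p. G ((\<lambda>(a, k). tens A K a k) p)) (terms t)"
    using sub(1) eq by (intro lsum_cong) auto
  also have "\<dots> = G t"
    by (subst (2) t') (rule lin_lsum_apply[OF cspace_tensor[OF A K] M G clo, symmetric])
  finally show ?thesis .
qed

section \<open>Linearity rules\<close>

lemma cspace_star_algebra: "star_algebra A \<Longrightarrow> cspace A"
  by (simp add: star_algebra_def cspace_def)

lemma cspace_complex: "cspace complex_alg"
  by (rule cspaceI) (auto simp: algebra_simps)

lemma lin_cong:
  assumes "cspace M" "\<And>x. x \<in> carrier M \<Longrightarrow> f x = g x" "lin M N g"
  shows "lin M N f"
proof -
  interpret cspace M by fact
  show ?thesis using assms(2,3) by (simp add: lin_def)
qed

context star_algebra
begin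

lemma is_ring: "ring A" ..

lemma is_cspace: "cspace A"
  unfolding cspace_def by (rule module_axioms)

lemma mult_closed: "x \<in> carrier A \<Longrightarrow> y \<in> carrier A \<Longrightarrow> x \<otimes> y \<in> carrier A"
  by (rule monoid.m_closed[OF ring.is_monoid[OF is_ring]])

lemma mult_add_left: "x \<in> carrier A \<Longrightarrow> y \<in> carrier A \<Longrightarrow> z \<in> carrier A \<Longrightarrow>
    (x \<oplus> y) \<otimes> z = x \<otimes> z \<oplus> y \<otimes> z"
  by (rule ring.ring_simprules(13)[OF is_ring])

lemma mult_add_right: "x \<in> carrier A \<Longrightarrow> y \<in> carrier A \<Longrightarrow> z \<in> carrier A \<Longrightarrow>
    z \<otimes> (x \<oplus> y) = z \<otimes> x \<oplus> z \<otimes> y"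
  by (rule ring.ring_simprules(23)[OF is_ring])

lemma mult_assoc: "x \<in> carrier A \<Longrightarrow> y \<in> carrier A \<Longrightarrow> z \<in> carrier A \<Longrightarrow>
    x \<otimes> y \<otimes> z = x \<otimes> (y \<otimes> z)"
  by (rule monoid.m_assoc[OF ring.is_monoid[OF is_ring]])

lemma one_closed: "\<one> \<in> carrier A"
  by (rule monoid.one_closed[OF ring.is_monoid[OF is_ring]])

lemma zero_closed: "\<zero> \<in> carrier A"
  by (rule ring.ring_simprules(2)[OF is_ring])

lemma mult_one_left: "x \<in> carrier A \<Longrightarrow> \<one> \<otimes> x = x"
  by (rule monoid.l_one[OF ring.is_monoid[OF is_ring]])

lemma mult_one_right: "x \<in> carrier A \<Longrightarrow> x \<otimes> \<one> = x"
  by (rule monoid.r_one[OF ring.is_monoid[OF is_ring]])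

lemma star_one: "star A \<one> = \<one>"
proof -
  have "star A (star A \<one> \<otimes> \<one>) = star A \<one> \<otimes> star A (star A \<one>)"
    by (rule star_mult[OF star_closed[OF one_closed] one_closed])
  then show ?thesis
    by (simp only: mult_one_right[OF star_closed[OF one_closed]] star_star[OF one_closed])
qed

lemma add_closed: "x \<in> carrier A \<Longrightarrow> y \<in> carrier A \<Longrightarrow> x \<oplus> y \<in> carrier A"
  by (rule ring.ring_simprules(1)[OF is_ring])

end

lemma lin_const_scale: "cspace N \<Longrightarrow> lin M N f \<Longrightarrow> lin M N (\<lambda>x. c \<odot>\<^bsub>N\<^esub> f x)"
proof (rule linI)
  assume "cspace N" and f: "lin M N f"
  then interpret N: cspace N by simp
  show "c \<odot>\<^bsub>N\<^esub> f x \<in> carrier N" if "x \<in> carrier M" for x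
    using that f by (simp add: linD)
  show "c \<odot>\<^bsub>N\<^esub> f (x \<oplus>\<^bsub>M\<^esub> y) = c \<odot>\<^bsub>N\<^esub> f x \<oplus>\<^bsub>N\<^esub> c \<odot>\<^bsub>N\<^esub> f y"
    if "x \<in> carrier M" "y \<in> carrier M" for x y
    using that by (simp add: linD[OF f] N.scale_add_right)
  show "c \<odot>\<^bsub>N\<^esub> f (d \<odot>\<^bsub>M\<^esub> x) = d \<odot>\<^bsub>N\<^esub> (c \<odot>\<^bsub>N\<^esub> f x)" if "x \<in> carrier M" for d x
    using that by (simp add: linD[OF f] N.scale_scale mult.commute)
qed

lemma lin_scale_const:
  "cspace N \<Longrightarrow> a \<in> carrier N \<Longrightarrow> lin M complex_alg f \<Longrightarrow> lin M N (\<lambda>x. f x \<odot>\<^bsub>N\<^esub> a)"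
proof (rule linI)
  assume "cspace N" and a: "a \<in> carrier N" and f: "lin M complex_alg f"
  then interpret N: cspace N by simp
  note f' = linD[OF f, simplified]
  show "f x \<odot>\<^bsub>N\<^esub> a \<in> carrier N" if "x \<in> carrier M" for x using a by simp
  show "f (x \<oplus>\<^bsub>M\<^esub> y) \<odot>\<^bsub>N\<^esub> a = f x \<odot>\<^bsub>N\<^esub> a \<oplus>\<^bsub>N\<^esub> f y \<odot>\<^bsub>N\<^esub> a"
    if "x \<in> carrier M" "y \<in> carrier M" for x y
    using that a by (simp add: f' N.scale_add_left)
  show "f (c \<odot>\<^bsub>M\<^esub> x) \<odot>\<^bsub>N\<^esub> a = c \<odot>\<^bsub>N\<^esub> (f x \<odot>\<^bsub>N\<^esub> a)" if "x \<in> carrier M" for c x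
    using that a by (simp add: f' N.scale_scale)
qed

lemma lin_add:
  assumes "cspace N" "lin M N f" "lin M N g"
  shows "lin M N (\<lambda>x. f x \<oplus>\<^bsub>N\<^esub> g x)"
proof -
  interpret N: cspace N by fact
  show ?thesis
    by (rule linI)
      (simp_all add: linD[OF assms(2)] linD[OF assms(3)] N.scale_add_right N.M.add.m_ac)
qed

lemma lin_lsum:
  assumes N: "cspace N" and f: "\<And>y. y \<in> set ys \<Longrightarrow> lin M N (\<lambda>x. f x y)"
  shows "lin M N (\<lambda>x. lsum N (\<lambda>y. f x y) ys)"
proof -
  interpret N: cspace N by fact
  show ?thesis
  proof (rule linI)
    show "lsum N (\<lambda>y. f x y) ys \<in> carrier N" if "x \<in> carrier M" for x
      using linD(1)[OF f] that by (intro N.lsum_closed)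
    show "lsum N (\<lambda>z. f (x \<oplus>\<^bsub>M\<^esub> y) z) ys = lsum N (\<lambda>z. f x z) ys \<oplus>\<^bsub>N\<^esub> lsum N (\<lambda>z. f y z) ys"
      if "x \<in> carrier M" "y \<in> carrier M" for x y
    proof -
      have "lsum N (\<lambda>z. f (x \<oplus>\<^bsub>M\<^esub> y) z) ys = lsum N (\<lambda>z. f x z \<oplus>\<^bsub>N\<^esub> f y z) ys"
        using that linD(2)[OF f] by (intro lsum_cong) auto
      then show ?thesis using that linD(1)[OF f] by (simp add: N.lsum_add)
    qed
    show "lsum N (\<lambda>z. f (c \<odot>\<^bsub>M\<^esub> x) z) ys = c \<odot>\<^bsub>N\<^esub> lsum N (\<lambda>z. f x z) ys"
      if "x \<in> carrier M" for c x
    proof -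
      have "lsum N (\<lambda>z. f (c \<odot>\<^bsub>M\<^esub> x) z) ys = lsum N (\<lambda>z. c \<odot>\<^bsub>N\<^esub> f x z) ys"
        using that linD(3)[OF f] by (intro lsum_cong) auto
      then show ?thesis using that linD(1)[OF f] by (simp add: N.lsum_scale)
    qed
  qed
qed

lemma lin_teval_const:
  assumes A: "cspace A" and K: "cspace K" and N: "cspace N" and t: "t \<in> carrier (tensor A K)"
    and f: "\<And>a k. a \<in> carrier A \<Longrightarrow> k \<in> carrier K \<Longrightarrow> lin M N (\<lambda>x. f x a k)"
  shows "lin M N (\<lambda>x. teval N (f x) t)"
  unfolding teval_def using terms_subset(1)[OF A K t]
  by (intro lin_lsum[OF N]) (auto intro: f)

lemma lin_mult_left:
  assumes "star_algebra A" "a \<in> carrier A" "lin M A f"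
  shows "lin M A (\<lambda>x. a \<otimes>\<^bsub>A\<^esub> f x)"
proof -
  interpret A: star_algebra A by fact
  show ?thesis
    by (rule linI)
      (simp_all add: linD[OF assms(3)] assms(2) A.mult_closed A.mult_add_right A.smult_mult_right)
qed

lemma lin_mult_right:
  assumes "star_algebra A" "a \<in> carrier A" "lin M A f"
  shows "lin M A (\<lambda>x. f x \<otimes>\<^bsub>A\<^esub> a)"
proof -
  interpret A: star_algebra A by fact
  show ?thesis
    by (rule linI)
      (simp_all add: linD[OF assms(3)] assms(2) A.mult_closed A.mult_add_left A.smult_mult_left)
qed

lemma lin_tens_left:
  assumes "cspace A" "cspace K" "k \<in> carrier K" "lin M A f"
  shows "lin M (tensor A K) (\<lambda>x. tens A K (f x) k)"
  by (rule lin_comp[OF bilD(2)[OF bil_tens]]) fact+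

lemma lin_tens_right:
  assumes "cspace A" "cspace K" "a \<in> carrier A" "lin M K f"
  shows "lin M (tensor A K) (\<lambda>x. tens A K a (f x))"
  by (rule lin_comp[OF bilD(1)[OF bil_tens]]) fact+

lemma lin_cmult_left: "lin M complex_alg f \<Longrightarrow> lin M complex_alg (\<lambda>x. c * f x)"
  and lin_cmult_right: "lin M complex_alg f \<Longrightarrow> lin M complex_alg (\<lambda>x. f x * c)"
  by (auto simp: lin_def algebra_simps)

lemma teval_closed:
  assumes "cspace A" "cspace K" "cspace M" "bil A K M f" "t \<in> carrier (tensor A K)"
  shows "teval M f t \<in> carrier M"
  using linD(1)[OF lin_teval] assms by blast

lemma teval_cong_carrier:
  assumes "cspace A" "cspace K" "t \<in> carrier (tensor A K)"
    and "\<And>a k. a \<in> carrier A \<Longrightarrow> k \<in> carrier K \<Longrightarrow> f a k = g a k"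
  shows "teval M f t = teval M g t"
  using terms_subset(1)[OF assms(1-3)] assms(4) by (intro teval_cong) auto

lemma lin_teval_apply:
  assumes "cspace A" "cspace K" "cspace M" "cspace N" "lin M N F" "bil A K M f"
    "t \<in> carrier (tensor A K)"
  shows "F (teval M f t) = teval N (\<lambda>a k. F (f a k)) t"
proof -
  have "F (lsum M (\<lambda>p. case p of (a, k) \<Rightarrow> f a k) (terms t))
      = lsum N (\<lambda>p. F (case p of (a, k) \<Rightarrow> f a k)) (terms t)"
    using terms_subset(1)[OF assms(1,2,7)] bilD(3)[OF assms(6)]
    by (intro lin_lsum_apply[OF assms(3,4,5)]) auto
  then show ?thesis unfolding teval_def by (simp add: case_prod_unfold)
qed

lemma terms_mem:
  assumes "cspace A" "cspace K" "t \<in> carrier (tensor A K)" "p \<in> set (terms t)"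
  shows "fst p \<in> carrier A" "snd p \<in> carrier K"
  using terms_subset(1)[OF assms(1-3)] assms(4) by auto

lemma teval_swap:
  assumes "cspace A" "cspace K" "t \<in> carrier (tensor A K)"
    and "cspace B" "cspace L" "s \<in> carrier (tensor B L)" and M: "cspace M"
    and "\<And>a k b l. a \<in> carrier A \<Longrightarrow> k \<in> carrier K \<Longrightarrow> b \<in> carrier B \<Longrightarrow> l \<in> carrier L \<Longrightarrow>
      f a k b l \<in> carrier M"
  shows "teval M (\<lambda>a k. teval M (\<lambda>b l. f a k b l) s) t = teval M (\<lambda>b l. teval M (\<lambda>a k. f a k b l) t) s"
proof -
  interpret M: cspace M by fact
  show ?thesis
    unfolding teval_def case_prod_unfold
    by (intro M.lsum_swap assms(8) terms_mem[OF assms(1-3)] terms_mem[OF assms(4-6)])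
qed

lemma bil_comp_tens:
  assumes "bil B L M F" "lin A B f" "lin K L g"
  shows "bil A K M (\<lambda>a k. F (f a) (g k))"
proof (rule bilI)
  show "lin K M (\<lambda>k. F (f a) (g k))" if "a \<in> carrier A" for a
    by (rule lin_comp[OF bilD(1)[OF assms(1)] assms(3)]) (rule linD(1)[OF assms(2) that])
  show "lin A M (\<lambda>a. F (f a) (g k))" if "k \<in> carrier K" for k
    by (rule lin_comp[OF bilD(2)[OF assms(1)] assms(2)]) (rule linD(1)[OF assms(3) that])
qed

section \<open>Tensor products of algebras\<close>

lemma tclass_map:
  assumes A: "cspace A" and K: "cspace K"
    and "\<And>x. x \<in> set xs \<Longrightarrow> f x \<in> carrier A \<and> g x \<in> carrier K"
  shows "tclass A K (map (\<lambda>x. (f x, g x)) xs) = lsum (tensor A K) (\<lambda>x. tens A K (f x) (g x)) xs"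
proof -
  have "set (map (\<lambda>x. (f x, g x)) xs) \<subseteq> carrier A \<times> carrier K" using assms(3) by auto
  from tclass_as_sum[OF A K this] show ?thesis by (simp add: comp_def)
qed

lemma tmap_eq_teval:
  assumes "cspace A" "cspace K" "cspace B" "cspace L" "lin A B f" "lin K L g"
    "t \<in> carrier (tensor A K)"
  shows "tmap B L f g t = teval (tensor B L) (\<lambda>a k. tens B L (f a) (g k)) t"
  unfolding tmap_def teval_def case_prod_unfold
  using terms_subset(1)[OF assms(1,2,7)] linD(1)[OF assms(5)] linD(1)[OF assms(6)]
  by (intro tclass_map[OF assms(3,4)]) auto

lemma slice_eq_teval: "slice A \<phi> t = teval A (\<lambda>a k. \<phi> k \<odot>\<^bsub>A\<^esub> a) t"
  by (simp add: slice_def teval_def)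

lemma bil_scale:
  assumes "cspace A" "lin K complex_alg \<phi>"
  shows "bil A K A (\<lambda>a k. \<phi> k \<odot>\<^bsub>A\<^esub> a)"
  using assms by (intro bilI lin_scale_const lin_const_scale lin_id)

lemma lin_slice:
  assumes "cspace A" "cspace K" "lin K complex_alg \<phi>"
  shows "lin (tensor A K) A (slice A \<phi>)"
  unfolding slice_eq_teval using assms by (intro lin_teval bil_scale)

lemma slice_closed:
  assumes "cspace A" "cspace K" "lin K complex_alg \<phi>" "t \<in> carrier (tensor A K)"
  shows "slice A \<phi> t \<in> carrier A"
  using lin_slice[OF assms(1-3)] assms(4) by (rule linD)

lemma slice_tens:
  assumes "cspace A" "cspace K" "lin K complex_alg \<phi>" "a \<in> carrier A" "k \<in> carrier K"
  shows "slice A \<phi> (tens A K a k) = \<phi> k \<odot>\<^bsub>A\<^esub> a"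
  unfolding slice_eq_teval using assms by (simp add: teval_tens bil_scale)

lemma lin_tmap:
  assumes "cspace A" "cspace K" "cspace B" "cspace L" "lin A B f" "lin K L g"
  shows "lin (tensor A K) (tensor B L) (tmap B L f g)"
proof -
  show ?thesis
    using assms
    by (intro lin_cong[OF _ tmap_eq_teval] lin_teval cspace_tensor bil_comp_tens[OF bil_tens])
qed

lemma tmap_tens:
  fixes A :: "('a, 'm) star_alg_scheme" and K :: "('k, 'n) star_alg_scheme"
    and B :: "('b, 'o) star_alg_scheme" and L :: "('l, 'p) star_alg_scheme"
  assumes "cspace A" "cspace K" "cspace B" "cspace L" "lin A B f" "lin K L g"
    "a \<in> carrier A" "k \<in> carrier K"
  shows "tmap B L f g (tens A K a k) = tens B L (f a) (g k)"
  using assms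
  by (simp add: tmap_eq_teval[OF assms(1-6)] tens_closed teval_tens cspace_tensor
      bil_comp_tens[OF bil_tens])

lemma slice_tmap:
  fixes A :: "('a, 'm) star_alg_scheme" and K :: "('k, 'n) star_alg_scheme"
    and B :: "('b, 'o) star_alg_scheme" and L :: "('l, 'p) star_alg_scheme"
  assumes "cspace A" "cspace K" "cspace B" "cspace L" "lin A B f" "lin K L g"
    and \<phi>: "lin L complex_alg \<phi>" and t: "t \<in> carrier (tensor A K)"
  shows "slice B \<phi> (tmap B L f g t) = f (slice A (\<lambda>k. \<phi> (g k)) t)"
proof (rule tensor_ext[OF assms(1,2,3) _ _ _ t])
  have p: "lin K complex_alg (\<lambda>k. \<phi> (g k))" by (rule lin_comp) fact+
  show "lin (tensor A K) B (\<lambda>t. slice B \<phi> (tmap B L f g t))"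
    by (rule lin_comp[OF lin_slice lin_tmap]) fact+
  show "lin (tensor A K) B (\<lambda>t. f (slice A (\<lambda>k. \<phi> (g k)) t))"
    by (rule lin_comp[OF _ lin_slice]) fact+
  show "slice B \<phi> (tmap B L f g (tens A K a k)) = f (slice A (\<lambda>k. \<phi> (g k)) (tens A K a k))"
    if "a \<in> carrier A" "k \<in> carrier K" for a k
    using that assms p by (simp add: tmap_tens[OF assms(1-6)] slice_tens linD)
qed

lemma tmult_eq_teval:
  assumes A: "star_algebra A" and K: "star_algebra K"
    and x: "x \<in> carrier (tensor A K)" and y: "y \<in> carrier (tensor A K)"
  shows "x \<otimes>\<^bsub>tensor A K\<^esub> y = teval (tensor A K) (\<lambda>a k. teval (tensor A K)
     (\<lambda>b l. tens A K (a \<otimes>\<^bsub>A\<^esub> b) (k \<otimes>\<^bsub>K\<^esub> l)) y) x"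
proof -
  interpret A: star_algebra A by fact
  interpret K: star_algebra K by fact
  note cA = cspace_star_algebra[OF A] and cK = cspace_star_algebra[OF K]
  note sx = terms_subset(1)[OF cA cK x] and sy = terms_subset(1)[OF cA cK y]
  have "x \<otimes>\<^bsub>tensor A K\<^esub> y = tclass A K (concat (map (\<lambda>p. map (\<lambda>q.
      (fst p \<otimes>\<^bsub>A\<^esub> fst q, snd p \<otimes>\<^bsub>K\<^esub> snd q)) (terms y)) (terms x)))"
    by (simp add: tensor_def case_prod_unfold)
  also have "\<dots> = lsum (tensor A K) (\<lambda>p. tclass A K (map (\<lambda>q.
      (fst p \<otimes>\<^bsub>A\<^esub> fst q, snd p \<otimes>\<^bsub>K\<^esub> snd q)) (terms y))) (terms x)"
    by (intro tclass_concat[OF cA cK])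
      (auto intro!: A.mult_closed K.mult_closed dest: subsetD[OF sx] subsetD[OF sy])
  also have "\<dots> = lsum (tensor A K) (\<lambda>p. lsum (tensor A K) (\<lambda>q.
      tens A K (fst p \<otimes>\<^bsub>A\<^esub> fst q) (snd p \<otimes>\<^bsub>K\<^esub> snd q)) (terms y)) (terms x)"
    by (intro lsum_cong tclass_map[OF cA cK])
      (auto intro!: A.mult_closed K.mult_closed dest: subsetD[OF sx] subsetD[OF sy])
  finally show ?thesis by (simp add: teval_def case_prod_unfold)
qed

lemma bil_tmult_inner:
  assumes A: "star_algebra A" and K: "star_algebra K" and y: "y \<in> carrier (tensor A K)"
  shows "bil A K (tensor A K) (\<lambda>a k. teval (tensor A K)
     (\<lambda>b l. tens A K (a \<otimes>\<^bsub>A\<^esub> b) (k \<otimes>\<^bsub>K\<^esub> l)) y)"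
proof -
  interpret A: star_algebra A by fact
  interpret K: star_algebra K by fact
  note cA = A.is_cspace and cK = K.is_cspace
  show ?thesis
    using A K y cA cK A.mult_closed K.mult_closed
    by (auto intro!: bilI lin_teval_const cspace_tensor lin_tens_left lin_tens_right
        lin_mult_right lin_id)
qed

lemma bil_tmult_tens:
  assumes A: "star_algebra A" and K: "star_algebra K" and "a \<in> carrier A" "k \<in> carrier K"
  shows "bil A K (tensor A K) (\<lambda>b l. tens A K (a \<otimes>\<^bsub>A\<^esub> b) (k \<otimes>\<^bsub>K\<^esub> l))"
proof -
  interpret A: star_algebra A by fact
  interpret K: star_algebra K by fact
  note cA = cspace_star_algebra[OF A] and cK = cspace_star_algebra[OF K]
  show ?thesis
    using assms cA cK A.mult_closed K.mult_closed
    by (auto intro!: bilI lin_tens_left lin_tens_right lin_mult_left lin_id)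
qed

lemma tmult_tens:
  assumes A: "star_algebra A" and K: "star_algebra K"
    and "a \<in> carrier A" "k \<in> carrier K" "b \<in> carrier A" "l \<in> carrier K"
  shows "tens A K a k \<otimes>\<^bsub>tensor A K\<^esub> tens A K b l = tens A K (a \<otimes>\<^bsub>A\<^esub> b) (k \<otimes>\<^bsub>K\<^esub> l)"
proof -
  note cA = cspace_star_algebra[OF A] and cK = cspace_star_algebra[OF K]
  show ?thesis
    using assms cA cK
    by (simp add: tmult_eq_teval tens_closed teval_tens cspace_tensor bil_tmult_inner
        bil_tmult_tens)
qed

lemma tmult_lin:
  assumes A: "star_algebra A" and K: "star_algebra K" and x: "x \<in> carrier (tensor A K)"
  shows "lin (tensor A K) (tensor A K) (\<lambda>y. y \<otimes>\<^bsub>tensor A K\<^esub> x)"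
    and "lin (tensor A K) (tensor A K) (\<lambda>y. x \<otimes>\<^bsub>tensor A K\<^esub> y)"
proof -
  note cA = cspace_star_algebra[OF A] and cK = cspace_star_algebra[OF K]
  note cT = cspace_tensor[OF cA cK]
  show "lin (tensor A K) (tensor A K) (\<lambda>y. y \<otimes>\<^bsub>tensor A K\<^esub> x)"
    using A K x
    by (intro lin_cong[OF cT tmult_eq_teval] lin_teval bil_tmult_inner cA cK cT)
  show "lin (tensor A K) (tensor A K) (\<lambda>y. x \<otimes>\<^bsub>tensor A K\<^esub> y)"
    using A K x
    by (intro lin_cong[OF cT tmult_eq_teval] lin_teval_const[OF cA cK cT x] lin_teval
        bil_tmult_tens cA cK cT)
qed

lemma tstar_eq:
  assumes A: "star_algebra A" and K: "star_algebra K" and x: "x \<in> carrier (tensor A K)"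
  shows "star (tensor A K) x = teval (tensor A K) (\<lambda>a k. tens A K (star A a) (star K k)) x"
proof -
  interpret A: star_algebra A by fact
  interpret K: star_algebra K by fact
  note cA = cspace_star_algebra[OF A] and cK = cspace_star_algebra[OF K]
  show ?thesis
    unfolding teval_def case_prod_unfold using terms_subset(1)[OF cA cK x]
    by (subst tclass_map[OF cA cK, symmetric])
      (auto simp: tensor_def case_prod_unfold A.star_closed K.star_closed)
qed

text \<open>
  The vector space with conjugated scalars: an antilinear map is a linear map into it, so that the
  rules for linear maps apply to the involutions.
\<close>

definition conj_space :: "(complex, 'a, 'm) module_scheme \<Rightarrow> (complex, 'a, 'm) module_scheme" where
  "conj_space M = M\<lparr>smult := (\<lambda>c x. cnj c \<odot>\<^bsub>M\<^esub> x)\<rparr>"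

lemma conj_space_sel [simp]:
  "carrier (conj_space M) = carrier M" "add (conj_space M) = add M" "zero (conj_space M) = zero M"
  "smult (conj_space M) = (\<lambda>c x. cnj c \<odot>\<^bsub>M\<^esub> x)"
  by (simp_all add: conj_space_def)

lemma cspace_conj: "cspace M \<Longrightarrow> cspace (conj_space M)"
proof -
  assume "cspace M"
  then interpret cspace M .
  show ?thesis
    by (rule cspaceI)
      (simp_all add: scale_add_left scale_add_right scale_scale scale_one scale_zero M.a_assoc M.a_comm M.a_lcomm)
qed

lemma list_sum_conj [simp]: "list_sum (conj_space M) xs = list_sum M xs"
  by (simp add: list_sum_def)

lemma teval_conj [simp]: "teval (conj_space M) = teval M"
  by (intro ext) (simp add: teval_def)

lemma lin_conj_conj: "lin (conj_space M) (conj_space N) f = lin M N f"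
proof -
  have "(\<forall>c. \<forall>x\<in>carrier M. f (cnj c \<odot>\<^bsub>M\<^esub> x) = cnj c \<odot>\<^bsub>N\<^esub> f x) \<longleftrightarrow>
      (\<forall>c. \<forall>x\<in>carrier M. f (c \<odot>\<^bsub>M\<^esub> x) = c \<odot>\<^bsub>N\<^esub> f x)"
    by (metis complex_cnj_cnj)
  then show ?thesis by (simp add: lin_def)
qed

lemma lin_conj_swap: "lin (conj_space M) N f = lin M (conj_space N) f"
proof -
  have "(\<forall>c. \<forall>x\<in>carrier M. f (cnj c \<odot>\<^bsub>M\<^esub> x) = c \<odot>\<^bsub>N\<^esub> f x) \<longleftrightarrow>
      (\<forall>c. \<forall>x\<in>carrier M. f (c \<odot>\<^bsub>M\<^esub> x) = cnj c \<odot>\<^bsub>N\<^esub> f x)"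
    by (metis complex_cnj_cnj)
  then show ?thesis by (simp add: lin_def)
qed

lemma lin_star: "star_algebra A \<Longrightarrow> lin A (conj_space A) (star A)"
  by (rule linI) (simp_all add: star_algebra.star_closed star_algebra.star_add star_algebra.star_smult)

lemma lin_antilin_comp:
  assumes "lin N (conj_space P) g" "lin M (conj_space N) f"
  shows "lin M P (\<lambda>x. g (f x))"
  by (rule lin_comp[OF lin_conj_swap[THEN iffD2, OF assms(1)] assms(2)])

context
  fixes A :: "('a, 'm) star_alg_scheme" and K :: "('k, 'n) star_alg_scheme"
  assumes A: "star_algebra A" and K: "star_algebra K"
begin

interpretation A: star_algebra A by (rule A)
interpretation K: star_algebra K by (rule K)

lemma bil_tstar: "bil A K (conj_space (tensor A K)) (\<lambda>a k. tens A K (star A a) (star K k))"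
proof (rule bilI)
  note b = bil_tens[OF A.is_cspace K.is_cspace]
  show "lin K (conj_space (tensor A K)) (\<lambda>k. tens A K (star A a) (star K k))"
    if "a \<in> carrier A" for a
    by (rule lin_comp[OF lin_conj_conj[THEN iffD2, OF bilD(1)[OF b]] lin_star[OF K]])
      (rule A.star_closed[OF that])
  show "lin A (conj_space (tensor A K)) (\<lambda>a. tens A K (star A a) (star K k))"
    if "k \<in> carrier K" for k
    by (rule lin_comp[OF lin_conj_conj[THEN iffD2, OF bilD(2)[OF b]] lin_star[OF A]])
      (rule K.star_closed[OF that])
qed

lemma cspace_tensor_alg: "cspace (tensor A K)"
  by (rule cspace_tensor[OF A.is_cspace K.is_cspace])

lemma lin_tstar: "lin (tensor A K) (conj_space (tensor A K)) (star (tensor A K))"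
proof (rule lin_cong[OF cspace_tensor_alg tstar_eq[OF A K]])
  show "lin (tensor A K) (conj_space (tensor A K))
      (teval (tensor A K) (\<lambda>a k. tens A K (star A a) (star K k)))"
    using lin_teval[OF A.is_cspace K.is_cspace cspace_conj[OF cspace_tensor_alg] bil_tstar] by simp
qed

lemma tstar_tens:
  "a \<in> carrier A \<Longrightarrow> k \<in> carrier K \<Longrightarrow>
    star (tensor A K) (tens A K a k) = tens A K (star A a) (star K k)"
  using teval_tens[OF A.is_cspace K.is_cspace cspace_conj[OF cspace_tensor_alg] bil_tstar]
  by (simp add: tstar_eq[OF A K] tens_closed)

lemma tensor_ext_alg:
  assumes "cspace M" "lin (tensor A K) M F" "lin (tensor A K) M G"
    and "\<And>a k. a \<in> carrier A \<Longrightarrow> k \<in> carrier K \<Longrightarrow> F (tens A K a k) = G (tens A K a k)"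
    and "t \<in> carrier (tensor A K)"
  shows "F t = G t"
  by (rule tensor_ext[OF A.is_cspace K.is_cspace]) fact+

lemma star_algebra_tensor: "star_algebra (tensor A K)"
proof -
  let ?T = "tensor A K"
  interpret T: cspace ?T by (rule cspace_tensor_alg)
  note cT = cspace_tensor_alg
  note ext = tensor_ext_alg[OF cT] and lr = tmult_lin(1)[OF A K] and ll = tmult_lin(2)[OF A K]
  note tm = tmult_tens[OF A K]
  note clo = tens_closed A.mult_closed K.mult_closed A.star_closed K.star_closed
    A.one_closed K.one_closed
  have mc: "x \<otimes>\<^bsub>?T\<^esub> y \<in> carrier ?T" if "x \<in> carrier ?T" "y \<in> carrier ?T" for x y
    by (rule linD(1)[OF lr[OF that(2)] that(1)])
  have sc: "star ?T x \<in> carrier ?T" if "x \<in> carrier ?T" for x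
    using linD(1)[OF lin_tstar that] by simp
  have one: "\<one>\<^bsub>?T\<^esub> \<in> carrier ?T" by (simp only: tensor_sel(3) clo)
  have assoc: "x \<otimes>\<^bsub>?T\<^esub> y \<otimes>\<^bsub>?T\<^esub> z = x \<otimes>\<^bsub>?T\<^esub> (y \<otimes>\<^bsub>?T\<^esub> z)"
    if x: "x \<in> carrier ?T" and y: "y \<in> carrier ?T" and z: "z \<in> carrier ?T" for x y z
  proof (rule ext[OF _ _ _ x, of "\<lambda>x. x \<otimes>\<^bsub>?T\<^esub> y \<otimes>\<^bsub>?T\<^esub> z"])
    show "lin ?T ?T (\<lambda>x. x \<otimes>\<^bsub>?T\<^esub> y \<otimes>\<^bsub>?T\<^esub> z)" by (rule lin_comp[OF lr[OF z] lr[OF y]])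
    show "lin ?T ?T (\<lambda>x. x \<otimes>\<^bsub>?T\<^esub> (y \<otimes>\<^bsub>?T\<^esub> z))" by (rule lr[OF mc[OF y z]])
    fix a k assume a: "a \<in> carrier A" and k: "k \<in> carrier K"
    note t = tens_closed[OF a k]
    show "tens A K a k \<otimes>\<^bsub>?T\<^esub> y \<otimes>\<^bsub>?T\<^esub> z = tens A K a k \<otimes>\<^bsub>?T\<^esub> (y \<otimes>\<^bsub>?T\<^esub> z)"
    proof (rule ext[OF _ _ _ y, of "\<lambda>y. tens A K a k \<otimes>\<^bsub>?T\<^esub> y \<otimes>\<^bsub>?T\<^esub> z"])
      show "lin ?T ?T (\<lambda>y. tens A K a k \<otimes>\<^bsub>?T\<^esub> y \<otimes>\<^bsub>?T\<^esub> z)" by (rule lin_comp[OF lr[OF z] ll[OF t]])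
      show "lin ?T ?T (\<lambda>y. tens A K a k \<otimes>\<^bsub>?T\<^esub> (y \<otimes>\<^bsub>?T\<^esub> z))" by (rule lin_comp[OF ll[OF t] lr[OF z]])
      fix b l assume b: "b \<in> carrier A" and l: "l \<in> carrier K"
      note s = tens_closed[OF b l]
      show "tens A K a k \<otimes>\<^bsub>?T\<^esub> tens A K b l \<otimes>\<^bsub>?T\<^esub> z = tens A K a k \<otimes>\<^bsub>?T\<^esub> (tens A K b l \<otimes>\<^bsub>?T\<^esub> z)"
      proof (rule ext[OF _ _ _ z])
        show "lin ?T ?T (\<lambda>z. tens A K a k \<otimes>\<^bsub>?T\<^esub> tens A K b l \<otimes>\<^bsub>?T\<^esub> z)" by (rule ll[OF mc[OF t s]])
        show "lin ?T ?T (\<lambda>z. tens A K a k \<otimes>\<^bsub>?T\<^esub> (tens A K b l \<otimes>\<^bsub>?T\<^esub> z))"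
          by (rule lin_comp[OF ll[OF t] ll[OF s]])
      qed (use a k b l in \<open>simp add: tm clo A.mult_assoc K.mult_assoc\<close>)
    qed
  qed
  have ol: "\<one>\<^bsub>?T\<^esub> \<otimes>\<^bsub>?T\<^esub> x = x" if x: "x \<in> carrier ?T" for x
    by (rule ext[OF ll[OF one] lin_id _ x])
      (simp add: tensor_sel(3) tm clo A.mult_one_left K.mult_one_left)
  have or: "x \<otimes>\<^bsub>?T\<^esub> \<one>\<^bsub>?T\<^esub> = x" if x: "x \<in> carrier ?T" for x
    by (rule ext[OF lr[OF one] lin_id _ x])
      (simp add: tensor_sel(3) tm clo A.mult_one_right K.mult_one_right)
  have ring: "ring ?T"
    by (rule ringI[OF T.M.abelian_group_axioms monoidI])
      (simp_all add: mc one assoc ol or linD(2)[OF lr] linD(2)[OF ll])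
  have ss: "star ?T (star ?T x) = x" if x: "x \<in> carrier ?T" for x
    by (rule ext[OF lin_antilin_comp[OF lin_tstar lin_tstar] lin_id _ x])
      (simp add: tstar_tens clo A.star_star K.star_star)
  have sm: "star ?T (x \<otimes>\<^bsub>?T\<^esub> y) = star ?T y \<otimes>\<^bsub>?T\<^esub> star ?T x"
    if x: "x \<in> carrier ?T" and y: "y \<in> carrier ?T" for x y
  proof (rule tensor_ext_alg[OF cspace_conj[OF cT] _ _ _ x, of "\<lambda>x. star ?T (x \<otimes>\<^bsub>?T\<^esub> y)"])
    show "lin ?T (conj_space ?T) (\<lambda>x. star ?T (x \<otimes>\<^bsub>?T\<^esub> y))"
      by (rule lin_comp[OF lin_tstar lr[OF y]])
    show "lin ?T (conj_space ?T) (\<lambda>x. star ?T y \<otimes>\<^bsub>?T\<^esub> star ?T x)"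
      by (rule lin_comp[OF lin_conj_conj[THEN iffD2, OF ll[OF sc[OF y]]] lin_tstar])
    fix a k assume a: "a \<in> carrier A" and k: "k \<in> carrier K"
    note t = tens_closed[OF a k]
    show "star ?T (tens A K a k \<otimes>\<^bsub>?T\<^esub> y) = star ?T y \<otimes>\<^bsub>?T\<^esub> star ?T (tens A K a k)"
    proof (rule tensor_ext_alg[OF cspace_conj[OF cT] _ _ _ y])
      show "lin ?T (conj_space ?T) (\<lambda>y. star ?T (tens A K a k \<otimes>\<^bsub>?T\<^esub> y))"
        by (rule lin_comp[OF lin_tstar ll[OF t]])
      show "lin ?T (conj_space ?T) (\<lambda>y. star ?T y \<otimes>\<^bsub>?T\<^esub> star ?T (tens A K a k))"
        by (rule lin_comp[OF lin_conj_conj[THEN iffD2, OF lr[OF sc[OF t]]] lin_tstar])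
    qed (use a k in \<open>simp add: tm tstar_tens clo A.star_mult K.star_mult\<close>)
  qed
  show ?thesis
    unfolding star_algebra_def star_algebra_axioms_def
    using ring T.module_axioms
    by (auto simp: linD(3)[OF lr] linD(3)[OF ll] sc ss sm
        linD(2,3)[OF lin_tstar, simplified])
qed

end

section \<open>Slices of tensors\<close>

lemma lin_id': "lin M M id"
  by (rule linI) auto

context
  fixes A :: "('a, 'm) star_alg_scheme" and K :: "('k, 'n) star_alg_scheme"
  assumes A: "star_algebra A" and K: "star_algebra K"
begin

interpretation A: star_algebra A by (rule A)
interpretation K: star_algebra K by (rule K)

lemma slice_tens_mult_left:
  assumes \<phi>: "lin K complex_alg \<phi>" and a: "a \<in> carrier A" and k: "k \<in> carrier K"
    and y: "y \<in> carrier (tensor A K)"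
  shows "slice A \<phi> (tens A K a k \<otimes>\<^bsub>tensor A K\<^esub> y) = a \<otimes>\<^bsub>A\<^esub> slice A (\<lambda>l. \<phi> (k \<otimes>\<^bsub>K\<^esub> l)) y"
proof (rule tensor_ext_alg[OF A K A.is_cspace _ _ _ y])
  have p: "lin K complex_alg (\<lambda>l. \<phi> (k \<otimes>\<^bsub>K\<^esub> l))"
    by (rule lin_comp[OF \<phi> lin_mult_left[OF K k lin_id]])
  note ls = lin_slice[OF A.is_cspace K.is_cspace]
  show "lin (tensor A K) A (\<lambda>y. slice A \<phi> (tens A K a k \<otimes>\<^bsub>tensor A K\<^esub> y))"
    by (rule lin_comp[OF ls[OF \<phi>] tmult_lin(2)[OF A K tens_closed[OF a k]]])
  show "lin (tensor A K) A (\<lambda>y. a \<otimes>\<^bsub>A\<^esub> slice A (\<lambda>l. \<phi> (k \<otimes>\<^bsub>K\<^esub> l)) y)"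
    by (rule lin_mult_left[OF A a ls[OF p]])
  show "slice A \<phi> (tens A K a k \<otimes>\<^bsub>tensor A K\<^esub> tens A K b l)
      = a \<otimes>\<^bsub>A\<^esub> slice A (\<lambda>l. \<phi> (k \<otimes>\<^bsub>K\<^esub> l)) (tens A K b l)"
    if "b \<in> carrier A" "l \<in> carrier K" for b l
    using that a k p \<phi>
    by (simp add: tmult_tens[OF A K] slice_tens[OF A.is_cspace K.is_cspace] A.mult_closed
        K.mult_closed A.smult_mult_right)
qed

lemma slice_tens_mult_right:
  assumes \<phi>: "lin K complex_alg \<phi>" and a: "a \<in> carrier A" and k: "k \<in> carrier K"
    and y: "y \<in> carrier (tensor A K)"
  shows "slice A \<phi> (y \<otimes>\<^bsub>tensor A K\<^esub> tens A K a k) = slice A (\<lambda>l. \<phi> (l \<otimes>\<^bsub>K\<^esub> k)) y \<otimes>\<^bsub>A\<^esub> a"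
proof (rule tensor_ext_alg[OF A K A.is_cspace _ _ _ y, of "\<lambda>y. slice A \<phi> (y \<otimes>\<^bsub>tensor A K\<^esub> tens A K a k)"])
  have p: "lin K complex_alg (\<lambda>l. \<phi> (l \<otimes>\<^bsub>K\<^esub> k))"
    by (rule lin_comp[OF \<phi> lin_mult_right[OF K k lin_id]])
  note ls = lin_slice[OF A.is_cspace K.is_cspace]
  show "lin (tensor A K) A (\<lambda>y. slice A \<phi> (y \<otimes>\<^bsub>tensor A K\<^esub> tens A K a k))"
    by (rule lin_comp[OF ls[OF \<phi>] tmult_lin(1)[OF A K tens_closed[OF a k]]])
  show "lin (tensor A K) A (\<lambda>y. slice A (\<lambda>l. \<phi> (l \<otimes>\<^bsub>K\<^esub> k)) y \<otimes>\<^bsub>A\<^esub> a)"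
    by (rule lin_mult_right[OF A a ls[OF p]])
  show "slice A \<phi> (tens A K b l \<otimes>\<^bsub>tensor A K\<^esub> tens A K a k)
      = slice A (\<lambda>l. \<phi> (l \<otimes>\<^bsub>K\<^esub> k)) (tens A K b l) \<otimes>\<^bsub>A\<^esub> a"
    if "b \<in> carrier A" "l \<in> carrier K" for b l
    using that a k p \<phi>
    by (simp add: tmult_tens[OF A K] slice_tens[OF A.is_cspace K.is_cspace] A.mult_closed
        K.mult_closed A.smult_mult_left)
qed

lemma slice_star:
  assumes \<phi>: "lin K complex_alg \<phi>" and x: "x \<in> carrier (tensor A K)"
  shows "slice A \<phi> (star (tensor A K) x) = star A (slice A (\<lambda>k. cnj (\<phi> (star K k))) x)"
proof -
  note cA = A.is_cspace and cK = K.is_cspace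
  have p: "lin K complex_alg (\<lambda>k. cnj (\<phi> (star K k)))"
    using lin_comp[OF lin_conj_conj[THEN iffD2, OF \<phi>] lin_star[OF K]] by (simp add: lin_def)
  show ?thesis
  proof (rule tensor_ext_alg[OF A K cspace_conj[OF cA] _ _ _ x, of "\<lambda>x. slice A \<phi> (star (tensor A K) x)"])
    show "lin (tensor A K) (conj_space A) (\<lambda>x. slice A \<phi> (star (tensor A K) x))"
      by (rule lin_comp[OF lin_conj_conj[THEN iffD2, OF lin_slice[OF cA cK \<phi>]] lin_tstar[OF A K]])
    show "lin (tensor A K) (conj_space A) (\<lambda>x. star A (slice A (\<lambda>k. cnj (\<phi> (star K k))) x))"
      by (rule lin_comp[OF lin_star[OF A] lin_slice[OF cA cK p]])
    show "slice A \<phi> (star (tensor A K) (tens A K a k))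
        = star A (slice A (\<lambda>k. cnj (\<phi> (star K k))) (tens A K a k))"
      if "a \<in> carrier A" "k \<in> carrier K" for a k
      using that p \<phi> by (simp add: tstar_tens[OF A K] slice_tens[OF cA cK] A.star_closed
          K.star_closed A.star_smult)
  qed
qed

end

definition tpair :: "('k \<Rightarrow> complex) \<Rightarrow> ('l \<Rightarrow> complex) \<Rightarrow> ('k \<times> 'l) list set \<Rightarrow> complex" where
  "tpair \<phi> \<psi> t = (\<Sum>(k, l)\<leftarrow>terms t. \<phi> k * \<psi> l)"

lemma tpair_eq_teval: "tpair \<phi> \<psi> t = teval complex_alg (\<lambda>k l. \<phi> k * \<psi> l) t"
  by (simp add: tpair_def teval_def list_sum_complex)

lemma bil_pair: "lin K complex_alg \<phi> \<Longrightarrow> lin L complex_alg \<psi> \<Longrightarrow>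
    bil K L complex_alg (\<lambda>k l. \<phi> k * \<psi> l)"
  by (intro bilI lin_cmult_left lin_cmult_right)

lemma lin_tpair:
  assumes "cspace K" "cspace L" "lin K complex_alg \<phi>" "lin L complex_alg \<psi>"
  shows "lin (tensor K L) complex_alg (tpair \<phi> \<psi>)"
  unfolding tpair_eq_teval[abs_def] using assms by (intro lin_teval cspace_complex bil_pair)

lemma tpair_tens:
  assumes "cspace K" "cspace L" "lin K complex_alg \<phi>" "lin L complex_alg \<psi>"
    "k \<in> carrier K" "l \<in> carrier L"
  shows "tpair \<phi> \<psi> (tens K L k l) = \<phi> k * \<psi> l"
  unfolding tpair_eq_teval using assms by (simp add: teval_tens cspace_complex bil_pair)

lemma tassoc_eq_teval:
  assumes A: "cspace A" and K: "cspace K" and L: "cspace L"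
    and x: "x \<in> carrier (tensor (tensor A K) L)"
  shows "tassoc A K L x = teval (tensor A (tensor K L))
     (\<lambda>t l. teval (tensor A (tensor K L)) (\<lambda>a k. tens A (tensor K L) a (tens K L k l)) t) x"
proof -
  note T = cspace_tensor[OF A K] and KL = cspace_tensor[OF K L]
  let ?R = "tensor A (tensor K L)"
  have mem: "a \<in> carrier A \<and> k \<in> carrier K \<and> l \<in> carrier L"
    if "(t, l) \<in> set (terms x)" "(a, k) \<in> set (terms t)" for t l a k
    using terms_mem[OF T L x that(1)] terms_mem[OF A K _ that(2)] by simp
  have "tassoc A K L x = tclass A (tensor K L) (concat (map (\<lambda>p. map (\<lambda>q.
      (fst q, tens K L (snd q) (snd p))) (terms (fst p))) (terms x)))"
    by (simp add: tassoc_def case_prod_unfold)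
  also have "\<dots> = lsum ?R (\<lambda>p. tclass A (tensor K L) (map (\<lambda>q.
      (fst q, tens K L (snd q) (snd p))) (terms (fst p)))) (terms x)"
    by (intro tclass_concat[OF A KL]) (auto dest: mem intro!: tens_closed)
  also have "\<dots> = lsum ?R (\<lambda>p. lsum ?R (\<lambda>q. tens A (tensor K L)
      (fst q) (tens K L (snd q) (snd p))) (terms (fst p))) (terms x)"
    by (intro lsum_cong tclass_map[OF A KL]) (auto dest: mem intro!: tens_closed)
  finally show ?thesis by (simp add: teval_def case_prod_unfold)
qed

lemma bil_tassoc:
  assumes A: "cspace A" and K: "cspace K" and L: "cspace L"
  shows "l \<in> carrier L \<Longrightarrow>
      bil A K (tensor A (tensor K L)) (\<lambda>a k. tens A (tensor K L) a (tens K L k l))"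
    and "bil (tensor A K) L (tensor A (tensor K L)) (\<lambda>t l. teval (tensor A (tensor K L))
      (\<lambda>a k. tens A (tensor K L) a (tens K L k l)) t)"
proof -
  note KL = cspace_tensor[OF K L]
  note R = cspace_tensor[OF A KL]
  show b: "bil A K (tensor A (tensor K L)) (\<lambda>a k. tens A (tensor K L) a (tens K L k l))"
    if "l \<in> carrier L" for l
    using that by (intro bilI lin_tens_left[OF A KL] lin_tens_right[OF A KL] lin_tens_left[OF K L]
        lin_id tens_closed)
  show "bil (tensor A K) L (tensor A (tensor K L)) (\<lambda>t l. teval (tensor A (tensor K L))
      (\<lambda>a k. tens A (tensor K L) a (tens K L k l)) t)"
    by (intro bilI lin_teval[OF A K R] b lin_teval_const[OF A K R] lin_tens_right[OF A KL]
        lin_tens_right[OF K L] lin_id)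
qed

text \<open>
  Equations in a threefold tensor product are compared through this formula: it turns the
  identification \<open>(A \<otimes> K) \<otimes> L = A \<otimes> (K \<otimes> L)\<close> into iterated slices.
\<close>

lemma slice_tassoc:
  assumes A: "cspace A" and K: "cspace K" and L: "cspace L"
    and \<phi>: "lin K complex_alg \<phi>" and \<psi>: "lin L complex_alg \<psi>"
    and x: "x \<in> carrier (tensor (tensor A K) L)"
  shows "slice A (tpair \<phi> \<psi>) (tassoc A K L x) = slice A \<phi> (slice (tensor A K) \<psi> x)"
proof -
  note T = cspace_tensor[OF A K] and KL = cspace_tensor[OF K L]
  note R = cspace_tensor[OF A KL] and pp = lin_tpair[OF K L \<phi> \<psi>]
  note b = bil_tassoc[OF A K L]
  note ls = lin_slice[OF A KL pp]
  note interchange = cspace.scale_scale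
  let ?f = "\<lambda>t l. teval (tensor A (tensor K L)) (\<lambda>a k. tens A (tensor K L) a (tens K L k l)) t"
  have "slice A (tpair \<phi> \<psi>) (teval (tensor A (tensor K L)) ?f x) = slice A \<phi> (slice (tensor A K) \<psi> x)"
  proof (rule tensor_ext[OF T L A _ _ _ x])
    show "lin (tensor (tensor A K) L) A (\<lambda>x. slice A (tpair \<phi> \<psi>) (teval (tensor A (tensor K L)) ?f x))"
      by (rule lin_comp[OF ls lin_teval[OF T L R b(2)]])
    show "lin (tensor (tensor A K) L) A (\<lambda>x. slice A \<phi> (slice (tensor A K) \<psi> x))"
      by (rule lin_comp[OF lin_slice[OF A K \<phi>] lin_slice[OF T L \<psi>]])
    fix t l assume t: "t \<in> carrier (tensor A K)" and l: "l \<in> carrier L"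
    have "slice A (tpair \<phi> \<psi>) (?f t l) = \<psi> l \<odot>\<^bsub>A\<^esub> slice A \<phi> t"
    proof (rule tensor_ext[OF A K A _ _ _ t])
      show "lin (tensor A K) A (\<lambda>t. slice A (tpair \<phi> \<psi>) (?f t l))"
        by (rule lin_comp[OF ls lin_teval[OF A K R b(1)[OF l]]])
      show "lin (tensor A K) A (\<lambda>t. \<psi> l \<odot>\<^bsub>A\<^esub> slice A \<phi> t)"
        by (rule lin_const_scale[OF A lin_slice[OF A K \<phi>]])
      show "slice A (tpair \<phi> \<psi>) (?f (tens A K a k) l) = \<psi> l \<odot>\<^bsub>A\<^esub> slice A \<phi> (tens A K a k)"
        if "a \<in> carrier A" "k \<in> carrier K" for a k
        using that l
        by (simp add: teval_tens[OF A K R b(1)] slice_tens[OF A KL pp] tens_closed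
            tpair_tens[OF K L \<phi> \<psi>] slice_tens[OF A K \<phi>] interchange[OF A] mult.commute)
    qed
    then show "slice A (tpair \<phi> \<psi>) (teval (tensor A (tensor K L)) ?f (tens (tensor A K) L t l))
      = slice A \<phi> (slice (tensor A K) \<psi> (tens (tensor A K) L t l))"
      using t l by (simp add: teval_tens[OF T L R b(2)] slice_tens[OF T L \<psi>]
          linD(3)[OF lin_slice[OF A K \<phi>]])
  qed
  then show ?thesis by (simp add: tassoc_eq_teval[OF A K L x])
qed

lemma slice_tmap_id:
  fixes A :: "('a, 'm) star_alg_scheme" and K :: "('k, 'n) star_alg_scheme"
    and L :: "('l, 'p) star_alg_scheme"
  assumes "cspace A" "cspace K" "cspace L" "lin K L g" "lin L complex_alg \<phi>"
    "t \<in> carrier (tensor A K)"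
  shows "slice A \<phi> (tmap A L id g t) = slice A (\<lambda>k. \<phi> (g k)) t"
  using slice_tmap[OF assms(1,2,1,3) lin_id' assms(4-6)] by simp

section \<open>Finite dimensional spaces\<close>

text \<open>Gaussian elimination; every comparison of dimensions below is an instance of this.\<close>

lemma underdetermined_system:
  fixes c :: "'i \<Rightarrow> nat \<Rightarrow> complex"
  assumes "finite M" "card M > n"
  shows "\<exists>d. (\<exists>m\<in>M. d m \<noteq> 0) \<and> (\<forall>i<n. (\<Sum>m\<in>M. d m * c m i) = 0)"
  using assms
proof (induction n arbitrary: M c)
  case 0
  then have "M \<noteq> {}" by auto
  then show ?case by (intro exI[of _ "\<lambda>_. 1"]) auto
next
  case (Suc n)
  show ?case
  proof (cases "\<forall>m\<in>M. c m n = 0")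
    case True
    obtain d where "\<exists>m\<in>M. d m \<noteq> 0" "\<forall>i<n. (\<Sum>m\<in>M. d m * c m i) = 0"
      using Suc.IH[of M c] Suc.prems by auto
    then show ?thesis using True by (intro exI[of _ d]) (auto simp: less_Suc_eq)
  next
    case False
    then obtain q where q: "q \<in> M" "c q n \<noteq> 0" by auto
    let ?N = "M - {q}"
    have card_N: "finite ?N" "card ?N > n" using Suc.prems q by auto
    let ?c = "\<lambda>m i. c m i - c m n / c q n * c q i"
    obtain d where d: "\<exists>m\<in>?N. d m \<noteq> 0" "\<forall>i<n. (\<Sum>m\<in>?N. d m * ?c m i) = 0"
      using Suc.IH[of ?N ?c] card_N by blast
    let ?d = "\<lambda>m. if m = q then - (\<Sum>m\<in>?N. d m * c m n) / c q n else d m"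
    have sum: "(\<Sum>m\<in>M. ?d m * c m i) = (\<Sum>m\<in>?N. d m * ?c m i)" for i
    proof -
      have "(\<Sum>m\<in>M. ?d m * c m i) = ?d q * c q i + (\<Sum>m\<in>?N. ?d m * c m i)"
        using q Suc.prems by (intro sum.remove) auto
      also have "(\<Sum>m\<in>?N. ?d m * c m i) = (\<Sum>m\<in>?N. d m * c m i)" by (intro sum.cong) auto
      finally show ?thesis
        by (simp add: right_diff_distrib sum_subtractf sum_divide_distrib sum_distrib_right
            sum_distrib_left algebra_simps)
    qed
    have "(\<Sum>m\<in>?N. d m * ?c m n) = 0" using q(2) by simp
    then show ?thesis
      using d by (intro exI[of _ ?d]) (auto simp: sum less_Suc_eq)
  qed
qed

definition coordinates ::
  "(complex, 'k, 'n) module_scheme \<Rightarrow> nat \<Rightarrow> (nat \<Rightarrow> 'k) \<Rightarrow> (nat \<Rightarrow> 'k \<Rightarrow> complex) \<Rightarrow> bool" where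
  "coordinates K n e f \<longleftrightarrow> (\<forall>i<n. e i \<in> carrier K) \<and> (\<forall>i<n. lin K complex_alg (f i)) \<and>
     (\<forall>i<n. \<forall>j<n. f i (e j) = (if i = j then 1 else 0)) \<and>
     (\<forall>x\<in>carrier K. x = lsum K (\<lambda>i. f i x \<odot>\<^bsub>K\<^esub> e i) [0..<n])"

lemma coordinatesD:
  assumes "coordinates K n e f"
  shows "i < n \<Longrightarrow> e i \<in> carrier K" "i < n \<Longrightarrow> lin K complex_alg (f i)"
    "i < n \<Longrightarrow> j < n \<Longrightarrow> f i (e j) = (if i = j then 1 else 0)"
    "x \<in> carrier K \<Longrightarrow> lsum K (\<lambda>i. f i x \<odot>\<^bsub>K\<^esub> e i) [0..<n] = x"
  using assms by (auto simp: coordinates_def)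

lemma lin_combination:
  assumes K: "cspace K" and M: "cspace M" and F: "lin K M F" and e: "\<And>i. i < n \<Longrightarrow> e i \<in> carrier K"
    and x: "lsum K (\<lambda>i. c i \<odot>\<^bsub>K\<^esub> e i) [0..<n] = x"
  shows "lsum M (\<lambda>i. c i \<odot>\<^bsub>M\<^esub> F (e i)) [0..<n] = F x"
proof -
  have "F x = lsum M (\<lambda>i. F (c i \<odot>\<^bsub>K\<^esub> e i)) [0..<n]"
    unfolding x[symmetric] using e by (intro lin_lsum_apply[OF K M F]) (auto intro: cspace.scale_closed[OF K])
  also have "\<dots> = lsum M (\<lambda>i. c i \<odot>\<^bsub>M\<^esub> F (e i)) [0..<n]"
    using e by (intro lsum_cong) (simp add: linD(3)[OF F])
  finally show ?thesis ..
qed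

lemma lin_expand:
  assumes "cspace K" "cspace M" "coordinates K n e f" "lin K M F" "x \<in> carrier K"
  shows "F x = lsum M (\<lambda>i. f i x \<odot>\<^bsub>M\<^esub> F (e i)) [0..<n]"
  by (rule lin_combination[OF assms(1,2,4) coordinatesD(1,4)[OF assms(3)], symmetric]; (assumption | rule assms))

context cspace
begin

lemma finsum_eq_lsum:
  "(\<And>i. i < n \<Longrightarrow> f i \<in> carrier M) \<Longrightarrow> (\<Oplus>i\<in>{..<(n::nat)}. f i) = lsum M f [0..<n]"
proof (induction n)
  case (Suc n)
  have "set (map f [0..<n]) \<subseteq> carrier M" "set [f n] \<subseteq> carrier M"
    using Suc.prems by auto
  then have "lsum M f ([0..<n] @ [n]) = lsum M f [0..<n] \<oplus> f n"
    using list_sum_append[of "map f [0..<n]" "[f n]"] by simp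
  moreover have "(\<Oplus>i\<in>{..<Suc n}. f i) = f n \<oplus> (\<Oplus>i\<in>{..<n}. f i)"
    unfolding lessThan_Suc using Suc.prems by (intro M.finsum_insert) auto
  ultimately show ?case using Suc lsum_closed[of "[0..<n]" f] by (simp add: M.a_comm)
qed simp

lemma lsum_remove1:
  "k \<in> set xs \<Longrightarrow> (\<And>x. x \<in> set xs \<Longrightarrow> f x \<in> carrier M) \<Longrightarrow>
    lsum M f xs = f k \<oplus> lsum M f (remove1 k xs)"
proof (induction xs)
  case (Cons x xs)
  have "lsum M f (remove1 k xs) \<in> carrier M"
    using Cons.prems by (intro lsum_closed) (meson list.set_intros(2) notin_set_remove1)
  then show ?case using Cons by (auto simp: M.a_lcomm)
qed simp

text \<open>
  A shortest spanning sublist is linearly independent, and the coefficients with respect to it are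
  then linear functionals.
\<close>

lemma exists_coordinates:
  assumes "\<forall>i<(n::nat). e i \<in> carrier M"
    and span: "\<forall>x\<in>carrier M. \<exists>c. x = (\<Oplus>i\<in>{..<n}. c i \<odot> e i)"
  shows "\<exists>n e f. coordinates M n e f"
proof -
  define spans where "spans is \<longleftrightarrow> distinct is \<and> set is \<subseteq> {..<n} \<and>
    (\<forall>x\<in>carrier M. \<exists>c. x = lsum M (\<lambda>i. c i \<odot> e i) is)" for "is"
  have "spans [0..<n]"
    unfolding spans_def
  proof (intro conjI ballI)
    fix x assume "x \<in> carrier M"
    then obtain c where "x = (\<Oplus>i\<in>{..<n}. c i \<odot> e i)" using span by blast
    then show "\<exists>c. x = lsum M (\<lambda>i. c i \<odot> e i) [0..<n]"
      using assms(1) finsum_eq_lsum[of n "\<lambda>i. c i \<odot> e i"] by auto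
  qed auto
  then obtain "is" where sp: "spans is" and min: "\<And>js. spans js \<Longrightarrow> length is \<le> length js"
    using ex_has_least_nat[of spans "[0..<n]" length] by blast
  have eclo: "e i \<in> carrier M" if "i \<in> set is" for i
    using that sp assms(1) by (auto simp: spans_def)
  have sclo: "lsum M (\<lambda>i. c i \<odot> e i) js \<in> carrier M" if "set js \<subseteq> set is" for c js
    using that eclo by (intro lsum_closed) auto
  have indep: "c k = 0" if zero: "lsum M (\<lambda>i. c i \<odot> e i) is = \<zero>" and k: "k \<in> set is" for c k
  proof (rule ccontr)
    assume ck: "c k \<noteq> 0"
    let ?js = "remove1 k is"
    have js: "set ?js \<subseteq> set is" by (rule set_remove1_subset)
    have ek: "e k = lsum M (\<lambda>i. (- c i / c k) \<odot> e i) ?js"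
    proof -
      have "c k \<odot> e k \<oplus> lsum M (\<lambda>i. c i \<odot> e i) ?js = \<zero>"
        using zero k eclo lsum_remove1[of k "is" "\<lambda>i. c i \<odot> e i"] by auto
      then have "c k \<odot> e k = \<ominus> lsum M (\<lambda>i. c i \<odot> e i) ?js"
        using sclo[OF js] eclo[OF k] by (metis M.minus_equality scale_closed)
      then have "c k \<odot> e k = (-1) \<odot> lsum M (\<lambda>i. c i \<odot> e i) ?js"
        using sclo[OF js] by (simp add: scale_minus)
      then have "(1 / c k) \<odot> (c k \<odot> e k) = (1 / c k) \<odot> ((-1) \<odot> lsum M (\<lambda>i. c i \<odot> e i) ?js)"
        by simp
      then have "e k = (- 1 / c k) \<odot> lsum M (\<lambda>i. c i \<odot> e i) ?js"
        using sclo[OF js] eclo[OF k] ck by (simp add: scale_scale scale_one)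
      also have "\<dots> = lsum M (\<lambda>i. (- 1 / c k) \<odot> (c i \<odot> e i)) ?js"
        using eclo js by (intro lsum_scale[symmetric]) auto
      also have "\<dots> = lsum M (\<lambda>i. (- c i / c k) \<odot> e i) ?js"
        using eclo js by (intro lsum_cong) (auto simp: scale_scale)
      finally show ?thesis .
    qed
    have "spans ?js"
      unfolding spans_def
    proof (intro conjI ballI)
      show "distinct ?js" using sp by (simp add: spans_def)
      show "set ?js \<subseteq> {..<n}" using js sp by (auto simp: spans_def)
      fix x assume "x \<in> carrier M"
      then obtain d where "x = lsum M (\<lambda>i. d i \<odot> e i) is" using sp by (auto simp: spans_def)
      then have "x = d k \<odot> e k \<oplus> lsum M (\<lambda>i. d i \<odot> e i) ?js"
        using k eclo lsum_remove1[of k "is" "\<lambda>i. d i \<odot> e i"] by auto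
      also have "d k \<odot> e k = lsum M (\<lambda>i. d k \<odot> ((- c i / c k) \<odot> e i)) ?js"
        using ek eclo js by (subst lsum_scale) auto
      also have "\<dots> \<oplus> lsum M (\<lambda>i. d i \<odot> e i) ?js
          = lsum M (\<lambda>i. d k \<odot> ((- c i / c k) \<odot> e i) \<oplus> d i \<odot> e i) ?js"
        using eclo js by (intro lsum_add[symmetric]) auto
      also have "\<dots> = lsum M (\<lambda>i. (d k * (- c i / c k) + d i) \<odot> e i) ?js"
      proof (rule lsum_cong)
        fix i assume "i \<in> set ?js"
        then have ei: "e i \<in> carrier M" using eclo js by auto
        show "d k \<odot> ((- c i / c k) \<odot> e i) \<oplus> d i \<odot> e i = (d k * (- c i / c k) + d i) \<odot> e i"
          by (simp only: scale_scale[OF ei] scale_add_left[OF ei])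
      qed
      finally show "\<exists>c. x = lsum M (\<lambda>i. c i \<odot> e i) ?js"
        by (rule exI[of _ "\<lambda>i. d k * (- c i / c k) + d i"])
    qed
    moreover have "length ?js < length is"
      using length_pos_if_in_set[OF k] k by (simp add: length_remove1)
    ultimately show False using min[of ?js] by simp
  qed
  define N where "N = length is"
  define b where "b j = e (is ! j)" for j
  have bclo: "b j \<in> carrier M" if "j < N" for j
    using that eclo by (auto simp: b_def N_def)
  have dist: "distinct is" using sp by (simp add: spans_def)
  have nth: "lsum M g is = lsum M (\<lambda>j. g (is ! j)) [0..<N]" for g
    by (metis (no_types, lifting) N_def map_map comp_def map_cong map_nth)
  have ind: "c j = 0" if "lsum M (\<lambda>j. c j \<odot> b j) [0..<N] = \<zero>" "j < N" for c j
  proof -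
    define g where "g = inv_into {..<N} (\<lambda>j. is ! j)"
    have g: "g (is ! j) = j" if "j < N" for j
      unfolding g_def using inj_on_nth[OF dist, of "{..<N}"] that
      by (intro inv_into_f_f) (auto simp: N_def)
    have "lsum M (\<lambda>i. c (g i) \<odot> e i) is = lsum M (\<lambda>j. c j \<odot> b j) [0..<N]"
      unfolding nth by (intro lsum_cong) (auto simp: g b_def)
    then have "c (g (is ! j)) = 0"
      using that indep[of "\<lambda>i. c (g i)" "is ! j"] by (auto simp: N_def)
    then show ?thesis using g that(2) by simp
  qed
  have ex: "\<exists>c. x = lsum M (\<lambda>j. c j \<odot> b j) [0..<N]" if x: "x \<in> carrier M" for x
  proof -
    obtain c where c: "x = lsum M (\<lambda>i. c i \<odot> e i) is"
      using sp x by (auto simp: spans_def)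
    show ?thesis
      by (rule exI[of _ "\<lambda>j. c (is ! j)"]) (simp only: c nth b_def)
  qed
  define f where "f j x = (SOME c. x = lsum M (\<lambda>j. c j \<odot> b j) [0..<N]) j" for j x
  have f: "x = lsum M (\<lambda>j. f j x \<odot> b j) [0..<N]" if "x \<in> carrier M" for x
    unfolding f_def using ex[OF that] by (rule someI_ex)
  have uniq: "c j = d j"
    if "lsum M (\<lambda>j. c j \<odot> b j) [0..<N] = lsum M (\<lambda>j. d j \<odot> b j) [0..<N]" "j < N" for c d j
  proof -
    have "lsum M (\<lambda>j. (c j - d j) \<odot> b j) [0..<N]
        = lsum M (\<lambda>j. c j \<odot> b j \<oplus> (-1) \<odot> (d j \<odot> b j)) [0..<N]"
      using bclo by (intro lsum_cong) (auto simp: scale_scale scale_add_left[symmetric])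
    also have "\<dots> = lsum M (\<lambda>j. c j \<odot> b j) [0..<N] \<oplus> lsum M (\<lambda>j. (-1) \<odot> (d j \<odot> b j)) [0..<N]"
      using bclo by (intro lsum_add) auto
    also have "lsum M (\<lambda>j. (-1) \<odot> (d j \<odot> b j)) [0..<N] = (-1) \<odot> lsum M (\<lambda>j. d j \<odot> b j) [0..<N]"
      using bclo by (intro lsum_scale) auto
    also have "lsum M (\<lambda>j. c j \<odot> b j) [0..<N] \<oplus> (-1) \<odot> lsum M (\<lambda>j. d j \<odot> b j) [0..<N] = \<zero>"
    proof -
      have clo: "lsum M (\<lambda>j. d j \<odot> b j) [0..<N] \<in> carrier M"
        using bclo by (intro lsum_closed) auto
      show ?thesis unfolding that(1) scale_minus[OF clo] using clo by (rule M.r_neg)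
    qed
    finally show ?thesis using ind[of "\<lambda>j. c j - d j" j] that(2) by simp
  qed
  have "coordinates M N b f"
    unfolding coordinates_def
  proof (intro conjI allI impI ballI)
    fix i assume i: "i < N"
    show "lin M complex_alg (f i)"
    proof (rule linI)
      fix x y assume x: "x \<in> carrier M" and y: "y \<in> carrier M"
      have "lsum M (\<lambda>j. f j (x \<oplus> y) \<odot> b j) [0..<N] = x \<oplus> y" using f[of "x \<oplus> y"] x y by simp
      also have "\<dots> = lsum M (\<lambda>j. f j x \<odot> b j) [0..<N] \<oplus> lsum M (\<lambda>j. f j y \<odot> b j) [0..<N]"
        using f[OF x] f[OF y] by simp
      also have "\<dots> = lsum M (\<lambda>j. f j x \<odot> b j \<oplus> f j y \<odot> b j) [0..<N]"
        using bclo by (intro lsum_add[symmetric]) auto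
      also have "\<dots> = lsum M (\<lambda>j. (f j x + f j y) \<odot> b j) [0..<N]"
        using bclo by (intro lsum_cong) (auto simp: scale_add_left)
      finally show "f i (x \<oplus> y) = f i x \<oplus>\<^bsub>complex_alg\<^esub> f i y"
        using uniq[of "\<lambda>j. f j (x \<oplus> y)" "\<lambda>j. f j x + f j y"] i by simp
    next
      fix c x assume x: "x \<in> carrier M"
      have "lsum M (\<lambda>j. f j (c \<odot> x) \<odot> b j) [0..<N] = c \<odot> x" using f[of "c \<odot> x"] x by simp
      also have "\<dots> = c \<odot> lsum M (\<lambda>j. f j x \<odot> b j) [0..<N]" using f[OF x] by simp
      also have "\<dots> = lsum M (\<lambda>j. c \<odot> (f j x \<odot> b j)) [0..<N]"
        using bclo by (intro lsum_scale[symmetric]) auto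
      also have "\<dots> = lsum M (\<lambda>j. (c * f j x) \<odot> b j) [0..<N]"
        using bclo by (intro lsum_cong) (auto simp: scale_scale)
      finally show "f i (c \<odot> x) = c \<odot>\<^bsub>complex_alg\<^esub> f i x"
        using uniq[of "\<lambda>j. f j (c \<odot> x)" "\<lambda>j. c * f j x"] i by simp
    qed simp
    fix j assume j: "j < N"
    have "lsum M (\<lambda>l. f l (b j) \<odot> b l) [0..<N] = b j" using f[OF bclo[OF j]] by simp
    also have "\<dots> = lsum M (\<lambda>l. (if l = j then 1 else 0) \<odot> b l) [0..<N]"
      using bclo j by (intro lsum_single[symmetric]) auto
    finally show "f i (b j) = (if i = j then 1 else 0)"
      using uniq[of "\<lambda>l. f l (b j)" "\<lambda>l. if l = j then 1 else 0"] i by simp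
  qed (use bclo f in auto)
  then show ?thesis by blast
qed

end

lemma tensor_coordinates:
  assumes A: "cspace A" and K: "cspace K" and co: "coordinates K n e f"
    and t: "t \<in> carrier (tensor A K)"
  shows "t = lsum (tensor A K) (\<lambda>i. tens A K (slice A (f i) t) (e i)) [0..<n]"
proof (rule tensor_ext[OF A K cspace_tensor[OF A K] lin_id _ _ t])
  interpret T: cspace "tensor A K" by (rule cspace_tensor[OF A K])
  note c = coordinatesD[OF co]
  show "lin (tensor A K) (tensor A K) (\<lambda>t. lsum (tensor A K) (\<lambda>i. tens A K (slice A (f i) t) (e i)) [0..<n])"
    by (intro lin_lsum T.cspace_axioms lin_tens_left[OF A K] lin_slice[OF A K] c) auto
  fix a k assume a: "a \<in> carrier A" and k: "k \<in> carrier K"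
  note tl = bilD(1)[OF bil_tens[OF A K] a] and tr = bilD(2)[OF bil_tens[OF A K]]
  have "tens A K a k = tens A K a (lsum K (\<lambda>i. f i k \<odot>\<^bsub>K\<^esub> e i) [0..<n])"
    using c(4)[OF k] by simp
  also have "\<dots> = lsum (tensor A K) (\<lambda>i. tens A K a (f i k \<odot>\<^bsub>K\<^esub> e i)) [0..<n]"
    using c by (intro lin_lsum_apply[OF K T.cspace_axioms tl]) (auto intro: cspace.scale_closed[OF K])
  also have "\<dots> = lsum (tensor A K) (\<lambda>i. tens A K (slice A (f i) (tens A K a k)) (e i)) [0..<n]"
    using c a k by (intro lsum_cong) (auto simp: slice_tens[OF A K] linD(3)[OF tl] linD(3)[OF tr])
  finally show "tens A K a k = lsum (tensor A K) (\<lambda>i. tens A K (slice A (f i) (tens A K a k)) (e i)) [0..<n]" .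
qed

lemma slices_separate:
  assumes "cspace A" "cspace K" "coordinates K n e f"
    and "s \<in> carrier (tensor A K)" "t \<in> carrier (tensor A K)"
    and "\<And>i. i < n \<Longrightarrow> slice A (f i) s = slice A (f i) t"
  shows "s = t"
proof -
  have "lsum (tensor A K) (\<lambda>i. tens A K (slice A (f i) s) (e i)) [0..<n]
      = lsum (tensor A K) (\<lambda>i. tens A K (slice A (f i) t) (e i)) [0..<n]"
    using assms(6) by (intro lsum_cong) auto
  then show ?thesis
    using tensor_coordinates[OF assms(1-3) assms(4)] tensor_coordinates[OF assms(1-3) assms(5)]
    by metis
qed

section \<open>Sweedler calculus\<close>

lemma teval_tmap:
  fixes A :: "('a, 'm) star_alg_scheme" and K :: "('k, 'n) star_alg_scheme"
    and B :: "('b, 'o) star_alg_scheme" and L :: "('l, 'p) star_alg_scheme"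
  assumes "cspace A" "cspace K" "cspace B" "cspace L" "lin A B f" "lin K L g" "cspace M"
    and h: "bil B L M h" and t: "t \<in> carrier (tensor A K)"
  shows "teval M h (tmap B L f g t) = teval M (\<lambda>a k. h (f a) (g k)) t"
proof (rule tensor_ext[OF assms(1,2,7) _ _ _ t])
  note b = bil_comp_tens[OF h assms(5,6)]
  show "lin (tensor A K) M (\<lambda>t. teval M h (tmap B L f g t))"
    by (rule lin_comp[OF lin_teval lin_tmap]) fact+
  show "lin (tensor A K) M (teval M (\<lambda>a k. h (f a) (g k)))"
    by (rule lin_teval) fact+
  show "teval M h (tmap B L f g (tens A K a k)) = teval M (\<lambda>a k. h (f a) (g k)) (tens A K a k)"
    if "a \<in> carrier A" "k \<in> carrier K" for a k
    using that assms by (simp add: tmap_tens[OF assms(1-6)] teval_tens[OF assms(3,4,7) h]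
        teval_tens[OF assms(1,2,7) b] linD)
qed

lemma teval_tassoc:
  assumes A: "cspace A" and K: "cspace K" and L: "cspace L" and M: "cspace M"
    and f1: "\<And>a k. a \<in> carrier A \<Longrightarrow> k \<in> carrier K \<Longrightarrow> lin L M (\<lambda>l. f a k l)"
    and f2: "\<And>a l. a \<in> carrier A \<Longrightarrow> l \<in> carrier L \<Longrightarrow> lin K M (\<lambda>k. f a k l)"
    and f3: "\<And>k l. k \<in> carrier K \<Longrightarrow> l \<in> carrier L \<Longrightarrow> lin A M (\<lambda>a. f a k l)"
    and x: "x \<in> carrier (tensor (tensor A K) L)"
  shows "teval M (\<lambda>a s. teval M (\<lambda>k l. f a k l) s) (tassoc A K L x)
    = teval M (\<lambda>t l. teval M (\<lambda>a k. f a k l) t) x"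
proof -
  note T = cspace_tensor[OF A K] and KL = cspace_tensor[OF K L]
  note R = cspace_tensor[OF A KL]
  note b = bil_tassoc[OF A K L]
  have b1: "bil K L M (\<lambda>k l. f a k l)" if "a \<in> carrier A" for a
    using that by (intro bilI f1 f2)
  have b2: "bil A K M (\<lambda>a k. f a k l)" if "l \<in> carrier L" for l
    using that by (intro bilI f2 f3)
  have b3: "bil A (tensor K L) M (\<lambda>a s. teval M (\<lambda>k l. f a k l) s)"
    by (intro bilI lin_teval[OF K L M b1] lin_teval_const[OF K L M] f3)
  have b4: "bil (tensor A K) L M (\<lambda>t l. teval M (\<lambda>a k. f a k l) t)"
    by (intro bilI lin_teval[OF A K M b2] lin_teval_const[OF A K M] f1)
  let ?R = "tensor A (tensor K L)"
  let ?f = "\<lambda>t l. teval ?R (\<lambda>a k. tens A (tensor K L) a (tens K L k l)) t"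
  let ?F = "teval M (\<lambda>a s. teval M (\<lambda>k l. f a k l) s)"
  have "?F (teval ?R ?f x) = teval M (\<lambda>t l. teval M (\<lambda>a k. f a k l) t) x"
  proof (rule tensor_ext[OF T L M _ _ _ x])
    show "lin (tensor (tensor A K) L) M (\<lambda>x. ?F (teval ?R ?f x))"
      by (rule lin_comp[OF lin_teval[OF A KL M b3] lin_teval[OF T L R b(2)]])
    show "lin (tensor (tensor A K) L) M (teval M (\<lambda>t l. teval M (\<lambda>a k. f a k l) t))"
      by (rule lin_teval[OF T L M b4])
    fix t l assume t: "t \<in> carrier (tensor A K)" and l: "l \<in> carrier L"
    have "?F (?f t l) = teval M (\<lambda>a k. f a k l) t"
    proof (rule tensor_ext[OF A K M _ _ _ t])
      show "lin (tensor A K) M (\<lambda>t. ?F (?f t l))"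
        by (rule lin_comp[OF lin_teval[OF A KL M b3] lin_teval[OF A K R b(1)[OF l]]])
      show "lin (tensor A K) M (teval M (\<lambda>a k. f a k l))"
        by (rule lin_teval[OF A K M b2[OF l]])
      show "?F (?f (tens A K a k) l) = teval M (\<lambda>a k. f a k l) (tens A K a k)"
        if "a \<in> carrier A" "k \<in> carrier K" for a k
        using that l
        by (simp add: teval_tens[OF A K R b(1)] teval_tens[OF A KL M b3] tens_closed
            teval_tens[OF K L M b1] teval_tens[OF A K M b2])
    qed
    then show "?F (teval ?R ?f (tens (tensor A K) L t l))
      = teval M (\<lambda>t l. teval M (\<lambda>a k. f a k l) t) (tens (tensor A K) L t l)"
      using t l by (simp add: teval_tens[OF T L R b(2)] teval_tens[OF T L M b4])
  qed
  then show ?thesis by (simp add: tassoc_eq_teval[OF A K L x])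
qed

lemma teval_tens_self:
  assumes A: "cspace A" and K: "cspace K" and t: "t \<in> carrier (tensor A K)"
  shows "teval (tensor A K) (tens A K) t = t"
  by (rule tensor_ext[OF A K cspace_tensor[OF A K] lin_teval[OF A K cspace_tensor[OF A K]
        bil_tens[OF A K]] lin_id _ t])
    (simp add: teval_tens[OF A K cspace_tensor[OF A K] bil_tens[OF A K]])

text \<open>\<open>sw K M f h\<close> is \<open>f(h\<^sub>1, h\<^sub>2)\<close>, summed in \<open>M\<close>.\<close>

definition sw ::
  "('k, 'm) hopf_scheme \<Rightarrow> ('b, 'n) ring_scheme \<Rightarrow> ('k \<Rightarrow> 'k \<Rightarrow> 'b) \<Rightarrow> 'k \<Rightarrow> 'b" where
  "sw K M f h = teval M f (comult K h)"

lemma sw_conj [simp]: "sw K (conj_space M) f h = sw K M f h"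
  by (simp add: sw_def)

lemma sw_complex: "sw K complex_alg f h = (\<Sum>(a, b)\<leftarrow>terms (comult K h). f a b)"
  by (simp add: sw_def teval_def list_sum_complex)

context cstar_hopf_algebra
begin

lemma star_alg: "star_algebra K" by unfold_locales

lemma cs: "cspace K" by (rule is_cspace)

lemma cs2: "cspace (tensor K K)" by (rule cspace_tensor[OF cs cs])

lemma star_alg2: "star_algebra (tensor K K)" by (rule star_algebra_tensor[OF star_alg star_alg])

lemma lin_comult: "lin K (tensor K K) (comult K)"
  using comult_hom by (auto simp: star_hom_def lin_def ring_hom_def)

lemma comult_closed: "h \<in> carrier K \<Longrightarrow> comult K h \<in> carrier (tensor K K)"
  by (rule linD(1)[OF lin_comult])

lemma comult_mult: "h \<in> carrier K \<Longrightarrow> g \<in> carrier K \<Longrightarrow>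
    comult K (h \<otimes> g) = comult K h \<otimes>\<^bsub>tensor K K\<^esub> comult K g"
  and comult_one: "comult K \<one> = \<one>\<^bsub>tensor K K\<^esub>"
  and comult_star: "h \<in> carrier K \<Longrightarrow> comult K (star K h) = star (tensor K K) (comult K h)"
  using comult_hom by (auto simp: star_hom_def ring_hom_def)

lemma lin_counit: "lin K complex_alg (counit K)"
  using counit_hom by (auto simp: star_hom_def lin_def ring_hom_def)

lemma counit_mult: "h \<in> carrier K \<Longrightarrow> g \<in> carrier K \<Longrightarrow> counit K (h \<otimes> g) = counit K h * counit K g"
  and counit_one: "counit K \<one> = 1"
  and counit_star: "h \<in> carrier K \<Longrightarrow> counit K (star K h) = cnj (counit K h)"
  using counit_hom by (auto simp: star_hom_def ring_hom_def)

lemma lin_antipode: "lin K K (antipode K)"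
  by (rule linI) (simp_all add: antipode_closed antipode_add antipode_smult)

text \<open>The inverse of the antipode \<open>S\<close>, as \<open>S(S(k)\<^sup>*)\<^sup>* = k\<close>.\<close>

definition coantipode :: "'k \<Rightarrow> 'k" where
  "coantipode h = star K (antipode K (star K h))"

lemma lin_coantipode: "lin K K coantipode"
  unfolding coantipode_def
  by (rule lin_antilin_comp[OF lin_star[OF star_alg]])
    (rule lin_comp[OF lin_conj_conj[THEN iffD2, OF lin_antipode] lin_star[OF star_alg]])

lemmas lin_antipode' = lin_comp[OF lin_antipode]
  and lin_counit' = lin_comp[OF lin_counit]
  and lin_coantipode' = lin_comp[OF lin_coantipode]
  and lin_comult' = lin_comp[OF lin_comult]

lemma lin_sw_const:
  assumes "cspace M" "h \<in> carrier K"
    and "\<And>a b. a \<in> carrier K \<Longrightarrow> b \<in> carrier K \<Longrightarrow> lin N M (\<lambda>x. f x a b)"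
  shows "lin N M (\<lambda>x. sw K M (\<lambda>a b. f x a b) h)"
  unfolding sw_def by (rule lin_teval_const[OF cs cs assms(1) comult_closed[OF assms(2)] assms(3)])

lemma lin_sw_arg:
  assumes "cspace M" "bil K K M f" "lin N K g"
  shows "lin N M (\<lambda>x. sw K M f (g x))"
  unfolding sw_def
  by (rule lin_comp[OF lin_teval[OF cs cs assms(1,2)] lin_comult'[OF assms(3)]])

lemma sw_closed: "cspace M \<Longrightarrow> bil K K M f \<Longrightarrow> h \<in> carrier K \<Longrightarrow> sw K M f h \<in> carrier M"
  unfolding sw_def by (rule teval_closed[OF cs cs]) (auto intro: comult_closed)

lemma sw_cong:
  "h \<in> carrier K \<Longrightarrow> (\<And>a b. a \<in> carrier K \<Longrightarrow> b \<in> carrier K \<Longrightarrow> f a b = g a b) \<Longrightarrow>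
    sw K M f h = sw K M g h"
  unfolding sw_def by (rule teval_cong_carrier[OF cs cs comult_closed])

lemma lin_sw_apply:
  assumes "cspace M" "cspace N" "lin M N F" "bil K K M f" "h \<in> carrier K"
  shows "F (sw K M f h) = sw K N (\<lambda>a b. F (f a b)) h"
  unfolding sw_def by (rule lin_teval_apply[OF cs cs assms(1-4) comult_closed[OF assms(5)]])

lemma sw_swap:
  assumes "cspace M" "h \<in> carrier K" "g \<in> carrier K"
    and "\<And>a b c d. a \<in> carrier K \<Longrightarrow> b \<in> carrier K \<Longrightarrow> c \<in> carrier K \<Longrightarrow> d \<in> carrier K \<Longrightarrow>
      f a b c d \<in> carrier M"
  shows "sw K M (\<lambda>a b. sw K M (\<lambda>c d. f a b c d) g) h = sw K M (\<lambda>c d. sw K M (\<lambda>a b. f a b c d) h) g"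
  unfolding sw_def
  by (rule teval_swap[OF cs cs comult_closed cs cs comult_closed]) (use assms in auto)

lemma sw_assoc:
  assumes M: "cspace M" and h: "h \<in> carrier K"
    and f1: "\<And>a k. a \<in> carrier K \<Longrightarrow> k \<in> carrier K \<Longrightarrow> lin K M (\<lambda>l. f a k l)"
    and f2: "\<And>a l. a \<in> carrier K \<Longrightarrow> l \<in> carrier K \<Longrightarrow> lin K M (\<lambda>k. f a k l)"
    and f3: "\<And>k l. k \<in> carrier K \<Longrightarrow> l \<in> carrier K \<Longrightarrow> lin K M (\<lambda>a. f a k l)"
  shows "sw K M (\<lambda>a b. sw K M (\<lambda>c d. f c d b) a) h = sw K M (\<lambda>a b. sw K M (\<lambda>c d. f a c d) b) h"
proof -
  note D = comult_closed[OF h]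
  have cl: "tmap (tensor K K) K (comult K) id (comult K h) \<in> carrier (tensor (tensor K K) K)"
    by (rule linD(1)[OF lin_tmap[OF cs cs cs2 cs lin_comult lin_id'] D])
  have b4: "bil (tensor K K) K M (\<lambda>t l. teval M (\<lambda>a k. f a k l) t)"
    by (intro bilI lin_teval[OF cs cs M] lin_teval_const[OF cs cs M] f1 bilI f2 f3)
  have b3: "bil K (tensor K K) M (\<lambda>a s. teval M (\<lambda>k l. f a k l) s)"
    by (intro bilI lin_teval[OF cs cs M] lin_teval_const[OF cs cs M] f1 bilI f2 f3)
  have "sw K M (\<lambda>a b. sw K M (\<lambda>c d. f c d b) a) h
      = teval M (\<lambda>t l. teval M (\<lambda>a k. f a k l) t) (tmap (tensor K K) K (comult K) id (comult K h))"
    unfolding sw_def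
    by (subst teval_tmap[OF cs cs cs2 cs lin_comult lin_id' M b4 D]) simp
  also have "\<dots> = teval M (\<lambda>a s. teval M (\<lambda>k l. f a k l) s)
      (tassoc K K K (tmap (tensor K K) K (comult K) id (comult K h)))"
    by (rule teval_tassoc[OF cs cs cs M f1 f2 f3 cl, symmetric])
  also have "\<dots> = teval M (\<lambda>a s. teval M (\<lambda>k l. f a k l) s)
      (tmap K (tensor K K) id (comult K) (comult K h))"
    by (simp only: coassoc[OF h])
  also have "\<dots> = sw K M (\<lambda>a b. sw K M (\<lambda>c d. f a c d) b) h"
    unfolding sw_def
    by (subst teval_tmap[OF cs cs cs cs2 lin_id' lin_comult M b3 D]) simp
  finally show ?thesis .
qed

lemma sw_mult:
  assumes M: "cspace M" and f: "bil K K M f" and h: "h \<in> carrier K" and g: "g \<in> carrier K"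
  shows "sw K M f (h \<otimes> g) = sw K M (\<lambda>a b. sw K M (\<lambda>c d. f (a \<otimes> c) (b \<otimes> d)) g) h"
proof -
  let ?T = "tensor K K"
  note D = comult_closed[OF h] and E = comult_closed[OF g]
  note le = lin_teval[OF cs cs M f]
  have b: "bil K K M (\<lambda>c d. f (a \<otimes> c) (b \<otimes> d))" if "a \<in> carrier K" "b \<in> carrier K" for a b
    by (rule bil_comp_tens[OF f lin_mult_left[OF star_alg that(1) lin_id]
          lin_mult_left[OF star_alg that(2) lin_id]])
  have b': "bil K K M (\<lambda>a b. f (a \<otimes> c) (b \<otimes> d))" if "c \<in> carrier K" "d \<in> carrier K" for c d
    by (rule bil_comp_tens[OF f lin_mult_right[OF star_alg that(1) lin_id]
          lin_mult_right[OF star_alg that(2) lin_id]])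
  have bb: "bil K K M (\<lambda>a b. teval M (\<lambda>c d. f (a \<otimes> c) (b \<otimes> d)) t)" if "t \<in> carrier ?T" for t
    by (intro bilI lin_teval_const[OF cs cs M that] bilD(1)[OF b'] bilD(2)[OF b'])
  have "teval M f (s \<otimes>\<^bsub>?T\<^esub> t) = teval M (\<lambda>a b. teval M (\<lambda>c d. f (a \<otimes> c) (b \<otimes> d)) t) s"
    if s: "s \<in> carrier ?T" and t: "t \<in> carrier ?T" for s t
  proof (rule tensor_ext[OF cs cs M _ _ _ s, of "\<lambda>s. teval M f (s \<otimes>\<^bsub>?T\<^esub> t)"])
    show "lin ?T M (\<lambda>s. teval M f (s \<otimes>\<^bsub>?T\<^esub> t))"
      by (rule lin_comp[OF le tmult_lin(1)[OF star_alg star_alg t]])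
    show "lin ?T M (teval M (\<lambda>a b. teval M (\<lambda>c d. f (a \<otimes> c) (b \<otimes> d)) t))"
      by (rule lin_teval[OF cs cs M bb[OF t]])
    fix a b assume a: "a \<in> carrier K" and b1: "b \<in> carrier K"
    have "teval M f (tens K K a b \<otimes>\<^bsub>?T\<^esub> t) = teval M (\<lambda>c d. f (a \<otimes> c) (b \<otimes> d)) t"
    proof (rule tensor_ext[OF cs cs M _ _ _ t])
      show "lin ?T M (\<lambda>t. teval M f (tens K K a b \<otimes>\<^bsub>?T\<^esub> t))"
        by (rule lin_comp[OF le tmult_lin(2)[OF star_alg star_alg tens_closed[OF a b1]]])
      show "lin ?T M (teval M (\<lambda>c d. f (a \<otimes> c) (b \<otimes> d)))"
        by (rule lin_teval[OF cs cs M b[OF a b1]])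
      show "teval M f (tens K K a b \<otimes>\<^bsub>?T\<^esub> tens K K c d)
          = teval M (\<lambda>c d. f (a \<otimes> c) (b \<otimes> d)) (tens K K c d)"
        if "c \<in> carrier K" "d \<in> carrier K" for c d
        using that a b1 by (simp add: tmult_tens[OF star_alg star_alg] teval_tens[OF cs cs M f]
            teval_tens[OF cs cs M b] mult_closed)
    qed
    then show "teval M f (tens K K a b \<otimes>\<^bsub>?T\<^esub> t)
        = teval M (\<lambda>a b. teval M (\<lambda>c d. f (a \<otimes> c) (b \<otimes> d)) t) (tens K K a b)"
      using a b1 by (simp add: teval_tens[OF cs cs M bb[OF t]])
  qed
  from this[OF D E] show ?thesis by (simp add: sw_def comult_mult h g)
qed

lemma sw_one: "cspace M \<Longrightarrow> bil K K M f \<Longrightarrow> sw K M f \<one> = f \<one> \<one>"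
  by (simp add: sw_def comult_one tensor_sel(3) teval_tens[OF cs cs] one_closed)

lemma sw_star:
  assumes M: "cspace M" and f: "bil K K M f" and h: "h \<in> carrier K"
  shows "sw K M f (star K h) = sw K M (\<lambda>a b. f (star K a) (star K b)) h"
proof -
  let ?T = "tensor K K"
  have b: "bil K K (conj_space M) (\<lambda>a b. f (star K a) (star K b))"
  proof (rule bilI)
    show "lin K (conj_space M) (\<lambda>b. f (star K a) (star K b))" if "a \<in> carrier K" for a
      by (rule lin_comp[OF lin_conj_conj[THEN iffD2, OF bilD(1)[OF f star_closed[OF that]]]
            lin_star[OF star_alg]])
    show "lin K (conj_space M) (\<lambda>a. f (star K a) (star K b))" if "b \<in> carrier K" for b
      by (rule lin_comp[OF lin_conj_conj[THEN iffD2, OF bilD(2)[OF f star_closed[OF that]]]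
            lin_star[OF star_alg]])
  qed
  have "teval M f (star ?T t) = teval M (\<lambda>a b. f (star K a) (star K b)) t" if t: "t \<in> carrier ?T" for t
  proof (rule tensor_ext[OF cs cs cspace_conj[OF M] _ _ _ t])
    show "lin ?T (conj_space M) (\<lambda>t. teval M f (star ?T t))"
      by (rule lin_comp[OF lin_conj_conj[THEN iffD2, OF lin_teval[OF cs cs M f]]
            lin_tstar[OF star_alg star_alg]])
    show "lin ?T (conj_space M) (teval M (\<lambda>a b. f (star K a) (star K b)))"
      using lin_teval[OF cs cs cspace_conj[OF M] b] by simp
    show "teval M f (star ?T (tens K K a c)) = teval M (\<lambda>a b. f (star K a) (star K b)) (tens K K a c)"
      if "a \<in> carrier K" "c \<in> carrier K" for a c
      using that teval_tens[OF cs cs cspace_conj[OF M] b]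
      by (simp add: tstar_tens[OF star_alg star_alg] teval_tens[OF cs cs M f] star_closed)
  qed
  then show ?thesis using h by (simp add: sw_def comult_star comult_closed)
qed

lemma bil_counit_left: "cspace M \<Longrightarrow> lin K M F \<Longrightarrow> bil K K M (\<lambda>a b. counit K a \<odot>\<^bsub>M\<^esub> F b)"
  and bil_counit_right: "cspace M \<Longrightarrow> lin K M F \<Longrightarrow> bil K K M (\<lambda>a b. counit K b \<odot>\<^bsub>M\<^esub> F a)"
  by (auto intro!: bilI lin_scale_const lin_const_scale lin_counit simp: linD)

lemma sw_counit_left:
  assumes M: "cspace M" and F: "lin K M F" and h: "h \<in> carrier K"
  shows "sw K M (\<lambda>a b. counit K a \<odot>\<^bsub>M\<^esub> F b) h = F h"
proof -
  have "h = sw K K (\<lambda>a b. counit K a \<odot> b) h"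
    using counit_left[OF h] by (simp add: sw_def teval_def)
  then have "F h = F (sw K K (\<lambda>a b. counit K a \<odot> b) h)" by simp
  also have "\<dots> = sw K M (\<lambda>a b. F (counit K a \<odot> b)) h"
    by (rule lin_sw_apply[OF cs M F bil_counit_left[OF cs lin_id] h])
  also have "\<dots> = sw K M (\<lambda>a b. counit K a \<odot>\<^bsub>M\<^esub> F b) h"
    using F by (intro sw_cong[OF h]) (simp add: linD)
  finally show ?thesis by simp
qed

lemma sw_counit_right:
  assumes M: "cspace M" and F: "lin K M F" and h: "h \<in> carrier K"
  shows "sw K M (\<lambda>a b. counit K b \<odot>\<^bsub>M\<^esub> F a) h = F h"
proof -
  have "h = sw K K (\<lambda>a b. counit K b \<odot> a) h"
    using counit_right[OF h] by (simp add: sw_def teval_def)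
  then have "F h = F (sw K K (\<lambda>a b. counit K b \<odot> a) h)" by simp
  also have "\<dots> = sw K M (\<lambda>a b. F (counit K b \<odot> a)) h"
    by (rule lin_sw_apply[OF cs M F bil_counit_right[OF cs lin_id] h])
  also have "\<dots> = sw K M (\<lambda>a b. counit K b \<odot>\<^bsub>M\<^esub> F a) h"
    using F by (intro sw_cong[OF h]) (simp add: linD)
  finally show ?thesis by simp
qed

lemma bil_mult: "lin K K f \<Longrightarrow> lin K K g \<Longrightarrow> bil K K K (\<lambda>a b. f a \<otimes> g b)"
  and bil_mult_op: "lin K K f \<Longrightarrow> lin K K g \<Longrightarrow> bil K K K (\<lambda>a b. g b \<otimes> f a)"
  by (auto intro!: bilI lin_mult_left[OF star_alg] lin_mult_right[OF star_alg] simp: linD)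

lemma sw_antipode_left:
  assumes M: "cspace M" and F: "lin K M F" and h: "h \<in> carrier K"
  shows "sw K M (\<lambda>a b. F (antipode K a \<otimes> b)) h = counit K h \<odot>\<^bsub>M\<^esub> F \<one>"
proof -
  have "sw K M (\<lambda>a b. F (antipode K a \<otimes> b)) h = F (sw K K (\<lambda>a b. antipode K a \<otimes> b) h)"
    by (rule lin_sw_apply[OF cs M F bil_mult[OF lin_antipode lin_id] h, symmetric])
  also have "sw K K (\<lambda>a b. antipode K a \<otimes> b) h = counit K h \<odot> \<one>"
    using antipode_left[OF h] by (simp add: sw_def teval_def)
  finally show ?thesis using F by (simp add: linD one_closed)
qed

lemma sw_antipode_right:
  assumes M: "cspace M" and F: "lin K M F" and h: "h \<in> carrier K"
  shows "sw K M (\<lambda>a b. F (a \<otimes> antipode K b)) h = counit K h \<odot>\<^bsub>M\<^esub> F \<one>"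
proof -
  have "sw K M (\<lambda>a b. F (a \<otimes> antipode K b)) h = F (sw K K (\<lambda>a b. a \<otimes> antipode K b) h)"
    by (rule lin_sw_apply[OF cs M F bil_mult[OF lin_id lin_antipode] h, symmetric])
  also have "sw K K (\<lambda>a b. a \<otimes> antipode K b) h = counit K h \<odot> \<one>"
    using antipode_right[OF h] by (simp add: sw_def teval_def)
  finally show ?thesis using F by (simp add: linD one_closed)
qed

lemma coantipode_closed: "h \<in> carrier K \<Longrightarrow> coantipode h \<in> carrier K"
  by (rule linD(1)[OF lin_coantipode])

text \<open>The antipode identities at \<open>h\<^sup>*\<close>, conjugated.\<close>

lemma sw_coantipode:
  assumes M: "cspace M" and F: "lin K M F" and h: "h \<in> carrier K"
  shows "sw K M (\<lambda>a b. F (b \<otimes> coantipode a)) h = counit K h \<odot>\<^bsub>M\<^esub> F \<one>"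
    and "sw K M (\<lambda>a b. F (coantipode b \<otimes> a)) h = counit K h \<odot>\<^bsub>M\<^esub> F \<one>"
proof -
  have *: "sw K M (\<lambda>a b. F (g a b)) h = counit K h \<odot>\<^bsub>M\<^esub> F \<one>"
    if g: "bil K K K g" and f: "bil K K K f"
      and e: "\<And>a b. a \<in> carrier K \<Longrightarrow> b \<in> carrier K \<Longrightarrow> g (star K a) (star K b) = star K (f a b)"
      and f1: "sw K K f (star K h) = counit K (star K h) \<odot> \<one>" for f g
  proof -
    have "sw K K g (star K (star K h)) = sw K K (\<lambda>a b. g (star K a) (star K b)) (star K h)"
      by (rule sw_star[OF cs g star_closed[OF h]])
    also have "\<dots> = sw K K (\<lambda>a b. star K (f a b)) (star K h)"
      by (rule sw_cong[OF star_closed[OF h] e])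
    also have "\<dots> = star K (sw K K f (star K h))"
      using lin_sw_apply[OF cs cspace_conj[OF cs] lin_star[OF star_alg] f star_closed[OF h]] by simp
    also have "\<dots> = counit K h \<odot> \<one>"
      using h by (simp add: f1 star_smult one_closed star_one counit_star)
    finally have e: "sw K K g h = counit K h \<odot> \<one>"
      using h by (simp add: star_star)
    show ?thesis
      using lin_sw_apply[OF cs M F g h] F by (simp add: e linD one_closed)
  qed
  note s = star_closed[OF h]
  show "sw K M (\<lambda>a b. F (b \<otimes> coantipode a)) h = counit K h \<odot>\<^bsub>M\<^esub> F \<one>"
    by (rule *[OF bil_mult_op[OF lin_coantipode lin_id] bil_mult[OF lin_antipode lin_id]])
      (simp_all add: coantipode_def star_star star_mult antipode_closed sw_antipode_left[OF cs lin_id s])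
  show "sw K M (\<lambda>a b. F (coantipode b \<otimes> a)) h = counit K h \<odot>\<^bsub>M\<^esub> F \<one>"
    by (rule *[OF bil_mult_op[OF lin_id lin_coantipode] bil_mult[OF lin_id lin_antipode]])
      (simp_all add: coantipode_def star_star star_mult antipode_closed sw_antipode_right[OF cs lin_id s])
qed

end

section \<open>The antipode and the dual Hopf algebra\<close>

lemma tensor_eq_cong:
  assumes c: "carrier A = carrier A'" "add A = add A'" "smult A = smult A'" "zero A = zero A'"
    and d: "carrier K = carrier K'" "add K = add K'" "smult K = smult K'"
  shows "tensor_eq A K xs ys \<Longrightarrow> tensor_eq A' K' xs ys"
proof (induction rule: tensor_eq.induct)
  case (sym xs ys)
  show ?case using sym.IH by (rule tensor_eq.sym)
next
  case (trans xs ys zs)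
  show ?case using trans.IH by (rule tensor_eq.trans)
next
  case (scalar a k c)
  then show ?case using tensor_eq.scalar[of a A' k K' c] by (simp add: c d)
next
  case (add_left a b k)
  then show ?case using tensor_eq.add_left[of a A' b k K'] by (simp add: c d)
next
  case (add_right a k l)
  then show ?case using tensor_eq.add_right[of a A' k K' l] by (simp add: c d)
next
  case (zero k)
  then show ?case using tensor_eq.zero[of k K' A'] by (simp add: c d)
qed (auto simp: c d intro: tensor_eq.refl tensor_eq.append tensor_eq.commute)

lemma tclass_cong:
  assumes "carrier A = carrier A'" "add A = add A'" "smult A = smult A'" "zero A = zero A'"
    and "carrier K = carrier K'" "add K = add K'" "smult K = smult K'"
  shows "tclass A K = tclass A' K'"
proof
  fix xs
  have "tensor_eq A K xs ys \<longleftrightarrow> tensor_eq A' K' xs ys" for ys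
    using tensor_eq_cong[of A A' K K' xs ys] tensor_eq_cong[of A' A K' K xs ys] assms by metis
  then show "tclass A K xs = tclass A' K' xs" by (simp add: tclass_def)
qed

context cstar_hopf_algebra
begin

lemmas lin_rules = lin_id lin_antipode' lin_coantipode' lin_comult' lin_mult_left[OF star_alg]
  lin_mult_right[OF star_alg] lin_tens_left[OF cs cs] lin_tens_right[OF cs cs]
  lin_mult_left[OF star_alg2] lin_mult_right[OF star_alg2]
  lin_const_scale[OF cs] lin_scale_const[OF cs] lin_counit'
  lin_sw_const[OF cs] lin_sw_const[OF cs2] lin_sw_arg[OF cs] lin_sw_arg[OF cs2]
  lin_cmult_left lin_cmult_right lin_sw_const[OF cspace_complex] lin_sw_arg[OF cspace_complex]

lemmas clo_rules = mult_closed one_closed antipode_closed coantipode_closed star_closed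
  tens_closed comult_closed

text \<open>
  The antipode reverses the comultiplication, since both sides are inverse to \<open>\<Delta>\<close> for the
  convolution of maps from \<open>K\<close> to \<open>K \<otimes> K\<close>.
\<close>

lemma comult_antipode:
  assumes h: "h \<in> carrier K"
  shows "comult K (antipode K h)
    = sw K (tensor K K) (\<lambda>a b. tens K K (antipode K b) (antipode K a)) h"
proof -
  let ?T = "tensor K K"
  let ?S = "antipode K"
  interpret T: star_algebra ?T by (rule star_alg2)
  define Y where "Y = sw K ?T (\<lambda>a b. tens K K (?S b) (?S a))"
  have bY: "bil K K ?T (\<lambda>a b. tens K K (?S b) (?S a))"
    by (intro bilI lin_rules clo_rules)
  have lY: "lin K ?T Y"
    unfolding Y_def by (rule lin_sw_arg[OF cs2 bY lin_id])
  have clY: "Y b \<in> carrier ?T" if "b \<in> carrier K" for b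
    by (rule linD(1)[OF lY that])
  have bT: "bil K K ?T (tens K K)" by (rule bil_tens[OF cs cs])
  have DY: "comult K a \<otimes>\<^bsub>?T\<^esub> Y b
      = sw K ?T (\<lambda>a1 a2. sw K ?T (\<lambda>c d. tens K K (a1 \<otimes> ?S d) (a2 \<otimes> ?S c)) b) a"
    if a: "a \<in> carrier K" and b: "b \<in> carrier K" for a b
  proof -
    have "comult K a \<otimes>\<^bsub>?T\<^esub> Y b = sw K ?T (tens K K) a \<otimes>\<^bsub>?T\<^esub> Y b"
      unfolding sw_def by (simp add: teval_tens_self[OF cs cs comult_closed[OF a]])
    also have "\<dots> = sw K ?T (\<lambda>a1 a2. tens K K a1 a2 \<otimes>\<^bsub>?T\<^esub> Y b) a"
      by (rule lin_sw_apply[OF cs2 cs2 tmult_lin(1)[OF star_alg star_alg clY[OF b]] bT a])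
    also have "\<dots> = sw K ?T (\<lambda>a1 a2. sw K ?T (\<lambda>c d. tens K K (a1 \<otimes> ?S d) (a2 \<otimes> ?S c)) b) a"
    proof (rule sw_cong[OF a])
      fix a1 a2 assume a12: "a1 \<in> carrier K" "a2 \<in> carrier K"
      note t = tens_closed[OF a12]
      have "tens K K a1 a2 \<otimes>\<^bsub>?T\<^esub> Y b
          = sw K ?T (\<lambda>c d. tens K K a1 a2 \<otimes>\<^bsub>?T\<^esub> tens K K (?S d) (?S c)) b"
        unfolding Y_def
        by (rule lin_sw_apply[OF cs2 cs2 tmult_lin(2)[OF star_alg star_alg t] bY b])
      also have "\<dots> = sw K ?T (\<lambda>c d. tens K K (a1 \<otimes> ?S d) (a2 \<otimes> ?S c)) b"
        using a12 by (intro sw_cong[OF b] tmult_tens[OF star_alg star_alg] clo_rules)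
      finally show "tens K K a1 a2 \<otimes>\<^bsub>?T\<^esub> Y b
          = sw K ?T (\<lambda>c d. tens K K (a1 \<otimes> ?S d) (a2 \<otimes> ?S c)) b" .
    qed
    finally show ?thesis .
  qed
  have C: "sw K ?T (\<lambda>a b. comult K a \<otimes>\<^bsub>?T\<^esub> Y b) h = counit K h \<odot>\<^bsub>?T\<^esub> \<one>\<^bsub>?T\<^esub>"
    if h: "h \<in> carrier K" for h
  proof -
    have "sw K ?T (\<lambda>a b. comult K a \<otimes>\<^bsub>?T\<^esub> Y b) h = sw K ?T (\<lambda>a b.
        sw K ?T (\<lambda>a1 a2. sw K ?T (\<lambda>c d. tens K K (a1 \<otimes> ?S d) (a2 \<otimes> ?S c)) b) a) h"
      by (intro sw_cong[OF h] DY)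
    also have "\<dots> = sw K ?T (\<lambda>a b.
        sw K ?T (\<lambda>b1 b2. sw K ?T (\<lambda>c d. tens K K (a \<otimes> ?S d) (b1 \<otimes> ?S c)) b2) b) h"
      by (rule sw_assoc[OF cs2 h]) (intro bilI lin_rules clo_rules; assumption)+
    also have "\<dots> = sw K ?T (\<lambda>a b. tens K K (a \<otimes> ?S b) \<one>) h"
    proof (rule sw_cong[OF h])
      fix a b assume a: "a \<in> carrier K" and b: "b \<in> carrier K"
      have "sw K ?T (\<lambda>b1 b2. sw K ?T (\<lambda>c d. tens K K (a \<otimes> ?S d) (b1 \<otimes> ?S c)) b2) b
          = sw K ?T (\<lambda>b1 b2. sw K ?T (\<lambda>c d. tens K K (a \<otimes> ?S b2) (c \<otimes> ?S d)) b1) b"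
        by (rule sw_assoc[OF cs2 b, symmetric]) (intro bilI lin_rules clo_rules a; assumption)+
      also have "\<dots> = sw K ?T (\<lambda>b1 b2. counit K b1 \<odot>\<^bsub>?T\<^esub> tens K K (a \<otimes> ?S b2) \<one>) b"
        by (rule sw_cong[OF b], rule sw_antipode_right[OF cs2])
          (intro lin_rules clo_rules a; assumption)+
      also have "\<dots> = tens K K (a \<otimes> ?S b) \<one>"
        by (rule sw_counit_left[OF cs2 _ b]) (intro lin_rules clo_rules a)
      finally show "sw K ?T (\<lambda>b1 b2. sw K ?T (\<lambda>c d. tens K K (a \<otimes> ?S d) (b1 \<otimes> ?S c)) b2) b
          = tens K K (a \<otimes> ?S b) \<one>" .
    qed
    also have "\<dots> = counit K h \<odot>\<^bsub>?T\<^esub> tens K K \<one> \<one>"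
      by (rule sw_antipode_right[OF cs2 _ h]) (intro lin_rules clo_rules)
    finally show ?thesis by (simp add: tensor_sel(3))
  qed
  have one: "\<one>\<^bsub>?T\<^esub> \<in> carrier ?T" by (rule T.one_closed)
  have lYr: "lin N ?T (\<lambda>x. Y (f x))" if "lin N K f" for f and N :: "(complex, 'k, 'n) module_scheme"
    by (rule lin_comp[OF lY that])
  have "comult K (?S h) = sw K ?T (\<lambda>a b. counit K b \<odot>\<^bsub>?T\<^esub> comult K (?S a)) h"
    by (rule sw_counit_right[OF cs2 _ h, symmetric]) (intro lin_rules)
  also have "\<dots> = sw K ?T (\<lambda>a b. sw K ?T (\<lambda>c d.
      comult K (?S a) \<otimes>\<^bsub>?T\<^esub> (comult K c \<otimes>\<^bsub>?T\<^esub> Y d)) b) h"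
  proof (rule sw_cong[OF h])
    fix a b assume a: "a \<in> carrier K" and b: "b \<in> carrier K"
    have x: "comult K (?S a) \<in> carrier ?T" by (intro clo_rules a)
    have "counit K b \<odot>\<^bsub>?T\<^esub> comult K (?S a) = comult K (?S a) \<otimes>\<^bsub>?T\<^esub> (counit K b \<odot>\<^bsub>?T\<^esub> \<one>\<^bsub>?T\<^esub>)"
      by (simp only: T.smult_mult_right[OF x one] T.mult_one_right[OF x])
    also have "\<dots> = comult K (?S a) \<otimes>\<^bsub>?T\<^esub> sw K ?T (\<lambda>c d. comult K c \<otimes>\<^bsub>?T\<^esub> Y d) b"
      by (simp only: C[OF b])
    also have "\<dots> = sw K ?T (\<lambda>c d. comult K (?S a) \<otimes>\<^bsub>?T\<^esub> (comult K c \<otimes>\<^bsub>?T\<^esub> Y d)) b"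
      by (rule lin_sw_apply[OF cs2 cs2 tmult_lin(2)[OF star_alg star_alg x] _ b])
        (intro bilI lin_rules lYr clo_rules clY; assumption)
    finally show "counit K b \<odot>\<^bsub>?T\<^esub> comult K (?S a)
        = sw K ?T (\<lambda>c d. comult K (?S a) \<otimes>\<^bsub>?T\<^esub> (comult K c \<otimes>\<^bsub>?T\<^esub> Y d)) b" .
  qed
  also have "\<dots> = sw K ?T (\<lambda>a b. sw K ?T (\<lambda>c d.
      comult K (?S c) \<otimes>\<^bsub>?T\<^esub> (comult K d \<otimes>\<^bsub>?T\<^esub> Y b)) a) h"
    by (rule sw_assoc[OF cs2 h, symmetric])
      (intro lin_rules lYr clo_rules clY T.mult_closed; assumption)+
  also have "\<dots> = sw K ?T (\<lambda>a b. counit K a \<odot>\<^bsub>?T\<^esub> Y b) h"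
  proof (rule sw_cong[OF h])
    fix a b assume a: "a \<in> carrier K" and b: "b \<in> carrier K"
    have "sw K ?T (\<lambda>c d. comult K (?S c) \<otimes>\<^bsub>?T\<^esub> (comult K d \<otimes>\<^bsub>?T\<^esub> Y b)) a
        = sw K ?T (\<lambda>c d. comult K (?S c \<otimes> d) \<otimes>\<^bsub>?T\<^esub> Y b) a"
      by (rule sw_cong[OF a]) (simp add: comult_mult antipode_closed T.mult_assoc comult_closed clY b)
    also have "\<dots> = counit K a \<odot>\<^bsub>?T\<^esub> (comult K \<one> \<otimes>\<^bsub>?T\<^esub> Y b)"
      by (rule sw_antipode_left[OF cs2 _ a]) (intro lin_rules clY b)
    finally show "sw K ?T (\<lambda>c d. comult K (?S c) \<otimes>\<^bsub>?T\<^esub> (comult K d \<otimes>\<^bsub>?T\<^esub> Y b)) a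
        = counit K a \<odot>\<^bsub>?T\<^esub> Y b"
      by (simp add: comult_one T.mult_one_left clY b)
  qed
  also have "\<dots> = Y h" by (rule sw_counit_left[OF cs2 lY h])
  finally show ?thesis by (simp add: Y_def)
qed

lemma sw_antipode_rev:
  assumes M: "cspace M" and f: "bil K K M f" and h: "h \<in> carrier K"
  shows "sw K M f (antipode K h) = sw K M (\<lambda>a b. f (antipode K b) (antipode K a)) h"
proof -
  have b: "bil K K (tensor K K) (\<lambda>a b. tens K K (antipode K b) (antipode K a))"
    by (intro bilI lin_rules clo_rules)
  have "sw K M f (antipode K h)
      = sw K M (\<lambda>a b. teval M f (tens K K (antipode K b) (antipode K a))) h"
    unfolding sw_def[of K M f] comult_antipode[OF h]
    by (rule lin_sw_apply[OF cs2 M lin_teval[OF cs cs M f] b h])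
  also have "\<dots> = sw K M (\<lambda>a b. f (antipode K b) (antipode K a)) h"
    by (intro sw_cong[OF h] teval_tens[OF cs cs M f] antipode_closed)
  finally show ?thesis .
qed

lemma functionals_iff: "\<phi> \<in> functionals K \<longleftrightarrow> \<phi> \<in> extensional (carrier K) \<and> lin K complex_alg \<phi>"
  by (auto simp: functionals_def lin_def)

lemma functionals_lin: "\<phi> \<in> functionals K \<Longrightarrow> lin K complex_alg \<phi>"
  by (simp add: functionals_iff)

lemma restrict_functional: "lin K complex_alg \<phi> \<Longrightarrow> restrict \<phi> (carrier K) \<in> functionals K"
  by (auto simp: functionals_iff lin_def mult_closed)

lemma functional_eqI:
  "\<phi> \<in> functionals K \<Longrightarrow> \<psi> \<in> functionals K \<Longrightarrow> (\<And>k. k \<in> carrier K \<Longrightarrow> \<phi> k = \<psi> k) \<Longrightarrow> \<phi> = \<psi>"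
  by (auto simp: functionals_iff intro: extensionalityI)

definition conv :: "('k \<Rightarrow> complex) \<Rightarrow> ('k \<Rightarrow> complex) \<Rightarrow> 'k \<Rightarrow> complex" where
  "conv \<phi> \<psi> = sw K complex_alg (\<lambda>a b. \<phi> a * \<psi> b)"

lemma lin_conv: "lin K complex_alg \<phi> \<Longrightarrow> lin K complex_alg \<psi> \<Longrightarrow> lin K complex_alg (conv \<phi> \<psi>)"
  unfolding conv_def by (rule lin_sw_arg[OF cspace_complex bil_pair lin_id])

lemma conv_assoc:
  assumes \<phi>: "lin K complex_alg \<phi>" and \<psi>: "lin K complex_alg \<psi>" and \<chi>: "lin K complex_alg \<chi>"
    and h: "h \<in> carrier K"
  shows "conv (conv \<phi> \<psi>) \<chi> h = conv \<phi> (conv \<psi> \<chi>) h"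
proof -
  have l: "lin complex_alg complex_alg (\<lambda>x. x * c)" "lin complex_alg complex_alg (\<lambda>x. c * x)" for c
    by (intro lin_cmult_left lin_cmult_right lin_id)+
  have "conv (conv \<phi> \<psi>) \<chi> h
      = sw K complex_alg (\<lambda>a b. sw K complex_alg (\<lambda>c d. \<phi> c * \<psi> d * \<chi> b) a) h"
    unfolding conv_def
    by (intro sw_cong[OF h] lin_sw_apply[OF cspace_complex cspace_complex l(1) bil_pair[OF \<phi> \<psi>]])
  also have "\<dots> = sw K complex_alg (\<lambda>a b. sw K complex_alg (\<lambda>c d. \<phi> a * \<psi> c * \<chi> d) b) h"
    by (rule sw_assoc[OF cspace_complex h]) (intro lin_cmult_left lin_cmult_right \<phi> \<psi> \<chi>)+
  also have "\<dots> = conv \<phi> (conv \<psi> \<chi>) h"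
    unfolding conv_def mult.assoc
    by (intro sw_cong[OF h] lin_sw_apply[OF cspace_complex cspace_complex l(2) bil_pair[OF \<psi> \<chi>], symmetric])
  finally show ?thesis .
qed

lemma conv_counit:
  assumes "lin K complex_alg \<phi>" "h \<in> carrier K"
  shows "conv (counit K) \<phi> h = \<phi> h" "conv \<phi> (counit K) h = \<phi> h"
  using sw_counit_left[OF cspace_complex assms] sw_counit_right[OF cspace_complex assms]
  by (simp_all add: conv_def mult.commute)

lemma conv_cong:
  assumes "h \<in> carrier K" "\<And>k. k \<in> carrier K \<Longrightarrow> \<phi> k = \<phi>' k" "\<And>k. k \<in> carrier K \<Longrightarrow> \<psi> k = \<psi>' k"
  shows "conv \<phi> \<psi> h = conv \<phi>' \<psi>' h"
  unfolding conv_def using assms by (intro sw_cong) auto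

lemma dual_star_alg_sel [simp]:
  "carrier (dual_star_alg K) = functionals K"
  "\<phi> \<otimes>\<^bsub>dual_star_alg K\<^esub> \<psi> = restrict (conv \<phi> \<psi>) (carrier K)"
  "\<one>\<^bsub>dual_star_alg K\<^esub> = restrict (counit K) (carrier K)"
  "\<zero>\<^bsub>dual_star_alg K\<^esub> = (\<lambda>k\<in>carrier K. 0)"
  "\<phi> \<oplus>\<^bsub>dual_star_alg K\<^esub> \<psi> = (\<lambda>k\<in>carrier K. \<phi> k + \<psi> k)"
  "c \<odot>\<^bsub>dual_star_alg K\<^esub> \<phi> = (\<lambda>k\<in>carrier K. c * \<phi> k)"
  "star (dual_star_alg K) \<phi> = (\<lambda>k\<in>carrier K. cnj (\<phi> (star K (antipode K k))))"
  by (simp_all add: dual_star_alg_def conv_def sw_complex restrict_def fun_eq_iff)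

lemma dual_sel [simp]:
  "carrier (dual K) = carrier (dual_star_alg K)" "mult (dual K) = mult (dual_star_alg K)"
  "one (dual K) = one (dual_star_alg K)" "zero (dual K) = zero (dual_star_alg K)"
  "add (dual K) = add (dual_star_alg K)" "smult (dual K) = smult (dual_star_alg K)"
  "star (dual K) = star (dual_star_alg K)"
  by (simp_all add: dual_def star_alg.defs)

text \<open>The conjugate of a functional after the antilinear map \<open>k \<mapsto> S(k)\<^sup>*\<close>: the involution of the dual.\<close>

definition fstar :: "('k \<Rightarrow> complex) \<Rightarrow> 'k \<Rightarrow> complex" where
  "fstar \<phi> k = cnj (\<phi> (star K (antipode K k)))"

lemma lin_fstar:
  assumes "lin K complex_alg \<phi>"
  shows "lin K complex_alg (fstar \<phi>)"
proof -
  have "lin K (conj_space complex_alg) (\<lambda>k. \<phi> (star K (antipode K k)))"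
    by (rule lin_comp[OF lin_conj_conj[THEN iffD2, OF assms]
          lin_comp[OF lin_star[OF star_alg] lin_antipode]])
  then show ?thesis by (auto simp: lin_def fstar_def)
qed

lemma fstar_conv:
  assumes \<phi>: "lin K complex_alg \<phi>" and \<psi>: "lin K complex_alg \<psi>" and k: "k \<in> carrier K"
  shows "fstar (conv \<phi> \<psi>) k = conv (fstar \<psi>) (fstar \<phi>) k"
proof -
  have cnj_sw: "cnj (sw K complex_alg f k) = sw K complex_alg (\<lambda>a b. cnj (f a b)) k" for f
  proof -
    have "cnj (\<Sum>p\<leftarrow>ps. f (fst p) (snd p)) = (\<Sum>p\<leftarrow>ps. cnj (f (fst p) (snd p)))" for ps
      by (induction ps) simp_all
    then show ?thesis by (simp add: sw_complex case_prod_unfold)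
  qed
  have b: "bil K K (conj_space complex_alg) (\<lambda>a b. \<phi> (star K a) * \<psi> (star K b))"
  proof (rule bilI)
    note l = lin_comp[OF lin_conj_conj[THEN iffD2] lin_star[OF star_alg]]
    show "lin K (conj_space complex_alg) (\<lambda>b. \<phi> (star K a) * \<psi> (star K b))" for a
      by (rule l[OF lin_cmult_left[OF \<psi>]])
    show "lin K (conj_space complex_alg) (\<lambda>a. \<phi> (star K a) * \<psi> (star K b))" for b
      by (rule l[OF lin_cmult_right[OF \<phi>]])
  qed
  have "conv \<phi> \<psi> (star K (antipode K k))
      = sw K complex_alg (\<lambda>a b. \<phi> (star K a) * \<psi> (star K b)) (antipode K k)"
    unfolding conv_def by (rule sw_star[OF cspace_complex bil_pair[OF \<phi> \<psi>] antipode_closed[OF k]])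
  also have "\<dots> = sw K complex_alg
      (\<lambda>a b. \<phi> (star K (antipode K b)) * \<psi> (star K (antipode K a))) k"
    using sw_antipode_rev[OF cspace_conj[OF cspace_complex] b k] by simp
  finally show ?thesis by (simp add: fstar_def conv_def cnj_sw mult.commute)
qed

lemma fstar_fstar:
  assumes "k \<in> carrier K"
  shows "fstar (fstar \<phi>) k = \<phi> k"
  by (simp add: fstar_def antipode_star[OF assms])

lemma cspace_dual: "cspace (dual K)"
  by (rule cspaceI)
    (auto simp: functionals_def extensional_def algebra_simps
      add_closed smult_closed
      intro!: restrict_ext extensionalityI[of _ "carrier K"] split: if_splits)

lemma star_algebra_dual: "star_algebra (dual K)"
proof -
  interpret D: cspace "dual K" by (rule cspace_dual)
  let ?F = "functionals K"
  note fl = functionals_lin and rf = restrict_functional and lc = lin_conv[OF fl fl]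
  note e = functional_eqI
  have rc: "conv (restrict \<phi> (carrier K)) \<psi> k = conv \<phi> \<psi> k"
    "conv \<phi> (restrict \<psi> (carrier K)) k = conv \<phi> \<psi> k" if "k \<in> carrier K" for \<phi> \<psi> k
    using that by (auto intro!: conv_cong)
  have sadd: "sw K complex_alg (\<lambda>a b. f a b + g a b) k
      = sw K complex_alg f k + sw K complex_alg g k" for f g k
    by (simp add: sw_complex case_prod_unfold sum_list_addf)
  have sscale: "sw K complex_alg (\<lambda>a b. c * f a b) k = c * sw K complex_alg f k" for f k c
    by (simp add: sw_complex case_prod_unfold sum_list_const_mult)
  have conv_add: "conv (\<lambda>k\<in>carrier K. \<phi> k + \<psi> k) \<chi> k = conv \<phi> \<chi> k + conv \<psi> \<chi> k"
    "conv \<chi> (\<lambda>k\<in>carrier K. \<phi> k + \<psi> k) k = conv \<chi> \<phi> k + conv \<chi> \<psi> k"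
    if k: "k \<in> carrier K" for \<phi> \<psi> \<chi> k
    unfolding rc[OF k] by (simp_all add: conv_def sadd[symmetric] algebra_simps)
  have conv_scale: "conv (\<lambda>k\<in>carrier K. c * \<phi> k) \<chi> k = c * conv \<phi> \<chi> k"
    "conv \<chi> (\<lambda>k\<in>carrier K. c * \<phi> k) k = c * conv \<chi> \<phi> k"
    if k: "k \<in> carrier K" for \<phi> \<chi> k c
    unfolding rc[OF k] by (simp_all add: conv_def sscale[symmetric] algebra_simps)
  have ring: "ring (dual K)"
  proof (rule ringI[OF D.M.abelian_group_axioms monoidI])
    show "x \<otimes>\<^bsub>dual K\<^esub> y \<in> carrier (dual K)" if "x \<in> carrier (dual K)" "y \<in> carrier (dual K)" for x y
      using that by (simp add: rf lc)
    show "\<one>\<^bsub>dual K\<^esub> \<in> carrier (dual K)" by (simp add: rf lin_counit)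
    show "x \<otimes>\<^bsub>dual K\<^esub> y \<otimes>\<^bsub>dual K\<^esub> z = x \<otimes>\<^bsub>dual K\<^esub> (y \<otimes>\<^bsub>dual K\<^esub> z)"
      if "x \<in> carrier (dual K)" "y \<in> carrier (dual K)" "z \<in> carrier (dual K)" for x y z
      using that by (auto simp: rc conv_assoc fl intro!: restrict_ext)
    show "\<one>\<^bsub>dual K\<^esub> \<otimes>\<^bsub>dual K\<^esub> x = x" if "x \<in> carrier (dual K)" for x
      using that by (auto simp: rc conv_counit fl rf lin_conv lin_counit intro!: e)
    show "x \<otimes>\<^bsub>dual K\<^esub> \<one>\<^bsub>dual K\<^esub> = x" if "x \<in> carrier (dual K)" for x
      using that by (auto simp: rc conv_counit fl rf lin_conv lin_counit intro!: e)
    show "(x \<oplus>\<^bsub>dual K\<^esub> y) \<otimes>\<^bsub>dual K\<^esub> z = x \<otimes>\<^bsub>dual K\<^esub> z \<oplus>\<^bsub>dual K\<^esub> y \<otimes>\<^bsub>dual K\<^esub> z"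
      "z \<otimes>\<^bsub>dual K\<^esub> (x \<oplus>\<^bsub>dual K\<^esub> y) = z \<otimes>\<^bsub>dual K\<^esub> x \<oplus>\<^bsub>dual K\<^esub> z \<otimes>\<^bsub>dual K\<^esub> y" for x y z
      by (auto simp: conv_add intro!: restrict_ext)
  qed
  have star: "star (dual K) \<phi> = restrict (fstar \<phi>) (carrier K)" for \<phi>
    by (simp add: fstar_def restrict_def fun_eq_iff)
  have rs: "fstar (restrict \<phi> (carrier K)) k = fstar \<phi> k" if "k \<in> carrier K" for \<phi> k
    using that by (simp add: fstar_def clo_rules)
  show ?thesis
    unfolding star_algebra_def star_algebra_axioms_def
  proof (intro conjI allI impI)
    show "ring (dual K)" by (rule ring)
    show "module complex_alg (dual K)" by (rule D.module_axioms)
    show "(c \<odot>\<^bsub>dual K\<^esub> x) \<otimes>\<^bsub>dual K\<^esub> y = c \<odot>\<^bsub>dual K\<^esub> (x \<otimes>\<^bsub>dual K\<^esub> y)"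
      "x \<otimes>\<^bsub>dual K\<^esub> (c \<odot>\<^bsub>dual K\<^esub> y) = c \<odot>\<^bsub>dual K\<^esub> (x \<otimes>\<^bsub>dual K\<^esub> y)" for c x y
      by (auto simp: conv_scale intro!: restrict_ext)
    show "star (dual K) x \<in> carrier (dual K)" if "x \<in> carrier (dual K)" for x
      unfolding star using that by (simp add: rf lin_fstar fl)
    show "star (dual K) (x \<oplus>\<^bsub>dual K\<^esub> y) = star (dual K) x \<oplus>\<^bsub>dual K\<^esub> star (dual K) y" for x y
      by (auto simp: clo_rules intro!: restrict_ext)
    show "star (dual K) (c \<odot>\<^bsub>dual K\<^esub> x) = cnj c \<odot>\<^bsub>dual K\<^esub> star (dual K) x" for c x
      by (auto simp: clo_rules intro!: restrict_ext)
    show "star (dual K) (x \<otimes>\<^bsub>dual K\<^esub> y) = star (dual K) y \<otimes>\<^bsub>dual K\<^esub> star (dual K) x"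
      if "x \<in> carrier (dual K)" "y \<in> carrier (dual K)" for x y
      unfolding star using that by (auto simp: rs rc fstar_conv fl intro!: restrict_ext)
    show "star (dual K) (star (dual K) x) = x" if "x \<in> carrier (dual K)" for x
      unfolding star using that
      by (auto simp: rs fstar_fstar fl rf lin_fstar intro!: e)
  qed
qed

lemma tensor_dual_star_alg: "tensor (dual_star_alg K) (dual_star_alg K) = tensor (dual K) (dual K)"
proof -
  have "tclass (dual_star_alg K) (dual_star_alg K) = tclass (dual K) (dual K)"
    by (rule tclass_cong) simp_all
  then show ?thesis by (simp add: tensor_def tens_def del: dual_star_alg_sel)
qed

lemma lin_eval: "k \<in> carrier K \<Longrightarrow> lin (dual K) complex_alg (\<lambda>\<phi>. \<phi> k)"
  by (rule linI) auto

lemma exists_basis: "\<exists>n e f. coordinates K n e f"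
  using finite_dim cspace.exists_coordinates[OF cs] by blast

lemma coordinates_dual:
  assumes co: "coordinates K n e f"
  shows "coordinates (dual K) n (\<lambda>i. restrict (f i) (carrier K)) (\<lambda>i \<phi>. \<phi> (e i))"
  unfolding coordinates_def
proof (intro conjI allI impI ballI)
  note c = coordinatesD[OF co]
  interpret D: cspace "dual K" by (rule cspace_dual)
  show "restrict (f i) (carrier K) \<in> carrier (dual K)" if "i < n" for i
    using c that by (simp add: restrict_functional)
  show "lin (dual K) complex_alg (\<lambda>\<phi>. \<phi> (e i))" if "i < n" for i
    using c that by (intro lin_eval)
  show "restrict (f j) (carrier K) (e i) = (if i = j then 1 else 0)" if "i < n" "j < n" for i j
    using c that by auto
  fix \<phi> assume \<phi>: "\<phi> \<in> carrier (dual K)"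
  let ?r = "lsum (dual K) (\<lambda>i. \<phi> (e i) \<odot>\<^bsub>dual K\<^esub> restrict (f i) (carrier K)) [0..<n]"
  have r: "?r \<in> carrier (dual K)"
  proof (rule D.lsum_closed)
    fix i assume "i \<in> set [0..<n]"
    then have "restrict (f i) (carrier K) \<in> carrier (dual K)" using c by (simp add: restrict_functional)
    then show "\<phi> (e i) \<odot>\<^bsub>dual K\<^esub> restrict (f i) (carrier K) \<in> carrier (dual K)"
      by (rule D.scale_closed)
  qed
  show "\<phi> = ?r"
  proof (rule functional_eqI)
    show "\<phi> \<in> functionals K" "?r \<in> functionals K" using \<phi> r by simp_all
    fix k assume k: "k \<in> carrier K"
    have "?r k = lsum complex_alg (\<lambda>i. (\<phi> (e i) \<odot>\<^bsub>dual K\<^esub> restrict (f i) (carrier K)) k) [0..<n]"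
    proof (rule lin_lsum_apply[OF cspace_dual cspace_complex lin_eval[OF k]])
      fix i assume "i \<in> set [0..<n]"
      then have "restrict (f i) (carrier K) \<in> carrier (dual K)" using c by (simp add: restrict_functional)
      then show "\<phi> (e i) \<odot>\<^bsub>dual K\<^esub> restrict (f i) (carrier K) \<in> carrier (dual K)"
        by (rule D.scale_closed)
    qed
    also have "\<dots> = lsum complex_alg (\<lambda>i. \<phi> (f i k \<odot> e i)) [0..<n]"
      using k c \<phi> by (intro lsum_cong) (auto simp: functionals_def)
    also have "\<dots> = \<phi> (lsum K (\<lambda>i. f i k \<odot> e i) [0..<n])"
      using \<phi> c by (intro lin_lsum_apply[OF cs cspace_complex, symmetric]) (auto simp: functionals_lin)
    also have "\<dots> = \<phi> k" using c(4)[OF k] by simp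
    finally show "\<phi> k = ?r k" by simp
  qed
qed

lemma slice_eval:
  assumes "k \<in> carrier K" "l \<in> carrier K" "t \<in> carrier (tensor (dual K) (dual K))"
  shows "slice (dual K) (\<lambda>\<beta>. \<beta> l) t k = tpair (\<lambda>\<alpha>. \<alpha> k) (\<lambda>\<beta>. \<beta> l) t"
proof (rule tensor_ext[OF cspace_dual cspace_dual cspace_complex _ _ _ assms(3),
      of "\<lambda>t. slice (dual K) (\<lambda>\<beta>. \<beta> l) t k"])
  note el = lin_eval[OF assms(2)] and ek = lin_eval[OF assms(1)]
  show "lin (tensor (dual K) (dual K)) complex_alg (\<lambda>t. slice (dual K) (\<lambda>\<beta>. \<beta> l) t k)"
    by (rule lin_comp[OF ek lin_slice[OF cspace_dual cspace_dual el]])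
  show "lin (tensor (dual K) (dual K)) complex_alg (tpair (\<lambda>\<alpha>. \<alpha> k) (\<lambda>\<beta>. \<beta> l))"
    by (rule lin_tpair[OF cspace_dual cspace_dual ek el])
  show "slice (dual K) (\<lambda>\<beta>. \<beta> l) (tens (dual K) (dual K) a b) k
      = tpair (\<lambda>\<alpha>. \<alpha> k) (\<lambda>\<beta>. \<beta> l) (tens (dual K) (dual K) a b)"
    if "a \<in> carrier (dual K)" "b \<in> carrier (dual K)" for a b
    unfolding slice_tens[OF cspace_dual cspace_dual el that] tpair_tens[OF cspace_dual cspace_dual ek el that]
    using assms by simp
qed

text \<open>Evaluation in both factors separates the tensors over the dual, as the slices in one factor are
  functionals.\<close>

lemma dual_tensor_eqI:
  assumes s: "s \<in> carrier (tensor (dual K) (dual K))" and t: "t \<in> carrier (tensor (dual K) (dual K))"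
    and st: "\<And>k l. k \<in> carrier K \<Longrightarrow> l \<in> carrier K \<Longrightarrow>
      tpair (\<lambda>\<alpha>. \<alpha> k) (\<lambda>\<beta>. \<beta> l) s = tpair (\<lambda>\<alpha>. \<alpha> k) (\<lambda>\<beta>. \<beta> l) t"
  shows "s = t"
proof -
  obtain n e f where co: "coordinates K n e f" using exists_basis by blast
  show ?thesis
  proof (rule slices_separate[OF cspace_dual cspace_dual coordinates_dual[OF co] s t])
    fix i assume "i < n"
    then have ei: "e i \<in> carrier K" by (rule coordinatesD(1)[OF co])
    show "slice (dual K) (\<lambda>\<phi>. \<phi> (e i)) s = slice (dual K) (\<lambda>\<phi>. \<phi> (e i)) t"
    proof (rule functional_eqI)
      show "slice (dual K) (\<lambda>\<phi>. \<phi> (e i)) s \<in> functionals K" "slice (dual K) (\<lambda>\<phi>. \<phi> (e i)) t \<in> functionals K"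
        using slice_closed[OF cspace_dual cspace_dual lin_eval[OF ei]] s t by auto
      show "slice (dual K) (\<lambda>\<phi>. \<phi> (e i)) s k = slice (dual K) (\<lambda>\<phi>. \<phi> (e i)) t k" if "k \<in> carrier K" for k
        using s t ei that by (simp add: slice_eval st)
    qed
  qed
qed

text \<open>With coordinates \<open>e\<^sub>i, f\<^sub>i\<close>, the tensor \<open>\<Sum> f\<^sub>i \<otimes> \<phi>(e\<^sub>i \<cdot>)\<close> is the required value.\<close>

lemma dual_comult:
  assumes \<phi>: "\<phi> \<in> functionals K"
  shows "comult (dual K) \<phi> \<in> carrier (tensor (dual K) (dual K))"
    and "k \<in> carrier K \<Longrightarrow> l \<in> carrier K \<Longrightarrow>
      tpair (\<lambda>\<alpha>. \<alpha> k) (\<lambda>\<beta>. \<beta> l) (comult (dual K) \<phi>) = \<phi> (k \<otimes> l)"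
proof -
  let ?T = "tensor (dual K) (dual K)"
  let ?P = "\<lambda>t. t \<in> carrier ?T \<and> (\<forall>k\<in>carrier K. \<forall>l\<in>carrier K.
    tpair (\<lambda>\<alpha>. \<alpha> k) (\<lambda>\<beta>. \<beta> l) t = \<phi> (k \<otimes> l))"
  obtain n e f where co: "coordinates K n e f" using exists_basis by blast
  note c = coordinatesD[OF co]
  note l\<phi> = functionals_lin[OF \<phi>]
  have cT: "cspace ?T" by (rule cspace_tensor[OF cspace_dual cspace_dual])
  define \<psi> where "\<psi> i = restrict (\<lambda>l. \<phi> (e i \<otimes> l)) (carrier K)" for i
  have \<psi>: "\<psi> i \<in> carrier (dual K)" if "i < n" for i
    using that c unfolding \<psi>_def
    by (simp add: restrict_functional lin_comp[OF l\<phi> lin_mult_left[OF star_alg _ lin_id]])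
  have f: "restrict (f i) (carrier K) \<in> carrier (dual K)" if "i < n" for i
    using that c by (simp add: restrict_functional)
  let ?t = "lsum ?T (\<lambda>i. tens (dual K) (dual K) (restrict (f i) (carrier K)) (\<psi> i)) [0..<n]"
  have "?P ?t"
  proof (intro conjI ballI)
    show "?t \<in> carrier ?T" using f \<psi> by (intro cspace.lsum_closed[OF cT]) (auto intro!: tens_closed)
    fix k l assume k: "k \<in> carrier K" and l: "l \<in> carrier K"
    note ek = lin_eval[OF k] and el = lin_eval[OF l]
    have "tpair (\<lambda>\<alpha>. \<alpha> k) (\<lambda>\<beta>. \<beta> l) ?t = lsum complex_alg (\<lambda>i. tpair (\<lambda>\<alpha>. \<alpha> k) (\<lambda>\<beta>. \<beta> l)
        (tens (dual K) (dual K) (restrict (f i) (carrier K)) (\<psi> i))) [0..<n]"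
      using f \<psi> by (intro lin_lsum_apply[OF cT cspace_complex lin_tpair[OF cspace_dual cspace_dual ek el]])
        (auto intro!: tens_closed)
    also have "\<dots> = lsum complex_alg (\<lambda>i. \<phi> ((f i k \<odot> e i) \<otimes> l)) [0..<n]"
    proof (rule lsum_cong_upt)
      fix i assume i: "i < n"
      have "tpair (\<lambda>\<alpha>. \<alpha> k) (\<lambda>\<beta>. \<beta> l) (tens (dual K) (dual K) (restrict (f i) (carrier K)) (\<psi> i))
          = f i k * \<phi> (e i \<otimes> l)"
        unfolding tpair_tens[OF cspace_dual cspace_dual ek el f[OF i] \<psi>[OF i]]
        using k l by (simp add: \<psi>_def)
      then show "tpair (\<lambda>\<alpha>. \<alpha> k) (\<lambda>\<beta>. \<beta> l) (tens (dual K) (dual K) (restrict (f i) (carrier K)) (\<psi> i))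
          = \<phi> ((f i k \<odot> e i) \<otimes> l)"
        using l c(1)[OF i] linD(3)[OF l\<phi>] by (simp add: smult_mult_left mult_closed)
    qed
    also have "\<dots> = \<phi> (lsum K (\<lambda>i. f i k \<odot> e i) [0..<n] \<otimes> l)"
      using c by (intro lin_lsum_apply[OF cs cspace_complex
            lin_comp[OF l\<phi> lin_mult_right[OF star_alg l lin_id]], symmetric]) auto
    finally show "tpair (\<lambda>\<alpha>. \<alpha> k) (\<lambda>\<beta>. \<beta> l) ?t = \<phi> (k \<otimes> l)" using c(4)[OF k] by simp
  qed
  moreover have "s = t" if "?P s" "?P t" for s t
    by (rule dual_tensor_eqI) (use that in auto)
  ultimately have ex1: "\<exists>!t. ?P t" by blast
  have "comult (dual K) \<phi> = (THE t. t \<in> carrier (tensor (dual_star_alg K) (dual_star_alg K)) \<and>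
      (\<forall>k\<in>carrier K. \<forall>l\<in>carrier K. (\<Sum>(\<alpha>, \<beta>)\<leftarrow>terms t. \<alpha> k * \<beta> l) = \<phi> (k \<otimes> l)))"
    by (simp add: dual_def hopf.defs star_alg.defs)
  then have "comult (dual K) \<phi> = (THE t. ?P t)"
    by (simp only: tensor_dual_star_alg tpair_def)
  then have "?P (comult (dual K) \<phi>)" using theI'[OF ex1] by simp
  then show "comult (dual K) \<phi> \<in> carrier ?T"
    and "k \<in> carrier K \<Longrightarrow> l \<in> carrier K \<Longrightarrow>
      tpair (\<lambda>\<alpha>. \<alpha> k) (\<lambda>\<beta>. \<beta> l) (comult (dual K) \<phi>) = \<phi> (k \<otimes> l)"
    by auto
qed

lemma dual_counit: "counit (dual K) \<phi> = \<phi> \<one>"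
  by (simp add: dual_def hopf.defs star_alg.defs)

end

section \<open>Haar functionals and dual bases\<close>

lemma (in cspace) diff_zero_eq:
  assumes "x \<in> carrier M" "y \<in> carrier M" "x \<oplus> (-1) \<odot> y = \<zero>"
  shows "x = y"
  using assms M.minus_equality[of x "\<ominus> y"] by (simp add: scale_minus)

context cstar_hopf_algebra
begin

definition haar :: "('k \<Rightarrow> complex) \<Rightarrow> bool" where
  "haar \<tau> \<longleftrightarrow> lin K complex_alg \<tau> \<and> \<tau> \<one> = 1 \<and>
     (\<forall>h\<in>carrier K. sw K K (\<lambda>a b. \<tau> b \<odot> a) h = \<tau> h \<odot> \<one>) \<and>
     (\<forall>h\<in>carrier K. sw K K (\<lambda>a b. \<tau> a \<odot> b) h = \<tau> h \<odot> \<one>)"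

text \<open>Bases of \<open>K\<close> that are dual to each other for the bilinear form \<open>(x, y) \<mapsto> \<tau>(xy)\<close>.\<close>

definition dual_bases :: "('k \<Rightarrow> complex) \<Rightarrow> nat \<Rightarrow> (nat \<Rightarrow> 'k) \<Rightarrow> (nat \<Rightarrow> 'k) \<Rightarrow> bool" where
  "dual_bases \<tau> n e e' \<longleftrightarrow> (\<forall>i<n. e i \<in> carrier K \<and> e' i \<in> carrier K) \<and>
     (\<forall>x\<in>carrier K. lsum K (\<lambda>i. \<tau> (e' i \<otimes> x) \<odot> e i) [0..<n] = x) \<and>
     (\<forall>x\<in>carrier K. lsum K (\<lambda>i. \<tau> (x \<otimes> e i) \<odot> e' i) [0..<n] = x)"

context
  fixes \<tau> :: "'k \<Rightarrow> complex"
  assumes haar: "haar \<tau>"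
begin

lemma lin_tau: "lin K complex_alg \<tau>"
  and tau_one: "\<tau> \<one> = 1"
  and tau_right: "h \<in> carrier K \<Longrightarrow> sw K K (\<lambda>a b. \<tau> b \<odot> a) h = \<tau> h \<odot> \<one>"
  and tau_left: "h \<in> carrier K \<Longrightarrow> sw K K (\<lambda>a b. \<tau> a \<odot> b) h = \<tau> h \<odot> \<one>"
  using haar by (simp_all add: haar_def)

lemmas lin_tau' = lin_comp[OF lin_tau]
lemmas tau_lin = linD(2,3)[OF lin_tau, simplified]

lemmas lint = lin_rules lin_tau'

interpretation S: cspace K by (rule cs)

text \<open>
  Insert \<open>l\<^sub>2 S'(l\<^sub>1) = \<epsilon>(l)1\<close>, with \<open>S'\<close> the inverse of the antipode, after the free factor and use
  the invariance of \<open>\<tau>\<close> for the product \<open>h l\<close>.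
\<close>

lemma tau_shift_right:
  assumes h: "h \<in> carrier K" and l: "l \<in> carrier K"
  shows "sw K K (\<lambda>a b. \<tau> (b \<otimes> l) \<odot> a) h = sw K K (\<lambda>a b. \<tau> (h \<otimes> b) \<odot> coantipode a) l"
proof -
  let ?S = coantipode
  have "sw K K (\<lambda>a b. \<tau> (h \<otimes> b) \<odot> ?S a) l
      = sw K K (\<lambda>a b. sw K K (\<lambda>x y. sw K K (\<lambda>c d. \<tau> (y \<otimes> d) \<odot> (x \<otimes> (c \<otimes> ?S a))) b) h) l"
  proof (rule sw_cong[OF l])
    fix a b assume a: "a \<in> carrier K" and b: "b \<in> carrier K"
    have hb: "h \<otimes> b \<in> carrier K" and Sa: "?S a \<in> carrier K" by (intro clo_rules h a b)+
    have "\<tau> (h \<otimes> b) \<odot> ?S a = (\<tau> (h \<otimes> b) \<odot> \<one>) \<otimes> ?S a"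
      using Sa by (simp add: smult_mult_left one_closed mult_one_left)
    also have "\<dots> = sw K K (\<lambda>x y. \<tau> y \<odot> x) (h \<otimes> b) \<otimes> ?S a" by (simp only: tau_right[OF hb])
    also have "\<dots> = sw K K (\<lambda>x y. (\<tau> y \<odot> x) \<otimes> ?S a) (h \<otimes> b)"
      by (rule lin_sw_apply[OF cs cs lin_mult_right[OF star_alg Sa lin_id] _ hb])
        (intro bilI lint; assumption)
    also have "\<dots> = sw K K (\<lambda>x y. sw K K (\<lambda>c d. (\<tau> (y \<otimes> d) \<odot> (x \<otimes> c)) \<otimes> ?S a) b) h"
      by (rule sw_mult[OF cs _ h b]) (intro bilI lint clo_rules S.scale_closed Sa; assumption)
    also have "\<dots> = sw K K (\<lambda>x y. sw K K (\<lambda>c d. \<tau> (y \<otimes> d) \<odot> (x \<otimes> (c \<otimes> ?S a))) b) h"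
      using Sa by (intro sw_cong h b) (simp add: smult_mult_left mult_closed mult_assoc)
    finally show "\<tau> (h \<otimes> b) \<odot> ?S a
        = sw K K (\<lambda>x y. sw K K (\<lambda>c d. \<tau> (y \<otimes> d) \<odot> (x \<otimes> (c \<otimes> ?S a))) b) h" .
  qed
  also have "\<dots> = sw K K (\<lambda>x y. sw K K (\<lambda>a b. sw K K (\<lambda>c d. \<tau> (y \<otimes> d) \<odot> (x \<otimes> (c \<otimes> ?S a))) b) l) h"
    by (rule sw_swap[OF cs l h])
      (intro sw_closed[OF cs] bilI lint clo_rules S.scale_closed; assumption)
  also have "\<dots> = sw K K (\<lambda>x y. \<tau> (y \<otimes> l) \<odot> x) h"
  proof (rule sw_cong[OF h])
    fix x y assume x: "x \<in> carrier K" and y: "y \<in> carrier K"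
    have "sw K K (\<lambda>a b. sw K K (\<lambda>c d. \<tau> (y \<otimes> d) \<odot> (x \<otimes> (c \<otimes> ?S a))) b) l
        = sw K K (\<lambda>a b. sw K K (\<lambda>c d. \<tau> (y \<otimes> b) \<odot> (x \<otimes> (d \<otimes> ?S c))) a) l"
      by (rule sw_assoc[OF cs l, symmetric]) (intro lint clo_rules x y; assumption)+
    also have "\<dots> = sw K K (\<lambda>a b. counit K a \<odot> (\<tau> (y \<otimes> b) \<odot> (x \<otimes> \<one>))) l"
      by (rule sw_cong[OF l], rule sw_coantipode[OF cs])
        (intro lint clo_rules x y; assumption)+
    also have "\<dots> = \<tau> (y \<otimes> l) \<odot> (x \<otimes> \<one>)"
      by (rule sw_counit_left[OF cs _ l]) (intro lint clo_rules x y)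
    finally show "sw K K (\<lambda>a b. sw K K (\<lambda>c d. \<tau> (y \<otimes> d) \<odot> (x \<otimes> (c \<otimes> ?S a))) b) l
        = \<tau> (y \<otimes> l) \<odot> x" using x by (simp add: mult_one_right)
  qed
  finally show ?thesis by simp
qed

lemma tau_shift_left:
  assumes h: "h \<in> carrier K" and l: "l \<in> carrier K"
  shows "sw K K (\<lambda>a b. \<tau> (a \<otimes> l) \<odot> b) h = sw K K (\<lambda>a b. \<tau> (h \<otimes> a) \<odot> antipode K b) l"
proof -
  let ?S = "antipode K"
  have "sw K K (\<lambda>a b. \<tau> (h \<otimes> a) \<odot> ?S b) l
      = sw K K (\<lambda>a b. sw K K (\<lambda>x y. sw K K (\<lambda>c d. \<tau> (x \<otimes> c) \<odot> (y \<otimes> (d \<otimes> ?S b))) a) h) l"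
  proof (rule sw_cong[OF l])
    fix a b assume a: "a \<in> carrier K" and b: "b \<in> carrier K"
    have ha: "h \<otimes> a \<in> carrier K" and Sb: "?S b \<in> carrier K" by (intro clo_rules h a b)+
    have "\<tau> (h \<otimes> a) \<odot> ?S b = (\<tau> (h \<otimes> a) \<odot> \<one>) \<otimes> ?S b"
      using Sb by (simp add: smult_mult_left one_closed mult_one_left)
    also have "\<dots> = sw K K (\<lambda>x y. \<tau> x \<odot> y) (h \<otimes> a) \<otimes> ?S b" by (simp only: tau_left[OF ha])
    also have "\<dots> = sw K K (\<lambda>x y. (\<tau> x \<odot> y) \<otimes> ?S b) (h \<otimes> a)"
      by (rule lin_sw_apply[OF cs cs lin_mult_right[OF star_alg Sb lin_id] _ ha])
        (intro bilI lint; assumption)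
    also have "\<dots> = sw K K (\<lambda>x y. sw K K (\<lambda>c d. (\<tau> (x \<otimes> c) \<odot> (y \<otimes> d)) \<otimes> ?S b) a) h"
      by (rule sw_mult[OF cs _ h a]) (intro bilI lint clo_rules S.scale_closed Sb; assumption)
    also have "\<dots> = sw K K (\<lambda>x y. sw K K (\<lambda>c d. \<tau> (x \<otimes> c) \<odot> (y \<otimes> (d \<otimes> ?S b))) a) h"
      using Sb by (intro sw_cong h a) (simp add: smult_mult_left mult_closed mult_assoc)
    finally show "\<tau> (h \<otimes> a) \<odot> ?S b
        = sw K K (\<lambda>x y. sw K K (\<lambda>c d. \<tau> (x \<otimes> c) \<odot> (y \<otimes> (d \<otimes> ?S b))) a) h" .
  qed
  also have "\<dots> = sw K K (\<lambda>x y. sw K K (\<lambda>a b. sw K K (\<lambda>c d. \<tau> (x \<otimes> c) \<odot> (y \<otimes> (d \<otimes> ?S b))) a) l) h"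
    by (rule sw_swap[OF cs l h])
      (intro sw_closed[OF cs] bilI lint clo_rules S.scale_closed; assumption)
  also have "\<dots> = sw K K (\<lambda>x y. \<tau> (x \<otimes> l) \<odot> y) h"
  proof (rule sw_cong[OF h])
    fix x y assume x: "x \<in> carrier K" and y: "y \<in> carrier K"
    have "sw K K (\<lambda>a b. sw K K (\<lambda>c d. \<tau> (x \<otimes> c) \<odot> (y \<otimes> (d \<otimes> ?S b))) a) l
        = sw K K (\<lambda>a b. sw K K (\<lambda>c d. \<tau> (x \<otimes> a) \<odot> (y \<otimes> (c \<otimes> ?S d))) b) l"
      by (rule sw_assoc[OF cs l]) (intro lint clo_rules x y; assumption)+
    also have "\<dots> = sw K K (\<lambda>a b. counit K b \<odot> (\<tau> (x \<otimes> a) \<odot> (y \<otimes> \<one>))) l"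
      by (rule sw_cong[OF l], rule sw_antipode_right[OF cs])
        (intro lint clo_rules x y; assumption)+
    also have "\<dots> = \<tau> (x \<otimes> l) \<odot> (y \<otimes> \<one>)"
      by (rule sw_counit_right[OF cs _ l]) (intro lint clo_rules x y)
    finally show "sw K K (\<lambda>a b. sw K K (\<lambda>c d. \<tau> (x \<otimes> c) \<odot> (y \<otimes> (d \<otimes> ?S b))) a) l
        = \<tau> (x \<otimes> l) \<odot> y" using y by (simp add: mult_one_right)
  qed
  finally show ?thesis by simp
qed

text \<open>
  By the shift rule \<open>h\<^sub>1 \<tau>(h\<^sub>2 l) = 0\<close> for all \<open>l\<close>.  The element \<open>h = h\<^sub>1 \<epsilon>(h\<^sub>2) = h\<^sub>1 \<tau>(h\<^sub>3 S'(h\<^sub>2))\<close>,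
  with \<open>S'\<close> the inverse of the antipode, is a sum of linear images of such expressions, as one sees by
  expanding \<open>S'(h\<^sub>2)\<close> in coordinates.
\<close>

lemma tau_nondegenerate:
  assumes h: "h \<in> carrier K" and zero: "\<And>l. l \<in> carrier K \<Longrightarrow> \<tau> (h \<otimes> l) = 0"
  shows "h = \<zero>"
proof -
  obtain n e f where co: "coordinates K n e f" using exists_basis by blast
  note c = coordinatesD[OF co]
  let ?S = coantipode
  define G where "G i x = sw K K (\<lambda>a b. f i (?S b) \<odot> a) x" for i x
  have lS: "lin N complex_alg (\<lambda>x. f i (?S (g x)))" if "lin N K g" "i < n"
    for N :: "(complex, 'c, 'd) module_scheme" and g i
    by (rule lin_comp[OF lin_comp[OF c(2)[OF that(2)] lin_coantipode] that(1)])
  have bG: "bil K K K (\<lambda>a b. f i (?S b) \<odot> a)" if "i < n" for i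
    by (intro bilI lint lS that; assumption)
  have lG: "lin K K (G i)" if "i < n" for i
    unfolding G_def by (rule lin_sw_arg[OF cs bG[OF that] lin_id])
  have z: "sw K K (\<lambda>a b. \<tau> (b \<otimes> l) \<odot> a) h = \<zero>" if l: "l \<in> carrier K" for l
  proof -
    have "sw K K (\<lambda>a b. \<tau> (b \<otimes> l) \<odot> a) h = sw K K (\<lambda>a b. \<zero>) l"
      unfolding tau_shift_right[OF h l] by (rule sw_cong[OF l]) (simp add: zero S.scale_zero coantipode_closed)
    then show ?thesis by (simp add: sw_def teval_def case_prod_unfold S.lsum_zero)
  qed
  have "h = sw K K (\<lambda>a b. counit K b \<odot> (\<tau> \<one> \<odot> a)) h"
    using h sw_counit_right[OF cs lin_id h] by (simp add: tau_one S.scale_one cong: sw_cong)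
  also have "\<dots> = sw K K (\<lambda>a b. sw K K (\<lambda>c d. \<tau> (d \<otimes> ?S c) \<odot> a) b) h"
    by (rule sw_cong[OF h], rule sw_coantipode(1)[OF cs, symmetric]) (intro lint; assumption)+
  also have "\<dots> = sw K K (\<lambda>p q. sw K K (\<lambda>a c. \<tau> (q \<otimes> ?S c) \<odot> a) p) h"
    by (rule sw_assoc[OF cs h, symmetric]) (intro lint clo_rules; assumption)+
  also have "\<dots> = sw K K (\<lambda>p q. lsum K (\<lambda>i. G i (\<tau> (q \<otimes> e i) \<odot> p)) [0..<n]) h"
  proof (rule sw_cong[OF h])
    fix p q assume p: "p \<in> carrier K" and q: "q \<in> carrier K"
    note lq = lin_tau'[OF lin_mult_left[OF star_alg q lin_id]]
    have "sw K K (\<lambda>a c. \<tau> (q \<otimes> ?S c) \<odot> a) p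
        = sw K K (\<lambda>a c. lsum K (\<lambda>i. (f i (?S c) * \<tau> (q \<otimes> e i)) \<odot> a) [0..<n]) p"
      by (rule sw_cong[OF p]) (simp add: lin_expand[OF cs cspace_complex co lq coantipode_closed]
          S.lsum_scale_left list_sum_complex)
    also have "\<dots> = lsum K (\<lambda>i. sw K K (\<lambda>a c. (f i (?S c) * \<tau> (q \<otimes> e i)) \<odot> a) p) [0..<n]"
      unfolding sw_def teval_def case_prod_unfold
      using terms_mem[OF cs cs comult_closed[OF p]] by (intro S.lsum_swap) (auto intro: S.scale_closed)
    also have "\<dots> = lsum K (\<lambda>i. G i (\<tau> (q \<otimes> e i) \<odot> p)) [0..<n]"
    proof (rule lsum_cong_upt)
      fix i assume i: "i < n"
      have "sw K K (\<lambda>a c. (f i (?S c) * \<tau> (q \<otimes> e i)) \<odot> a) p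
          = sw K K (\<lambda>a c. \<tau> (q \<otimes> e i) \<odot> (f i (?S c) \<odot> a)) p"
        by (rule sw_cong[OF p]) (simp add: S.scale_scale mult.commute)
      also have "\<dots> = \<tau> (q \<otimes> e i) \<odot> G i p"
        unfolding G_def by (rule lin_sw_apply[OF cs cs lin_const_scale[OF cs lin_id] bG[OF i] p, symmetric])
      finally show "sw K K (\<lambda>a c. (f i (?S c) * \<tau> (q \<otimes> e i)) \<odot> a) p = G i (\<tau> (q \<otimes> e i) \<odot> p)"
        by (simp add: linD(3)[OF lG[OF i] p])
    qed
    finally show "sw K K (\<lambda>a c. \<tau> (q \<otimes> ?S c) \<odot> a) p = \<dots>" .
  qed
  also have "\<dots> = lsum K (\<lambda>i. sw K K (\<lambda>p q. G i (\<tau> (q \<otimes> e i) \<odot> p)) h) [0..<n]"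
    unfolding sw_def teval_def case_prod_unfold
    using terms_mem[OF cs cs comult_closed[OF h]] linD(1)[OF lG] by (intro S.lsum_swap) (auto intro: S.scale_closed)
  also have "\<dots> = lsum K (\<lambda>i. \<zero>) [0..<n]"
  proof (rule lsum_cong_upt)
    fix i assume i: "i < n"
    have "sw K K (\<lambda>p q. G i (\<tau> (q \<otimes> e i) \<odot> p)) h = G i (sw K K (\<lambda>p q. \<tau> (q \<otimes> e i) \<odot> p) h)"
      by (rule lin_sw_apply[OF cs cs lG[OF i] _ h, symmetric]) (intro bilI lint c(1)[OF i]; assumption)
    then show "sw K K (\<lambda>p q. G i (\<tau> (q \<otimes> e i) \<odot> p)) h = \<zero>"
      by (simp only: z[OF c(1)[OF i]] lin_zero[OF cs cs lG[OF i]])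
  qed
  finally show ?thesis by (simp only: S.lsum_zero)
qed

text \<open>
  The \<open>n\<close> functionals \<open>\<tau>(e\<^sub>m \<cdot>)\<close> and a coordinate functional \<open>f\<^sub>k\<close> are linearly dependent.  By
  nondegeneracy the relation involves \<open>f\<^sub>k\<close>, so that \<open>f\<^sub>k = \<tau>(e'\<^sub>k \<cdot>)\<close> for some \<open>e'\<^sub>k\<close>.
\<close>

lemma exists_dual_bases: "\<exists>n e e'. dual_bases \<tau> n e e'"
proof -
  obtain n e f where co: "coordinates K n e f" using exists_basis by blast
  note c = coordinatesD[OF co]
  have tau_l: "lin K complex_alg (\<lambda>x. \<tau> (x \<otimes> l))" "lin K complex_alg (\<lambda>x. \<tau> (l \<otimes> x))"
    if "l \<in> carrier K" for l
    by (intro lint that)+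
  have "\<exists>x\<in>carrier K. \<forall>i<n. \<tau> (x \<otimes> e i) = (if k = i then 1 else 0)" if k: "k < n" for k
  proof -
    let ?c = "\<lambda>m i. if m < n then \<tau> (e m \<otimes> e i) else if k = i then 1 else 0"
    obtain d where d: "\<exists>m\<in>{..n}. d m \<noteq> 0" "\<forall>i<n. (\<Sum>m\<in>{..n}. d m * ?c m i) = 0"
      using underdetermined_system[of "{..n}" n ?c] by auto
    define x where "x g = lsum K (\<lambda>m. g m \<odot> e m) [0..<n]" for g
    have x: "x g \<in> carrier K" for g unfolding x_def using c by (intro S.lsum_closed) auto
    have tx: "\<tau> (x g \<otimes> e i) = (\<Sum>m<n. g m * \<tau> (e m \<otimes> e i))" if i: "i < n" for g i
    proof -
      have "\<tau> (x g \<otimes> e i) = lsum complex_alg (\<lambda>m. \<tau> ((g m \<odot> e m) \<otimes> e i)) [0..<n]"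
        unfolding x_def using c
        by (intro lin_lsum_apply[OF cs cspace_complex tau_l(1)[OF c(1)[OF i]]]) auto
      also have "\<dots> = lsum complex_alg (\<lambda>m. g m * \<tau> (e m \<otimes> e i)) [0..<n]"
        using c i by (intro lsum_cong) (auto simp: smult_mult_left tau_lin mult_closed)
      also have "\<dots> = (\<Sum>m<n. g m * \<tau> (e m \<otimes> e i))"
        by (simp add: list_sum_complex sum_list_distinct_conv_sum_set atLeast0LessThan)
      finally show ?thesis .
    qed
    have sum: "(\<Sum>m\<in>{..n}. d m * ?c m i) = \<tau> (x d \<otimes> e i) + d n * (if k = i then 1 else 0)"
      if i: "i < n" for i
    proof -
      have "{..n} = insert n {..<n}" by auto
      then show ?thesis using tx[OF i] by simp
    qed
    have dn: "d n \<noteq> 0"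
    proof
      assume dn: "d n = 0"
      have "\<tau> (x d \<otimes> l) = 0" if l: "l \<in> carrier K" for l
      proof -
        have "\<tau> (x d \<otimes> l) = lsum complex_alg (\<lambda>i. f i l * \<tau> (x d \<otimes> e i)) [0..<n]"
          using lin_expand[OF cs cspace_complex co tau_l(2)[OF x] l] by simp
        also have "\<dots> = lsum complex_alg (\<lambda>i. 0) [0..<n]" using d(2) sum dn by (intro lsum_cong) auto
        finally show ?thesis using cspace.lsum_zero[OF cspace_complex] by simp
      qed
      then have x0: "x d = \<zero>" by (rule tau_nondegenerate[OF x])
      have "d m = 0" if m: "m < n" for m
      proof -
        have "f m (x d) = lsum complex_alg (\<lambda>j. f m (d j \<odot> e j)) [0..<n]"
          unfolding x_def using c m by (intro lin_lsum_apply[OF cs cspace_complex]) auto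
        also have "\<dots> = lsum complex_alg (\<lambda>j. (if j = m then 1 else 0) \<odot>\<^bsub>complex_alg\<^esub> d j) [0..<n]"
          using c m linD(3)[OF c(2)[OF m]] by (intro lsum_cong) auto
        also have "\<dots> = d m" using m by (intro cspace.lsum_single[OF cspace_complex]) auto
        finally show ?thesis using lin_zero[OF cs cspace_complex c(2)[OF m]] x0 by simp
      qed
      then show False using d(1) dn by (metis atMost_iff le_neq_implies_less)
    qed
    show ?thesis
    proof (intro bexI[of _ "(- 1 / d n) \<odot> x d"] allI impI)
      show "(- 1 / d n) \<odot> x d \<in> carrier K" using x by simp
      fix i assume i: "i < n"
      have "\<tau> (x d \<otimes> e i) = - d n * (if k = i then 1 else 0)"
        using d(2) sum[OF i] i by (simp add: eq_neg_iff_add_eq_0)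
      then show "\<tau> ((- 1 / d n) \<odot> x d \<otimes> e i) = (if k = i then 1 else 0)"
        using dn c(1)[OF i] x by (simp add: smult_mult_left tau_lin mult_closed)
    qed
  qed
  then obtain e' where e': "\<And>k. k < n \<Longrightarrow> e' k \<in> carrier K"
    and te: "\<And>k i. k < n \<Longrightarrow> i < n \<Longrightarrow> \<tau> (e' k \<otimes> e i) = (if k = i then 1 else 0)"
    by metis
  have tf: "\<tau> (e' k \<otimes> x) = f k x" if k: "k < n" and x: "x \<in> carrier K" for k x
  proof -
    have "\<tau> (e' k \<otimes> x) = lsum complex_alg (\<lambda>i. f i x * \<tau> (e' k \<otimes> e i)) [0..<n]"
      using lin_expand[OF cs cspace_complex co tau_l(2)[OF e'[OF k]] x] by simp
    also have "\<dots> = lsum complex_alg (\<lambda>i. (if i = k then 1 else 0) \<odot>\<^bsub>complex_alg\<^esub> f i x) [0..<n]"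
      using k te by (intro lsum_cong) auto
    also have "\<dots> = f k x" using k by (intro cspace.lsum_single[OF cspace_complex]) auto
    finally show ?thesis .
  qed
  have "dual_bases \<tau> n e e'"
    unfolding dual_bases_def
  proof (intro conjI allI impI ballI)
    show "e i \<in> carrier K" "e' i \<in> carrier K" if "i < n" for i using c e' that by auto
    fix x assume x: "x \<in> carrier K"
    show "lsum K (\<lambda>i. \<tau> (e' i \<otimes> x) \<odot> e i) [0..<n] = x"
      using lsum_cong[of "[0..<n]" "\<lambda>i. \<tau> (e' i \<otimes> x) \<odot> e i" "\<lambda>i. f i x \<odot> e i" K] x c(4)[OF x]
      by (simp add: tf)
    let ?y = "lsum K (\<lambda>i. \<tau> (x \<otimes> e i) \<odot> e' i) [0..<n]"
    have y: "?y \<in> carrier K" using e' by (intro S.lsum_closed) auto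
    have eq: "\<tau> (?y \<otimes> l) = \<tau> (x \<otimes> l)" if l: "l \<in> carrier K" for l
    proof -
      have "\<tau> (?y \<otimes> l) = lsum complex_alg (\<lambda>i. \<tau> ((\<tau> (x \<otimes> e i) \<odot> e' i) \<otimes> l)) [0..<n]"
        using e' by (intro lin_lsum_apply[OF cs cspace_complex tau_l(1)[OF l]]) auto
      also have "\<dots> = lsum complex_alg (\<lambda>i. \<tau> (x \<otimes> (f i l \<odot> e i))) [0..<n]"
        using c e' x l by (intro lsum_cong)
          (auto simp: smult_mult_left smult_mult_right tau_lin mult_closed tf)
      also have "\<dots> = \<tau> (x \<otimes> lsum K (\<lambda>i. f i l \<odot> e i) [0..<n])"
        using c by (intro lin_lsum_apply[OF cs cspace_complex tau_l(2)[OF x], symmetric]) auto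
      finally show ?thesis using c(4)[OF l] by simp
    qed
    have "?y \<oplus> (-1) \<odot> x = \<zero>"
    proof (rule tau_nondegenerate)
      show "?y \<oplus> (-1) \<odot> x \<in> carrier K" using x y by (intro add_closed S.scale_closed)
      fix l assume l: "l \<in> carrier K"
      have "\<tau> ((?y \<oplus> (-1) \<odot> x) \<otimes> l) = \<tau> (?y \<otimes> l) + (-1) * \<tau> (x \<otimes> l)"
        using linD(2)[OF tau_l(1)[OF l] y S.scale_closed[OF x, of "-1"]]
          linD(3)[OF tau_l(1)[OF l] x, of "-1"] by simp
      then show "\<tau> ((?y \<oplus> (-1) \<odot> x) \<otimes> l) = 0" using eq[OF l] by simp
    qed
    then show "?y = x"
      by (rule S.diff_zero_eq[OF y x])
  qed
  then show ?thesis by blast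
qed

context
  fixes n e e'
  assumes db: "dual_bases \<tau> n e e'"
begin

lemma basis_closed: "i < n \<Longrightarrow> e i \<in> carrier K" and dual_basis_closed: "i < n \<Longrightarrow> e' i \<in> carrier K"
  and basis_expansion: "x \<in> carrier K \<Longrightarrow> lsum K (\<lambda>i. \<tau> (e' i \<otimes> x) \<odot> e i) [0..<n] = x"
  and dual_basis_expansion: "x \<in> carrier K \<Longrightarrow> lsum K (\<lambda>i. \<tau> (x \<otimes> e i) \<odot> e' i) [0..<n] = x"
  using db by (auto simp: dual_bases_def)

lemmas bc = basis_closed dual_basis_closed

lemma lin_basis_expansion:
  assumes M: "cspace M" and F: "lin K M F" and x: "x \<in> carrier K"
  shows "lsum M (\<lambda>i. \<tau> (e' i \<otimes> x) \<odot>\<^bsub>M\<^esub> F (e i)) [0..<n] = F x"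
    and "lsum M (\<lambda>i. \<tau> (x \<otimes> e i) \<odot>\<^bsub>M\<^esub> F (e' i)) [0..<n] = F x"
  by (rule lin_combination[OF cs M F bc(1) basis_expansion[OF x]]
      lin_combination[OF cs M F bc(2) dual_basis_expansion[OF x]]; assumption)+

text \<open>Expanded in the dual bases, both sides have the coefficients \<open>\<tau>(e'\<^sub>k h e\<^sub>i)\<close>.\<close>

lemma casimir:
  assumes M: "cspace M" and F: "bil K K M F" and h: "h \<in> carrier K"
  shows "lsum M (\<lambda>i. F (h \<otimes> e i) (e' i)) [0..<n] = lsum M (\<lambda>i. F (e i) (e' i \<otimes> h)) [0..<n]"
proof -
  interpret M: cspace M by (rule M)
  note Fl = bilD(2)[OF F dual_basis_closed] and Fr = bilD(1)[OF F basis_closed]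
  have "lsum M (\<lambda>i. F (h \<otimes> e i) (e' i)) [0..<n]
      = lsum M (\<lambda>i. lsum M (\<lambda>k. \<tau> (e' k \<otimes> (h \<otimes> e i)) \<odot>\<^bsub>M\<^esub> F (e k) (e' i)) [0..<n]) [0..<n]"
    using h bc by (intro lsum_cong lin_basis_expansion(1)[OF M Fl, symmetric]) (auto intro: clo_rules)
  also have "\<dots> = lsum M (\<lambda>k. lsum M (\<lambda>i. \<tau> (e' k \<otimes> (h \<otimes> e i)) \<odot>\<^bsub>M\<^esub> F (e k) (e' i)) [0..<n]) [0..<n]"
    using bc F by (intro M.lsum_swap) (auto intro!: M.scale_closed bilD(3)[OF F])
  also have "\<dots> = lsum M (\<lambda>k. lsum M (\<lambda>i. \<tau> ((e' k \<otimes> h) \<otimes> e i) \<odot>\<^bsub>M\<^esub> F (e k) (e' i)) [0..<n]) [0..<n]"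
    using h bc by (intro lsum_cong) (auto simp: mult_assoc)
  also have "\<dots> = lsum M (\<lambda>k. F (e k) (e' k \<otimes> h)) [0..<n]"
    using h bc by (intro lsum_cong lin_basis_expansion(2)[OF M Fr]) (auto intro: clo_rules)
  finally show ?thesis .
qed

text \<open>
  Shifting the comultiplication from \<open>e'\<^sub>i\<close> to \<open>l\<close> and summing over \<open>i\<close> leaves \<open>l\<^sub>2 S'(l\<^sub>1)\<close>, with \<open>S'\<close>
  the inverse of the antipode.
\<close>

lemma casimir_counit:
  assumes l: "l \<in> carrier K"
  shows "lsum K (\<lambda>i. e i \<otimes> sw K K (\<lambda>a b. \<tau> (b \<otimes> l) \<odot> a) (e' i)) [0..<n] = counit K l \<odot> \<one>"
proof -
  let ?S = coantipode
  have "lsum K (\<lambda>i. e i \<otimes> sw K K (\<lambda>a b. \<tau> (b \<otimes> l) \<odot> a) (e' i)) [0..<n]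
      = lsum K (\<lambda>i. sw K K (\<lambda>a b. \<tau> (e' i \<otimes> b) \<odot> (e i \<otimes> ?S a)) l) [0..<n]"
  proof (rule lsum_cong_upt)
    fix i assume "i < n"
    then have ei: "e i \<in> carrier K" and ei': "e' i \<in> carrier K" using bc by auto
    have "e i \<otimes> sw K K (\<lambda>a b. \<tau> (b \<otimes> l) \<odot> a) (e' i)
        = e i \<otimes> sw K K (\<lambda>a b. \<tau> (e' i \<otimes> b) \<odot> ?S a) l"
      by (simp only: tau_shift_right[OF ei' l])
    also have "\<dots> = sw K K (\<lambda>a b. e i \<otimes> (\<tau> (e' i \<otimes> b) \<odot> ?S a)) l"
      by (rule lin_sw_apply[OF cs cs lin_mult_left[OF star_alg ei lin_id] _ l])
        (intro bilI lint clo_rules ei'; assumption)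
    also have "\<dots> = sw K K (\<lambda>a b. \<tau> (e' i \<otimes> b) \<odot> (e i \<otimes> ?S a)) l"
      using ei by (intro sw_cong[OF l]) (simp add: smult_mult_right coantipode_closed)
    finally show "e i \<otimes> sw K K (\<lambda>a b. \<tau> (b \<otimes> l) \<odot> a) (e' i)
        = sw K K (\<lambda>a b. \<tau> (e' i \<otimes> b) \<odot> (e i \<otimes> ?S a)) l" .
  qed
  also have "\<dots> = sw K K (\<lambda>a b. lsum K (\<lambda>i. \<tau> (e' i \<otimes> b) \<odot> (e i \<otimes> ?S a)) [0..<n]) l"
    unfolding sw_def teval_def case_prod_unfold
    using terms_mem[OF cs cs comult_closed[OF l]] bc
    by (intro S.lsum_swap) (auto intro!: clo_rules S.scale_closed)
  also have "\<dots> = sw K K (\<lambda>a b. b \<otimes> ?S a) l"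
    by (intro sw_cong[OF l] lin_basis_expansion(1)[OF cs] lint clo_rules)
  also have "\<dots> = counit K l \<odot> \<one>" by (rule sw_coantipode(1)[OF cs lin_id l])
  finally show ?thesis .
qed

text \<open>The Haar integral in \<open>K\<close> that belongs to the Haar functional.\<close>

definition integral :: 'k where "integral = lsum K (\<lambda>i. counit K (e' i) \<odot> e i) [0..<n]"

lemma integral_closed: "integral \<in> carrier K"
  unfolding integral_def using bc by (intro S.lsum_closed) (auto intro: S.scale_closed)

text \<open>
  Pairing the first factor with \<open>\<tau>(l \<cdot>)\<close> and shifting the comultiplication to \<open>l\<close> leaves
  \<open>S\<^sup>-\<^sup>1(l\<^sub>2) l\<^sub>1\<close>.
\<close>

lemma casimir_comult_pairing:
  assumes l: "l \<in> carrier K"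
  shows "lsum K (\<lambda>i. sw K K (\<lambda>a b. \<tau> (l \<otimes> a) \<odot> (b \<otimes> e' i)) (e i)) [0..<n] = counit K l \<odot> \<one>"
proof -
  let ?S = coantipode
  have inv: "?S (antipode K x) = x" if "x \<in> carrier K" for x
    using that by (simp add: coantipode_def antipode_star)
  have "lsum K (\<lambda>i. sw K K (\<lambda>a b. \<tau> (l \<otimes> a) \<odot> (b \<otimes> e' i)) (e i)) [0..<n]
      = lsum K (\<lambda>i. sw K K (\<lambda>c d. \<tau> (c \<otimes> e i) \<odot> (?S d \<otimes> e' i)) l) [0..<n]"
  proof (rule lsum_cong_upt)
    fix i assume "i < n"
    then have ei: "e i \<in> carrier K" and ei': "e' i \<in> carrier K" using bc by auto
    note lm = lin_mult_right[OF star_alg ei' lin_coantipode]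
    have "sw K K (\<lambda>a b. \<tau> (l \<otimes> a) \<odot> (b \<otimes> e' i)) (e i)
        = sw K K (\<lambda>a b. ?S (\<tau> (l \<otimes> a) \<odot> antipode K b) \<otimes> e' i) (e i)"
      using ei' by (intro sw_cong[OF ei])
        (simp add: linD(3)[OF lin_coantipode] antipode_closed inv smult_mult_left)
    also have "\<dots> = ?S (sw K K (\<lambda>a b. \<tau> (l \<otimes> a) \<odot> antipode K b) (e i)) \<otimes> e' i"
      by (rule lin_sw_apply[OF cs cs lm _ ei, symmetric]) (intro bilI lint clo_rules l; assumption)
    also have "\<dots> = ?S (sw K K (\<lambda>c d. \<tau> (c \<otimes> e i) \<odot> d) l) \<otimes> e' i"
      by (simp only: tau_shift_left[OF l ei])
    also have "\<dots> = sw K K (\<lambda>c d. ?S (\<tau> (c \<otimes> e i) \<odot> d) \<otimes> e' i) l"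
      by (rule lin_sw_apply[OF cs cs lm _ l]) (intro bilI lint clo_rules ei; assumption)
    also have "\<dots> = sw K K (\<lambda>c d. \<tau> (c \<otimes> e i) \<odot> (?S d \<otimes> e' i)) l"
      using ei' by (intro sw_cong[OF l])
        (simp add: linD(3)[OF lin_coantipode] coantipode_closed smult_mult_left)
    finally show "sw K K (\<lambda>a b. \<tau> (l \<otimes> a) \<odot> (b \<otimes> e' i)) (e i)
        = sw K K (\<lambda>c d. \<tau> (c \<otimes> e i) \<odot> (?S d \<otimes> e' i)) l" .
  qed
  also have "\<dots> = sw K K (\<lambda>c d. lsum K (\<lambda>i. \<tau> (c \<otimes> e i) \<odot> (?S d \<otimes> e' i)) [0..<n]) l"
    unfolding sw_def teval_def case_prod_unfold
    using terms_mem[OF cs cs comult_closed[OF l]] bc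
    by (intro S.lsum_swap) (auto intro!: clo_rules S.scale_closed)
  also have "\<dots> = sw K K (\<lambda>c d. ?S d \<otimes> c) l"
    by (intro sw_cong[OF l] lin_basis_expansion(2)[OF cs] lint clo_rules)
  also have "\<dots> = counit K l \<odot> \<one>" by (rule sw_coantipode(2)[OF cs lin_id l])
  finally show ?thesis .
qed

text \<open>In the tensor \<open>\<Sum> e\<^sub>i\<^sub>1 \<otimes> e\<^sub>i\<^sub>2 e'\<^sub>i\<close> the first factor is expanded in the dual bases; the pairing
  formula makes all second factors scalar.\<close>

lemma casimir_integral:
  assumes M: "cspace M" and F: "bil K K M F"
  shows "lsum M (\<lambda>i. sw K M (\<lambda>a b. F a (b \<otimes> e' i)) (e i)) [0..<n] = F integral \<one>"
proof -
  interpret M: cspace M by (rule M)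
  have lF1: "lin N M (\<lambda>x. F (g x) y)" if "lin N K g" "y \<in> carrier K"
    for N :: "(complex, 'c, 'd) module_scheme" and g y
    by (rule lin_comp[OF bilD(2)[OF F that(2)] that(1)])
  have lF2: "lin N M (\<lambda>x. F y (g x))" if "lin N K g" "y \<in> carrier K"
    for N :: "(complex, 'c, 'd) module_scheme" and g y
    by (rule lin_comp[OF bilD(1)[OF F that(2)] that(1)])
  have "lsum M (\<lambda>i. sw K M (\<lambda>a b. F a (b \<otimes> e' i)) (e i)) [0..<n]
      = lsum M (\<lambda>i. lsum M (\<lambda>k. F (e k) (sw K K (\<lambda>a b. \<tau> (e' k \<otimes> a) \<odot> (b \<otimes> e' i)) (e i))) [0..<n]) [0..<n]"
  proof (rule lsum_cong_upt)
    fix i assume "i < n"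
    then have ei: "e i \<in> carrier K" and ei': "e' i \<in> carrier K" using bc by auto
    have "sw K M (\<lambda>a b. F a (b \<otimes> e' i)) (e i)
        = sw K M (\<lambda>a b. lsum M (\<lambda>k. F (e k) (\<tau> (e' k \<otimes> a) \<odot> (b \<otimes> e' i))) [0..<n]) (e i)"
    proof (rule sw_cong[OF ei])
      fix a b assume a: "a \<in> carrier K" and b: "b \<in> carrier K"
      have be: "b \<otimes> e' i \<in> carrier K" by (rule mult_closed[OF b ei'])
      have "F a (b \<otimes> e' i) = lsum M (\<lambda>k. \<tau> (e' k \<otimes> a) \<odot>\<^bsub>M\<^esub> F (e k) (b \<otimes> e' i)) [0..<n]"
        by (rule lin_basis_expansion(1)[OF M bilD(2)[OF F be] a, symmetric])
      also have "\<dots> = lsum M (\<lambda>k. F (e k) (\<tau> (e' k \<otimes> a) \<odot> (b \<otimes> e' i))) [0..<n]"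
        using bc be by (intro lsum_cong) (simp add: linD(3)[OF bilD(1)[OF F]])
      finally show "F a (b \<otimes> e' i) = \<dots>" .
    qed
    also have "\<dots> = lsum M (\<lambda>k. sw K M (\<lambda>a b. F (e k) (\<tau> (e' k \<otimes> a) \<odot> (b \<otimes> e' i))) (e i)) [0..<n]"
      unfolding sw_def teval_def case_prod_unfold
      using terms_mem[OF cs cs comult_closed[OF ei]] bc ei'
      by (intro M.lsum_swap) (auto intro!: bilD(3)[OF F] S.scale_closed clo_rules)
    also have "\<dots> = lsum M (\<lambda>k. F (e k) (sw K K (\<lambda>a b. \<tau> (e' k \<otimes> a) \<odot> (b \<otimes> e' i)) (e i))) [0..<n]"
    proof (rule lsum_cong_upt)
      fix k assume "k < n"
      then have ek: "e k \<in> carrier K" and ek': "e' k \<in> carrier K" using bc by auto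
      show "sw K M (\<lambda>a b. F (e k) (\<tau> (e' k \<otimes> a) \<odot> (b \<otimes> e' i))) (e i)
          = F (e k) (sw K K (\<lambda>a b. \<tau> (e' k \<otimes> a) \<odot> (b \<otimes> e' i)) (e i))"
        by (rule lin_sw_apply[OF cs M bilD(1)[OF F ek] _ ei, symmetric])
          (intro bilI lint clo_rules ek' ei'; assumption)
    qed
    finally show "sw K M (\<lambda>a b. F a (b \<otimes> e' i)) (e i) = \<dots>" .
  qed
  also have "\<dots> = lsum M (\<lambda>k. lsum M (\<lambda>i. F (e k) (sw K K (\<lambda>a b. \<tau> (e' k \<otimes> a) \<odot> (b \<otimes> e' i)) (e i))) [0..<n]) [0..<n]"
  proof -
    have "sw K K (\<lambda>a b. \<tau> (e' k \<otimes> a) \<odot> (b \<otimes> e' i)) (e i) \<in> carrier K" if "k < n" "i < n" for k i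
      by (rule sw_closed[OF cs _ basis_closed[OF that(2)]])
        (intro bilI lint clo_rules dual_basis_closed that; assumption)
    then show ?thesis using bc by (intro M.lsum_swap) (auto intro!: bilD(3)[OF F])
  qed
  also have "\<dots> = lsum M (\<lambda>k. F (counit K (e' k) \<odot> e k) \<one>) [0..<n]"
  proof (rule lsum_cong_upt)
    fix k assume "k < n"
    then have ek: "e k \<in> carrier K" and ek': "e' k \<in> carrier K" using bc by auto
    have sc: "sw K K (\<lambda>a b. \<tau> (e' k \<otimes> a) \<odot> (b \<otimes> e' i)) (e i) \<in> carrier K" if "i < n" for i
      by (rule sw_closed[OF cs _ basis_closed[OF that]])
        (intro bilI lint clo_rules dual_basis_closed that ek'; assumption)
    have "lsum M (\<lambda>i. F (e k) (sw K K (\<lambda>a b. \<tau> (e' k \<otimes> a) \<odot> (b \<otimes> e' i)) (e i))) [0..<n]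
        = F (e k) (lsum K (\<lambda>i. sw K K (\<lambda>a b. \<tau> (e' k \<otimes> a) \<odot> (b \<otimes> e' i)) (e i)) [0..<n])"
      using sc by (intro lin_lsum_apply[OF cs M bilD(1)[OF F ek], symmetric]) auto
    also have "\<dots> = F (counit K (e' k) \<odot> e k) \<one>"
      by (simp only: casimir_comult_pairing[OF ek'] linD(3)[OF bilD(1)[OF F ek] one_closed]
          linD(3)[OF bilD(2)[OF F one_closed] ek])
    finally show "lsum M (\<lambda>i. F (e k) (sw K K (\<lambda>a b. \<tau> (e' k \<otimes> a) \<odot> (b \<otimes> e' i)) (e i))) [0..<n]
        = F (counit K (e' k) \<odot> e k) \<one>" .
  qed
  also have "\<dots> = F integral \<one>"
    unfolding integral_def using bc
    by (intro lin_lsum_apply[OF cs M bilD(2)[OF F one_closed], symmetric]) (auto intro: S.scale_closed)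
  finally show ?thesis .
qed

end

end

end

section \<open>Coactions of the dual as actions, and the crossed product\<close>

locale coaction_of_dual =
  A: star_algebra A + H: cstar_hopf_algebra H nrmH + B: star_algebra "crossed_product A H \<rho>"
  for A :: "'a star_alg" and H :: "'h hopf" and nrmH :: "'h \<Rightarrow> real"
    and \<rho> :: "'a \<Rightarrow> ('a \<times> ('h \<Rightarrow> complex)) list set" +
  assumes coaction: "coaction A (dual H) \<rho>"
begin

abbreviation D where "D \<equiv> dual H"
abbreviation B where "B \<equiv> crossed_product A H \<rho>"
abbreviation AD where "AD \<equiv> tensor A D"
abbreviation mult_A (infixl "\<otimes>\<^sub>A" 70) where "x \<otimes>\<^sub>A y \<equiv> x \<otimes>\<^bsub>A\<^esub> y"
abbreviation mult_B (infixl "\<otimes>\<^sub>B" 70) where "x \<otimes>\<^sub>B y \<equiv> x \<otimes>\<^bsub>B\<^esub> y"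
abbreviation mult_H (infixl "\<otimes>\<^sub>H" 70) where "x \<otimes>\<^sub>H y \<equiv> x \<otimes>\<^bsub>H\<^esub> y"
abbreviation mult_D (infixl "\<otimes>\<^sub>D" 70) where "x \<otimes>\<^sub>D y \<equiv> x \<otimes>\<^bsub>D\<^esub> y"
abbreviation mult_AD (infixl "\<otimes>\<^sub>A\<^sub>D" 70) where "x \<otimes>\<^sub>A\<^sub>D y \<equiv> x \<otimes>\<^bsub>AD\<^esub> y"
abbreviation smult_A (infixl "\<odot>\<^sub>A" 70) where "c \<odot>\<^sub>A x \<equiv> c \<odot>\<^bsub>A\<^esub> x"
abbreviation smult_B (infixl "\<odot>\<^sub>B" 70) where "c \<odot>\<^sub>B x \<equiv> c \<odot>\<^bsub>B\<^esub> x"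
abbreviation smult_H (infixl "\<odot>\<^sub>H" 70) where "c \<odot>\<^sub>H x \<equiv> c \<odot>\<^bsub>H\<^esub> x"
abbreviation smult_D (infixl "\<odot>\<^sub>D" 70) where "c \<odot>\<^sub>D x \<equiv> c \<odot>\<^bsub>D\<^esub> x"
abbreviation one_A ("\<one>\<^sub>A") where "\<one>\<^sub>A \<equiv> \<one>\<^bsub>A\<^esub>"
abbreviation one_B ("\<one>\<^sub>B") where "\<one>\<^sub>B \<equiv> \<one>\<^bsub>B\<^esub>"
abbreviation one_H ("\<one>\<^sub>H") where "\<one>\<^sub>H \<equiv> \<one>\<^bsub>H\<^esub>"
abbreviation one_D ("\<one>\<^sub>D") where "\<one>\<^sub>D \<equiv> \<one>\<^bsub>D\<^esub>"
abbreviation one_AD ("\<one>\<^sub>A\<^sub>D") where "\<one>\<^sub>A\<^sub>D \<equiv> \<one>\<^bsub>AD\<^esub>"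
abbreviation ev :: "'h \<Rightarrow> ('h \<Rightarrow> complex) \<Rightarrow> complex" where "ev h \<equiv> \<lambda>\<phi>. \<phi> h"

lemmas cA = A.is_cspace and cB = B.is_cspace and cH = H.cs and cD = H.cspace_dual
lemmas sA = A.star_algebra_axioms and sH = H.star_alg and sB = B.star_algebra_axioms
  and sD = H.star_algebra_dual

lemma sAD: "star_algebra AD" by (rule star_algebra_tensor[OF sA sD])
lemma cAD: "cspace AD" by (rule cspace_tensor[OF cA cD])
text \<open>A tensor in \<open>A \<otimes> H\<^sup>0\<close> is treated as the linear map \<open>H \<rightarrow> A\<close> given by its slices.\<close>

definition coef :: "('a \<times> ('h \<Rightarrow> complex)) list set \<Rightarrow> 'h \<Rightarrow> 'a" where
  "coef t h = slice A (ev h) t"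

lemma lin_coef_left: "h \<in> carrier H \<Longrightarrow> lin AD A (\<lambda>t. coef t h)"
  unfolding coef_def by (rule lin_slice[OF cA cD H.lin_eval])

lemma lin_coef_right:
  assumes "t \<in> carrier AD"
  shows "lin H A (coef t)"
proof -
  have "lin H A (\<lambda>h. teval A (\<lambda>a \<phi>. \<phi> h \<odot>\<^sub>A a) t)"
    by (rule lin_teval_const[OF cA cD cA assms])
      (auto intro: lin_scale_const[OF cA] H.functionals_lin)
  then show ?thesis by (simp add: coef_def[abs_def] slice_eq_teval)
qed

lemma coef_closed: "t \<in> carrier AD \<Longrightarrow> h \<in> carrier H \<Longrightarrow> coef t h \<in> carrier A"
  by (rule linD(1)[OF lin_coef_right])

lemma coef_tens: "a \<in> carrier A \<Longrightarrow> \<phi> \<in> carrier D \<Longrightarrow> h \<in> carrier H \<Longrightarrow> coef (tens A D a \<phi>) h = \<phi> h \<odot>\<^sub>A a"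
  unfolding coef_def by (rule slice_tens[OF cA cD H.lin_eval])

lemma coef_eqI:
  assumes "s \<in> carrier AD" "t \<in> carrier AD" "\<And>h. h \<in> carrier H \<Longrightarrow> coef s h = coef t h"
  shows "s = t"
proof -
  obtain n e f where co: "coordinates H n e f" using H.exists_basis by blast
  show ?thesis
    using assms coordinatesD(1)[OF co] unfolding coef_def
    by (intro slices_separate[OF cA cD H.coordinates_dual[OF co]]) auto
qed

lemma bil_A:
  assumes "lin H A f" "lin H A g"
  shows "bil H H A (\<lambda>a b. f a \<otimes>\<^sub>A g b)"
  using assms by (intro bilI lin_mult_left[OF sA] lin_mult_right[OF sA]) (auto simp: linD)

text \<open>The multiplication of \<open>H\<^sup>0\<close> is dual to the comultiplication of \<open>H\<close>.\<close>

lemma coef_mult: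
  assumes x: "x \<in> carrier AD" and y: "y \<in> carrier AD" and h: "h \<in> carrier H"
  shows "coef (x \<otimes>\<^sub>A\<^sub>D y) h = sw H A (\<lambda>a b. coef x a \<otimes>\<^sub>A coef y b) h"
proof (rule tensor_ext_alg[OF sA sD cA _ _ _ x, of "\<lambda>x. coef (x \<otimes>\<^sub>A\<^sub>D y) h"])
  show "lin AD A (\<lambda>x. coef (x \<otimes>\<^sub>A\<^sub>D y) h)"
    by (rule lin_comp[OF lin_coef_left[OF h] tmult_lin(1)[OF sA sD y]])
  show "lin AD A (\<lambda>x. sw H A (\<lambda>a b. coef x a \<otimes>\<^sub>A coef y b) h)"
    by (intro H.lin_sw_const[OF cA h] lin_mult_right[OF sA] lin_coef_left coef_closed y; assumption)
  fix a \<phi> assume a: "a \<in> carrier A" and \<phi>: "\<phi> \<in> carrier D"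
  note t = tens_closed[OF a \<phi>]
  show "coef (tens A D a \<phi> \<otimes>\<^sub>A\<^sub>D y) h = sw H A (\<lambda>c d. coef (tens A D a \<phi>) c \<otimes>\<^sub>A coef y d) h"
  proof (rule tensor_ext_alg[OF sA sD cA _ _ _ y])
    show "lin AD A (\<lambda>y. coef (tens A D a \<phi> \<otimes>\<^sub>A\<^sub>D y) h)"
      by (rule lin_comp[OF lin_coef_left[OF h] tmult_lin(2)[OF sA sD t]])
    show "lin AD A (\<lambda>y. sw H A (\<lambda>c d. coef (tens A D a \<phi>) c \<otimes>\<^sub>A coef y d) h)"
      by (intro H.lin_sw_const[OF cA h] lin_mult_left[OF sA] lin_coef_left coef_closed t; assumption)
    fix b \<psi> assume b: "b \<in> carrier A" and \<psi>: "\<psi> \<in> carrier D"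
    have l: "lin H complex_alg \<phi>" "lin H complex_alg \<psi>" using \<phi> \<psi> by (auto intro: H.functionals_lin)
    have "coef (tens A D a \<phi> \<otimes>\<^sub>A\<^sub>D tens A D b \<psi>) h = H.conv \<phi> \<psi> h \<odot>\<^sub>A (a \<otimes>\<^sub>A b)"
      using a b \<phi> \<psi> h l
      by (simp add: tmult_tens[OF sA sD] coef_tens A.mult_closed H.restrict_functional H.lin_conv)
    also have "\<dots> = sw H A (\<lambda>c d. (\<phi> c * \<psi> d) \<odot>\<^sub>A (a \<otimes>\<^sub>A b)) h"
      unfolding H.conv_def
      by (rule H.lin_sw_apply[OF cspace_complex cA lin_scale_const[OF cA A.mult_closed[OF a b] lin_id]
            bil_pair[OF l] h])
    also have "\<dots> = sw H A (\<lambda>c d. coef (tens A D a \<phi>) c \<otimes>\<^sub>A coef (tens A D b \<psi>) d) h"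
      using a b \<phi> \<psi>
      by (intro H.sw_cong[OF h])
        (simp add: coef_tens A.smult_mult_left A.smult_mult_right cspace.scale_scale[OF cA] A.mult_closed mult.commute)
    finally show "coef (tens A D a \<phi> \<otimes>\<^sub>A\<^sub>D tens A D b \<psi>) h
        = sw H A (\<lambda>c d. coef (tens A D a \<phi>) c \<otimes>\<^sub>A coef (tens A D b \<psi>) d) h" .
  qed
qed

lemma one_D: "\<one>\<^sub>D \<in> carrier D"
  by (simp add: H.restrict_functional H.lin_counit)

lemma coef_one: "a \<in> carrier A \<Longrightarrow> h \<in> carrier H \<Longrightarrow> coef (tens A D a \<one>\<^sub>D) h = counit H h \<odot>\<^sub>A a"
  using coef_tens[OF _ one_D] by simp

lemma lin_rho: "lin A AD \<rho>"
  using coaction by (auto simp: coaction_def star_hom_def lin_def ring_hom_def)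

lemma rho_closed: "a \<in> carrier A \<Longrightarrow> \<rho> a \<in> carrier AD"
  by (rule linD(1)[OF lin_rho])

lemma rho_mult: "a \<in> carrier A \<Longrightarrow> b \<in> carrier A \<Longrightarrow> \<rho> (a \<otimes>\<^sub>A b) = \<rho> a \<otimes>\<^sub>A\<^sub>D \<rho> b"
  and rho_one: "\<rho> \<one>\<^sub>A = \<one>\<^sub>A\<^sub>D"
  and rho_star: "a \<in> carrier A \<Longrightarrow> \<rho> (star A a) = star AD (\<rho> a)"
  using coaction by (auto simp: coaction_def star_hom_def ring_hom_def)

abbreviation act where "act \<equiv> action A \<rho>"

lemma act_eq: "act h a = coef (\<rho> a) h"
  by (simp add: action_def coef_def)

lemma lin_act_right: "h \<in> carrier H \<Longrightarrow> lin A A (act h)"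
  unfolding act_eq by (rule lin_comp[OF lin_coef_left lin_rho])

lemma lin_act_left: "a \<in> carrier A \<Longrightarrow> lin H A (\<lambda>h. act h a)"
  unfolding act_eq by (rule lin_coef_right[OF rho_closed])

lemma act_closed: "h \<in> carrier H \<Longrightarrow> a \<in> carrier A \<Longrightarrow> act h a \<in> carrier A"
  by (rule linD(1)[OF lin_act_right])

lemma act_one: "a \<in> carrier A \<Longrightarrow> act \<one>\<^sub>H a = a"
  using coaction by (simp add: coaction_def action_def H.dual_counit[abs_def])

lemma act_unit: "h \<in> carrier H \<Longrightarrow> act h \<one>\<^sub>A = counit H h \<odot>\<^sub>A \<one>\<^sub>A"
  by (simp add: act_eq rho_one tensor_sel(3) coef_one A.one_closed del: H.dual_sel H.dual_star_alg_sel)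

lemma slice_dual_comult:
  assumes t: "t \<in> carrier AD" and h: "h \<in> carrier H" and g: "g \<in> carrier H"
  shows "slice A (tpair (ev h) (ev g)) (tmap A (tensor D D) id (comult D) t) = coef t (h \<otimes>\<^sub>H g)"
proof -
  note p = lin_tpair[OF cD cD H.lin_eval[OF h] H.lin_eval[OF g]]
  have co: "comult D \<phi> \<in> carrier (tensor D D)" "tpair (ev h) (ev g) (comult D \<phi>) = \<phi> (h \<otimes>\<^sub>H g)"
    if "\<phi> \<in> carrier D" for \<phi>
    using H.dual_comult[of \<phi>] that h g by auto
  have lc: "lin D (tensor D D) (comult D)"
  proof (rule linI)
    note eq = H.dual_tensor_eqI
    interpret DD: cspace "tensor D D" by (rule cspace_tensor[OF cD cD])
    interpret D: cspace D by (rule cD)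
    note lp = lin_tpair[OF cD cD H.lin_eval H.lin_eval]
    fix x assume x: "x \<in> carrier D"
    show cx: "comult D x \<in> carrier (tensor D D)" using H.dual_comult x by simp
    show "comult D (c \<odot>\<^sub>D x) = c \<odot>\<^bsub>tensor D D\<^esub> comult D x" for c
    proof (rule eq)
      have cx': "c \<odot>\<^sub>D x \<in> carrier D" using x by (rule D.scale_closed)
      then show "comult D (c \<odot>\<^sub>D x) \<in> carrier (tensor D D)" using H.dual_comult by simp
      show "c \<odot>\<^bsub>tensor D D\<^esub> comult D x \<in> carrier (tensor D D)" using cx by (rule DD.scale_closed)
      fix h g assume h: "h \<in> carrier H" and g: "g \<in> carrier H"
      show "tpair (ev h) (ev g) (comult D (c \<odot>\<^sub>D x)) = tpair (ev h) (ev g) (c \<odot>\<^bsub>tensor D D\<^esub> comult D x)"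
        using H.dual_comult(2)[of "c \<odot>\<^sub>D x"] H.dual_comult(2)[of x] x cx' h g
          linD(3)[OF lp[OF h g] cx, of c] by (simp add: H.mult_closed)
    qed
    fix y assume y: "y \<in> carrier D"
    have cy: "comult D y \<in> carrier (tensor D D)" using H.dual_comult y by simp
    show "comult D (x \<oplus>\<^bsub>D\<^esub> y) = comult D x \<oplus>\<^bsub>tensor D D\<^esub> comult D y"
    proof (rule eq)
      have xy: "x \<oplus>\<^bsub>D\<^esub> y \<in> carrier D" using x y by (rule D.M.a_closed)
      then show "comult D (x \<oplus>\<^bsub>D\<^esub> y) \<in> carrier (tensor D D)" using H.dual_comult by simp
      show "comult D x \<oplus>\<^bsub>tensor D D\<^esub> comult D y \<in> carrier (tensor D D)" using cx cy by (rule DD.M.a_closed)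
      fix h g assume h: "h \<in> carrier H" and g: "g \<in> carrier H"
      show "tpair (ev h) (ev g) (comult D (x \<oplus>\<^bsub>D\<^esub> y)) = tpair (ev h) (ev g) (comult D x \<oplus>\<^bsub>tensor D D\<^esub> comult D y)"
        using H.dual_comult(2)[of "x \<oplus>\<^bsub>D\<^esub> y"] H.dual_comult(2)[of x] H.dual_comult(2)[of y] x y xy h g
          linD(2)[OF lp[OF h g] cx cy] by (simp add: H.mult_closed)
    qed
  qed
  have "slice A (tpair (ev h) (ev g)) (tmap A (tensor D D) id (comult D) t)
      = slice A (\<lambda>\<phi>. tpair (ev h) (ev g) (comult D \<phi>)) t"
    by (rule slice_tmap_id[OF cA cD cspace_tensor[OF cD cD] lc p t])
  also have "\<dots> = coef t (h \<otimes>\<^sub>H g)"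
    unfolding coef_def slice_eq_teval
    by (rule teval_cong_carrier[OF cA cD t]) (simp add: co)
  finally show ?thesis .
qed

subsection \<open>The crossed product\<close>

lemma B_sel:
  "carrier B = carrier (tensor A H)" "add B = add (tensor A H)" "zero B = zero (tensor A H)"
  "smult B = smult (tensor A H)" "one B = tens A H \<one>\<^sub>A \<one>\<^sub>H"
  by (simp_all add: crossed_product_def tensor_sel)

lemma list_sum_B: "list_sum B = list_sum (tensor A H)"
  by (rule ext) (simp add: list_sum_def B_sel)

lemma lin_B: "lin N B f = lin N (tensor A H) f" and lin_B': "lin B N' f' = lin (tensor A H) N' f'"
  by (simp_all add: lin_def B_sel)

lemma B_ext:
  assumes "cspace M" "lin B M F" "lin B M G"
    and "\<And>a h. a \<in> carrier A \<Longrightarrow> h \<in> carrier H \<Longrightarrow> F (tens A H a h) = G (tens A H a h)"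
    and "t \<in> carrier B"
  shows "F t = G t"
  using tensor_ext[OF cA cH assms(1), of F G t] assms(2-5) by (simp add: lin_B' B_sel)

lemma tens_B: "a \<in> carrier A \<Longrightarrow> h \<in> carrier H \<Longrightarrow> tens A H a h \<in> carrier B"
  by (simp add: B_sel tens_closed)

lemma lin_tens_B_left: "k \<in> carrier H \<Longrightarrow> lin N A f \<Longrightarrow> lin N B (\<lambda>x. tens A H (f x) k)"
  and lin_tens_B_right: "a \<in> carrier A \<Longrightarrow> lin N H g \<Longrightarrow> lin N B (\<lambda>x. tens A H a (g x))"
  unfolding lin_B by (rule lin_tens_left[OF cA cH] lin_tens_right[OF cA cH]; assumption)+

lemma lin_act_right': "h \<in> carrier H \<Longrightarrow> lin N A f \<Longrightarrow> lin N A (\<lambda>x. act h (f x))"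
  and lin_act_left': "a \<in> carrier A \<Longrightarrow> lin N H g \<Longrightarrow> lin N A (\<lambda>x. act (g x) a)"
  by (rule lin_comp[OF lin_act_right] lin_comp[OF lin_act_left]; assumption)+

lemmas linA = lin_mult_left[OF sA] lin_mult_right[OF sA] lin_act_right' lin_act_left'
  lin_tens_B_left lin_tens_B_right H.lin_rules H.lin_sw_const[OF cA] H.lin_sw_arg[OF cA]
  H.lin_sw_const[OF cB] H.lin_sw_arg[OF cB] lin_const_scale[OF cB] lin_scale_const[OF cB]
  lin_const_scale[OF cA] lin_scale_const[OF cA]

lemmas cloA = H.clo_rules A.mult_closed A.one_closed A.star_closed act_closed tens_B

lemma B_mult_teval:
  assumes x: "x \<in> carrier B" and y: "y \<in> carrier B"
  shows "x \<otimes>\<^sub>B y = teval B (\<lambda>a h. teval B (\<lambda>b g.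
    sw H B (\<lambda>h1 h2. tens A H (a \<otimes>\<^sub>A act h1 b) (h2 \<otimes>\<^sub>H g)) h) y) x"
proof -
  let ?T = "tensor A H"
  have memx: "fst p \<in> carrier A" "snd p \<in> carrier H" if "p \<in> set (terms x)" for p
    using terms_mem[OF cA cH _ that] x by (simp_all add: B_sel)
  have memy: "fst p \<in> carrier A" "snd p \<in> carrier H" if "p \<in> set (terms y)" for p
    using terms_mem[OF cA cH _ that] y by (simp_all add: B_sel)
  have memc: "fst p \<in> carrier H" "snd p \<in> carrier H" if "p \<in> set (terms (comult H h))" "h \<in> carrier H" for p h
    using terms_mem[OF cH cH H.comult_closed that(1)] that(2) by auto
  have "x \<otimes>\<^sub>B y = tclass A H (concat (map (\<lambda>p. concat (map (\<lambda>q. map (\<lambda>r.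
      (fst p \<otimes>\<^sub>A act (fst r) (fst q), snd r \<otimes>\<^sub>H snd q)) (terms (comult H (snd p)))) (terms y))) (terms x)))"
    by (simp add: crossed_product_def case_prod_unfold)
  also have "\<dots> = lsum ?T (\<lambda>p. tclass A H (concat (map (\<lambda>q. map (\<lambda>r.
      (fst p \<otimes>\<^sub>A act (fst r) (fst q), snd r \<otimes>\<^sub>H snd q)) (terms (comult H (snd p)))) (terms y)))) (terms x)"
    using memx memy memc by (intro tclass_concat[OF cA cH]) (auto intro!: cloA)
  also have "\<dots> = lsum ?T (\<lambda>p. lsum ?T (\<lambda>q. tclass A H (map (\<lambda>r.
      (fst p \<otimes>\<^sub>A act (fst r) (fst q), snd r \<otimes>\<^sub>H snd q)) (terms (comult H (snd p))))) (terms y)) (terms x)"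
    using memx memy memc by (intro lsum_cong tclass_concat[OF cA cH]) (auto intro!: cloA)
  also have "\<dots> = lsum ?T (\<lambda>p. lsum ?T (\<lambda>q. lsum ?T (\<lambda>r.
      tens A H (fst p \<otimes>\<^sub>A act (fst r) (fst q)) (snd r \<otimes>\<^sub>H snd q)) (terms (comult H (snd p)))) (terms y)) (terms x)"
    using memx memy memc by (intro lsum_cong tclass_map[OF cA cH]) (auto intro!: cloA)
  finally show ?thesis by (simp add: teval_def sw_def case_prod_unfold list_sum_B)
qed

lemma bil_B_mult_inner:
  assumes "a \<in> carrier A" "h \<in> carrier H"
  shows "bil A H B (\<lambda>b g. sw H B (\<lambda>h1 h2. tens A H (a \<otimes>\<^sub>A act h1 b) (h2 \<otimes>\<^sub>H g)) h)"
  by (intro bilI linA cloA assms; assumption)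

lemma B_mult_tens:
  assumes a: "a \<in> carrier A" and h: "h \<in> carrier H" and b: "b \<in> carrier A" and g: "g \<in> carrier H"
  shows "tens A H a h \<otimes>\<^sub>B tens A H b g
    = sw H B (\<lambda>h1 h2. tens A H (a \<otimes>\<^sub>A act h1 b) (h2 \<otimes>\<^sub>H g)) h"
proof -
  have outer: "bil A H B (\<lambda>a h. teval B (\<lambda>b g.
      sw H B (\<lambda>h1 h2. tens A H (a \<otimes>\<^sub>A act h1 b) (h2 \<otimes>\<^sub>H g)) h) (tens A H b g))"
    by (intro bilI lin_teval_const[OF cA cH cB tens_closed[OF b g]] linA cloA; assumption)
  show ?thesis
    unfolding B_mult_teval[OF tens_B[OF a h] tens_B[OF b g]]
      teval_tens[OF cA cH cB outer a h] teval_tens[OF cA cH cB bil_B_mult_inner[OF a h] b g] ..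
qed

definition ja :: "'a \<Rightarrow> ('a \<times> 'h) list set" where "ja a = tens A H a \<one>\<^sub>H"

lemma lin_ja: "lin A B ja"
  unfolding ja_def by (intro linA cloA)

lemma ja_closed: "a \<in> carrier A \<Longrightarrow> ja a \<in> carrier B"
  unfolding ja_def by (intro cloA)

lemma ja_mult_tens: "a \<in> carrier A \<Longrightarrow> b \<in> carrier A \<Longrightarrow> g \<in> carrier H \<Longrightarrow>
    ja a \<otimes>\<^sub>B tens A H b g = tens A H (a \<otimes>\<^sub>A b) g"
proof -
  assume a: "a \<in> carrier A" and b: "b \<in> carrier A" and g: "g \<in> carrier H"
  have bb: "bil H H B (\<lambda>h1 h2. tens A H (a \<otimes>\<^sub>A act h1 b) (h2 \<otimes>\<^sub>H g))"
    by (intro bilI linA cloA a b g; assumption)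
  show ?thesis
    unfolding ja_def B_mult_tens[OF a H.one_closed b g] H.sw_one[OF cB bb]
    by (simp add: act_one b H.mult_one_left g)
qed

lemma ja_mult: "a \<in> carrier A \<Longrightarrow> b \<in> carrier A \<Longrightarrow> ja (a \<otimes>\<^sub>A b) = ja a \<otimes>\<^sub>B ja b"
  using ja_mult_tens[of a b "\<one>\<^sub>H"] by (simp add: ja_def H.one_closed)

lemma ja_one: "ja \<one>\<^sub>A = \<one>\<^sub>B"
  by (simp add: ja_def B_sel)

lemma lin_slice_B: "lin H complex_alg \<phi> \<Longrightarrow> lin B A (slice A \<phi>)"
  unfolding lin_B' by (rule lin_slice[OF cA cH])

lemma slice_ja: "lin H complex_alg \<phi> \<Longrightarrow> a \<in> carrier A \<Longrightarrow> slice A \<phi> (ja a) = \<phi> \<one>\<^sub>H \<odot>\<^sub>A a"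
  unfolding ja_def by (rule slice_tens[OF cA cH _ _ H.one_closed])

lemma ja_inj:
  assumes "a \<in> carrier A" "b \<in> carrier A" "ja a = ja b"
  shows "a = b"
proof -
  have "slice A (counit H) (ja c) = c" if "c \<in> carrier A" for c
    using slice_ja[OF H.lin_counit that] by (simp add: H.counit_one cspace.scale_one[OF cA that])
  then show ?thesis using assms by metis
qed

lemma ja_star:
  assumes a: "a \<in> carrier A"
  shows "star B (ja a) = ja (star A a)"
proof -
  let ?T = "tensor A H"
  let ?f = "\<lambda>a h. sw H B (\<lambda>h1 h2. tens A H (act (star H h1) (star A a)) (star H h2)) h"
  have memj: "fst p \<in> carrier A" "snd p \<in> carrier H" if "p \<in> set (terms (ja a))" for p
    using terms_mem[OF cA cH _ that] ja_closed[OF a] by (simp_all add: B_sel)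
  have memc: "fst p \<in> carrier H" "snd p \<in> carrier H" if "p \<in> set (terms (comult H h))" "h \<in> carrier H" for p h
    using terms_mem[OF cH cH H.comult_closed that(1)] that(2) by auto
  have "star B (ja a) = tclass A H (concat (map (\<lambda>p. map (\<lambda>r.
      (act (star H (fst r)) (star A (fst p)), star H (snd r))) (terms (comult H (snd p)))) (terms (ja a))))"
    by (simp add: crossed_product_def case_prod_unfold)
  also have "\<dots> = lsum ?T (\<lambda>p. tclass A H (map (\<lambda>r.
      (act (star H (fst r)) (star A (fst p)), star H (snd r))) (terms (comult H (snd p))))) (terms (ja a))"
    using memj memc by (intro tclass_concat[OF cA cH]) (auto intro!: cloA)
  also have "\<dots> = lsum ?T (\<lambda>p. lsum ?T (\<lambda>r.
      tens A H (act (star H (fst r)) (star A (fst p))) (star H (snd r))) (terms (comult H (snd p)))) (terms (ja a))"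
    using memj memc by (intro lsum_cong tclass_map[OF cA cH]) (auto intro!: cloA)
  finally have e: "star B (ja a) = teval B ?f (ja a)"
    by (simp add: teval_def sw_def case_prod_unfold list_sum_B)
  note ls = lin_star[OF sA] lin_star[OF sH]
  have bin: "bil H H (conj_space B) (\<lambda>h1 h2. tens A H (act (star H h1) (star A a)) (star H h2))"
    if a: "a \<in> carrier A" for a
  proof (rule bilI)
    show "lin H (conj_space B) (\<lambda>h2. tens A H (act (star H h1) (star A a)) (star H h2))"
      if "h1 \<in> carrier H" for h1
      by (rule lin_comp[OF lin_conj_conj[THEN iffD2] lin_star[OF sH]]) (intro linA cloA that a)
    show "lin H (conj_space B) (\<lambda>h1. tens A H (act (star H h1) (star A a)) (star H h2))"
      if "h2 \<in> carrier H" for h2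
      by (rule lin_comp[OF lin_conj_conj[THEN iffD2] lin_star[OF sH]]) (intro linA cloA that a)
  qed
  have bf: "bil A H (conj_space B) ?f"
  proof (rule bilI)
    show "lin H (conj_space B) (\<lambda>h. ?f a h)" if "a \<in> carrier A" for a
      using H.lin_sw_arg[OF cspace_conj[OF cB] bin[OF that] lin_id] by simp
    fix h assume h: "h \<in> carrier H"
    have "lin A (conj_space B) (\<lambda>a. sw H (conj_space B)
        (\<lambda>h1 h2. tens A H (act (star H h1) (star A a)) (star H h2)) h)"
    proof (rule H.lin_sw_const[OF cspace_conj[OF cB] h])
      fix h1 h2 assume "h1 \<in> carrier H" "h2 \<in> carrier H"
      then show "lin A (conj_space B) (\<lambda>a. tens A H (act (star H h1) (star A a)) (star H h2))"
        by (intro lin_comp[OF lin_conj_conj[THEN iffD2] lin_star[OF sA],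
              of _ "\<lambda>a. tens A H (act (star H h1) a) (star H h2)"] linA cloA)
    qed
    then show "lin A (conj_space B) (\<lambda>a. ?f a h)" by simp
  qed
  have "teval B ?f (ja a) = ?f a \<one>\<^sub>H"
    using teval_tens[OF cA cH cspace_conj[OF cB] bf a H.one_closed] by (simp add: ja_def)
  also have "\<dots> = ja (star A a)"
    using H.sw_one[OF cspace_conj[OF cB] bin[OF a]] a
    by (simp add: H.star_one act_one A.star_closed ja_def)
  finally show ?thesis using e by simp
qed

subsection \<open>Cocycles and the representations of \<open>H\<close> in the crossed product\<close>

text \<open>The unitary of an exterior equivalence, in terms of its coefficients; this is what makes \<open>rep v\<close> below
  multiplicative and unital.\<close>

definition cocycle :: "('a \<times> ('h \<Rightarrow> complex)) list set \<Rightarrow> bool" where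
  "cocycle v \<longleftrightarrow> v \<in> carrier AD \<and> coef v \<one>\<^sub>H = \<one>\<^sub>A \<and>
    (\<forall>h\<in>carrier H. \<forall>g\<in>carrier H.
      sw H A (\<lambda>h1 h2. coef v h1 \<otimes>\<^sub>A act h2 (coef v g)) h = coef v (h \<otimes>\<^sub>H g))"

definition rep :: "('a \<times> ('h \<Rightarrow> complex)) list set \<Rightarrow> 'h \<Rightarrow> ('a \<times> 'h) list set" where
  "rep v h = sw H B (\<lambda>h1 h2. tens A H (coef v h1) h2) h"

lemma lin_coef': "v \<in> carrier AD \<Longrightarrow> lin N H g \<Longrightarrow> lin N A (\<lambda>x. coef v (g x))"
  by (rule lin_comp[OF lin_coef_right])

lemmas linV = linA lin_coef'
lemmas cloV = cloA coef_closed

lemma bil_rep: "v \<in> carrier AD \<Longrightarrow> bil H H B (\<lambda>h1 h2. tens A H (coef v h1) h2)"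
  by (intro bilI linV cloV; assumption)

lemma lin_rep: "v \<in> carrier AD \<Longrightarrow> lin H B (rep v)"
  unfolding rep_def by (rule H.lin_sw_arg[OF cB bil_rep lin_id])

lemma rep_closed: "v \<in> carrier AD \<Longrightarrow> h \<in> carrier H \<Longrightarrow> rep v h \<in> carrier B"
  by (rule linD(1)[OF lin_rep])

lemma rep_mult_tens:
  assumes v: "v \<in> carrier AD" and h: "h \<in> carrier H" and b: "b \<in> carrier A" and g: "g \<in> carrier H"
  shows "rep v h \<otimes>\<^sub>B tens A H b g
    = sw H B (\<lambda>x y. tens A H (sw H A (\<lambda>c d. coef v c \<otimes>\<^sub>A act d b) x) (y \<otimes>\<^sub>H g)) h"
proof -
  have "rep v h \<otimes>\<^sub>B tens A H b g = sw H B (\<lambda>h1 h2. tens A H (coef v h1) h2 \<otimes>\<^sub>B tens A H b g) h"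
    unfolding rep_def
    by (rule H.lin_sw_apply[OF cB cB lin_mult_right[OF sB tens_B[OF b g] lin_id] bil_rep[OF v] h])
  also have "\<dots> = sw H B (\<lambda>x y. sw H B (\<lambda>c d. tens A H (coef v x \<otimes>\<^sub>A act c b) (d \<otimes>\<^sub>H g)) y) h"
    by (intro H.sw_cong[OF h] B_mult_tens b g cloV v)
  also have "\<dots> = sw H B (\<lambda>x y. sw H B (\<lambda>c d. tens A H (coef v c \<otimes>\<^sub>A act d b) (y \<otimes>\<^sub>H g)) x) h"
    by (rule H.sw_assoc[OF cB h, symmetric]) (intro linV cloV v b g; assumption)+
  also have "\<dots> = sw H B (\<lambda>x y. tens A H (sw H A (\<lambda>c d. coef v c \<otimes>\<^sub>A act d b) x) (y \<otimes>\<^sub>H g)) h"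
  proof (rule H.sw_cong[OF h])
    fix x y assume x: "x \<in> carrier H" and y: "y \<in> carrier H"
    have l: "lin A B (\<lambda>a. tens A H a (y \<otimes>\<^sub>H g))" by (intro linV cloV y g)
    show "sw H B (\<lambda>c d. tens A H (coef v c \<otimes>\<^sub>A act d b) (y \<otimes>\<^sub>H g)) x
        = tens A H (sw H A (\<lambda>c d. coef v c \<otimes>\<^sub>A act d b) x) (y \<otimes>\<^sub>H g)"
      by (rule H.lin_sw_apply[OF cA cB l _ x, symmetric]) (intro bilI linV cloV v b; assumption)
  qed
  finally show ?thesis .
qed

lemma rep_mult:
  assumes v: "cocycle v" and h: "h \<in> carrier H" and g: "g \<in> carrier H"
  shows "rep v (h \<otimes>\<^sub>H g) = rep v h \<otimes>\<^sub>B rep v g"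
proof -
  have vc: "v \<in> carrier AD" using v by (simp add: cocycle_def)
  have "rep v h \<otimes>\<^sub>B rep v g = sw H B (\<lambda>c d. rep v h \<otimes>\<^sub>B tens A H (coef v c) d) g"
    unfolding rep_def[of v g]
    by (rule H.lin_sw_apply[OF cB cB lin_mult_left[OF sB rep_closed[OF vc h] lin_id] bil_rep[OF vc] g])
  also have "\<dots> = sw H B (\<lambda>c d. sw H B (\<lambda>x y. tens A H (coef v (x \<otimes>\<^sub>H c)) (y \<otimes>\<^sub>H d)) h) g"
  proof (rule H.sw_cong[OF g])
    fix c d assume c: "c \<in> carrier H" and d: "d \<in> carrier H"
    have "rep v h \<otimes>\<^sub>B tens A H (coef v c) d
        = sw H B (\<lambda>x y. tens A H (sw H A (\<lambda>a b. coef v a \<otimes>\<^sub>A act b (coef v c)) x) (y \<otimes>\<^sub>H d)) h"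
      by (rule rep_mult_tens[OF vc h coef_closed[OF vc c] d])
    also have "\<dots> = sw H B (\<lambda>x y. tens A H (coef v (x \<otimes>\<^sub>H c)) (y \<otimes>\<^sub>H d)) h"
      using v c by (intro H.sw_cong[OF h]) (simp add: cocycle_def)
    finally show "rep v h \<otimes>\<^sub>B tens A H (coef v c) d
        = sw H B (\<lambda>x y. tens A H (coef v (x \<otimes>\<^sub>H c)) (y \<otimes>\<^sub>H d)) h" .
  qed
  also have "\<dots> = sw H B (\<lambda>x y. sw H B (\<lambda>c d. tens A H (coef v (x \<otimes>\<^sub>H c)) (y \<otimes>\<^sub>H d)) g) h"
    by (intro H.sw_swap[OF cB g h] cloV vc)
  also have "\<dots> = rep v (h \<otimes>\<^sub>H g)"
    unfolding rep_def by (rule H.sw_mult[OF cB bil_rep[OF vc] h g, symmetric])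
  finally show ?thesis ..
qed

lemma rep_one:
  assumes "cocycle v"
  shows "rep v \<one>\<^sub>H = \<one>\<^sub>B"
  using assms H.sw_one[OF cB bil_rep, of v] by (simp add: cocycle_def rep_def B_sel)

lemma rep_ja:
  assumes v: "v \<in> carrier AD" and h: "h \<in> carrier H" and z: "z \<in> carrier A"
  shows "rep v h \<otimes>\<^sub>B ja z = sw H B (\<lambda>x y. tens A H (coef (v \<otimes>\<^sub>A\<^sub>D \<rho> z) x) y) h"
  unfolding ja_def rep_mult_tens[OF v h z H.one_closed]
  using v z by (intro H.sw_cong[OF h]) (simp add: coef_mult rho_closed act_eq H.mult_one_right)

definition ih :: "'h \<Rightarrow> ('a \<times> 'h) list set" where "ih h = tens A H \<one>\<^sub>A h"

lemma one_AD: "\<one>\<^sub>A\<^sub>D \<in> carrier AD"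
  by (rule star_algebra.one_closed[OF sAD])

lemma coef_unit: "h \<in> carrier H \<Longrightarrow> coef \<one>\<^sub>A\<^sub>D h = counit H h \<odot>\<^sub>A \<one>\<^sub>A"
  unfolding tensor_sel(3) by (rule coef_one[OF A.one_closed])

lemma cocycle_one: "cocycle \<one>\<^sub>A\<^sub>D"
  unfolding cocycle_def
proof (intro conjI ballI one_AD)
  show "coef \<one>\<^sub>A\<^sub>D \<one>\<^sub>H = \<one>\<^sub>A"
    by (simp add: coef_unit H.one_closed H.counit_one cspace.scale_one[OF cA] A.one_closed)
  fix h g assume h: "h \<in> carrier H" and g: "g \<in> carrier H"
  have "sw H A (\<lambda>h1 h2. coef \<one>\<^sub>A\<^sub>D h1 \<otimes>\<^sub>A act h2 (coef \<one>\<^sub>A\<^sub>D g)) h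
      = sw H A (\<lambda>h1 h2. counit H h1 \<odot>\<^sub>A ((counit H g * counit H h2) \<odot>\<^sub>A \<one>\<^sub>A)) h"
    using g by (intro H.sw_cong[OF h])
      (simp add: coef_unit A.smult_mult_left A.one_closed A.mult_one_left act_closed
        cspace.scale_closed[OF cA] linD(3)[OF lin_act_right] act_unit cspace.scale_scale[OF cA])
  also have "\<dots> = (counit H g * counit H h) \<odot>\<^sub>A \<one>\<^sub>A"
    by (rule H.sw_counit_left[OF cA _ h]) (intro linV cloV)
  also have "\<dots> = coef \<one>\<^sub>A\<^sub>D (h \<otimes>\<^sub>H g)"
    using h g by (simp add: coef_unit H.mult_closed H.counit_mult mult.commute)
  finally show "sw H A (\<lambda>h1 h2. coef \<one>\<^sub>A\<^sub>D h1 \<otimes>\<^sub>A act h2 (coef \<one>\<^sub>A\<^sub>D g)) h = coef \<one>\<^sub>A\<^sub>D (h \<otimes>\<^sub>H g)" .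
qed

lemma rep_unit:
  assumes h: "h \<in> carrier H"
  shows "rep \<one>\<^sub>A\<^sub>D h = ih h"
proof -
  have "rep \<one>\<^sub>A\<^sub>D h = sw H B (\<lambda>h1 h2. counit H h1 \<odot>\<^sub>B tens A H \<one>\<^sub>A h2) h"
    unfolding rep_def by (intro H.sw_cong[OF h])
      (simp add: coef_unit linD(3)[OF lin_tens_B_left[OF _ lin_id]] A.one_closed)
  also have "\<dots> = ih h"
    unfolding ih_def by (rule H.sw_counit_left[OF cB _ h]) (intro linV cloV)
  finally show ?thesis .
qed

lemma ja_ih: "a \<in> carrier A \<Longrightarrow> h \<in> carrier H \<Longrightarrow> ja a \<otimes>\<^sub>B ih h = tens A H a h"
  by (simp add: ih_def ja_mult_tens A.one_closed A.mult_one_right)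

text \<open>
  Both products are computed in the crossed product: the left hand side has the coefficients
  \<open>(v \<rho>(z))(h\<^sub>1) \<rtimes> h\<^sub>2\<close>, from which \<open>id \<otimes> \<epsilon>\<close> recovers \<open>(v \<rho>(z))(h)\<close>.
\<close>

lemma intertwiner_iff:
  assumes v: "v \<in> carrier AD" and z: "z \<in> carrier A"
  shows "(\<forall>h\<in>carrier H. rep v h \<otimes>\<^sub>B ja z = ja z \<otimes>\<^sub>B ih h) \<longleftrightarrow>
    v \<otimes>\<^sub>A\<^sub>D \<rho> z = tens A D z \<one>\<^sub>D"
proof
  have vz: "v \<otimes>\<^sub>A\<^sub>D \<rho> z \<in> carrier AD"
    by (rule star_algebra.mult_closed[OF sAD v rho_closed[OF z]])
  {
    assume e: "v \<otimes>\<^sub>A\<^sub>D \<rho> z = tens A D z \<one>\<^sub>D"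
    show "\<forall>h\<in>carrier H. rep v h \<otimes>\<^sub>B ja z = ja z \<otimes>\<^sub>B ih h"
    proof
      fix h assume h: "h \<in> carrier H"
      have "rep v h \<otimes>\<^sub>B ja z = sw H B (\<lambda>x y. counit H x \<odot>\<^sub>B tens A H z y) h"
        unfolding rep_ja[OF v h z] e using z
        by (intro H.sw_cong[OF h]) (simp only: coef_one linD(3)[OF lin_tens_B_left[OF _ lin_id]])
      also have "\<dots> = tens A H z h"
        by (rule H.sw_counit_left[OF cB _ h]) (intro linV cloV z)
      finally show "rep v h \<otimes>\<^sub>B ja z = ja z \<otimes>\<^sub>B ih h" using z h by (simp add: ja_ih)
    qed
  }
  assume e: "\<forall>h\<in>carrier H. rep v h \<otimes>\<^sub>B ja z = ja z \<otimes>\<^sub>B ih h"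
  show "v \<otimes>\<^sub>A\<^sub>D \<rho> z = tens A D z \<one>\<^sub>D"
  proof (rule coef_eqI[OF vz tens_closed[OF z one_D]])
    fix h assume h: "h \<in> carrier H"
    have "counit H h \<odot>\<^sub>A z = slice A (counit H) (tens A H z h)"
      by (rule slice_tens[OF cA cH H.lin_counit z h, symmetric])
    also have "tens A H z h = sw H B (\<lambda>x y. tens A H (coef (v \<otimes>\<^sub>A\<^sub>D \<rho> z) x) y) h"
      using e h z rep_ja[OF v h z] by (simp add: ja_ih)
    also have "slice A (counit H) \<dots> = sw H A (\<lambda>x y. slice A (counit H) (tens A H (coef (v \<otimes>\<^sub>A\<^sub>D \<rho> z) x) y)) h"
      by (rule H.lin_sw_apply[OF cB cA lin_slice_B[OF H.lin_counit] bil_rep[OF vz] h])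
    also have "\<dots> = sw H A (\<lambda>x y. counit H y \<odot>\<^sub>A coef (v \<otimes>\<^sub>A\<^sub>D \<rho> z) x) h"
      by (intro H.sw_cong[OF h] slice_tens[OF cA cH H.lin_counit] cloV vz)
    also have "\<dots> = coef (v \<otimes>\<^sub>A\<^sub>D \<rho> z) h"
      by (rule H.sw_counit_right[OF cA lin_coef_right[OF vz] h])
    finally show "coef (v \<otimes>\<^sub>A\<^sub>D \<rho> z) h = coef (tens A D z \<one>\<^sub>D) h"
      using z h by (simp only: coef_one)
  qed
qed

subsection \<open>The dual coaction\<close>

abbreviation BH where "BH \<equiv> tensor B H"
abbreviation dco where "dco \<equiv> dual_coaction A H \<rho>"

lemma cBH: "cspace BH" by (rule cspace_tensor[OF cB cH])

lemma lin_tens_BH_left: "k \<in> carrier H \<Longrightarrow> lin N B f \<Longrightarrow> lin N BH (\<lambda>x. tens B H (f x) k)"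
  and lin_tens_BH_right: "b \<in> carrier B \<Longrightarrow> lin N H g \<Longrightarrow> lin N BH (\<lambda>x. tens B H b (g x))"
  by (rule lin_tens_left[OF cB cH] lin_tens_right[OF cB cH]; assumption)+

lemmas linB = linV lin_tens_BH_left lin_tens_BH_right H.lin_sw_const[OF cBH] H.lin_sw_arg[OF cBH]
lemmas cloB = cloV tens_closed[where A = B and K = H]

lemma bil_dco: "bil A H BH (\<lambda>a h. sw H BH (\<lambda>h1 h2. tens B H (tens A H a h1) h2) h)"
  by (intro bilI linB cloB; assumption)

lemma dco_teval:
  assumes x: "x \<in> carrier B"
  shows "dco x = teval BH (\<lambda>a h. sw H BH (\<lambda>h1 h2. tens B H (tens A H a h1) h2) h) x"
proof -
  have memx: "fst p \<in> carrier A" "snd p \<in> carrier H" if "p \<in> set (terms x)" for p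
    using terms_mem[OF cA cH _ that] x by (simp_all add: B_sel)
  have memc: "fst p \<in> carrier H" "snd p \<in> carrier H" if "p \<in> set (terms (comult H h))" "h \<in> carrier H" for p h
    using terms_mem[OF cH cH H.comult_closed that(1)] that(2) by auto
  have "dco x = tclass B H (concat (map (\<lambda>p. map (\<lambda>r. (tens A H (fst p) (fst r), snd r))
      (terms (comult H (snd p)))) (terms x)))"
    by (simp add: dual_coaction_def case_prod_unfold)
  also have "\<dots> = lsum BH (\<lambda>p. tclass B H (map (\<lambda>r. (tens A H (fst p) (fst r), snd r))
      (terms (comult H (snd p))))) (terms x)"
    using memx memc by (intro tclass_concat[OF cB cH]) (auto intro!: cloB)
  also have "\<dots> = lsum BH (\<lambda>p. lsum BH (\<lambda>r. tens B H (tens A H (fst p) (fst r)) (snd r))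
      (terms (comult H (snd p)))) (terms x)"
    using memx memc by (intro lsum_cong tclass_map[OF cB cH]) (auto intro!: cloB)
  finally show ?thesis by (simp add: teval_def sw_def case_prod_unfold)
qed

lemma lin_dco: "lin B BH dco"
proof (rule lin_cong[OF cB dco_teval])
  show "lin B BH (teval BH (\<lambda>a h. sw H BH (\<lambda>h1 h2. tens B H (tens A H a h1) h2) h))"
    unfolding lin_B' by (rule lin_teval[OF cA cH cBH bil_dco])
qed

lemma dco_closed: "b \<in> carrier B \<Longrightarrow> dco b \<in> carrier BH"
  by (rule linD(1)[OF lin_dco])

lemma dco_tens:
  assumes "a \<in> carrier A" "h \<in> carrier H"
  shows "dco (tens A H a h) = sw H BH (\<lambda>h1 h2. tens B H (tens A H a h1) h2) h"
  unfolding dco_teval[OF tens_B[OF assms]] by (rule teval_tens[OF cA cH cBH bil_dco assms])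

lemma dco_ja: "a \<in> carrier A \<Longrightarrow> dco (ja a) = tens B H (ja a) \<one>\<^sub>H"
proof -
  assume a: "a \<in> carrier A"
  have "bil H H BH (\<lambda>h1 h2. tens B H (tens A H a h1) h2)" by (intro bilI linB cloB a; assumption)
  from H.sw_one[OF cBH this] show ?thesis
    unfolding ja_def dco_tens[OF a H.one_closed] .
qed

lemma dco_rep:
  assumes v: "v \<in> carrier AD" and h: "h \<in> carrier H"
  shows "dco (rep v h) = sw H BH (\<lambda>x y. tens B H (rep v x) y) h"
proof -
  have "dco (rep v h) = sw H BH (\<lambda>a b. dco (tens A H (coef v a) b)) h"
    unfolding rep_def by (rule H.lin_sw_apply[OF cB cBH lin_dco bil_rep[OF v] h])
  also have "\<dots> = sw H BH (\<lambda>a b. sw H BH (\<lambda>c d. tens B H (tens A H (coef v a) c) d) b) h"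
    by (intro H.sw_cong[OF h] dco_tens cloB v)
  also have "\<dots> = sw H BH (\<lambda>a b. sw H BH (\<lambda>c d. tens B H (tens A H (coef v c) d) b) a) h"
    by (rule H.sw_assoc[OF cBH h, symmetric]) (intro linB cloB v; assumption)+
  also have "\<dots> = sw H BH (\<lambda>x y. tens B H (rep v x) y) h"
  proof (rule H.sw_cong[OF h])
    fix x y assume x: "x \<in> carrier H" and y: "y \<in> carrier H"
    show "sw H BH (\<lambda>c d. tens B H (tens A H (coef v c) d) y) x = tens B H (rep v x) y"
      unfolding rep_def
      by (rule H.lin_sw_apply[OF cB cBH lin_tens_BH_left[OF y lin_id] bil_rep[OF v] x, symmetric])
  qed
  finally show ?thesis .
qed

text \<open>The slices of the dual coaction; the one along a Haar functional projects onto \<open>A\<close>.\<close>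

definition cexp :: "('h \<Rightarrow> complex) \<Rightarrow> ('a \<times> 'h) list set \<Rightarrow> ('a \<times> 'h) list set" where
  "cexp \<phi> b = slice B \<phi> (dco b)"

lemma lin_cexp: "lin H complex_alg \<phi> \<Longrightarrow> lin B B (cexp \<phi>)"
  unfolding cexp_def by (rule lin_comp[OF lin_slice[OF cB cH] lin_dco])

lemma cexp_closed: "lin H complex_alg \<phi> \<Longrightarrow> b \<in> carrier B \<Longrightarrow> cexp \<phi> b \<in> carrier B"
  by (rule linD(1)[OF lin_cexp])

lemma cexp_ja: "lin H complex_alg \<phi> \<Longrightarrow> a \<in> carrier A \<Longrightarrow> cexp \<phi> (ja a) = \<phi> \<one>\<^sub>H \<odot>\<^sub>B ja a"
  by (simp add: cexp_def dco_ja slice_tens[OF cB cH] ja_closed H.one_closed)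

lemma cexp_haar:
  assumes \<tau>: "H.haar \<tau>" and b: "b \<in> carrier B"
  shows "cexp \<tau> b = ja (slice A \<tau> b)"
proof (rule B_ext[OF cB lin_cexp lin_comp[OF lin_ja lin_slice_B] _ b])
  note lt = H.lin_tau[OF \<tau>]
  show "lin H complex_alg \<tau>" "lin H complex_alg \<tau>" by (fact lt)+
  fix a h assume a: "a \<in> carrier A" and h: "h \<in> carrier H"
  have bb: "bil H H BH (\<lambda>h1 h2. tens B H (tens A H a h1) h2)" by (intro bilI linB cloB a; assumption)
  have lh: "lin H B (tens A H a)" by (intro linB a)
  have "cexp \<tau> (tens A H a h) = sw H B (\<lambda>h1 h2. slice B \<tau> (tens B H (tens A H a h1) h2)) h"
    unfolding cexp_def dco_tens[OF a h] by (rule H.lin_sw_apply[OF cBH cB lin_slice[OF cB cH lt] bb h])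
  also have "\<dots> = sw H B (\<lambda>h1 h2. tens A H a (\<tau> h2 \<odot>\<^sub>H h1)) h"
    using a by (intro H.sw_cong[OF h]) (simp add: slice_tens[OF cB cH lt] tens_B linD(3)[OF lh])
  also have "\<dots> = tens A H a (sw H H (\<lambda>h1 h2. \<tau> h2 \<odot>\<^sub>H h1) h)"
    by (rule H.lin_sw_apply[OF cH cB lh _ h, symmetric]) (intro bilI linB lt; assumption)
  also have "\<dots> = \<tau> h \<odot>\<^sub>B ja a"
    by (simp add: H.tau_right[OF \<tau> h] linD(3)[OF lh] H.one_closed ja_def)
  also have "\<dots> = ja (\<tau> h \<odot>\<^sub>A a)" by (simp add: linD(3)[OF lin_ja a])
  finally show "cexp \<tau> (tens A H a h) = ja (slice A \<tau> (tens A H a h))"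
    by (simp add: slice_tens[OF cA cH lt a h])
qed

end

section \<open>Sequence algebras\<close>

context star_algebra
begin

lemma add_assoc: "x \<in> carrier A \<Longrightarrow> y \<in> carrier A \<Longrightarrow> z \<in> carrier A \<Longrightarrow> x \<oplus> y \<oplus> z = x \<oplus> (y \<oplus> z)"
  by (rule ring.ring_simprules(7)[OF is_ring])

lemma add_comm: "x \<in> carrier A \<Longrightarrow> y \<in> carrier A \<Longrightarrow> x \<oplus> y = y \<oplus> x"
  by (rule ring.ring_simprules(10)[OF is_ring])

lemma add_left_comm: "x \<in> carrier A \<Longrightarrow> y \<in> carrier A \<Longrightarrow> z \<in> carrier A \<Longrightarrow> x \<oplus> (y \<oplus> z) = y \<oplus> (x \<oplus> z)"
  by (rule ring.ring_simprules(22)[OF is_ring])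

lemma add_zero_left: "x \<in> carrier A \<Longrightarrow> \<zero> \<oplus> x = x"
  by (rule ring.ring_simprules(8)[OF is_ring])

lemma add_zero_right: "x \<in> carrier A \<Longrightarrow> x \<oplus> \<zero> = x"
  by (rule ring.ring_simprules(15)[OF is_ring])

lemma sub_self: "x \<in> carrier A \<Longrightarrow> x \<ominus> x = \<zero>"
  using ring.ring_simprules(16)[OF is_ring, of x] by (simp add: a_minus_def)

lemma sub_zero: "x \<in> carrier A \<Longrightarrow> x \<ominus> \<zero> = x"
  using ring.ring_simprules(21)[OF is_ring] ring.ring_simprules(15)[OF is_ring] by (simp add: a_minus_def)

end

lemma null_comparison:
  fixes f g :: "nat \<Rightarrow> real"
  assumes "\<And>n. 0 \<le> f n" "\<And>n. f n \<le> g n" "g \<longlonglongrightarrow> 0"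
  shows "f \<longlonglongrightarrow> 0"
  using assms by (intro real_tendsto_sandwich[of "\<lambda>_. 0" f sequentially g]) auto

lemma star_algebra_image:
  assumes R: "star_algebra R" and surj: "f ` carrier R = carrier Q"
    and add: "\<And>x y. x \<in> carrier R \<Longrightarrow> y \<in> carrier R \<Longrightarrow> f (x \<oplus>\<^bsub>R\<^esub> y) = f x \<oplus>\<^bsub>Q\<^esub> f y"
    and mult: "\<And>x y. x \<in> carrier R \<Longrightarrow> y \<in> carrier R \<Longrightarrow> f (x \<otimes>\<^bsub>R\<^esub> y) = f x \<otimes>\<^bsub>Q\<^esub> f y"
    and smult: "\<And>c x. x \<in> carrier R \<Longrightarrow> f (c \<odot>\<^bsub>R\<^esub> x) = c \<odot>\<^bsub>Q\<^esub> f x"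
    and st: "\<And>x. x \<in> carrier R \<Longrightarrow> f (star R x) = star Q (f x)"
    and one: "f \<one>\<^bsub>R\<^esub> = \<one>\<^bsub>Q\<^esub>" and zero: "f \<zero>\<^bsub>R\<^esub> = \<zero>\<^bsub>Q\<^esub>"
  shows "star_algebra Q"
proof -
  interpret R: star_algebra R by fact
  interpret Rc: cspace R by (rule R.is_cspace)
  have ex: "\<exists>x\<in>carrier R. y = f x" if "y \<in> carrier Q" for y
    using that surj by auto
  have cl: "f x \<in> carrier Q" if "x \<in> carrier R" for x
    using that surj by auto
  note hom = add[symmetric] mult[symmetric] smult[symmetric] st[symmetric] one[symmetric] zero[symmetric]
  note rc = R.add_closed R.mult_closed R.star_closed R.one_closed R.zero_closed Rc.scale_closed
  note rr = R.mult_assoc R.mult_one_left R.mult_one_right R.mult_add_left R.mult_add_right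
    R.smult_mult_left R.smult_mult_right R.star_add R.star_smult R.star_mult R.star_star
  have cs: "cspace Q"
  proof (rule cspaceI)
    show "\<zero>\<^bsub>Q\<^esub> \<in> carrier Q" unfolding zero[symmetric] by (intro cl rc)
    show "x \<oplus>\<^bsub>Q\<^esub> y \<in> carrier Q" if "x \<in> carrier Q" "y \<in> carrier Q" for x y
      using ex[OF that(1)] ex[OF that(2)] by (auto simp: hom intro!: cl rc)
    show "x \<oplus>\<^bsub>Q\<^esub> y \<oplus>\<^bsub>Q\<^esub> z = x \<oplus>\<^bsub>Q\<^esub> (y \<oplus>\<^bsub>Q\<^esub> z)" if "x \<in> carrier Q" "y \<in> carrier Q" "z \<in> carrier Q" for x y z
      using ex[OF that(1)] ex[OF that(2)] ex[OF that(3)] by (auto simp: hom rc R.add_assoc)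
    show "x \<oplus>\<^bsub>Q\<^esub> y = y \<oplus>\<^bsub>Q\<^esub> x" if "x \<in> carrier Q" "y \<in> carrier Q" for x y
      using ex[OF that(1)] ex[OF that(2)] by (auto simp: hom rc R.add_comm)
    show "c \<odot>\<^bsub>Q\<^esub> x \<in> carrier Q" if "x \<in> carrier Q" for c x
      using ex[OF that] by (auto simp: hom intro!: cl rc)
    show "\<zero>\<^bsub>Q\<^esub> \<oplus>\<^bsub>Q\<^esub> x = x" "0 \<odot>\<^bsub>Q\<^esub> x = \<zero>\<^bsub>Q\<^esub>" "1 \<odot>\<^bsub>Q\<^esub> x = x"
      "(a + b) \<odot>\<^bsub>Q\<^esub> x = a \<odot>\<^bsub>Q\<^esub> x \<oplus>\<^bsub>Q\<^esub> b \<odot>\<^bsub>Q\<^esub> x" "(a * b) \<odot>\<^bsub>Q\<^esub> x = a \<odot>\<^bsub>Q\<^esub> (b \<odot>\<^bsub>Q\<^esub> x)"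
      if "x \<in> carrier Q" for a b x
      using ex[OF that] by (auto simp: hom rc R.add_zero_left Rc.scale_zero Rc.scale_one Rc.scale_add_left Rc.scale_scale)
    show "c \<odot>\<^bsub>Q\<^esub> (x \<oplus>\<^bsub>Q\<^esub> y) = c \<odot>\<^bsub>Q\<^esub> x \<oplus>\<^bsub>Q\<^esub> c \<odot>\<^bsub>Q\<^esub> y" if "x \<in> carrier Q" "y \<in> carrier Q" for c x y
      using ex[OF that(1)] ex[OF that(2)] by (auto simp: hom rc Rc.scale_add_right)
  qed
  interpret Q: cspace Q by (rule cs)
  have ring: "ring Q"
  proof (rule ringI[OF Q.M.abelian_group_axioms monoidI])
    show "\<one>\<^bsub>Q\<^esub> \<in> carrier Q" unfolding one[symmetric] by (intro cl rc)
    show "x \<otimes>\<^bsub>Q\<^esub> y \<in> carrier Q" if "x \<in> carrier Q" "y \<in> carrier Q" for x y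
      using ex[OF that(1)] ex[OF that(2)] by (auto simp: hom intro!: cl rc)
    show "x \<otimes>\<^bsub>Q\<^esub> y \<otimes>\<^bsub>Q\<^esub> z = x \<otimes>\<^bsub>Q\<^esub> (y \<otimes>\<^bsub>Q\<^esub> z)"
      "(x \<oplus>\<^bsub>Q\<^esub> y) \<otimes>\<^bsub>Q\<^esub> z = x \<otimes>\<^bsub>Q\<^esub> z \<oplus>\<^bsub>Q\<^esub> y \<otimes>\<^bsub>Q\<^esub> z"
      "z \<otimes>\<^bsub>Q\<^esub> (x \<oplus>\<^bsub>Q\<^esub> y) = z \<otimes>\<^bsub>Q\<^esub> x \<oplus>\<^bsub>Q\<^esub> z \<otimes>\<^bsub>Q\<^esub> y"
      if "x \<in> carrier Q" "y \<in> carrier Q" "z \<in> carrier Q" for x y z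
      using ex[OF that(1)] ex[OF that(2)] ex[OF that(3)] by (auto simp: hom rc rr)
    show "\<one>\<^bsub>Q\<^esub> \<otimes>\<^bsub>Q\<^esub> x = x" "x \<otimes>\<^bsub>Q\<^esub> \<one>\<^bsub>Q\<^esub> = x" if "x \<in> carrier Q" for x
      using ex[OF that] by (auto simp: hom rc rr)
  qed
  show ?thesis
    unfolding star_algebra_def star_algebra_axioms_def
  proof (intro conjI allI impI)
    show "ring Q" by (rule ring)
    show "module complex_alg Q" by (rule Q.module_axioms)
    show "(c \<odot>\<^bsub>Q\<^esub> x) \<otimes>\<^bsub>Q\<^esub> y = c \<odot>\<^bsub>Q\<^esub> (x \<otimes>\<^bsub>Q\<^esub> y)"
      "x \<otimes>\<^bsub>Q\<^esub> (c \<odot>\<^bsub>Q\<^esub> y) = c \<odot>\<^bsub>Q\<^esub> (x \<otimes>\<^bsub>Q\<^esub> y)"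
      "star Q (x \<oplus>\<^bsub>Q\<^esub> y) = star Q x \<oplus>\<^bsub>Q\<^esub> star Q y"
      "star Q (x \<otimes>\<^bsub>Q\<^esub> y) = star Q y \<otimes>\<^bsub>Q\<^esub> star Q x"
      if "x \<in> carrier Q" "y \<in> carrier Q" for c x y
      using ex[OF that(1)] ex[OF that(2)] by (auto simp: hom rc rr)
    show "star Q x \<in> carrier Q" if "x \<in> carrier Q" for x
      using ex[OF that] by (auto simp: hom intro!: cl rc)
    show "star Q (c \<odot>\<^bsub>Q\<^esub> x) = cnj c \<odot>\<^bsub>Q\<^esub> star Q x" "star Q (star Q x) = x" if "x \<in> carrier Q" for c x
      using ex[OF that] by (auto simp: hom rc rr)
  qed
qed

context cstar_algebra
begin

interpretation cspace A by (rule is_cspace)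

lemma nrm_zero: "nrm \<zero> = 0"
  using nrm_eq_0[OF zero_closed] by simp

lemma sub_eq: "x \<in> carrier A \<Longrightarrow> y \<in> carrier A \<Longrightarrow> x \<ominus> y = x \<oplus> (-1) \<odot> y"
  by (simp add: a_minus_def scale_minus)

lemma sub_closed: "x \<in> carrier A \<Longrightarrow> y \<in> carrier A \<Longrightarrow> x \<ominus> y \<in> carrier A"
  by (simp add: sub_eq add_closed)

lemma nrm_star: "x \<in> carrier A \<Longrightarrow> nrm (star A x) = nrm x"
proof -
  have le: "nrm x \<le> nrm (star A x)" if x: "x \<in> carrier A" for x
  proof -
    have "nrm x * nrm x \<le> nrm (star A x) * nrm x"
      using cstar_identity[OF x] nrm_mult[OF star_closed[OF x] x] by (simp add: power2_eq_square)
    then show ?thesis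
      using nrm_nonneg[OF x] nrm_nonneg[OF star_closed[OF x]] by (cases "nrm x = 0") auto
  qed
  assume x: "x \<in> carrier A"
  show ?thesis using le[OF x] le[OF star_closed[OF x]] by (simp add: star_star x)
qed

abbreviation L where "L \<equiv> linf A nrm"
abbreviation Q where "Q \<equiv> seq_alg A nrm"
abbreviation cls where "cls \<equiv> seq_class A nrm"

definition const :: "'a \<Rightarrow> (nat \<Rightarrow> 'a) set" where "const b = cls (\<lambda>n. b)"

lemma L_sel [simp]:
  "carrier L = {s. (\<forall>n. s n \<in> carrier A) \<and> (\<exists>C. \<forall>n. nrm (s n) \<le> C)}"
  "s \<otimes>\<^bsub>L\<^esub> t = (\<lambda>n. s n \<otimes> t n)" "\<one>\<^bsub>L\<^esub> = (\<lambda>n. \<one>)" "\<zero>\<^bsub>L\<^esub> = (\<lambda>n. \<zero>)"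
  "s \<oplus>\<^bsub>L\<^esub> t = (\<lambda>n. s n \<oplus> t n)" "c \<odot>\<^bsub>L\<^esub> s = (\<lambda>n. c \<odot> s n)" "star L s = (\<lambda>n. star A (s n))"
  by (simp_all add: linf_def)

lemma L_add: "s \<in> carrier L \<Longrightarrow> t \<in> carrier L \<Longrightarrow> (\<lambda>n. s n \<oplus> t n) \<in> carrier L"
proof -
  assume "s \<in> carrier L" "t \<in> carrier L"
  then obtain C D where "\<And>n. s n \<in> carrier A" "\<And>n. t n \<in> carrier A" "\<And>n. nrm (s n) \<le> C" "\<And>n. nrm (t n) \<le> D"
    by auto
  then show ?thesis
    by (auto simp: add_closed intro!: exI[of _ "C + D"] order_trans[OF nrm_triangle] add_mono)
qed

lemma L_mult: "s \<in> carrier L \<Longrightarrow> t \<in> carrier L \<Longrightarrow> (\<lambda>n. s n \<otimes> t n) \<in> carrier L"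
proof -
  assume "s \<in> carrier L" "t \<in> carrier L"
  then obtain C D where "\<And>n. s n \<in> carrier A" "\<And>n. t n \<in> carrier A" "\<And>n. nrm (s n) \<le> C" "\<And>n. nrm (t n) \<le> D"
    by auto
  moreover have "0 \<le> C" using calculation nrm_nonneg by (meson order_trans)
  ultimately show ?thesis
    by (auto simp: mult_closed intro!: exI[of _ "C * D"] order_trans[OF nrm_mult] mult_mono nrm_nonneg)
qed

lemma L_scale: "s \<in> carrier L \<Longrightarrow> (\<lambda>n. c \<odot> s n) \<in> carrier L"
proof -
  assume "s \<in> carrier L"
  then obtain C where "\<And>n. s n \<in> carrier A" "\<And>n. nrm (s n) \<le> C" by auto
  then show ?thesis
    by (auto simp: nrm_smult intro!: exI[of _ "cmod c * C"] mult_left_mono)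
qed

lemma L_star: "s \<in> carrier L \<Longrightarrow> (\<lambda>n. star A (s n)) \<in> carrier L"
  by (auto simp: nrm_star star_closed)

lemma L_const: "b \<in> carrier A \<Longrightarrow> (\<lambda>n. b) \<in> carrier L"
  by auto

lemma cspace_L: "cspace L"
proof (rule cspaceI)
  show "\<zero>\<^bsub>L\<^esub> \<in> carrier L" using L_const[OF zero_closed] by simp
qed (use L_add L_scale in \<open>auto simp: fun_eq_iff add_assoc add_comm add_left_comm add_zero_left scale_zero scale_add_left scale_add_right
    scale_scale scale_one\<close>)

lemma star_algebra_L: "star_algebra L"
proof -
  interpret L: cspace L by (rule cspace_L)
  have "ring L"
  proof (rule ringI[OF L.M.abelian_group_axioms monoidI])
    show "\<one>\<^bsub>L\<^esub> \<in> carrier L" using L_const[OF one_closed] by simp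
  qed (use L_mult in \<open>auto simp: fun_eq_iff mult_assoc mult_one_left mult_one_right mult_add_left mult_add_right\<close>)
  then show ?thesis
    unfolding star_algebra_def star_algebra_axioms_def
    using L.module_axioms L_star
    by (auto simp: fun_eq_iff smult_mult_left smult_mult_right star_add star_smult star_mult star_star)
qed

lemma c0_sub: "s \<in> c0 A nrm \<Longrightarrow> s \<in> carrier L"
proof -
  assume s: "s \<in> c0 A nrm"
  then have "Bseq (\<lambda>n. nrm (s n))" unfolding c0_def by (auto intro: convergent_imp_Bseq convergentI)
  then obtain C where C: "\<And>n. norm (nrm (s n)) \<le> C" by (auto simp: Bseq_def)
  have "nrm (s n) \<le> C" for n using C[of n] by simp
  then show ?thesis using s by (auto simp: c0_def)
qed

lemma c0_ideal: "ideal (c0 A nrm) L"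
proof -
  interpret L: star_algebra L by (rule star_algebra_L)
  interpret Lc: cspace L by (rule cspace_L)
  have add: "(\<lambda>n. s n \<oplus> t n) \<in> c0 A nrm" if "s \<in> c0 A nrm" "t \<in> c0 A nrm" for s t
  proof -
    have "(\<lambda>n. nrm (s n) + nrm (t n)) \<longlonglongrightarrow> 0"
      using that tendsto_add[of "\<lambda>n. nrm (s n)" 0 sequentially "\<lambda>n. nrm (t n)" 0] by (simp add: c0_def)
    then have "(\<lambda>n. nrm (s n \<oplus> t n)) \<longlonglongrightarrow> 0"
      by (rule null_comparison[rotated 2])
        (use that in \<open>auto simp: c0_def intro!: nrm_nonneg add_closed nrm_triangle\<close>)
    then show ?thesis using that by (auto simp: c0_def add_closed)
  qed
  have scale: "(\<lambda>n. c \<odot> s n) \<in> c0 A nrm" if "s \<in> c0 A nrm" for s c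
    using that tendsto_mult_right_zero[of "\<lambda>n. nrm (s n)" sequentially "cmod c"]
    by (auto simp: c0_def nrm_smult)
  have mul: "(\<lambda>n. s n \<otimes> t n) \<in> c0 A nrm" "(\<lambda>n. t n \<otimes> s n) \<in> c0 A nrm"
    if s: "s \<in> c0 A nrm" and t: "t \<in> carrier L" for s t
  proof -
    obtain C where C: "\<And>n. t n \<in> carrier A" "\<And>n. nrm (t n) \<le> C" using t by auto
    have lim: "(\<lambda>n. nrm (s n) * C) \<longlonglongrightarrow> 0"
      using s tendsto_mult_left_zero[of "\<lambda>n. nrm (s n)" sequentially C] by (simp add: c0_def)
    have sc: "s n \<in> carrier A" for n using s by (simp add: c0_def)
    have "nrm (s n \<otimes> t n) \<le> nrm (s n) * C" for n
      using nrm_mult[OF sc C(1)] mult_left_mono[OF C(2) nrm_nonneg[OF sc]] by (rule order_trans)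
    then have "(\<lambda>n. nrm (s n \<otimes> t n)) \<longlonglongrightarrow> 0"
      using sc C by (intro null_comparison[OF _ _ lim]) (auto simp: nrm_nonneg mult_closed)
    then show "(\<lambda>n. s n \<otimes> t n) \<in> c0 A nrm" using sc C by (auto simp: c0_def mult_closed)
    have "nrm (t n \<otimes> s n) \<le> nrm (s n) * C" for n
      using nrm_mult[OF C(1) sc] mult_left_mono[OF C(2) nrm_nonneg[OF sc]]
      by (metis mult.commute order_trans)
    then have "(\<lambda>n. nrm (t n \<otimes> s n)) \<longlonglongrightarrow> 0"
      using sc C by (intro null_comparison[OF _ _ lim]) (auto simp: nrm_nonneg mult_closed)
    then show "(\<lambda>n. t n \<otimes> s n) \<in> c0 A nrm" using sc C by (auto simp: c0_def mult_closed)
  qed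
  have zero: "(\<lambda>n. \<zero>) \<in> c0 A nrm" by (simp add: c0_def nrm_zero zero_closed)
  have "additive_subgroup (c0 A nrm) L"
  proof (rule additive_subgroup.intro, rule subgroup.intro)
    show "c0 A nrm \<subseteq> carrier (add_monoid L)" using c0_sub by (auto simp del: L_sel)
    show "x \<otimes>\<^bsub>add_monoid L\<^esub> y \<in> c0 A nrm" if "x \<in> c0 A nrm" "y \<in> c0 A nrm" for x y
      using add[OF that] by simp
    show "\<one>\<^bsub>add_monoid L\<^esub> \<in> c0 A nrm" using zero by simp
    fix x assume x: "x \<in> c0 A nrm"
    have "\<ominus>\<^bsub>L\<^esub> x \<in> c0 A nrm"
      using scale[OF x, of "-1"] Lc.scale_minus[OF c0_sub[OF x]] by simp
    then show "inv\<^bsub>add_monoid L\<^esub> x \<in> c0 A nrm" by (simp add: a_inv_def)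
  qed
  from additive_subgroup.a_subgroup[OF this] show ?thesis
  proof (rule idealI[OF L.is_ring])
    show "x \<otimes>\<^bsub>L\<^esub> a \<in> c0 A nrm" "a \<otimes>\<^bsub>L\<^esub> x \<in> c0 A nrm" if "a \<in> c0 A nrm" "x \<in> carrier L" for a x
      using mul[OF that] by simp_all
  qed
qed

lemma Q_sel:
  "carrier Q = a_rcosets\<^bsub>L\<^esub> (c0 A nrm)" "mult Q = rcoset_mult L (c0 A nrm)"
  "one Q = c0 A nrm +>\<^bsub>L\<^esub> \<one>\<^bsub>L\<^esub>" "zero Q = c0 A nrm" "add Q = set_add L"
  "smult Q = (\<lambda>c S. \<Union>s\<in>S. cls (c \<odot>\<^bsub>L\<^esub> s))" "star Q = (\<lambda>S. \<Union>s\<in>S. cls (star L s))"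
  by (simp_all add: seq_alg_def FactRing_def ring.defs)

lemma cls_closed: "s \<in> carrier L \<Longrightarrow> cls s \<in> carrier Q"
  unfolding Q_sel seq_class_def A_RCOSETS_def' by blast

lemma cls_surj: "x \<in> carrier Q \<Longrightarrow> \<exists>s\<in>carrier L. x = cls s"
  unfolding Q_sel seq_class_def A_RCOSETS_def' by blast

lemma cls_mem:
  assumes s: "s \<in> carrier L" and t: "t \<in> carrier L"
  shows "t \<in> cls s \<longleftrightarrow> (\<lambda>n. nrm (t n \<ominus> s n)) \<longlonglongrightarrow> 0"
proof -
  interpret I: ideal "c0 A nrm" L by (rule c0_ideal)
  interpret Lc: cspace L by (rule cspace_L)
  have e: "t \<ominus>\<^bsub>L\<^esub> s = (\<lambda>n. t n \<ominus> s n)"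
    using Lc.scale_minus[OF s] s t by (auto simp: a_minus_def[of L] sub_eq fun_eq_iff)
  have "t \<in> cls s \<longleftrightarrow> t \<ominus>\<^bsub>L\<^esub> s \<in> c0 A nrm"
    unfolding seq_class_def by (rule I.a_rcos_module_minus[OF star_algebra.is_ring[OF star_algebra_L] s t])
  also have "\<dots> \<longleftrightarrow> (\<lambda>n. nrm (t n \<ominus> s n)) \<longlonglongrightarrow> 0"
    using s t by (auto simp: e c0_def sub_closed)
  finally show ?thesis .
qed

lemma cls_eq_iff:
  assumes s: "s \<in> carrier L" and t: "t \<in> carrier L"
  shows "cls t = cls s \<longleftrightarrow> (\<lambda>n. nrm (t n \<ominus> s n)) \<longlonglongrightarrow> 0"
proof -
  interpret I: ideal "c0 A nrm" L by (rule c0_ideal)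
  have "cls t = cls s \<longleftrightarrow> t \<in> cls s"
    unfolding seq_class_def
    using I.a_repr_independence[OF _ s I.a_subgroup, of t] I.a_rcos_self[OF t] by auto
  then show ?thesis by (simp only: cls_mem[OF s t])
qed

lemma cls_subset: "s \<in> carrier L \<Longrightarrow> t \<in> cls s \<Longrightarrow> t \<in> carrier L"
proof -
  interpret I: ideal "c0 A nrm" L by (rule c0_ideal)
  show "s \<in> carrier L \<Longrightarrow> t \<in> cls s \<Longrightarrow> t \<in> carrier L"
    unfolding seq_class_def using I.a_elemrcos_carrier by blast
qed

lemma cls_self: "s \<in> carrier L \<Longrightarrow> s \<in> cls s"
  by (subst cls_mem) (auto simp: sub_self nrm_zero)

lemma cls_mult: "s \<in> carrier L \<Longrightarrow> t \<in> carrier L \<Longrightarrow> cls (\<lambda>n. s n \<otimes> t n) = cls s \<otimes>\<^bsub>Q\<^esub> cls t"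
proof -
  interpret I: ideal "c0 A nrm" L by (rule c0_ideal)
  show "s \<in> carrier L \<Longrightarrow> t \<in> carrier L \<Longrightarrow> ?thesis"
    unfolding seq_class_def Q_sel using I.rcoset_mult_add[of s t] by simp
qed

lemma cls_add: "s \<in> carrier L \<Longrightarrow> t \<in> carrier L \<Longrightarrow> cls (\<lambda>n. s n \<oplus> t n) = cls s \<oplus>\<^bsub>Q\<^esub> cls t"
proof -
  interpret I: ideal "c0 A nrm" L by (rule c0_ideal)
  show "s \<in> carrier L \<Longrightarrow> t \<in> carrier L \<Longrightarrow> ?thesis"
    unfolding seq_class_def Q_sel using I.a_rcos_sum[of s t] by simp
qed

lemma cls_one: "cls (\<lambda>n. \<one>) = \<one>\<^bsub>Q\<^esub>"
  by (simp add: Q_sel seq_class_def)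

lemma cls_zero: "cls (\<lambda>n. \<zero>) = \<zero>\<^bsub>Q\<^esub>"
proof -
  interpret I: ideal "c0 A nrm" L by (rule c0_ideal)
  have "c0 A nrm +>\<^bsub>L\<^esub> \<zero>\<^bsub>L\<^esub> = c0 A nrm"
    by (rule I.a_coset_join2[OF _ I.a_subgroup]) (use I.zero_closed I.additive_subgroup_axioms in
      \<open>auto intro: additive_subgroup.zero_closed simp del: L_sel\<close>)
  then show ?thesis by (simp add: Q_sel seq_class_def)
qed

lemma cls_scale:
  assumes s: "s \<in> carrier L"
  shows "cls (\<lambda>n. c \<odot> s n) = c \<odot>\<^bsub>Q\<^esub> cls s"
proof -
  have "cls (\<lambda>n. c \<odot> t n) = cls (\<lambda>n. c \<odot> s n)" if t: "t \<in> cls s" for t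
  proof -
    note tl = cls_subset[OF s t]
    have "nrm (c \<odot> t n \<ominus> c \<odot> s n) = cmod c * nrm (t n \<ominus> s n)" for n
    proof -
      have m: "t n \<in> carrier A" "s n \<in> carrier A" using s tl by auto
      have "c \<odot> t n \<ominus> c \<odot> s n = c \<odot> (t n \<ominus> s n)"
        using m by (simp add: sub_eq scale_add_right scale_scale)
      then show ?thesis using m by (simp add: nrm_smult sub_closed)
    qed
    then show ?thesis
      using t tendsto_mult_right_zero[of "\<lambda>n. nrm (t n \<ominus> s n)" sequentially "cmod c"]
      by (simp add: cls_eq_iff[OF L_scale[OF s] L_scale[OF tl]] cls_mem[OF s tl] del: L_sel(1))
  qed
  note eq = this
  have "cls s \<noteq> {}" using cls_self[OF s] by (metis empty_iff)
  then have "(\<Union>t\<in>cls s. cls (c \<odot>\<^bsub>L\<^esub> t)) = cls (\<lambda>n. c \<odot> s n)"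
  proof (rule SUP_eq_const)
    fix t assume "t \<in> cls s"
    then show "cls (c \<odot>\<^bsub>L\<^esub> t) = cls (\<lambda>n. c \<odot> s n)" unfolding L_sel by (rule eq)
  qed
  then show ?thesis by (simp only: Q_sel)
qed

lemma cls_star:
  assumes s: "s \<in> carrier L"
  shows "cls (\<lambda>n. star A (s n)) = star Q (cls s)"
proof -
  have "cls (\<lambda>n. star A (t n)) = cls (\<lambda>n. star A (s n))" if t: "t \<in> cls s" for t
  proof -
    note tl = cls_subset[OF s t]
    have "nrm (star A (t n) \<ominus> star A (s n)) = nrm (t n \<ominus> s n)" for n
    proof -
      have m: "t n \<in> carrier A" "s n \<in> carrier A" using s tl by auto
      have "star A (t n) \<ominus> star A (s n) = star A (t n \<ominus> s n)"
        using m by (simp add: sub_eq star_add star_smult star_closed)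
      then show ?thesis using m by (simp add: nrm_star sub_closed)
    qed
    then show ?thesis
      using t by (simp add: cls_eq_iff[OF L_star[OF s] L_star[OF tl]] cls_mem[OF s tl] del: L_sel(1))
  qed
  note eq = this
  have "cls s \<noteq> {}" using cls_self[OF s] by (metis empty_iff)
  then have "(\<Union>t\<in>cls s. cls (star L t)) = cls (\<lambda>n. star A (s n))"
  proof (rule SUP_eq_const)
    fix t assume "t \<in> cls s"
    then show "cls (star L t) = cls (\<lambda>n. star A (s n))" unfolding L_sel by (rule eq)
  qed
  then show ?thesis by (simp only: Q_sel)
qed

lemma star_algebra_Q: "star_algebra Q"
proof (rule star_algebra_image[OF star_algebra_L, of cls])
  show "cls ` carrier L = carrier Q" using cls_closed cls_surj by (auto simp del: L_sel)
  show "cls \<one>\<^bsub>L\<^esub> = \<one>\<^bsub>Q\<^esub>" "cls \<zero>\<^bsub>L\<^esub> = \<zero>\<^bsub>Q\<^esub>" by (simp_all add: cls_one cls_zero)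
qed (simp_all only: L_sel(2-) cls_add cls_mult cls_scale cls_star)

lemma cspace_Q: "cspace Q" by (rule cspace_star_algebra[OF star_algebra_Q])

lemma lin_cls: "lin L Q cls"
  by (rule linI) (simp_all only: L_sel(2-) cls_add cls_scale cls_closed)

lemma lin_const: "lin A Q const"
  unfolding const_def
  by (rule linI) (simp_all only: cls_add[OF L_const L_const] cls_scale[OF L_const] cls_closed L_const)

lemma const_closed: "b \<in> carrier A \<Longrightarrow> const b \<in> carrier Q"
  by (rule linD(1)[OF lin_const])

lemma const_mult: "a \<in> carrier A \<Longrightarrow> b \<in> carrier A \<Longrightarrow> const (a \<otimes> b) = const a \<otimes>\<^bsub>Q\<^esub> const b"
  unfolding const_def by (rule cls_mult[OF L_const L_const])

lemma const_star: "a \<in> carrier A \<Longrightarrow> const (star A a) = star Q (const a)"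
  unfolding const_def by (rule cls_star[OF L_const])

lemma const_one: "const \<one> = \<one>\<^bsub>Q\<^esub>"
  unfolding const_def by (rule cls_one)

lemma const_inj:
  assumes "a \<in> carrier A" "b \<in> carrier A" "const a = const b"
  shows "a = b"
proof -
  have "(\<lambda>n. nrm (a \<ominus> b)) \<longlonglongrightarrow> 0"
    using assms unfolding const_def by (simp only: cls_eq_iff[OF L_const L_const])
  then have "nrm (a \<ominus> b) = 0" by (simp add: LIMSEQ_const_iff)
  then have "a \<ominus> b = \<zero>" using nrm_eq_0[OF sub_closed[OF assms(1,2)]] by simp
  then show ?thesis by (intro diff_zero_eq[OF assms(1,2)]) (simp add: sub_eq[OF assms(1,2)])
qed

text \<open>A representing sequence satisfies \<open>\<parallel>s\<^sub>n\<parallel>\<^sup>2 = \<parallel>s\<^sub>n\<^sup>*s\<^sub>n\<parallel> \<longlonglongrightarrow> 0\<close>.\<close>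

lemma Q_proper:
  assumes x: "x \<in> carrier Q" and z: "star Q x \<otimes>\<^bsub>Q\<^esub> x = \<zero>\<^bsub>Q\<^esub>"
  shows "x = \<zero>\<^bsub>Q\<^esub>"
proof -
  obtain s where s: "s \<in> carrier L" "x = cls s" using cls_surj[OF x] by blast
  have sn: "s n \<in> carrier A" for n using s by auto
  have z0: "(\<lambda>n. \<zero>) \<in> carrier L" by (rule L_const[OF zero_closed])
  note sub0 = sub_zero
  have "cls (\<lambda>n. star A (s n) \<otimes> s n) = cls (\<lambda>n. \<zero>)"
    using z by (simp only: s(2) cls_mult[OF L_star[OF s(1)] s(1)] cls_star[OF s(1)] cls_zero)
  then have "(\<lambda>n. nrm (star A (s n) \<otimes> s n \<ominus> \<zero>)) \<longlonglongrightarrow> 0"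
    by (simp only: cls_eq_iff[OF z0 L_mult[OF L_star[OF s(1)] s(1)]])
  then have "(\<lambda>n. (nrm (s n))\<^sup>2) \<longlonglongrightarrow> 0"
    by (simp add: sub0 mult_closed star_closed sn cstar_identity)
  then have "(\<lambda>n. sqrt ((nrm (s n))\<^sup>2)) \<longlonglongrightarrow> sqrt 0" by (rule tendsto_real_sqrt)
  then have "(\<lambda>n. nrm (s n \<ominus> \<zero>)) \<longlonglongrightarrow> 0" by (simp add: sub0 sn nrm_nonneg)
  then have "cls s = cls (\<lambda>n. \<zero>)" by (simp only: cls_eq_iff[OF z0 s(1)])
  then show ?thesis by (simp add: s(2) cls_zero)
qed

definition bounded_map :: "('a \<Rightarrow> 'a) \<Rightarrow> bool" where
  "bounded_map f \<longleftrightarrow> lin A A f \<and> (\<exists>C. \<forall>x\<in>carrier A. nrm (f x) \<le> C * nrm x)"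

lemma bounded_map_L: "bounded_map f \<Longrightarrow> s \<in> carrier L \<Longrightarrow> (\<lambda>n. f (s n)) \<in> carrier L"
proof -
  assume f: "bounded_map f" and s: "s \<in> carrier L"
  obtain C where C: "\<And>x. x \<in> carrier A \<Longrightarrow> nrm (f x) \<le> C * nrm x" using f by (auto simp: bounded_map_def)
  obtain M where M: "\<And>n. nrm (s n) \<le> M" and sn: "\<And>n. s n \<in> carrier A" using s by auto
  have "nrm (f (s n)) \<le> \<bar>C\<bar> * M" for n
  proof -
    have "nrm (f (s n)) \<le> C * nrm (s n)" by (rule C[OF sn])
    also have "\<dots> \<le> \<bar>C\<bar> * nrm (s n)" using nrm_nonneg[OF sn] by (intro mult_right_mono) auto
    also have "\<dots> \<le> \<bar>C\<bar> * M" using M by (intro mult_left_mono) auto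
    finally show ?thesis .
  qed
  then show ?thesis using f sn by (auto simp: bounded_map_def linD)
qed

lemma bounded_map_cls:
  assumes f: "bounded_map f" and s: "s \<in> carrier L" and t: "t \<in> carrier L" and e: "cls s = cls t"
  shows "cls (\<lambda>n. f (s n)) = cls (\<lambda>n. f (t n))"
proof -
  obtain C where C: "\<And>x. x \<in> carrier A \<Longrightarrow> nrm (f x) \<le> C * nrm x" using f by (auto simp: bounded_map_def)
  have l: "lin A A f" using f by (simp add: bounded_map_def)
  have m: "t n \<in> carrier A" "s n \<in> carrier A" for n using s t by auto
  have d: "f (s n) \<ominus> f (t n) = f (s n \<ominus> t n)" for n
    using m by (simp add: sub_eq linD[OF l])
  have "(\<lambda>n. nrm (s n \<ominus> t n)) \<longlonglongrightarrow> 0" using e by (simp only: cls_eq_iff[OF t s])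
  then have "(\<lambda>n. C * nrm (s n \<ominus> t n)) \<longlonglongrightarrow> 0" by (rule tendsto_mult_right_zero)
  then have "(\<lambda>n. nrm (f (s n) \<ominus> f (t n))) \<longlonglongrightarrow> 0"
    unfolding d
    by (rule null_comparison[rotated 2])
      (use m in \<open>auto simp: C sub_closed linD(1)[OF l] nrm_nonneg\<close>)
  then show ?thesis by (simp only: cls_eq_iff[OF bounded_map_L[OF f t] bounded_map_L[OF f s]])
qed

section \<open>Unitaries near almost unitary elements\<close>

text \<open>
  Newton's iteration \<open>z \<mapsto> z (3 - z\<^sup>*z) / 2\<close> for the unitary part of the polar decomposition.  The
  defects \<open>1 - z\<^sup>*z\<close> and \<open>1 - zz\<^sup>*\<close> are squared in every step.
\<close>

definition newton :: "'a \<Rightarrow> 'a" where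
  "newton z = z \<otimes> (\<one> \<oplus> (1/2) \<odot> (\<one> \<ominus> star A z \<otimes> z))"

lemma newton_closed: "z \<in> carrier A \<Longrightarrow> newton z \<in> carrier A"
  by (simp add: newton_def mult_closed add_closed one_closed sub_closed star_closed)

lemma nrm_one: "nrm \<one> \<le> 1"
proof -
  have "nrm \<one> = (nrm \<one>)\<^sup>2" using cstar_identity[OF one_closed] by (simp add: star_one mult_one_left one_closed)
  then have "nrm \<one> = 0 \<or> nrm \<one> = 1" by (simp add: power2_eq_square)
  then show ?thesis by auto
qed

lemma newton_identity:
  assumes q: "q \<in> carrier A"
  shows "\<one> \<ominus> (\<one> \<oplus> q) \<otimes> ((\<one> \<ominus> (q \<oplus> q)) \<otimes> (\<one> \<oplus> q)) = q \<otimes> q \<otimes> (\<one> \<oplus> (\<one> \<oplus> (\<one> \<oplus> (q \<oplus> q))))"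
proof -
  interpret R: ring A by (rule is_ring)
  show ?thesis using q one_closed mult_one_right[OF q] by algebra
qed

lemma newton_estimate:
  assumes d: "d \<in> carrier A" and n: "nrm d \<le> 1"
  shows "nrm (\<one> \<ominus> (\<one> \<oplus> (1/2) \<odot> d) \<otimes> ((\<one> \<ominus> d) \<otimes> (\<one> \<oplus> (1/2) \<odot> d))) \<le> (nrm d)\<^sup>2"
proof -
  let ?q = "(1/2) \<odot> d"
  have q: "?q \<in> carrier A" using d by simp
  have nq: "nrm ?q = nrm d / 2" using d by (simp add: nrm_smult)
  have dq: "?q \<oplus> ?q = d" using d by (simp add: scale_add_left[symmetric] scale_one)
  have "nrm (\<one> \<oplus> (\<one> \<oplus> (\<one> \<oplus> d))) \<le> nrm \<one> + (nrm \<one> + (nrm \<one> + nrm d))"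
    using d one_closed
    by (intro order_trans[OF nrm_triangle] add_left_mono) (auto intro!: add_closed)
  also have "\<dots> \<le> 4" using nrm_one n by simp
  finally have n4: "nrm (\<one> \<oplus> (\<one> \<oplus> (\<one> \<oplus> d))) \<le> 4" .
  have "nrm (?q \<otimes> ?q \<otimes> (\<one> \<oplus> (\<one> \<oplus> (\<one> \<oplus> d)))) \<le> nrm ?q * nrm ?q * 4"
    using q d one_closed nrm_nonneg
    by (intro order_trans[OF nrm_mult] mult_mono nrm_mult n4) (auto intro!: add_closed mult_closed)
  also have "\<dots> = (nrm d)\<^sup>2" by (simp add: nq power2_eq_square)
  finally show ?thesis using newton_identity[OF q] by (simp add: dq)
qed

lemma newton_defect:
  assumes z: "z \<in> carrier A"
  shows "nrm (\<one> \<ominus> star A z \<otimes> z) \<le> 1 \<Longrightarrow>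
      nrm (\<one> \<ominus> star A (newton z) \<otimes> newton z) \<le> (nrm (\<one> \<ominus> star A z \<otimes> z))\<^sup>2"
    and "nrm (\<one> \<ominus> z \<otimes> star A z) \<le> 1 \<Longrightarrow>
      nrm (\<one> \<ominus> newton z \<otimes> star A (newton z)) \<le> (nrm (\<one> \<ominus> z \<otimes> star A z))\<^sup>2"
proof -
  interpret R: ring A by (rule is_ring)
  let ?s = "star A z"
  let ?c = "?s \<otimes> z" and ?c' = "z \<otimes> ?s"
  let ?d = "\<one> \<ominus> ?c" and ?d' = "\<one> \<ominus> ?c'"
  let ?u = "\<one> \<oplus> (1/2) \<odot> ?d" and ?u' = "\<one> \<oplus> (1/2) \<odot> ?d'"
  note clo = z star_closed one_closed mult_closed add_closed sub_closed
  have so: "star A \<one> = \<one>"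
    using star_mult[OF star_closed[OF one_closed] one_closed]
    by (simp only: mult_one_right[OF star_closed[OF one_closed]] star_star[OF one_closed])
  have su: "star A ?u = ?u" "star A ?u' = ?u'"
    using z by (simp_all add: clo sub_eq star_add star_smult star_mult star_star so)
  have cd: "\<one> \<ominus> ?d = ?c" "\<one> \<ominus> ?d' = ?c'"
    using clo by algebra+
  have comm: "z \<otimes> ?u = ?u' \<otimes> z"
  proof -
    have "z \<otimes> ?d = ?d' \<otimes> z" using clo mult_one_right[OF z] by algebra
    then show ?thesis
      using z by (simp add: clo mult_add_left mult_add_right smult_mult_left smult_mult_right
          mult_one_left mult_one_right)
  qed
  have uc: "?u \<in> carrier A" "?u' \<in> carrier A" "?c \<in> carrier A" "?c' \<in> carrier A"
    using z by (simp_all add: clo)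
  have "star A (newton z) \<otimes> newton z = ?u \<otimes> (?c \<otimes> ?u)"
    unfolding newton_def using z uc by (simp add: star_mult su mult_assoc star_closed mult_closed)
  then show "nrm ?d \<le> 1 \<Longrightarrow> nrm (\<one> \<ominus> star A (newton z) \<otimes> newton z) \<le> (nrm ?d)\<^sup>2"
    using newton_estimate[of ?d] z by (simp add: cd clo)
  have "newton z \<otimes> star A (newton z) = ?u' \<otimes> (?c' \<otimes> ?u')"
    unfolding newton_def comm using z uc by (simp add: star_mult su mult_assoc star_closed mult_closed)
  then show "nrm ?d' \<le> 1 \<Longrightarrow> nrm (\<one> \<ominus> newton z \<otimes> star A (newton z)) \<le> (nrm ?d')\<^sup>2"
    using newton_estimate[of ?d'] z by (simp add: cd clo)
qed

text \<open>
  The defects decay like \<open>2\<^sup>-\<^sup>k\<close> at least, so that the iterates form a Cauchy sequence whose limit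
  has no defect.
\<close>

lemma newton_limit:
  assumes z: "z \<in> carrier A"
    and d: "nrm (\<one> \<ominus> star A z \<otimes> z) \<le> 1/2" "nrm (\<one> \<ominus> z \<otimes> star A z) \<le> 1/2"
  obtains x where "unitary A x" "(\<lambda>k. (newton ^^ k) z) \<in> carrier L"
    "cls (\<lambda>k. (newton ^^ k) z) = const x"
proof -
  interpret R: ring A by (rule is_ring)
  define s where "s k = (newton ^^ k) z" for k
  have s0: "s 0 = z" and sS: "s (Suc k) = newton (s k)" for k by (simp_all add: s_def)
  have sc: "s k \<in> carrier A" for k
    by (induction k) (simp_all add: s0 sS z newton_closed)
  have half: "y \<le> (1/2) ^ Suc (Suc k)" if "y \<le> x\<^sup>2" "0 \<le> x" "x \<le> (1/2) ^ Suc k" for x y :: real and k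
  proof -
    have "x\<^sup>2 \<le> (1/2) * ((1/2) ^ Suc k)"
      unfolding power2_eq_square
    proof (intro mult_mono that)
      show "x \<le> 1/2" using that(3) power_le_one[of "1/2::real" k] by simp
    qed (use that in auto)
    then show ?thesis using that(1) by simp
  qed
  have clo1: "\<one> \<ominus> star A (s k) \<otimes> s k \<in> carrier A" and clo2: "\<one> \<ominus> s k \<otimes> star A (s k) \<in> carrier A" for k
    using sc by (simp_all add: sub_closed one_closed mult_closed star_closed)
  have le1: "(1/2 :: real) ^ Suc k \<le> 1" for k by (rule power_le_one) auto
  have dk: "nrm (\<one> \<ominus> star A (s k) \<otimes> s k) \<le> (1/2) ^ Suc k"
    "nrm (\<one> \<ominus> s k \<otimes> star A (s k)) \<le> (1/2) ^ Suc k" for k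
  proof (induction k)
    case 0
    { case 1 show ?case using d by (simp add: s0) next case 2 show ?case using d by (simp add: s0) }
  next
    case (Suc k)
    {
      case 1
      show ?case unfolding sS
        using newton_defect(1)[OF sc order_trans[OF Suc.IH(1) le1]] Suc.IH(1) nrm_nonneg[OF clo1]
        by (intro half)
    next
      case 2
      show ?case unfolding sS
        using newton_defect(2)[OF sc order_trans[OF Suc.IH(2) le1]] Suc.IH(2) nrm_nonneg[OF clo2]
        by (intro half)
    }
  qed
  have s2: "nrm (s k) \<le> 2" for k
  proof -
    let ?c = "star A (s k) \<otimes> s k"
    have c: "?c \<in> carrier A" using sc by (simp add: mult_closed star_closed)
    have "?c = \<one> \<oplus> (-1) \<odot> (\<one> \<ominus> ?c)"
      unfolding scale_minus[OF clo1] using c one_closed by algebra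
    then have "nrm ?c \<le> nrm \<one> + nrm ((-1) \<odot> (\<one> \<ominus> ?c))"
      using nrm_triangle[OF one_closed scale_closed[OF clo1, of "-1" k]] by simp
    also have "\<dots> \<le> 1 + 1"
      using nrm_one order_trans[OF dk(1) le1, of k] by (intro add_mono) (simp_all add: nrm_smult clo1)
    finally have "(nrm (s k))\<^sup>2 \<le> 2\<^sup>2" using cstar_identity[OF sc] by simp
    then show ?thesis by (rule power2_le_imp_le) simp
  qed
  have step: "nrm (s (Suc k) \<ominus> s k) \<le> (1/2) ^ Suc k" for k
  proof -
    let ?d = "\<one> \<ominus> star A (s k) \<otimes> s k"
    have "s (Suc k) \<ominus> s k = s k \<otimes> ((1/2) \<odot> ?d)"
    proof -
      have h: "(1/2) \<odot> ?d \<in> carrier A" using clo1 by simp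
      show ?thesis unfolding sS newton_def using sc[of k] h one_closed mult_one_right[OF sc[of k]] by algebra
    qed
    then have "nrm (s (Suc k) \<ominus> s k) \<le> nrm (s k) * (nrm ?d / 2)"
      using nrm_mult[OF sc scale_closed[OF clo1, of "1/2" k]] by (simp add: nrm_smult clo1)
    also have "\<dots> \<le> 2 * ((1/2) ^ Suc k / 2)"
      using s2 dk(1) nrm_nonneg[OF clo1] nrm_nonneg[OF sc] by (intro mult_mono divide_right_mono) auto
    finally show ?thesis by simp
  qed
  have far: "nrm (s (k + j) \<ominus> s k) \<le> (1/2) ^ k * (1 - (1/2) ^ j)" for k j
  proof (induction j)
    case 0
    show ?case using sc by (simp add: sub_self nrm_zero)
  next
    case (Suc j)
    have "s (k + Suc j) \<ominus> s k = (s (Suc (k + j)) \<ominus> s (k + j)) \<oplus> (s (k + j) \<ominus> s k)"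
      using sc[of "k + Suc j"] sc[of k] sc[of "k + j"] by simp algebra
    then have "nrm (s (k + Suc j) \<ominus> s k) \<le> (1/2) ^ Suc (k + j) + (1/2) ^ k * (1 - (1/2) ^ j)"
      using nrm_triangle[OF sub_closed[OF sc sc] sub_closed[OF sc sc], of "Suc (k + j)" "k + j" "k + j" k]
        step[of "k + j"] Suc.IH by simp
    then show ?case by (simp add: power_add algebra_simps)
  qed
  have symm: "nrm (s m \<ominus> s k) = nrm (s k \<ominus> s m)" for m k
  proof -
    have "s m \<ominus> s k = (-1) \<odot> (s k \<ominus> s m)"
      using sc[of m] sc[of k] by (simp add: sub_eq scale_add_right scale_scale scale_one add_comm)
    then show ?thesis by (simp add: nrm_smult sub_closed sc)
  qed
  have "\<exists>x\<in>carrier A. (\<lambda>n. nrm (s n \<ominus> x)) \<longlonglongrightarrow> 0"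
  proof (rule complete[OF sc])
    fix e :: real assume e: "e > 0"
    have "(\<lambda>k. (1/2 :: real) ^ k) \<longlonglongrightarrow> 0" by (rule LIMSEQ_power_zero) simp
    then obtain N where N: "\<And>k. k \<ge> N \<Longrightarrow> (1/2 :: real) ^ k < e"
      using e by (auto simp: LIMSEQ_iff)
    have near: "nrm (s m \<ominus> s k) < e" if "k \<ge> N" "k \<le> m" for m k
    proof -
      have "nrm (s m \<ominus> s k) \<le> (1/2) ^ k * (1 - (1/2) ^ (m - k))" using far[of k "m - k"] that by simp
      also have "\<dots> \<le> (1/2) ^ k * 1" by (intro mult_left_mono) auto
      finally show ?thesis using N[OF that(1)] by simp
    qed
    show "\<exists>M. \<forall>m\<ge>M. \<forall>n\<ge>M. nrm (s m \<ominus> s n) < e"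
    proof (intro exI[of _ N] allI impI)
      fix m n assume "N \<le> m" "N \<le> n"
      then show "nrm (s m \<ominus> s n) < e"
        using near[of n m] near[of m n] symm[of m n] by (cases "n \<le> m") auto
    qed
  qed
  then obtain x where x: "x \<in> carrier A" and lim: "(\<lambda>n. nrm (s n \<ominus> x)) \<longlonglongrightarrow> 0" by blast
  have sL: "s \<in> carrier L" using sc s2 by auto
  have sx: "cls s = const x"
    unfolding const_def using lim by (simp only: cls_eq_iff[OF L_const[OF x] sL])
  interpret Q: star_algebra Q by (rule star_algebra_Q)
  have lim0: "(\<lambda>k. (1/2 :: real) ^ Suc k) \<longlonglongrightarrow> 0"
    using LIMSEQ_Suc[OF LIMSEQ_power_zero[of "1/2 :: real"]] by simp
  have "star A x \<otimes> x = \<one>"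
  proof (rule const_inj[OF mult_closed[OF star_closed[OF x] x] one_closed])
    have "const (star A x \<otimes> x) = cls (\<lambda>n. star A (s n) \<otimes> s n)"
      by (simp only: const_mult[OF star_closed[OF x] x] const_star[OF x] sx[symmetric]
          cls_mult[OF L_star[OF sL] sL] cls_star[OF sL])
    also have "\<dots> = const \<one>"
    proof -
      have "(\<lambda>n. nrm (\<one> \<ominus> star A (s n) \<otimes> s n)) \<longlonglongrightarrow> 0"
        using dk(1) nrm_nonneg[OF clo1] by (intro null_comparison[OF _ _ lim0]) auto
      then show ?thesis
        unfolding const_def by (simp only: cls_eq_iff[OF L_mult[OF L_star[OF sL] sL] L_const[OF one_closed], symmetric])
    qed
    finally show "const (star A x \<otimes> x) = const \<one>" .
  qed
  moreover have "x \<otimes> star A x = \<one>"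
  proof (rule const_inj[OF mult_closed[OF x star_closed[OF x]] one_closed])
    have "const (x \<otimes> star A x) = cls (\<lambda>n. s n \<otimes> star A (s n))"
      by (simp only: const_mult[OF x star_closed[OF x]] const_star[OF x] sx[symmetric]
          cls_mult[OF sL L_star[OF sL]] cls_star[OF sL])
    also have "\<dots> = const \<one>"
    proof -
      have "(\<lambda>n. nrm (\<one> \<ominus> s n \<otimes> star A (s n))) \<longlonglongrightarrow> 0"
        using dk(2) nrm_nonneg[OF clo2] by (intro null_comparison[OF _ _ lim0]) auto
      then show ?thesis
        unfolding const_def by (simp only: cls_eq_iff[OF L_mult[OF sL L_star[OF sL]] L_const[OF one_closed], symmetric])
    qed
    finally show "const (x \<otimes> star A x) = const \<one>" .
  qed
  ultimately have "unitary A x" using x by (simp add: unitary_def)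
  then show ?thesis
    using that[of x] sL sx unfolding s_def[abs_def] by blast
qed

end

section \<open>Units of finite dimensional ideals\<close>

context star_algebra
begin

interpretation V: cspace A by (rule is_cspace)

text \<open>
  A finite dimensional algebra with a proper involution has a unit.  For a selfadjoint \<open>a\<close> some power
  satisfies \<open>a\<^sup>m = a\<^sup>m g\<close> with a polynomial \<open>g\<close> in \<open>a\<close>, as the powers are linearly dependent, and
  properness of the involution cancels factors until \<open>a = ag\<close>.  Applied to \<open>x\<^sup>*x\<close> this gives \<open>xg = x\<close>,
  and right units of finitely many elements are combined as \<open>1 - (1 - f)(1 - g)\<close>.
\<close>

lemma right_unit:
  assumes proper: "\<And>x. x \<in> carrier A \<Longrightarrow> star A x \<otimes> x = \<zero> \<Longrightarrow> x = \<zero>"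
    and JA: "J \<subseteq> carrier A" and J0: "\<zero> \<in> J"
    and Jadd: "\<And>x y. x \<in> J \<Longrightarrow> y \<in> J \<Longrightarrow> x \<oplus> y \<in> J" and Jscale: "\<And>c x. x \<in> J \<Longrightarrow> c \<odot> x \<in> J"
    and Jmult: "\<And>x y. x \<in> J \<Longrightarrow> y \<in> J \<Longrightarrow> x \<otimes> y \<in> J" and Jstar: "\<And>x. x \<in> J \<Longrightarrow> star A x \<in> J"
    and yJ: "\<And>i. i < n \<Longrightarrow> y i \<in> J"
    and span: "\<And>x. x \<in> J \<Longrightarrow> \<exists>c. x = lsum A (\<lambda>i. c i \<odot> y i) [0..<n]"
  shows "\<exists>f\<in>J. \<forall>x\<in>J. x \<otimes> f = x"
proof -
  interpret R: ring A by (rule is_ring)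
  have Jc: "x \<in> carrier A" if "x \<in> J" for x using that JA by blast
  have Jsum: "lsum A g is \<in> J" if "\<And>i. i \<in> set is \<Longrightarrow> g i \<in> J" for g and "is" :: "nat list"
    using that by (induction "is") (auto simp: J0 Jadd)
  have Jsub: "x \<ominus> y \<in> J" if "x \<in> J" "y \<in> J" for x y
    using Jadd[OF that(1) Jscale[OF that(2), of "-1"]] Jc that by (simp add: a_minus_def V.scale_minus)
  have cancel: "u = v" if "u \<in> carrier A" "v \<in> carrier A" "u \<ominus> v = \<zero>" for u v
    using that(3) by (intro V.diff_zero_eq[OF that(1,2)]) (simp add: a_minus_def V.scale_minus that(2))
  have selfadjoint: "\<exists>g\<in>J. a \<otimes> g = a" if a: "a \<in> J" and sa: "star A a = a" for a
  proof -
    define pw where "pw k = ((\<lambda>x. x \<otimes> a) ^^ k) a" for k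
    have pw0: "pw 0 = a" and pwS: "pw (Suc k) = pw k \<otimes> a" for k by (simp_all add: pw_def)
    have pwJ: "pw k \<in> J" for k by (induction k) (auto simp: pw0 pwS a Jmult)
    note pwc = Jc[OF pwJ] and ac = Jc[OF a]
    have pwS': "a \<otimes> pw k = pw (Suc k)" for k
    proof (induction k)
      case (Suc k)
      have "a \<otimes> pw (Suc k) = a \<otimes> pw k \<otimes> a" using pwc ac by (simp add: pwS mult_assoc)
      then show ?case by (simp only: Suc.IH) (simp only: pwS)
    qed (simp add: pw0 pwS)
    have pws: "star A (pw k) = pw k" for k
    proof (induction k)
      case (Suc k)
      then show ?case using pwc ac sa pwS'[of k] by (simp add: pwS star_mult)
    qed (simp add: pw0 sa)
    have pwadd: "pw j \<otimes> pw k = pw (Suc (j + k))" for j k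
    proof (induction k)
      case (Suc k)
      have "pw j \<otimes> pw (Suc k) = pw j \<otimes> pw k \<otimes> a" using pwc ac by (simp add: pwS mult_assoc)
      then show ?case by (simp only: Suc.IH) (simp add: pwS)
    qed (simp add: pw0 pwS)
    obtain c where c: "\<And>m. pw m = lsum A (\<lambda>i. c m i \<odot> y i) [0..<n]"
      using span[OF pwJ] by metis
    obtain d where d: "\<exists>m\<in>{..n}. d m \<noteq> 0" "\<forall>i<n. (\<Sum>m\<in>{..n}. d m * c m i) = 0"
      using underdetermined_system[of "{..n}" n c] by auto
    have dep: "lsum A (\<lambda>m. d m \<odot> pw m) [0..<Suc n] = \<zero>"
    proof -
      have "lsum A (\<lambda>m. d m \<odot> pw m) [0..<Suc n]
          = lsum A (\<lambda>m. lsum A (\<lambda>i. (d m * c m i) \<odot> y i) [0..<n]) [0..<Suc n]"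
      proof (rule lsum_cong)
        fix m
        have "d m \<odot> pw m = lsum A (\<lambda>i. d m \<odot> (c m i \<odot> y i)) [0..<n]"
          unfolding c[of m] using yJ Jc by (intro V.lsum_scale[symmetric]) auto
        also have "\<dots> = lsum A (\<lambda>i. (d m * c m i) \<odot> y i) [0..<n]"
          using yJ Jc by (intro lsum_cong) (auto simp: V.scale_scale)
        finally show "d m \<odot> pw m = lsum A (\<lambda>i. (d m * c m i) \<odot> y i) [0..<n]" .
      qed
      also have "\<dots> = lsum A (\<lambda>i. lsum A (\<lambda>m. (d m * c m i) \<odot> y i) [0..<Suc n]) [0..<n]"
        using yJ Jc by (intro V.lsum_swap) auto
      also have "\<dots> = lsum A (\<lambda>i. \<zero>) [0..<n]"
      proof (rule lsum_cong_upt)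
        fix i assume i: "i < n"
        have "lsum A (\<lambda>m. (d m * c m i) \<odot> y i) [0..<Suc n] = (\<Sum>m\<leftarrow>[0..<Suc n]. d m * c m i) \<odot> y i"
          by (rule V.lsum_scale_left[OF Jc[OF yJ[OF i]]])
        also have "(\<Sum>m\<leftarrow>[0..<Suc n]. d m * c m i) = (\<Sum>m\<in>{..n}. d m * c m i)"
          by (simp only: sum_list_distinct_conv_sum_set distinct_upt set_upt atLeast0LessThan lessThan_Suc_atMost)
        finally show "lsum A (\<lambda>m. (d m * c m i) \<odot> y i) [0..<Suc n] = \<zero>"
          using d(2) i by (simp add: V.scale_zero Jc yJ)
      qed
      finally show ?thesis by (simp add: V.lsum_zero)
    qed
    define m0 where "m0 = (LEAST m. d m \<noteq> 0)"
    obtain m1 where m1: "m1 \<le> n" "d m1 \<noteq> 0" using d(1) by auto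
    have dm0: "d m0 \<noteq> 0" unfolding m0_def by (rule LeastI[of _ m1]) (rule m1(2))
    have dlt: "d m = 0" if "m < m0" for m using not_less_Least[OF that[unfolded m0_def]] by simp
    have m0n: "m0 \<le> n"
      unfolding m0_def by (rule order_trans[OF Least_le[of "\<lambda>m. d m \<noteq> 0", OF m1(2)] m1(1)])
    define g where "g = lsum A (\<lambda>j. (- d (Suc (m0 + j)) / d m0) \<odot> pw j) [0..<n - m0]"
    have gJ: "g \<in> J" unfolding g_def by (intro Jsum Jscale pwJ)
    note gc = Jc[OF gJ]
    have top: "pw m0 \<otimes> g = pw m0"
    proof -
      let ?t = "lsum A (\<lambda>j. d (Suc (m0 + j)) \<odot> pw (Suc (m0 + j))) [0..<n - m0]"
      have tc: "?t \<in> carrier A" using pwc by (intro V.lsum_closed) auto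
      have split: "[0..<Suc n] = [0..<m0] @ m0 # map (\<lambda>j. Suc (m0 + j)) [0..<n - m0]"
        by (rule nth_equalityI) (use m0n in \<open>auto simp: nth_append nth_Cons split: nat.split\<close>)
      have "lsum A (\<lambda>m. d m \<odot> pw m) [0..<m0] = lsum A (\<lambda>m. \<zero>) [0..<m0]"
        using pwc by (intro lsum_cong) (auto simp: dlt V.scale_zero)
      then have "lsum A (\<lambda>m. d m \<odot> pw m) [0..<Suc n] = \<zero> \<oplus> (d m0 \<odot> pw m0 \<oplus> ?t)"
        unfolding split map_append using pwc
        by (subst V.list_sum_append) (auto simp: V.lsum_zero comp_def)
      then have sum0: "d m0 \<odot> pw m0 \<oplus> ?t = \<zero>" using dep pwc tc by (simp add: add_zero_left add_closed)
      have "pw m0 \<otimes> g = lsum A (\<lambda>j. pw m0 \<otimes> ((- d (Suc (m0 + j)) / d m0) \<odot> pw j)) [0..<n - m0]"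
        unfolding g_def using pwc
        by (intro lin_lsum_apply[OF V.cspace_axioms V.cspace_axioms
              lin_mult_left[OF star_algebra_axioms pwc lin_id]]) auto
      also have "\<dots> = lsum A (\<lambda>j. (- 1 / d m0) \<odot> (d (Suc (m0 + j)) \<odot> pw (Suc (m0 + j)))) [0..<n - m0]"
        using pwc by (intro lsum_cong) (simp add: smult_mult_right pwadd V.scale_scale)
      also have "\<dots> = (- 1 / d m0) \<odot> ?t" using pwc by (intro V.lsum_scale) auto
      also have "?t = (- d m0) \<odot> pw m0"
      proof (rule cancel[OF tc])
        have "?t \<ominus> (- d m0) \<odot> pw m0 = ?t \<oplus> (-1) \<odot> ((- d m0) \<odot> pw m0)"
          using pwc by (simp add: a_minus_def V.scale_minus)
        also have "\<dots> = ?t \<oplus> d m0 \<odot> pw m0" by (simp only: V.scale_scale[OF pwc]) simp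
        also have "\<dots> = \<zero>" using sum0 by (simp only: add_comm[OF V.scale_closed[OF pwc] tc])
        finally show "?t \<ominus> (- d m0) \<odot> pw m0 = \<zero>" .
      qed (use pwc in simp)
      also have "(- 1 / d m0) \<odot> ((- d m0) \<odot> pw m0) = pw m0"
        using dm0 pwc by (simp add: V.scale_scale V.scale_one)
      finally show ?thesis .
    qed
    let ?e = "\<one> \<ominus> g"
    have ec: "?e \<in> carrier A" using gc one_closed by (simp add: R.minus_closed)
    have pe: "pw k \<otimes> ?e = pw k \<ominus> pw k \<otimes> g" for k
      using pwc[of k] gc mult_one_right[OF pwc[of k]] by algebra
    have "pw k \<otimes> ?e = \<zero>" if "k \<le> m0" for k
      using that
    proof (induction rule: inc_induct)
      case base
      show ?case using pwc top by (simp add: pe sub_self)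
    next
      case (step k)
      have az: "a \<otimes> (pw k \<otimes> ?e) = \<zero>"
        using step.IH pwc ac ec pwS'[of k] by (simp add: mult_assoc[symmetric])
      obtain u where u: "u \<in> carrier A" "pw k = u \<otimes> a"
      proof (cases k)
        case 0
        then show ?thesis using that[of \<one>] one_closed ac by (simp add: pw0 mult_one_left)
      next
        case (Suc j)
        then show ?thesis using that[of "pw j"] pwc by (simp add: pwS)
      qed
      have "star A (pw k \<otimes> ?e) \<otimes> (pw k \<otimes> ?e) = star A ?e \<otimes> (pw k \<otimes> (pw k \<otimes> ?e))"
        using pwc ec by (simp add: star_mult pws mult_assoc star_closed mult_closed)
      also have "pw k \<otimes> (pw k \<otimes> ?e) = u \<otimes> (a \<otimes> (pw k \<otimes> ?e))"
        by (subst u(2)) (use u(1) ac pwc ec in \<open>simp add: mult_assoc mult_closed\<close>)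
      also have "star A ?e \<otimes> (u \<otimes> (a \<otimes> (pw k \<otimes> ?e))) = \<zero>"
        unfolding az using u ec star_closed by simp
      finally show ?case by (rule proper[rotated]) (simp add: mult_closed pwc ec)
    qed
    from this[of 0] have "a \<ominus> a \<otimes> g = \<zero>" using pe[of 0] by (simp add: pw0)
    then have "a = a \<otimes> g" by (rule cancel[OF ac mult_closed[OF ac gc]])
    then show ?thesis using gJ by metis
  qed
  have single: "\<exists>g\<in>J. x \<otimes> g = x" if x: "x \<in> J" for x
  proof -
    note xc = Jc[OF x]
    have "star A (star A x \<otimes> x) = star A x \<otimes> x" using xc by (simp add: star_mult star_star star_closed)
    then obtain g where g: "g \<in> J" "star A x \<otimes> x \<otimes> g = star A x \<otimes> x"
      using selfadjoint[OF Jmult[OF Jstar[OF x] x]] by blast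
    note gc = Jc[OF g(1)]
    let ?e = "\<one> \<ominus> g"
    have ec: "?e \<in> carrier A" using gc one_closed by (simp add: R.minus_closed)
    have sc: "star A x \<in> carrier A" by (rule star_closed[OF xc])
    have "star A x \<otimes> x \<otimes> ?e = star A x \<otimes> x \<ominus> star A x \<otimes> x \<otimes> g"
      using xc sc gc mult_one_right[OF xc] by algebra
    then have z: "star A x \<otimes> (x \<otimes> ?e) = \<zero>"
      using g(2) xc sc ec by (simp add: sub_self mult_closed mult_assoc)
    have "star A (x \<otimes> ?e) \<otimes> (x \<otimes> ?e) = star A ?e \<otimes> (star A x \<otimes> (x \<otimes> ?e))"
      using xc ec sc by (simp add: star_mult mult_assoc star_closed mult_closed)
    also have "\<dots> = \<zero>" unfolding z using ec star_closed by simp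
    finally have "x \<otimes> ?e = \<zero>" by (rule proper[rotated]) (simp add: mult_closed xc ec)
    moreover have "x \<otimes> ?e = x \<ominus> x \<otimes> g" using xc gc mult_one_right[OF xc] by algebra
    ultimately have "x = x \<otimes> g" by (intro cancel[OF xc mult_closed[OF xc gc]]) simp
    then show ?thesis using g(1) by metis
  qed
  have "\<exists>f\<in>J. \<forall>i<k. y i \<otimes> f = y i" if "k \<le> n" for k
    using that
  proof (induction k)
    case 0
    then show ?case using J0 by auto
  next
    case (Suc k)
    then obtain f where f: "f \<in> J" "\<And>i. i < k \<Longrightarrow> y i \<otimes> f = y i" by auto
    have yk: "y k \<in> J" using Suc.prems yJ by simp
    obtain g where g: "g \<in> J" "(y k \<ominus> y k \<otimes> f) \<otimes> g = y k \<ominus> y k \<otimes> f"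
      using single[OF Jsub[OF yk Jmult[OF yk f(1)]]] by blast
    note fc = Jc[OF f(1)] and gc = Jc[OF g(1)] and ykc = Jc[OF yk]
    let ?f = "f \<oplus> g \<ominus> f \<otimes> g"
    have "?f \<in> J" using f(1) g(1) by (intro Jsub Jadd Jmult)
    moreover have "y i \<otimes> ?f = y i" if "i < k" for i
    proof -
      have yi: "y i \<in> carrier A" using that Suc.prems yJ Jc by simp
      have "y i \<otimes> ?f = y i \<otimes> f \<oplus> y i \<otimes> g \<ominus> (y i \<otimes> f) \<otimes> g" using yi fc gc by algebra
      also have "\<dots> = y i" unfolding f(2)[OF that] using yi gc by algebra
      finally show ?thesis .
    qed
    moreover have "y k \<otimes> ?f = y k"
    proof -
      have "y k \<otimes> ?f = y k \<otimes> f \<oplus> (y k \<ominus> y k \<otimes> f) \<otimes> g" using ykc fc gc by algebra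
      also have "\<dots> = y k" unfolding g(2) using ykc fc by algebra
      finally show ?thesis .
    qed
    ultimately show ?case by (auto simp: less_Suc_eq intro!: bexI[of _ ?f])
  qed
  then obtain f where f: "f \<in> J" "\<And>i. i < n \<Longrightarrow> y i \<otimes> f = y i" by blast
  have "x \<otimes> f = x" if x: "x \<in> J" for x
  proof -
    obtain c where c: "x = lsum A (\<lambda>i. c i \<odot> y i) [0..<n]" using span[OF x] by blast
    have "x \<otimes> f = lsum A (\<lambda>i. (c i \<odot> y i) \<otimes> f) [0..<n]"
      unfolding c using yJ Jc
      by (intro lin_lsum_apply[OF V.cspace_axioms V.cspace_axioms
            lin_mult_right[OF star_algebra_axioms Jc[OF f(1)] lin_id]]) auto
    also have "\<dots> = lsum A (\<lambda>i. c i \<odot> y i) [0..<n]"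
      using f yJ Jc by (intro lsum_cong) (auto simp: smult_mult_left)
    finally show ?thesis by (simp only: c)
  qed
  then show ?thesis using f(1) by blast
qed

end

section \<open>Slices and coordinates\<close>

lemma slice_cong:
  assumes "cspace A" "cspace K" "t \<in> carrier (tensor A K)" "\<And>k. k \<in> carrier K \<Longrightarrow> \<phi> k = \<psi> k"
  shows "slice A \<phi> t = slice A \<psi> t"
  unfolding slice_eq_teval using assms by (intro teval_cong_carrier) auto

lemma slice_sum:
  assumes A: "cspace A" and K: "cspace K" and t: "t \<in> carrier (tensor A K)"
    and l: "\<And>i. i \<in> set is \<Longrightarrow> lin K complex_alg (\<phi> i)"
  shows "slice A (\<lambda>k. lsum complex_alg (\<lambda>i. \<phi> i k) is) t = lsum A (\<lambda>i. slice A (\<phi> i) t) is"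
proof (rule tensor_ext[OF A K A _ _ _ t])
  have ls: "lin K complex_alg (\<lambda>k. lsum complex_alg (\<lambda>i. \<phi> i k) is)"
    by (rule lin_lsum[OF cspace_complex l])
  show "lin (tensor A K) A (slice A (\<lambda>k. lsum complex_alg (\<lambda>i. \<phi> i k) is))"
    by (rule lin_slice[OF A K ls])
  show "lin (tensor A K) A (\<lambda>t. lsum A (\<lambda>i. slice A (\<phi> i) t) is)"
    by (rule lin_lsum[OF A lin_slice[OF A K l]])
  fix a k assume a: "a \<in> carrier A" and k: "k \<in> carrier K"
  have "lsum A (\<lambda>i. slice A (\<phi> i) (tens A K a k)) is = lsum A (\<lambda>i. \<phi> i k \<odot>\<^bsub>A\<^esub> a) is"
    using a k l by (intro lsum_cong slice_tens[OF A K])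
  also have "\<dots> = (\<Sum>i\<leftarrow>is. \<phi> i k) \<odot>\<^bsub>A\<^esub> a" by (rule cspace.lsum_scale_left[OF A a])
  finally show "slice A (\<lambda>k. lsum complex_alg (\<lambda>i. \<phi> i k) is) (tens A K a k)
      = lsum A (\<lambda>i. slice A (\<phi> i) (tens A K a k)) is"
    unfolding slice_tens[OF A K ls a k] by (simp only: list_sum_complex)
qed

lemma slice_expand:
  assumes A: "cspace A" and K: "cspace K" and co: "coordinates K n e f"
    and \<phi>: "lin K complex_alg \<phi>" and t: "t \<in> carrier (tensor A K)"
  shows "slice A \<phi> t = lsum A (\<lambda>i. \<phi> (e i) \<odot>\<^bsub>A\<^esub> slice A (f i) t) [0..<n]"
proof -
  note c = coordinatesD[OF co]
  have "slice A \<phi> t = slice A \<phi> (lsum (tensor A K) (\<lambda>i. tens A K (slice A (f i) t) (e i)) [0..<n])"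
    using tensor_coordinates[OF A K co t] by simp
  also have "\<dots> = lsum A (\<lambda>i. slice A \<phi> (tens A K (slice A (f i) t) (e i))) [0..<n]"
    using c t by (intro lin_lsum_apply[OF cspace_tensor[OF A K] A lin_slice[OF A K \<phi>]])
      (auto intro!: tens_closed slice_closed[OF A K])
  also have "\<dots> = lsum A (\<lambda>i. \<phi> (e i) \<odot>\<^bsub>A\<^esub> slice A (f i) t) [0..<n]"
    using c t by (intro lsum_cong slice_tens[OF A K \<phi>]) (auto intro!: slice_closed[OF A K])
  finally show ?thesis .
qed

lemma slice_scale_functional:
  assumes A: "cspace A" and K: "cspace K" and \<phi>: "lin K complex_alg \<phi>" and t: "t \<in> carrier (tensor A K)"
  shows "slice A (\<lambda>k. c * \<phi> k) t = c \<odot>\<^bsub>A\<^esub> slice A \<phi> t"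
proof (rule tensor_ext[OF A K A _ _ _ t])
  note l = lin_cmult_left[OF \<phi>, of c]
  show "lin (tensor A K) A (slice A (\<lambda>k. c * \<phi> k))" by (rule lin_slice[OF A K l])
  show "lin (tensor A K) A (\<lambda>t. c \<odot>\<^bsub>A\<^esub> slice A \<phi> t)" by (rule lin_const_scale[OF A lin_slice[OF A K \<phi>]])
  show "slice A (\<lambda>k. c * \<phi> k) (tens A K a k) = c \<odot>\<^bsub>A\<^esub> slice A \<phi> (tens A K a k)"
    if "a \<in> carrier A" "k \<in> carrier K" for a k
    using that by (simp add: slice_tens[OF A K l] slice_tens[OF A K \<phi>] cspace.scale_scale[OF A])
qed

lemma slice_mult_coordinates:
  assumes A: "star_algebra A" and K: "star_algebra K" and co: "coordinates K n e f"
    and \<phi>: "lin K complex_alg \<phi>" and x: "x \<in> carrier (tensor A K)" and y: "y \<in> carrier (tensor A K)"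
  shows "slice A \<phi> (x \<otimes>\<^bsub>tensor A K\<^esub> y)
    = lsum A (\<lambda>i. slice A (f i) x \<otimes>\<^bsub>A\<^esub> slice A (\<lambda>l. \<phi> (e i \<otimes>\<^bsub>K\<^esub> l)) y) [0..<n]"
proof -
  let ?T = "tensor A K"
  note cA = cspace_star_algebra[OF A] and cK = cspace_star_algebra[OF K]
  note c = coordinatesD[OF co]
  have "slice A \<phi> (x \<otimes>\<^bsub>?T\<^esub> y)
      = slice A \<phi> (lsum ?T (\<lambda>i. tens A K (slice A (f i) x) (e i)) [0..<n] \<otimes>\<^bsub>?T\<^esub> y)"
    using tensor_coordinates[OF cA cK co x] by simp
  also have "\<dots> = lsum A (\<lambda>i. slice A \<phi> (tens A K (slice A (f i) x) (e i) \<otimes>\<^bsub>?T\<^esub> y)) [0..<n]"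
    using c x by (intro lin_lsum_apply[OF cspace_tensor[OF cA cK] cA
          lin_comp[OF lin_slice[OF cA cK \<phi>] tmult_lin(1)[OF A K y]]])
      (auto intro!: tens_closed slice_closed[OF cA cK])
  also have "\<dots> = lsum A (\<lambda>i. slice A (f i) x \<otimes>\<^bsub>A\<^esub> slice A (\<lambda>l. \<phi> (e i \<otimes>\<^bsub>K\<^esub> l)) y) [0..<n]"
    using c x y by (intro lsum_cong slice_tens_mult_left[OF A K \<phi>]) (auto intro!: slice_closed[OF cA cK])
  finally show ?thesis .
qed

section \<open>The implementing unitary of an approximately representable dual coaction\<close>

locale rohlin_coaction = coaction_of_dual A H nrmH \<rho> + N: cstar_algebra "crossed_product A H \<rho>" nrmB
  for A :: "'a star_alg" and H :: "'h hopf" and nrmH :: "'h \<Rightarrow> real"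
    and \<rho> :: "'a \<Rightarrow> ('a \<times> ('h \<Rightarrow> complex)) list set" and nrmB :: "('a \<times> 'h) list set \<Rightarrow> real" +
  fixes w
  assumes w_unitary: "unitary (tensor (seq_alg (crossed_product A H \<rho>) nrmB) H) w"
    and w_implements: "b \<in> carrier (crossed_product A H \<rho>) \<Longrightarrow>
      tmap (seq_alg (crossed_product A H \<rho>) nrmB) H N.const id (dual_coaction A H \<rho> b)
      = Ad (tensor (seq_alg (crossed_product A H \<rho>) nrmB) H) w
          (tens (seq_alg (crossed_product A H \<rho>) nrmB) H (N.const b) \<one>\<^bsub>H\<^esub>)"
    and w_trivial_cocycle:
      "tassoc (seq_alg (crossed_product A H \<rho>) nrmB) H H
        (tens (tensor (seq_alg (crossed_product A H \<rho>) nrmB) H) H w \<one>\<^bsub>H\<^esub>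
          \<otimes>\<^bsub>tensor (tensor (seq_alg (crossed_product A H \<rho>) nrmB) H) H\<^esub>
        tmap (tensor (seq_alg (crossed_product A H \<rho>) nrmB) H) H
          (\<lambda>x. tens (seq_alg (crossed_product A H \<rho>) nrmB) H x \<one>\<^bsub>H\<^esub>) id w)
      = tmap (seq_alg (crossed_product A H \<rho>) nrmB) (tensor H H) id (comult H) w"
    and w_cocycle:
      "tassoc (seq_alg (crossed_product A H \<rho>) nrmB) H H
        (tmap (tensor (seq_alg (crossed_product A H \<rho>) nrmB) H) H
          (seq_coaction (crossed_product A H \<rho>) nrmB H (dual_coaction A H \<rho>)) id w
          \<otimes>\<^bsub>tensor (tensor (seq_alg (crossed_product A H \<rho>) nrmB) H) H\<^esub>
        tens (tensor (seq_alg (crossed_product A H \<rho>) nrmB) H) H w \<one>\<^bsub>H\<^esub>)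
      = tmap (seq_alg (crossed_product A H \<rho>) nrmB) (tensor H H) id (comult H) w"
begin

abbreviation C where "C \<equiv> seq_alg B nrmB"
abbreviation CH where "CH \<equiv> tensor C H"
abbreviation mult_C (infixl "\<otimes>\<^sub>C" 70) where "x \<otimes>\<^sub>C y \<equiv> x \<otimes>\<^bsub>C\<^esub> y"
abbreviation smult_C (infixl "\<odot>\<^sub>C" 70) where "c \<odot>\<^sub>C x \<equiv> c \<odot>\<^bsub>C\<^esub> x"
abbreviation smult_CH (infixl "\<odot>\<^sub>C\<^sub>H" 70) where "c \<odot>\<^sub>C\<^sub>H x \<equiv> c \<odot>\<^bsub>CH\<^esub> x"
abbreviation one_C ("\<one>\<^sub>C") where "\<one>\<^sub>C \<equiv> \<one>\<^bsub>C\<^esub>"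
abbreviation mult_CH (infixl "\<otimes>\<^sub>C\<^sub>H" 70) where "x \<otimes>\<^sub>C\<^sub>H y \<equiv> x \<otimes>\<^bsub>CH\<^esub> y"
abbreviation one_CH ("\<one>\<^sub>C\<^sub>H") where "\<one>\<^sub>C\<^sub>H \<equiv> \<one>\<^bsub>CH\<^esub>"
abbreviation LB where "LB \<equiv> linf B nrmB"
abbreviation cls where "cls \<equiv> seq_class B nrmB"
abbreviation const where "const \<equiv> N.const"
abbreviation sco where "sco \<equiv> seq_coaction B nrmB H dco"

lemmas sC = N.star_algebra_Q and cC = N.cspace_Q and cL = N.cspace_L

lemma sCH: "star_algebra CH" by (rule star_algebra_tensor[OF sC sH])
lemma cCH: "cspace CH" by (rule cspace_tensor[OF cC cH])

sublocale C: star_algebra C by (rule sC)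
sublocale CH: star_algebra CH by (rule sCH)

lemma wc: "w \<in> carrier CH" and w_left: "star CH w \<otimes>\<^sub>C\<^sub>H w = \<one>\<^sub>C\<^sub>H"
  and w_right: "w \<otimes>\<^sub>C\<^sub>H star CH w = \<one>\<^sub>C\<^sub>H"
  using w_unitary by (auto simp: unitary_def)

definition W :: "('h \<Rightarrow> complex) \<Rightarrow> (nat \<Rightarrow> ('a \<times> 'h) list set) set" where
  "W \<phi> = slice C \<phi> w"

lemma W_closed: "lin H complex_alg \<phi> \<Longrightarrow> W \<phi> \<in> carrier C"
  unfolding W_def by (rule slice_closed[OF cC cH _ wc])

lemma W_cong: "(\<And>k. k \<in> carrier H \<Longrightarrow> \<phi> k = \<psi> k) \<Longrightarrow> W \<phi> = W \<psi>"
  unfolding W_def by (rule slice_cong[OF cC cH wc])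

lemma lin_embed: "lin C CH (\<lambda>x. tens C H x \<one>\<^sub>H)"
  by (rule lin_tens_left[OF cC cH H.one_closed lin_id])

lemma slice_comult:
  assumes "lin H complex_alg \<phi>" "lin H complex_alg \<psi>"
  shows "slice C (tpair \<phi> \<psi>) (tmap C (tensor H H) id (comult H) w) = W (H.conv \<phi> \<psi>)"
proof -
  have "H.conv \<phi> \<psi> = (\<lambda>k. tpair \<phi> \<psi> (comult H k))"
    by (rule ext) (simp add: H.conv_def sw_def tpair_eq_teval)
  then show ?thesis
    unfolding W_def by (simp only: slice_tmap_id[OF cC cH H.cs2 H.lin_comult lin_tpair[OF cH cH assms] wc])
qed

lemma slice_w_right:
  assumes \<phi>: "lin H complex_alg \<phi>" and x: "x \<in> carrier C"
  shows "slice C \<phi> (w \<otimes>\<^sub>C\<^sub>H tens C H x \<one>\<^sub>H) = W \<phi> \<otimes>\<^sub>C x"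
proof -
  have "slice C (\<lambda>l. \<phi> (l \<otimes>\<^sub>H \<one>\<^sub>H)) w = W \<phi>"
    unfolding W_def by (rule slice_cong[OF cC cH wc]) (simp add: H.mult_one_right)
  then show ?thesis by (simp add: slice_tens_mult_right[OF sC sH \<phi> x H.one_closed wc])
qed

text \<open>The slice \<open>\<phi> \<otimes> \<psi>\<close> of the identity \<open>(w \<otimes> 1)(\<iota> \<otimes> id)(w) = (id \<otimes> \<Delta>)(w)\<close>.\<close>

lemma W_mult:
  assumes \<phi>: "lin H complex_alg \<phi>" and \<psi>: "lin H complex_alg \<psi>"
  shows "W \<phi> \<otimes>\<^sub>C W \<psi> = W (H.conv \<phi> \<psi>)"
proof -
  let ?i = "\<lambda>x. tens C H x \<one>\<^sub>H"
  let ?Y = "tmap CH H ?i id w"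
  have Y: "?Y \<in> carrier (tensor CH H)"
    by (rule linD(1)[OF lin_tmap[OF cC cH cCH cH lin_embed lin_id'] wc])
  let ?X = "tens CH H w \<one>\<^sub>H \<otimes>\<^bsub>tensor CH H\<^esub> ?Y"
  have X: "?X \<in> carrier (tensor CH H)"
    by (rule star_algebra.mult_closed[OF star_algebra_tensor[OF sCH sH] tens_closed[OF wc H.one_closed] Y])
  have one_left: "slice CH (\<lambda>l. \<psi> (\<one>\<^sub>H \<otimes>\<^sub>H l)) ?Y = slice CH \<psi> ?Y"
    by (rule slice_cong[OF cCH cH Y]) (simp add: H.mult_one_left)
  have "W (H.conv \<phi> \<psi>) = slice C (tpair \<phi> \<psi>) (tassoc C H H ?X)"
    by (simp only: w_trivial_cocycle slice_comult[OF \<phi> \<psi>])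
  also have "\<dots> = slice C \<phi> (slice CH \<psi> ?X)"
    by (rule slice_tassoc[OF cC cH cH \<phi> \<psi> X])
  also have "slice CH \<psi> ?X = w \<otimes>\<^sub>C\<^sub>H slice CH \<psi> ?Y"
    by (simp only: slice_tens_mult_left[OF sCH sH \<psi> wc H.one_closed Y] one_left)
  also have "slice CH \<psi> ?Y = ?i (W \<psi>)"
    unfolding W_def slice_tmap[OF cC cH cCH cH lin_embed lin_id' \<psi> wc] by simp
  also have "slice C \<phi> (w \<otimes>\<^sub>C\<^sub>H ?i (W \<psi>)) = W \<phi> \<otimes>\<^sub>C W \<psi>"
    by (rule slice_w_right[OF \<phi> W_closed[OF \<psi>]])
  finally show ?thesis ..
qed

lemma slice_one_CH: "lin H complex_alg \<phi> \<Longrightarrow> slice C \<phi> \<one>\<^sub>C\<^sub>H = \<phi> \<one>\<^sub>H \<odot>\<^sub>C \<one>\<^sub>C"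
  unfolding tensor_sel(3) by (rule slice_tens[OF cC cH _ C.one_closed H.one_closed])

text \<open>As \<open>W(\<phi>) W(\<epsilon>) = W(\<phi>)\<close> for all \<open>\<phi>\<close>, one has \<open>w (W(\<epsilon>) \<otimes> 1) = w\<close>, and \<open>w\<close> is invertible.\<close>

lemma W_counit: "W (counit H) = \<one>\<^sub>C"
proof -
  obtain n e f where co: "coordinates H n e f" using H.exists_basis by blast
  note c = coordinatesD[OF co] and le = H.lin_counit
  let ?u = "tens C H (W (counit H)) \<one>\<^sub>H"
  have W: "W (counit H) \<in> carrier C" by (rule W_closed[OF le])
  have u: "?u \<in> carrier CH" by (rule tens_closed[OF W H.one_closed])
  have "w \<otimes>\<^sub>C\<^sub>H ?u = w"
  proof (rule slices_separate[OF cC cH co CH.mult_closed[OF wc u] wc])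
    fix i assume "i < n"
    note fi = c(2)[OF this]
    have "slice C (f i) (w \<otimes>\<^sub>C\<^sub>H ?u) = W (H.conv (f i) (counit H))"
      by (simp only: slice_w_right[OF fi W] W_mult[OF fi le])
    also have "\<dots> = slice C (f i) w" unfolding W_def[symmetric] by (rule W_cong) (rule H.conv_counit(2)[OF fi])
    finally show "slice C (f i) (w \<otimes>\<^sub>C\<^sub>H ?u) = slice C (f i) w" .
  qed
  then have "star CH w \<otimes>\<^sub>C\<^sub>H w \<otimes>\<^sub>C\<^sub>H ?u = star CH w \<otimes>\<^sub>C\<^sub>H w"
    by (simp only: CH.mult_assoc[OF CH.star_closed[OF wc] wc u])
  then have "?u = \<one>\<^sub>C\<^sub>H" by (simp only: w_left CH.mult_one_left[OF u])
  then have "slice C (counit H) ?u = \<one>\<^sub>C"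
    by (simp add: slice_one_CH[OF le] H.counit_one cspace.scale_one[OF cC C.one_closed])
  then show ?thesis
    by (simp add: slice_tens[OF cC cH le W H.one_closed] H.counit_one cspace.scale_one[OF cC W])
qed

lemma W_scale: "lin H complex_alg \<phi> \<Longrightarrow> W (\<lambda>k. c * \<phi> k) = c \<odot>\<^sub>C W \<phi>"
  unfolding W_def by (rule slice_scale_functional[OF cC cH _ wc])

text \<open>The element \<open>(id \<otimes> S)(w)\<close> is a right inverse of \<open>w\<close> and therefore equal to \<open>w\<^sup>*\<close>.\<close>

lemma W_star:
  assumes \<phi>: "lin H complex_alg \<phi>"
  shows "star C (W \<phi>) = W (H.fstar \<phi>)"
proof -
  obtain n e f where co: "coordinates H n e f" using H.exists_basis by blast
  note c = coordinatesD[OF co]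
  let ?S = "antipode H"
  let ?w' = "tmap C H id ?S w"
  have w': "?w' \<in> carrier CH"
    by (rule linD(1)[OF lin_tmap[OF cC cH cC cH lin_id' H.lin_antipode] wc])
  have sw': "slice C \<psi> ?w' = W (\<lambda>k. \<psi> (?S k))" if "lin H complex_alg \<psi>" for \<psi>
    unfolding W_def by (rule slice_tmap_id[OF cC cH cH H.lin_antipode that wc])
  have "w \<otimes>\<^sub>C\<^sub>H ?w' = \<one>\<^sub>C\<^sub>H"
  proof (rule slices_separate[OF cC cH co CH.mult_closed[OF wc w'] CH.one_closed])
    fix j assume j: "j < n"
    note \<psi> = c(2)[OF j]
    let ?\<psi> = "\<lambda>i l. f j (e i \<otimes>\<^sub>H ?S l)"
    have l1: "lin H complex_alg (\<lambda>l. f j (k \<otimes>\<^sub>H l))" if "k \<in> carrier H" for k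
      by (rule lin_comp[OF \<psi> lin_mult_left[OF sH that lin_id]])
    have l2: "lin H complex_alg (\<lambda>l. f j (k \<otimes>\<^sub>H ?S l))" if "k \<in> carrier H" for k
      by (rule lin_comp[OF l1[OF that] H.lin_antipode])
    have "slice C (f j) (w \<otimes>\<^sub>C\<^sub>H ?w')
        = lsum C (\<lambda>i. slice C (f i) w \<otimes>\<^sub>C slice C (\<lambda>l. f j (e i \<otimes>\<^sub>H l)) ?w') [0..<n]"
      by (rule slice_mult_coordinates[OF sC sH co \<psi> wc w'])
    also have "\<dots> = lsum C (\<lambda>i. W (H.conv (f i) (?\<psi> i))) [0..<n]"
      using c by (intro lsum_cong) (simp add: sw'[OF l1] W_def[symmetric] W_mult[OF _ l2])
    also have "\<dots> = W (\<lambda>k. lsum complex_alg (\<lambda>i. H.conv (f i) (?\<psi> i) k) [0..<n])"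
      unfolding W_def using c by (intro slice_sum[OF cC cH wc, symmetric] H.lin_conv l2) auto
    also have "\<dots> = W (\<lambda>k. f j \<one>\<^sub>H * counit H k)"
    proof (rule W_cong)
      fix k assume k: "k \<in> carrier H"
      have "lsum complex_alg (\<lambda>i. H.conv (f i) (?\<psi> i) k) [0..<n]
          = sw H complex_alg (\<lambda>a b. lsum complex_alg (\<lambda>i. f i a * ?\<psi> i b) [0..<n]) k"
        unfolding H.conv_def sw_def teval_def case_prod_unfold
        by (rule cspace.lsum_swap[OF cspace_complex]) simp
      also have "\<dots> = sw H complex_alg (\<lambda>a b. f j (a \<otimes>\<^sub>H ?S b)) k"
      proof (rule H.sw_cong[OF k])
        fix a b assume a: "a \<in> carrier H" and b: "b \<in> carrier H"
        note Sb = H.antipode_closed[OF b]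
        have l: "lin H complex_alg (\<lambda>x. f j (x \<otimes>\<^sub>H ?S b))"
          by (rule lin_comp[OF \<psi> lin_mult_right[OF sH Sb lin_id]])
        have "f j (a \<otimes>\<^sub>H ?S b) = lsum complex_alg (\<lambda>i. f i a * ?\<psi> i b) [0..<n]"
          using lin_expand[OF cH cspace_complex co l a] by simp
        then show "lsum complex_alg (\<lambda>i. f i a * ?\<psi> i b) [0..<n] = f j (a \<otimes>\<^sub>H ?S b)" ..
      qed
      also have "\<dots> = f j \<one>\<^sub>H * counit H k"
        using H.sw_antipode_right[OF cspace_complex \<psi> k] by simp
      finally show "lsum complex_alg (\<lambda>i. H.conv (f i) (?\<psi> i) k) [0..<n] = f j \<one>\<^sub>H * counit H k" .
    qed
    also have "\<dots> = f j \<one>\<^sub>H \<odot>\<^sub>C \<one>\<^sub>C" by (simp only: W_scale[OF H.lin_counit] W_counit)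
    also have "f j \<one>\<^sub>H \<odot>\<^sub>C \<one>\<^sub>C = slice C (f j) \<one>\<^sub>C\<^sub>H" by (rule slice_one_CH[OF \<psi>, symmetric])
    finally show "slice C (f j) (w \<otimes>\<^sub>C\<^sub>H ?w') = slice C (f j) \<one>\<^sub>C\<^sub>H" .
  qed
  then have "star CH w \<otimes>\<^sub>C\<^sub>H (w \<otimes>\<^sub>C\<^sub>H ?w') = star CH w"
    by (simp add: CH.mult_one_right CH.star_closed wc)
  then have ws: "?w' = star CH w"
    by (simp only: CH.mult_assoc[OF CH.star_closed[OF wc] wc w', symmetric] w_left CH.mult_one_left[OF w'])
  let ?\<psi> = "\<lambda>k. cnj (\<phi> (star H k))"
  have \<psi>: "lin H complex_alg ?\<psi>"
    using lin_comp[OF lin_conj_conj[THEN iffD2, OF \<phi>] lin_star[OF sH]] by (simp add: lin_def)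
  have "slice C ?\<psi> (star CH w) = star C (slice C (\<lambda>k. cnj (?\<psi> (star H k))) w)"
    by (rule slice_star[OF sC sH \<psi> wc])
  also have "slice C (\<lambda>k. cnj (?\<psi> (star H k))) w = W \<phi>"
    unfolding W_def by (rule slice_cong[OF cC cH wc]) (simp add: H.star_star)
  finally have "star C (W \<phi>) = W (\<lambda>k. ?\<psi> (?S k))" by (simp only: ws[symmetric] sw'[OF \<psi>])
  then show ?thesis by (simp add: H.fstar_def[abs_def])
qed

text \<open>
  Elements \<open>R h\<close> of the crossed product on which the dual coaction acts as the comultiplication pass
  through \<open>W\<close> by the covariance of \<open>w\<close>.
\<close>

lemma const_dco_w:
  assumes b: "b \<in> carrier B"
  shows "tmap C H const id (dco b) \<otimes>\<^sub>C\<^sub>H w = w \<otimes>\<^sub>C\<^sub>H tens C H (const b) \<one>\<^sub>H"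
proof -
  have t: "tens C H (const b) \<one>\<^sub>H \<in> carrier CH" by (rule tens_closed[OF N.const_closed[OF b] H.one_closed])
  note clo = CH.mult_closed wc t CH.star_closed
  have "tmap C H const id (dco b) \<otimes>\<^sub>C\<^sub>H w = w \<otimes>\<^sub>C\<^sub>H tens C H (const b) \<one>\<^sub>H \<otimes>\<^sub>C\<^sub>H star CH w \<otimes>\<^sub>C\<^sub>H w"
    by (simp only: w_implements[OF b] Ad_def)
  also have "\<dots> = w \<otimes>\<^sub>C\<^sub>H tens C H (const b) \<one>\<^sub>H \<otimes>\<^sub>C\<^sub>H (star CH w \<otimes>\<^sub>C\<^sub>H w)"
    by (intro CH.mult_assoc clo)
  also have "\<dots> = w \<otimes>\<^sub>C\<^sub>H tens C H (const b) \<one>\<^sub>H"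
    unfolding w_left by (intro CH.mult_one_right clo)
  finally show ?thesis .
qed

lemma lin_const: "lin B C const" by (rule N.lin_const)

lemma W_rep:
  assumes v: "v \<in> carrier AD" and \<phi>: "lin H complex_alg \<phi>" and h: "h \<in> carrier H"
  shows "W \<phi> \<otimes>\<^sub>C const (rep v h)
    = sw H C (\<lambda>x y. const (rep v x) \<otimes>\<^sub>C W (\<lambda>l. \<phi> (y \<otimes>\<^sub>H l))) h"
proof -
  have rc: "lin H B (rep v)" by (rule lin_rep[OF v])
  have b1: "bil H H BH (\<lambda>x y. tens B H (rep v x) y)"
    by (intro bilI lin_tens_BH_left lin_tens_BH_right rc rep_closed v lin_id)
  have b2: "bil H H CH (\<lambda>x y. tens C H (const (rep v x)) y)"
    by (intro bilI lin_tens_left[OF cC cH] lin_tens_right[OF cC cH] lin_comp[OF lin_const rc]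
        N.const_closed rep_closed v lin_id)
  have "tmap C H const id (dco (rep v h)) = sw H CH (\<lambda>x y. tens C H (const (rep v x)) y) h"
  proof -
    have "tmap C H const id (sw H BH (\<lambda>x y. tens B H (rep v x) y) h)
        = sw H CH (\<lambda>x y. tmap C H const id (tens B H (rep v x) y)) h"
      by (rule H.lin_sw_apply[OF cBH cCH lin_tmap[OF cB cH cC cH lin_const lin_id'] b1 h])
    also have "\<dots> = sw H CH (\<lambda>x y. tens C H (const (rep v x)) y) h"
      by (rule H.sw_cong[OF h])
        (simp add: tmap_tens[OF cB cH cC cH lin_const lin_id'] rep_closed v)
    finally show ?thesis by (simp only: dco_rep[OF v h])
  qed
  then have "sw H CH (\<lambda>x y. tens C H (const (rep v x)) y) h \<otimes>\<^sub>C\<^sub>H w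
      = w \<otimes>\<^sub>C\<^sub>H tens C H (const (rep v h)) \<one>\<^sub>H"
    using const_dco_w[OF rep_closed[OF v h]] by simp
  then have "W \<phi> \<otimes>\<^sub>C const (rep v h)
      = slice C \<phi> (sw H CH (\<lambda>x y. tens C H (const (rep v x)) y) h \<otimes>\<^sub>C\<^sub>H w)"
    by (simp add: slice_w_right[OF \<phi> N.const_closed[OF rep_closed[OF v h]]])
  also have "\<dots> = sw H C (\<lambda>x y. slice C \<phi> (tens C H (const (rep v x)) y \<otimes>\<^sub>C\<^sub>H w)) h"
    by (rule H.lin_sw_apply[OF cCH cC lin_comp[OF lin_slice[OF cC cH \<phi>] tmult_lin(1)[OF sC sH wc]] b2 h])
  also have "\<dots> = sw H C (\<lambda>x y. const (rep v x) \<otimes>\<^sub>C W (\<lambda>l. \<phi> (y \<otimes>\<^sub>H l))) h"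
    unfolding W_def
    by (rule H.sw_cong[OF h], rule slice_tens_mult_left[OF sC sH \<phi> _ _ wc])
      (auto intro!: N.const_closed rep_closed v)
  finally show ?thesis .
qed

subsection \<open>Continuity of the slices of the dual coaction\<close>

lemma list_sum_L: "list_sum LB (map g is) m = list_sum B (map (\<lambda>i. g i m) is)"
  by (induction "is") (simp_all add: linf_def)

text \<open>
  By \<open>\<beta>(b) = w(b \<otimes> 1)w\<^sup>*\<close> the slices of the dual coaction \<open>\<beta>\<close> have the form \<open>\<Sum> s\<^sub>i b t\<^sub>i\<close> in \<open>B\<^sup>\<infinity>\<close>.
\<close>

lemma cexp_bounded:
  assumes \<phi>: "lin H complex_alg \<phi>"
  shows "N.bounded_map (cexp \<phi>)"
  unfolding N.bounded_map_def
proof (intro conjI lin_cexp[OF \<phi>])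
  obtain n e f where co: "coordinates H n e f" using H.exists_basis by blast
  note c = coordinatesD[OF co]
  have ws: "star CH w \<in> carrier CH" by (rule CH.star_closed[OF wc])
  let ?\<phi> = "\<lambda>i l. \<phi> (e i \<otimes>\<^sub>H l)"
  have l\<phi>: "lin H complex_alg (?\<phi> i)" if "i < n" for i
    by (rule lin_comp[OF \<phi> lin_mult_left[OF sH c(1)[OF that] lin_id]])
  have "\<exists>s\<in>carrier LB. slice C (f i) w = cls s" if "i < n" for i
    by (rule N.cls_surj[OF slice_closed[OF cC cH c(2)[OF that] wc]])
  then obtain s where s: "\<And>i. i < n \<Longrightarrow> s i \<in> carrier LB" "\<And>i. i < n \<Longrightarrow> slice C (f i) w = cls (s i)"
    by metis
  have "\<exists>s\<in>carrier LB. slice C (?\<phi> i) (star CH w) = cls s" if "i < n" for i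
    by (rule N.cls_surj[OF slice_closed[OF cC cH l\<phi>[OF that] ws]])
  then obtain t where t: "\<And>i. i < n \<Longrightarrow> t i \<in> carrier LB"
    "\<And>i. i < n \<Longrightarrow> slice C (?\<phi> i) (star CH w) = cls (t i)"
    by metis
  have "\<exists>S. \<forall>m. nrmB (s i m) \<le> S" if "i < n" for i using s(1)[OF that] by auto
  then obtain S where S: "\<And>i m. i < n \<Longrightarrow> nrmB (s i m) \<le> S i" by metis
  have "\<exists>S. \<forall>m. nrmB (t i m) \<le> S" if "i < n" for i using t(1)[OF that] by auto
  then obtain T where T: "\<And>i m. i < n \<Longrightarrow> nrmB (t i m) \<le> T i" by metis
  have sc: "s i m \<in> carrier B" and tc: "t i m \<in> carrier B" if "i < n" for i m
    using s(1)[OF that] t(1)[OF that] by auto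
  have S0: "0 \<le> S i" and T0: "0 \<le> T i" if "i < n" for i
    using S[OF that, of 0] T[OF that, of 0] N.nrm_nonneg[OF sc[OF that, of 0]] N.nrm_nonneg[OF tc[OF that, of 0]] by linarith+
  let ?K = "\<Sum>i\<leftarrow>[0..<n]. S i * T i"
  show "\<exists>K. \<forall>b\<in>carrier B. nrmB (cexp \<phi> b) \<le> K * nrmB b"
  proof (intro exI ballI)
    fix b assume b: "b \<in> carrier B"
    let ?b = "\<lambda>m::nat. b"
    note bL = N.L_const[OF b]
    note cb = N.const_closed[OF b]
    let ?tb = "tens C H (const b) \<one>\<^sub>H"
    have tb: "?tb \<in> carrier CH" by (rule tens_closed[OF cb H.one_closed])
    let ?Z = "?tb \<otimes>\<^sub>C\<^sub>H star CH w"
    have Z: "?Z \<in> carrier CH" by (rule CH.mult_closed[OF tb ws])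
    define u where "u m = lsum B (\<lambda>i. s i m \<otimes>\<^sub>B (b \<otimes>\<^sub>B t i m)) [0..<n]" for m
    have gL: "(\<lambda>m. s i m \<otimes>\<^sub>B (b \<otimes>\<^sub>B t i m)) \<in> carrier LB" if "i < n" for i
      by (intro N.L_mult s(1) t(1) that bL)
    have u_eq: "u = lsum LB (\<lambda>i m. s i m \<otimes>\<^sub>B (b \<otimes>\<^sub>B t i m)) [0..<n]"
      by (rule ext) (simp add: u_def list_sum_L)
    have uL: "u \<in> carrier LB"
      unfolding u_eq using gL by (intro cspace.lsum_closed[OF cL]) auto
    have "const (cexp \<phi> b) = slice C \<phi> (tmap C H const id (dco b))"
      unfolding cexp_def by (simp add: slice_tmap[OF cB cH cC cH lin_const lin_id' \<phi> dco_closed[OF b]])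
    also have "tmap C H const id (dco b) = w \<otimes>\<^sub>C\<^sub>H ?Z"
      unfolding w_implements[OF b] Ad_def by (rule CH.mult_assoc[OF wc tb ws])
    also have "slice C \<phi> (w \<otimes>\<^sub>C\<^sub>H ?Z) = lsum C (\<lambda>i. slice C (f i) w \<otimes>\<^sub>C slice C (?\<phi> i) ?Z) [0..<n]"
      by (rule slice_mult_coordinates[OF sC sH co \<phi> wc Z])
    also have "\<dots> = lsum C (\<lambda>i. cls (\<lambda>m. s i m \<otimes>\<^sub>B (b \<otimes>\<^sub>B t i m))) [0..<n]"
    proof (rule lsum_cong_upt)
      fix i assume i: "i < n"
      have "slice C (?\<phi> i) ?Z = const b \<otimes>\<^sub>C slice C (\<lambda>l. ?\<phi> i (\<one>\<^sub>H \<otimes>\<^sub>H l)) (star CH w)"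
        by (rule slice_tens_mult_left[OF sC sH l\<phi>[OF i] cb H.one_closed ws])
      also have "slice C (\<lambda>l. ?\<phi> i (\<one>\<^sub>H \<otimes>\<^sub>H l)) (star CH w) = cls (t i)"
        unfolding t(2)[OF i, symmetric] by (rule slice_cong[OF cC cH ws]) (simp add: H.mult_one_left)
      finally show "slice C (f i) w \<otimes>\<^sub>C slice C (?\<phi> i) ?Z = cls (\<lambda>m. s i m \<otimes>\<^sub>B (b \<otimes>\<^sub>B t i m))"
        by (simp only: s(2)[OF i] N.const_def N.cls_mult[OF bL t(1)[OF i]] N.cls_mult[OF s(1)[OF i] N.L_mult[OF bL t(1)[OF i]]])
    qed
    also have "\<dots> = cls u"
      unfolding u_eq using gL by (intro lin_lsum_apply[OF cL cC N.lin_cls, symmetric]) auto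
    finally have lim: "(\<lambda>m. nrmB (cexp \<phi> b \<ominus>\<^bsub>B\<^esub> u m)) \<longlonglongrightarrow> 0"
      unfolding N.const_def by (simp only: N.cls_eq_iff[OF uL N.L_const[OF cexp_closed[OF \<phi> b]]])
    have uc: "u m \<in> carrier B" for m using uL by auto
    have bound: "nrmB (lsum B (\<lambda>i. s i m \<otimes>\<^sub>B (b \<otimes>\<^sub>B t i m)) is) \<le> (\<Sum>i\<leftarrow>is. S i * T i) * nrmB b"
      if "set is \<subseteq> {..<n}" for m "is"
      using that
    proof (induction "is")
      case Nil
      then show ?case by (simp add: N.nrm_zero)
    next
      case (Cons i "is")
      then have i: "i < n" by simp
      have t1: "s i m \<otimes>\<^sub>B (b \<otimes>\<^sub>B t i m) \<in> carrier B" if "i < n" for i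
        by (intro B.mult_closed sc tc that b)
      have "nrmB (s i m \<otimes>\<^sub>B (b \<otimes>\<^sub>B t i m)) \<le> nrmB (s i m) * (nrmB b * nrmB (t i m))"
        using sc[OF i] tc[OF i] b by (intro order_trans[OF N.nrm_mult] mult_left_mono N.nrm_mult N.nrm_nonneg) (auto simp: B.mult_closed)
      also have "\<dots> \<le> S i * (nrmB b * T i)"
        using S[OF i] T[OF i] S0[OF i] T0[OF i] N.nrm_nonneg[OF b] N.nrm_nonneg[OF tc[OF i]] by (intro mult_mono) auto
      finally have "nrmB (s i m \<otimes>\<^sub>B (b \<otimes>\<^sub>B t i m)) \<le> S i * T i * nrmB b" by (simp add: algebra_simps)
      moreover have "lsum B (\<lambda>i. s i m \<otimes>\<^sub>B (b \<otimes>\<^sub>B t i m)) is \<in> carrier B"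
        using Cons.prems t1 by (intro cspace.lsum_closed[OF cB]) auto
      ultimately show ?case
        using N.nrm_triangle[OF t1[OF i], of "lsum B (\<lambda>i. s i m \<otimes>\<^sub>B (b \<otimes>\<^sub>B t i m)) is"] Cons
        by (simp add: algebra_simps)
    qed
    have ub: "nrmB (u m) \<le> ?K * nrmB b" for m unfolding u_def by (rule bound) auto
    have le: "nrmB (cexp \<phi> b) \<le> nrmB (cexp \<phi> b \<ominus>\<^bsub>B\<^esub> u m) + ?K * nrmB b" for m
    proof -
      interpret R: ring B by (rule B.is_ring)
      have "cexp \<phi> b = (cexp \<phi> b \<ominus>\<^bsub>B\<^esub> u m) \<oplus>\<^bsub>B\<^esub> u m"
        using cexp_closed[OF \<phi> b] uc[of m] by algebra
      then have "nrmB (cexp \<phi> b) \<le> nrmB (cexp \<phi> b \<ominus>\<^bsub>B\<^esub> u m) + nrmB (u m)"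
        using N.nrm_triangle[OF N.sub_closed[OF cexp_closed[OF \<phi> b] uc[of m]] uc[of m]] by simp
      then show ?thesis using ub[of m] by linarith
    qed
    have "(\<lambda>m. nrmB (cexp \<phi> b \<ominus>\<^bsub>B\<^esub> u m) + ?K * nrmB b) \<longlonglongrightarrow> 0 + ?K * nrmB b"
      by (intro tendsto_intros lim)
    then show "nrmB (cexp \<phi> b) \<le> ?K * nrmB b"
      using le by (intro LIMSEQ_le_const[of _ "?K * nrmB b"]) auto
  qed
qed

text \<open>With coordinates \<open>e\<^sub>i, f\<^sub>i\<close> of \<open>H\<close>, the tensor \<open>\<Sum> (E\<^sub>i(s\<^sub>m))\<^sub>m \<otimes> e\<^sub>i\<close>, with \<open>E\<^sub>i\<close> the slice of \<open>\<beta>\<close> along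
  \<open>f\<^sub>i\<close>, has the values \<open>\<beta>(s\<^sub>m)\<close>; the boundedness of the slices puts it into \<open>l\<^sup>\<infinity>(B) \<otimes> H\<close>.\<close>

lemma sco_slice:
  assumes s: "s \<in> carrier LB"
  shows "sco (cls s) \<in> carrier CH"
    and "lin H complex_alg \<phi> \<Longrightarrow> slice C \<phi> (sco (cls s)) = cls (\<lambda>m. cexp \<phi> (s m))"
proof -
  obtain n e f where co: "coordinates H n e f" using H.exists_basis by blast
  note c = coordinatesD[OF co]
  let ?P = "\<lambda>t. \<exists>b\<in>cls s. \<exists>T\<in>carrier (tensor LB H).
       (\<forall>m. tmap B H (\<lambda>s. s m) id T = dco (b m)) \<and> t = tmap C H cls id T"
  have lm: "lin LB B (\<lambda>s. s m)" for m by (rule linI) auto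
  have expL: "(\<lambda>m. cexp \<phi> (b m)) \<in> carrier LB" if "lin H complex_alg \<phi>" "b \<in> carrier LB" for \<phi> b
    by (rule N.bounded_map_L[OF cexp_bounded[OF that(1)] that(2)])
  have sl: "slice C \<phi> t = cls (\<lambda>m. cexp \<phi> (s m))" and tcl: "t \<in> carrier CH"
    if t: "?P t" and \<phi>: "lin H complex_alg \<phi>" for t \<phi>
  proof -
    obtain b T where b: "b \<in> cls s" and T: "T \<in> carrier (tensor LB H)"
      and bT: "\<And>m. tmap B H (\<lambda>s. s m) id T = dco (b m)" and tT: "t = tmap C H cls id T"
      using t by blast
    note bL = N.cls_subset[OF s b]
    show "t \<in> carrier CH" unfolding tT
      by (rule linD(1)[OF lin_tmap[OF cL cH cC cH N.lin_cls lin_id'] T])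
    have "slice LB \<phi> T = (\<lambda>m. cexp \<phi> (b m))"
    proof
      fix m
      have "cexp \<phi> (b m) = slice B \<phi> (tmap B H (\<lambda>s. s m) id T)" by (simp add: cexp_def bT)
      also have "\<dots> = slice LB \<phi> T m"
        using slice_tmap[OF cL cH cB cH lm lin_id' \<phi> T] by simp
      finally show "slice LB \<phi> T m = cexp \<phi> (b m)" ..
    qed
    then have "slice C \<phi> t = cls (\<lambda>m. cexp \<phi> (b m))"
      unfolding tT using slice_tmap[OF cL cH cC cH N.lin_cls lin_id' \<phi> T] by simp
    also have "\<dots> = cls (\<lambda>m. cexp \<phi> (s m))"
      by (rule N.bounded_map_cls[OF cexp_bounded[OF \<phi>] bL s])
        (use N.cls_eq_iff[OF s bL] N.cls_mem[OF s bL] b in blast)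
    finally show "slice C \<phi> t = cls (\<lambda>m. cexp \<phi> (s m))" .
  qed
  let ?T = "lsum (tensor LB H) (\<lambda>i. tens LB H (\<lambda>m. cexp (f i) (s m)) (e i)) [0..<n]"
  have T: "?T \<in> carrier (tensor LB H)"
    using c s expL by (intro cspace.lsum_closed[OF cspace_tensor[OF cL cH]]) (auto intro!: tens_closed simp del: N.L_sel)
  have "tmap B H (\<lambda>s. s m) id ?T = dco (s m)" for m
  proof -
    have sm: "s m \<in> carrier B" using s by auto
    have "tmap B H (\<lambda>s. s m) id ?T
        = lsum BH (\<lambda>i. tmap B H (\<lambda>s. s m) id (tens LB H (\<lambda>m. cexp (f i) (s m)) (e i))) [0..<n]"
      using c s expL
      by (intro lin_lsum_apply[OF cspace_tensor[OF cL cH] cBH lin_tmap[OF cL cH cB cH lm lin_id']])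
        (auto intro!: tens_closed simp del: N.L_sel)
    also have "\<dots> = lsum BH (\<lambda>i. tens B H (slice B (f i) (dco (s m))) (e i)) [0..<n]"
      using c s expL
      by (intro lsum_cong) (simp add: tmap_tens[OF cL cH cB cH lm lin_id'] cexp_def del: N.L_sel)
    also have "\<dots> = dco (s m)" by (rule tensor_coordinates[OF cB cH co dco_closed[OF sm], symmetric])
    finally show ?thesis .
  qed
  then have ex: "?P (tmap C H cls id ?T)" using T N.cls_self[OF s] by blast
  have uniq: "t = t'" if "?P t" "?P t'" for t t'
    by (rule slices_separate[OF cC cH co tcl[OF that(1) H.lin_counit] tcl[OF that(2) H.lin_counit]])
      (simp only: sl[OF that(1) c(2)] sl[OF that(2) c(2)])
  have "sco (cls s) = (THE t. ?P t)" by (simp only: seq_coaction_def)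
  moreover have "?P (THE t. ?P t)" by (rule theI[of ?P, OF ex]) (rule uniq[OF _ ex])
  ultimately have P: "?P (sco (cls s))" by simp
  show "sco (cls s) \<in> carrier CH" by (rule tcl[OF P H.lin_counit])
  show "lin H complex_alg \<phi> \<Longrightarrow> slice C \<phi> (sco (cls s)) = cls (\<lambda>m. cexp \<phi> (s m))" by (rule sl[OF P])
qed

lemma lin_sco: "lin C CH sco"
proof (rule linI)
  obtain n e f where co: "coordinates H n e f" using H.exists_basis by blast
  note c = coordinatesD[OF co]
  interpret CHc: cspace CH by (rule cCH)
  fix x assume "x \<in> carrier C"
  then obtain s where s: "s \<in> carrier LB" "x = cls s" using N.cls_surj by blast
  show xs: "sco x \<in> carrier CH" unfolding s(2) by (rule sco_slice(1)[OF s(1)])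
  have bm: "(\<lambda>m. cexp (f i) (s m)) \<in> carrier LB" if "i < n" "s \<in> carrier LB" for i s
    by (rule N.bounded_map_L[OF cexp_bounded[OF c(2)[OF that(1)]] that(2)])
  {
    fix k
    show "sco (k \<odot>\<^sub>C x) = k \<odot>\<^sub>C\<^sub>H sco x"
    proof (rule slices_separate[OF cC cH co])
      have ks: "k \<odot>\<^sub>C x = cls (\<lambda>m. k \<odot>\<^sub>B s m)" by (simp only: s(2) N.cls_scale[OF s(1)])
      note kL = N.L_scale[OF s(1)]
      show "sco (k \<odot>\<^sub>C x) \<in> carrier CH" unfolding ks by (rule sco_slice(1)[OF kL])
      show "k \<odot>\<^sub>C\<^sub>H sco x \<in> carrier CH" using xs by (rule CHc.scale_closed)
      fix i assume i: "i < n"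
      have sm: "s m \<in> carrier B" for m using s(1) by auto
      have "slice C (f i) (sco (k \<odot>\<^sub>C x)) = cls (\<lambda>m. k \<odot>\<^sub>B cexp (f i) (s m))"
        unfolding ks sco_slice(2)[OF kL c(2)[OF i]] by (simp only: linD(3)[OF lin_cexp[OF c(2)[OF i]] sm])
      also have "\<dots> = k \<odot>\<^sub>C slice C (f i) (sco x)"
        by (simp only: N.cls_scale[OF bm[OF i s(1)]] s(2) sco_slice(2)[OF s(1) c(2)[OF i]])
      finally show "slice C (f i) (sco (k \<odot>\<^sub>C x)) = slice C (f i) (k \<odot>\<^sub>C\<^sub>H sco x)"
        by (simp only: linD(3)[OF lin_slice[OF cC cH c(2)[OF i]] xs])
    qed
  }
  fix y assume "y \<in> carrier C"
  then obtain t where t: "t \<in> carrier LB" "y = cls t" using N.cls_surj by blast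
  have ys: "sco y \<in> carrier CH" unfolding t(2) by (rule sco_slice(1)[OF t(1)])
  show "sco (x \<oplus>\<^bsub>C\<^esub> y) = sco x \<oplus>\<^bsub>CH\<^esub> sco y"
  proof (rule slices_separate[OF cC cH co])
    have st: "x \<oplus>\<^bsub>C\<^esub> y = cls (\<lambda>m. s m \<oplus>\<^bsub>B\<^esub> t m)" by (simp only: s(2) t(2) N.cls_add[OF s(1) t(1)])
    note stL = N.L_add[OF s(1) t(1)]
    show "sco (x \<oplus>\<^bsub>C\<^esub> y) \<in> carrier CH" unfolding st by (rule sco_slice(1)[OF stL])
    show "sco x \<oplus>\<^bsub>CH\<^esub> sco y \<in> carrier CH" using xs ys by (rule CH.add_closed)
    fix i assume i: "i < n"
    have sm: "s m \<in> carrier B" "t m \<in> carrier B" for m using s(1) t(1) by auto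
    have "slice C (f i) (sco (x \<oplus>\<^bsub>C\<^esub> y)) = cls (\<lambda>m. cexp (f i) (s m) \<oplus>\<^bsub>B\<^esub> cexp (f i) (t m))"
      unfolding st sco_slice(2)[OF stL c(2)[OF i]] by (simp only: linD(2)[OF lin_cexp[OF c(2)[OF i]] sm])
    also have "\<dots> = slice C (f i) (sco x) \<oplus>\<^bsub>C\<^esub> slice C (f i) (sco y)"
      by (simp only: N.cls_add[OF bm[OF i s(1)] bm[OF i t(1)]] s(2) t(2)
          sco_slice(2)[OF s(1) c(2)[OF i]] sco_slice(2)[OF t(1) c(2)[OF i]])
    finally show "slice C (f i) (sco (x \<oplus>\<^bsub>C\<^esub> y)) = slice C (f i) (sco x \<oplus>\<^bsub>CH\<^esub> sco y)"
      by (simp only: linD(2)[OF lin_slice[OF cC cH c(2)[OF i]] xs ys])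
  qed
qed

text \<open>The slice \<open>\<phi> \<otimes> \<psi>\<close> of the identity \<open>(\<beta>\<^sup>\<infinity> \<otimes> id)(w)(w \<otimes> 1) = (id \<otimes> \<Delta>)(w)\<close>.\<close>

lemma sco_W:
  assumes \<phi>: "lin H complex_alg \<phi>" and \<psi>: "lin H complex_alg \<psi>"
  shows "slice C \<phi> (sco (W \<psi>) \<otimes>\<^sub>C\<^sub>H w) = W (H.conv \<phi> \<psi>)"
proof -
  let ?Y = "tmap CH H sco id w"
  have Y: "?Y \<in> carrier (tensor CH H)"
    by (rule linD(1)[OF lin_tmap[OF cC cH cCH cH lin_sco lin_id'] wc])
  let ?X = "?Y \<otimes>\<^bsub>tensor CH H\<^esub> tens CH H w \<one>\<^sub>H"
  have X: "?X \<in> carrier (tensor CH H)"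
    by (rule star_algebra.mult_closed[OF star_algebra_tensor[OF sCH sH] Y tens_closed[OF wc H.one_closed]])
  have one_right: "slice CH (\<lambda>l. \<psi> (l \<otimes>\<^sub>H \<one>\<^sub>H)) ?Y = slice CH \<psi> ?Y"
    by (rule slice_cong[OF cCH cH Y]) (simp add: H.mult_one_right)
  have "W (H.conv \<phi> \<psi>) = slice C (tpair \<phi> \<psi>) (tassoc C H H ?X)"
    by (simp only: w_cocycle slice_comult[OF \<phi> \<psi>])
  also have "\<dots> = slice C \<phi> (slice CH \<psi> ?X)"
    by (rule slice_tassoc[OF cC cH cH \<phi> \<psi> X])
  also have "slice CH \<psi> ?X = slice CH \<psi> ?Y \<otimes>\<^sub>C\<^sub>H w"
    by (simp only: slice_tens_mult_right[OF sCH sH \<psi> wc H.one_closed Y] one_right)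
  also have "slice CH \<psi> ?Y = sco (W \<psi>)"
    unfolding W_def slice_tmap[OF cC cH cCH cH lin_sco lin_id' \<psi> wc] by simp
  finally show ?thesis ..
qed

end

lemma slice_add_functional:
  assumes A: "cspace A" and K: "cspace K" and \<phi>: "lin K complex_alg \<phi>" and \<psi>: "lin K complex_alg \<psi>"
    and t: "t \<in> carrier (tensor A K)"
  shows "slice A (\<lambda>k. \<phi> k + \<psi> k) t = slice A \<phi> t \<oplus>\<^bsub>A\<^esub> slice A \<psi> t"
proof (rule tensor_ext[OF A K A _ _ _ t])
  have l: "lin K complex_alg (\<lambda>k. \<phi> k + \<psi> k)"
    using lin_add[OF cspace_complex \<phi> \<psi>] by simp
  show "lin (tensor A K) A (slice A (\<lambda>k. \<phi> k + \<psi> k))" by (rule lin_slice[OF A K l])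
  show "lin (tensor A K) A (\<lambda>t. slice A \<phi> t \<oplus>\<^bsub>A\<^esub> slice A \<psi> t)"
    by (rule lin_add[OF A lin_slice[OF A K \<phi>] lin_slice[OF A K \<psi>]])
  show "slice A (\<lambda>k. \<phi> k + \<psi> k) (tens A K a k) = slice A \<phi> (tens A K a k) \<oplus>\<^bsub>A\<^esub> slice A \<psi> (tens A K a k)"
    if "a \<in> carrier A" "k \<in> carrier K" for a k
    using that by (simp add: slice_tens[OF A K l] slice_tens[OF A K \<phi>] slice_tens[OF A K \<psi>] cspace.scale_add_left[OF A])
qed

context cstar_hopf_algebra
begin

lemma antipode_one: "antipode K \<one> = \<one>"
  using sw_antipode_left[OF cs lin_id one_closed] sw_one[OF cs bil_mult[OF lin_antipode lin_id]]
  by (simp add: counit_one cspace.scale_one[OF cs one_closed] mult_one_right antipode_closed one_closed)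

lemma conv_one: "lin K complex_alg \<phi> \<Longrightarrow> lin K complex_alg \<psi> \<Longrightarrow> conv \<phi> \<psi> \<one> = \<phi> \<one> * \<psi> \<one>"
  unfolding conv_def by (rule sw_one[OF cspace_complex bil_pair])

lemma bil_scale:
  assumes "lin K complex_alg \<phi>"
  shows "bil K K K (\<lambda>a b. \<phi> b \<odot> a)" "bil K K K (\<lambda>a b. \<phi> a \<odot> b)"
  by (rule bilI; (rule lin_scale_const[OF cs _ assms] | rule lin_const_scale[OF cs lin_id]); assumption)+

lemma conv_haar:
  assumes \<tau>: "haar \<tau>" and \<phi>: "lin K complex_alg \<phi>" and h: "h \<in> carrier K"
  shows "conv \<phi> \<tau> h = \<phi> \<one> * \<tau> h" "conv \<tau> \<phi> h = \<phi> \<one> * \<tau> h"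
proof -
  note lt = lin_tau[OF \<tau>]
  have b1: "bil K K K (\<lambda>a b. \<tau> b \<odot> a)" by (rule bil_scale(1)[OF lt])
  have b2: "bil K K K (\<lambda>a b. \<tau> a \<odot> b)" by (rule bil_scale(2)[OF lt])
  have "conv \<phi> \<tau> h = sw K complex_alg (\<lambda>a b. \<phi> (\<tau> b \<odot> a)) h"
    unfolding conv_def by (rule sw_cong[OF h]) (simp add: linD(3)[OF \<phi>])
  also have "\<dots> = \<phi> (sw K K (\<lambda>a b. \<tau> b \<odot> a) h)" by (rule lin_sw_apply[OF cs cspace_complex \<phi> b1 h, symmetric])
  also have "\<dots> = \<phi> \<one> * \<tau> h" by (simp add: tau_right[OF \<tau> h] linD(3)[OF \<phi>] one_closed)
  finally show "conv \<phi> \<tau> h = \<phi> \<one> * \<tau> h" .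
  have "conv \<tau> \<phi> h = sw K complex_alg (\<lambda>a b. \<phi> (\<tau> a \<odot> b)) h"
    unfolding conv_def by (rule sw_cong[OF h]) (simp add: linD(3)[OF \<phi>])
  also have "\<dots> = \<phi> (sw K K (\<lambda>a b. \<tau> a \<odot> b) h)" by (rule lin_sw_apply[OF cs cspace_complex \<phi> b2 h, symmetric])
  also have "\<dots> = \<phi> \<one> * \<tau> h" by (simp add: tau_left[OF \<tau> h] linD(3)[OF \<phi>] one_closed)
  finally show "conv \<tau> \<phi> h = \<phi> \<one> * \<tau> h" .
qed

text \<open>The two invariance properties are tested against the coordinate functionals.\<close>

lemma haarI:
  assumes \<tau>: "lin K complex_alg \<tau>" and one: "\<tau> \<one> = 1"
    and r: "\<And>\<phi> h. lin K complex_alg \<phi> \<Longrightarrow> h \<in> carrier K \<Longrightarrow> conv \<phi> \<tau> h = \<phi> \<one> * \<tau> h"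
    and l: "\<And>\<phi> h. lin K complex_alg \<phi> \<Longrightarrow> h \<in> carrier K \<Longrightarrow> conv \<tau> \<phi> h = \<phi> \<one> * \<tau> h"
  shows "haar \<tau>"
proof -
  obtain n e f where co: "coordinates K n e f" using exists_basis by blast
  note c = coordinatesD[OF co]
  interpret S: cspace K by (rule cs)
  have eq: "x = y" if "x \<in> carrier K" "y \<in> carrier K" "\<And>i. i < n \<Longrightarrow> f i x = f i y" for x y
  proof -
    have "lsum K (\<lambda>i. f i x \<odot> e i) [0..<n] = lsum K (\<lambda>i. f i y \<odot> e i) [0..<n]"
      using that(3) by (intro lsum_cong) auto
    then show ?thesis by (simp only: c(4)[OF that(1)] c(4)[OF that(2)])
  qed
  have b1: "bil K K K (\<lambda>a b. \<tau> b \<odot> a)" by (rule bil_scale(1)[OF \<tau>])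
  have b2: "bil K K K (\<lambda>a b. \<tau> a \<odot> b)" by (rule bil_scale(2)[OF \<tau>])
  have R: "sw K K (\<lambda>a b. \<tau> b \<odot> a) h = \<tau> h \<odot> \<one>" if h: "h \<in> carrier K" for h
  proof (rule eq[OF sw_closed[OF cs b1 h] S.scale_closed[OF one_closed]])
    fix i assume i: "i < n"
    note fi = c(2)[OF i]
    have "f i (sw K K (\<lambda>a b. \<tau> b \<odot> a) h) = sw K complex_alg (\<lambda>a b. f i (\<tau> b \<odot> a)) h"
      by (rule lin_sw_apply[OF cs cspace_complex fi b1 h])
    also have "\<dots> = conv (f i) \<tau> h"
      unfolding conv_def by (rule sw_cong[OF h]) (simp add: linD(3)[OF fi])
    also have "\<dots> = f i (\<tau> h \<odot> \<one>)" by (simp add: r[OF fi h] linD(3)[OF fi one_closed])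
    finally show "f i (sw K K (\<lambda>a b. \<tau> b \<odot> a) h) = f i (\<tau> h \<odot> \<one>)" .
  qed
  have L: "sw K K (\<lambda>a b. \<tau> a \<odot> b) h = \<tau> h \<odot> \<one>" if h: "h \<in> carrier K" for h
  proof (rule eq[OF sw_closed[OF cs b2 h] S.scale_closed[OF one_closed]])
    fix i assume i: "i < n"
    note fi = c(2)[OF i]
    have "f i (sw K K (\<lambda>a b. \<tau> a \<odot> b) h) = sw K complex_alg (\<lambda>a b. f i (\<tau> a \<odot> b)) h"
      by (rule lin_sw_apply[OF cs cspace_complex fi b2 h])
    also have "\<dots> = conv \<tau> (f i) h"
      unfolding conv_def by (rule sw_cong[OF h]) (simp add: linD(3)[OF fi])
    also have "\<dots> = f i (\<tau> h \<odot> \<one>)" by (simp add: l[OF fi h] linD(3)[OF fi one_closed])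
    finally show "f i (sw K K (\<lambda>a b. \<tau> a \<odot> b) h) = f i (\<tau> h \<odot> \<one>)" .
  qed
  show ?thesis unfolding haar_def using \<tau> one R L by blast
qed

end

context rohlin_coaction
begin

section \<open>The Haar functional\<close>

interpretation Cc: cspace C by (rule cC)

lemma W_add: "lin H complex_alg \<phi> \<Longrightarrow> lin H complex_alg \<psi> \<Longrightarrow> W (\<lambda>k. \<phi> k + \<psi> k) = W \<phi> \<oplus>\<^bsub>C\<^esub> W \<psi>"
  unfolding W_def by (rule slice_add_functional[OF cC cH _ _ wc])

lemma lin_shift: "lin H complex_alg \<phi> \<Longrightarrow> h \<in> carrier H \<Longrightarrow> lin H complex_alg (\<lambda>l. \<phi> (h \<otimes>\<^sub>H l))"
  by (rule lin_comp[OF _ lin_mult_left[OF sH _ lin_id]])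

lemma lin_W_shift:
  assumes \<phi>: "lin H complex_alg \<phi>"
  shows "lin H C (\<lambda>h. W (\<lambda>l. \<phi> (h \<otimes>\<^sub>H l)))"
  unfolding W_def slice_eq_teval
  by (intro lin_teval_const[OF cC cH cC wc] lin_scale_const[OF cC] lin_comp[OF \<phi>]
      lin_mult_right[OF sH] lin_id)

text \<open>
  By covariance the kernel of \<open>W\<close> is stable under \<open>\<phi> \<mapsto> \<phi>(h \<cdot>)\<close>, and it is an ideal.  So it contains
  \<open>k \<mapsto> \<phi>(S(k\<^sub>1) k\<^sub>2) = \<phi>(1) \<epsilon>(k)\<close> along with \<open>\<phi>\<close>, whence \<open>\<phi>(1) = 0\<close>, and \<open>\<phi>(h) = 0\<close> by translation.
\<close>

lemma W_inj:
  assumes ne: "\<one>\<^sub>C \<noteq> \<zero>\<^bsub>C\<^esub>" and \<phi>: "lin H complex_alg \<phi>" and W0: "W \<phi> = \<zero>\<^bsub>C\<^esub>" and h: "h \<in> carrier H"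
  shows "\<phi> h = 0"
proof -
  let ?S = "antipode H"
  let ?v = "\<one>\<^sub>A\<^sub>D"
  let ?I = "\<lambda>h. const (rep ?v h)"
  note v = one_AD
  have lI: "lin H C ?I" by (rule lin_comp[OF lin_const lin_rep[OF v]])
  have I_mult: "?I (a \<otimes>\<^sub>H b) = ?I a \<otimes>\<^sub>C ?I b" if "a \<in> carrier H" "b \<in> carrier H" for a b
    using that by (simp add: rep_mult[OF cocycle_one] N.const_mult rep_closed[OF v])
  have I_one: "?I \<one>\<^sub>H = \<one>\<^sub>C" by (simp add: rep_one[OF cocycle_one] N.const_one)
  have I_closed: "?I a \<in> carrier C" if "a \<in> carrier H" for a by (rule linD(1)[OF lI that])
  have shift: "W (\<lambda>l. \<phi> (h \<otimes>\<^sub>H l)) = \<zero>\<^bsub>C\<^esub>"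
    if \<phi>: "lin H complex_alg \<phi>" and W0: "W \<phi> = \<zero>\<^bsub>C\<^esub>" and h: "h \<in> carrier H" for \<phi> h
  proof -
    let ?w = "\<lambda>h. W (\<lambda>l. \<phi> (h \<otimes>\<^sub>H l))"
    note lw = lin_W_shift[OF \<phi>]
    have wcl: "?w b \<in> carrier C" if "b \<in> carrier H" for b by (rule linD(1)[OF lw that])
    have lI': "lin N C (\<lambda>x. ?I (g x))" if "lin N H g" for N :: "(complex, 'x, 'y) module_scheme" and g
      by (rule lin_comp[OF lI that])
    have lw': "lin N C (\<lambda>x. ?w (g x))" if "lin N H g" for N :: "(complex, 'x, 'y) module_scheme" and g
      by (rule lin_comp[OF lw that])
    note lr = lin_mult_left[OF sC] lin_mult_right[OF sC] lI' lw' H.lin_rules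
    note cr = C.mult_closed I_closed wcl H.clo_rules
    have "?w h = sw H C (\<lambda>a b. counit H a \<odot>\<^sub>C ?w b) h"
      by (rule H.sw_counit_left[OF cC lw h, symmetric])
    also have "\<dots> = sw H C (\<lambda>a b. sw H C (\<lambda>c d. ?I (?S c \<otimes>\<^sub>H d) \<otimes>\<^sub>C ?w b) a) h"
    proof (rule H.sw_cong[OF h])
      fix a b assume a: "a \<in> carrier H" and b: "b \<in> carrier H"
      have "sw H C (\<lambda>c d. ?I (?S c \<otimes>\<^sub>H d) \<otimes>\<^sub>C ?w b) a = counit H a \<odot>\<^sub>C (?I \<one>\<^sub>H \<otimes>\<^sub>C ?w b)"
        by (rule H.sw_antipode_left[OF cC _ a]) (intro lr cr b)
      then show "counit H a \<odot>\<^sub>C ?w b = sw H C (\<lambda>c d. ?I (?S c \<otimes>\<^sub>H d) \<otimes>\<^sub>C ?w b) a"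
        by (simp only: I_one C.mult_one_left[OF wcl[OF b]])
    qed
    also have "\<dots> = sw H C (\<lambda>a b. sw H C (\<lambda>c d. ?I (?S a \<otimes>\<^sub>H c) \<otimes>\<^sub>C ?w d) b) h"
      by (rule H.sw_assoc[OF cC h]) (intro lr cr; assumption)+
    also have "\<dots> = sw H C (\<lambda>a b. counit H b \<odot>\<^sub>C \<zero>\<^bsub>C\<^esub>) h"
    proof (rule H.sw_cong[OF h])
      fix a b assume a: "a \<in> carrier H" and b: "b \<in> carrier H"
      have Sa: "?I (?S a) \<in> carrier C" by (intro cr a)
      have "sw H C (\<lambda>c d. ?I (?S a \<otimes>\<^sub>H c) \<otimes>\<^sub>C ?w d) b = sw H C (\<lambda>c d. ?I (?S a) \<otimes>\<^sub>C (?I c \<otimes>\<^sub>C ?w d)) b"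
        using a by (intro H.sw_cong[OF b])
          (simp add: I_mult H.antipode_closed C.mult_assoc I_closed wcl)
      also have "\<dots> = ?I (?S a) \<otimes>\<^sub>C sw H C (\<lambda>c d. ?I c \<otimes>\<^sub>C ?w d) b"
        by (rule H.lin_sw_apply[OF cC cC lin_mult_left[OF sC Sa lin_id] _ b, symmetric])
          (intro bilI lr cr; assumption)
      also have "sw H C (\<lambda>c d. ?I c \<otimes>\<^sub>C ?w d) b = W \<phi> \<otimes>\<^sub>C ?I b" by (rule W_rep[OF v \<phi> b, symmetric])
      also have "?I (?S a) \<otimes>\<^sub>C (W \<phi> \<otimes>\<^sub>C ?I b) = \<zero>\<^bsub>C\<^esub>"
      proof -
        show ?thesis using Sa I_closed[OF b] by (simp only: W0 ring.ring_simprules(24,25)[OF C.is_ring])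
      qed
      finally show "sw H C (\<lambda>c d. ?I (?S a \<otimes>\<^sub>H c) \<otimes>\<^sub>C ?w d) b = counit H b \<odot>\<^sub>C \<zero>\<^bsub>C\<^esub>"
        by (simp only: Cc.scale_zero_right)
    qed
    also have "\<dots> = \<zero>\<^bsub>C\<^esub>"
      by (simp add: Cc.scale_zero_right sw_def teval_def case_prod_unfold Cc.lsum_zero)
    finally show ?thesis .
  qed
  have at_one: "\<phi> \<one>\<^sub>H = 0" if \<phi>: "lin H complex_alg \<phi>" and W0: "W \<phi> = \<zero>\<^bsub>C\<^esub>" for \<phi>
  proof -
    obtain n e f where co: "coordinates H n e f" using H.exists_basis by blast
    note c = coordinatesD[OF co]
    let ?g = "\<lambda>i. H.conv (\<lambda>l. f i (?S l)) (\<lambda>l. \<phi> (e i \<otimes>\<^sub>H l))"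
    have lf: "lin H complex_alg (\<lambda>l. f i (?S l))" if "i < n" for i
      by (rule lin_comp[OF c(2)[OF that] H.lin_antipode])
    have lg: "lin H complex_alg (?g i)" if "i < n" for i
      by (rule H.lin_conv[OF lf[OF that] lin_shift[OF \<phi> c(1)[OF that]]])
    have sum: "lsum complex_alg (\<lambda>i. ?g i k) [0..<n] = \<phi> \<one>\<^sub>H * counit H k" if k: "k \<in> carrier H" for k
    proof -
      have "lsum complex_alg (\<lambda>i. ?g i k) [0..<n]
          = sw H complex_alg (\<lambda>a b. lsum complex_alg (\<lambda>i. f i (?S a) * \<phi> (e i \<otimes>\<^sub>H b)) [0..<n]) k"
        unfolding H.conv_def sw_def teval_def case_prod_unfold
        by (rule cspace.lsum_swap[OF cspace_complex]) simp
      also have "\<dots> = sw H complex_alg (\<lambda>a b. \<phi> (?S a \<otimes>\<^sub>H b)) k"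
      proof (rule H.sw_cong[OF k])
        fix a b assume a: "a \<in> carrier H" and b: "b \<in> carrier H"
        note Sa = H.antipode_closed[OF a]
        have l: "lin H complex_alg (\<lambda>x. \<phi> (x \<otimes>\<^sub>H b))"
          by (rule lin_comp[OF \<phi> lin_mult_right[OF sH b lin_id]])
        have "\<phi> (?S a \<otimes>\<^sub>H b) = lsum complex_alg (\<lambda>i. f i (?S a) * \<phi> (e i \<otimes>\<^sub>H b)) [0..<n]"
          using lin_expand[OF cH cspace_complex co l Sa] by simp
        then show "lsum complex_alg (\<lambda>i. f i (?S a) * \<phi> (e i \<otimes>\<^sub>H b)) [0..<n] = \<phi> (?S a \<otimes>\<^sub>H b)" ..
      qed
      also have "\<dots> = \<phi> \<one>\<^sub>H * counit H k"
        using H.sw_antipode_left[OF cspace_complex \<phi> k] by simp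
      finally show ?thesis .
    qed
    have "\<phi> \<one>\<^sub>H \<odot>\<^sub>C \<one>\<^sub>C = W (\<lambda>k. \<phi> \<one>\<^sub>H * counit H k)"
      by (simp only: W_scale[OF H.lin_counit] W_counit)
    also have "\<dots> = W (\<lambda>k. lsum complex_alg (\<lambda>i. ?g i k) [0..<n])"
      by (rule W_cong) (simp only: sum)
    also have "\<dots> = lsum C (\<lambda>i. W (?g i)) [0..<n]"
      unfolding W_def using lg by (intro slice_sum[OF cC cH wc]) auto
    also have "\<dots> = lsum C (\<lambda>i. \<zero>\<^bsub>C\<^esub>) [0..<n]"
    proof (rule lsum_cong_upt)
      fix i assume i: "i < n"
      show "W (?g i) = \<zero>\<^bsub>C\<^esub>"
        unfolding W_mult[OF lf[OF i] lin_shift[OF \<phi> c(1)[OF i]], symmetric] shift[OF \<phi> W0 c(1)[OF i]]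
        by (rule ring.ring_simprules(25)[OF C.is_ring W_closed[OF lf[OF i]]])
    qed
    finally have z: "\<phi> \<one>\<^sub>H \<odot>\<^sub>C \<one>\<^sub>C = \<zero>\<^bsub>C\<^esub>" by (simp add: Cc.lsum_zero)
    show ?thesis
    proof (rule ccontr)
      assume nz: "\<phi> \<one>\<^sub>H \<noteq> 0"
      have "\<one>\<^sub>C = (1 / \<phi> \<one>\<^sub>H) \<odot>\<^sub>C (\<phi> \<one>\<^sub>H \<odot>\<^sub>C \<one>\<^sub>C)"
        using nz by (simp add: Cc.scale_scale C.one_closed Cc.scale_one)
      then show False using ne by (simp add: z Cc.scale_zero_right)
    qed
  qed
  have "\<phi> (h \<otimes>\<^sub>H \<one>\<^sub>H) = 0" by (rule at_one[OF lin_shift[OF \<phi> h] shift[OF \<phi> W0 h]])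
  then show ?thesis using h by (simp add: H.mult_one_right)
qed

text \<open>
  The functionals that vanish at \<open>1\<close> form an ideal of codimension one in \<open>H\<^sup>0\<close>.  Its image in the
  \<open>C\<^sup>*\<close>-algebra \<open>B\<^sup>\<infinity>\<close> has a unit, and the complement of this unit comes from a Haar functional.
\<close>

lemma exists_haar:
  assumes ne: "\<one>\<^sub>C \<noteq> \<zero>\<^bsub>C\<^esub>"
  shows "\<exists>\<tau>. H.haar \<tau>"
proof -
  obtain n e f where co: "coordinates H n e f" using H.exists_basis by blast
  note c = coordinatesD[OF co] and le = H.lin_counit
  interpret R: ring C by (rule C.is_ring)
  define J where "J = {W \<phi> | \<phi>. lin H complex_alg \<phi> \<and> \<phi> \<one>\<^sub>H = 0}"
  have lc: "lin H complex_alg (\<lambda>k. c * \<phi> k)" if "lin H complex_alg \<phi>" for c \<phi>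
    by (rule lin_cmult_left[OF that])
  have la: "lin H complex_alg (\<lambda>k. \<phi> k + \<psi> k)" if "lin H complex_alg \<phi>" "lin H complex_alg \<psi>" for \<phi> \<psi>
    using lin_add[OF cspace_complex that] by simp
  \<comment> \<open>The projection of \<open>\<phi>\<close> along \<open>\<epsilon>\<close> onto the functionals that vanish at \<open>1\<close>.\<close>
  define red where "red \<phi> k = \<phi> k + (- \<phi> \<one>\<^sub>H) * counit H k" for \<phi> :: "'h \<Rightarrow> complex" and k
  have lred: "lin H complex_alg (red \<phi>)" if "lin H complex_alg \<phi>" for \<phi>
    unfolding red_def by (intro la lc that le)
  have red1: "red \<phi> \<one>\<^sub>H = 0" for \<phi> by (simp add: red_def H.counit_one)
  have redJ: "W (red \<phi>) \<in> J" if "lin H complex_alg \<phi>" for \<phi>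
    unfolding J_def using lred[OF that] red1[of \<phi>] by blast
  have JI: "W \<phi> \<in> J" if "lin H complex_alg \<phi>" "\<phi> \<one>\<^sub>H = 0" for \<phi>
    unfolding J_def using that by blast
  have Jstar: "star C x \<in> J" if xJ: "x \<in> J" for x
  proof -
    obtain \<phi> where "x = W \<phi>" "lin H complex_alg \<phi>" "\<phi> \<one>\<^sub>H = 0" using xJ unfolding J_def by blast
    then show ?thesis using JI[OF H.lin_fstar, of \<phi>]
      by (simp add: W_star H.fstar_def H.antipode_one H.star_one)
  qed
  have "\<exists>f\<in>J. \<forall>x\<in>J. x \<otimes>\<^sub>C f = x"
  proof (rule C.right_unit[where J = J and y = "\<lambda>i. W (red (f i))" and n = n])
    show "x = \<zero>\<^bsub>C\<^esub>" if "x \<in> carrier C" "star C x \<otimes>\<^sub>C x = \<zero>\<^bsub>C\<^esub>" for x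
      by (rule N.Q_proper[OF that])
    show "J \<subseteq> carrier C" unfolding J_def using W_closed by blast
    have "W (\<lambda>k. 0 * counit H k) = \<zero>\<^bsub>C\<^esub>"
      by (simp only: W_scale[OF le] Cc.scale_zero[OF W_closed[OF le]])
    then show "\<zero>\<^bsub>C\<^esub> \<in> J" using JI[OF lc[OF le, of 0]] by simp
    show "x \<oplus>\<^bsub>C\<^esub> y \<in> J" if "x \<in> J" "y \<in> J" for x y
    proof -
      obtain \<phi> \<psi> where "x = W \<phi>" "lin H complex_alg \<phi>" "\<phi> \<one>\<^sub>H = 0" "y = W \<psi>" "lin H complex_alg \<psi>" "\<psi> \<one>\<^sub>H = 0"
        using \<open>x \<in> J\<close> \<open>y \<in> J\<close> unfolding J_def by blast
      then show ?thesis using JI[OF la, of \<phi> \<psi>] by (simp add: W_add)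
    qed
    show "c \<odot>\<^sub>C x \<in> J" if xJ: "x \<in> J" for c x
    proof -
      obtain \<phi> where "x = W \<phi>" "lin H complex_alg \<phi>" "\<phi> \<one>\<^sub>H = 0" using xJ unfolding J_def by blast
      then show ?thesis using JI[OF lc, of \<phi> c] by (simp add: W_scale)
    qed
    show "x \<otimes>\<^sub>C y \<in> J" if "x \<in> J" "y \<in> J" for x y
    proof -
      obtain \<phi> \<psi> where "x = W \<phi>" "lin H complex_alg \<phi>" "\<phi> \<one>\<^sub>H = 0" "y = W \<psi>" "lin H complex_alg \<psi>" "\<psi> \<one>\<^sub>H = 0"
        using \<open>x \<in> J\<close> \<open>y \<in> J\<close> unfolding J_def by blast
      then show ?thesis using JI[OF H.lin_conv, of \<phi> \<psi>] by (simp add: W_mult H.conv_one)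
    qed
    show "star C x \<in> J" if "x \<in> J" for x by (rule Jstar[OF that])
    show "W (red (f i)) \<in> J" if "i < n" for i by (rule redJ[OF c(2)[OF that]])
    show "\<exists>c. x = lsum C (\<lambda>i. c i \<odot>\<^sub>C W (red (f i))) [0..<n]" if xJ: "x \<in> J" for x
    proof -
      obtain \<phi> where \<phi>: "x = W \<phi>" "lin H complex_alg \<phi>" "\<phi> \<one>\<^sub>H = 0" using xJ unfolding J_def by blast
      have ex: "lsum complex_alg (\<lambda>i. \<phi> (e i) * f i k) [0..<n] = \<phi> k" if k: "k \<in> carrier H" for k
        using lin_expand[OF cH cspace_complex co \<phi>(2) k] by (simp add: mult.commute)
      have "W \<phi> = W (\<lambda>k. lsum complex_alg (\<lambda>i. \<phi> (e i) * red (f i) k) [0..<n])"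
      proof (rule W_cong)
        fix k assume k: "k \<in> carrier H"
        have "lsum complex_alg (\<lambda>i. \<phi> (e i) * red (f i) k) [0..<n]
            = (\<Sum>i\<leftarrow>[0..<n]. \<phi> (e i) * f i k) - (\<Sum>i\<leftarrow>[0..<n]. \<phi> (e i) * f i \<one>\<^sub>H) * counit H k"
          by (simp add: list_sum_complex red_def algebra_simps sum_list_subtractf sum_list_const_mult sum_list_mult_const)
        also have "\<dots> = \<phi> k - \<phi> \<one>\<^sub>H * counit H k"
          using ex[OF k] ex[OF H.one_closed] by (simp add: list_sum_complex)
        finally show "\<phi> k = lsum complex_alg (\<lambda>i. \<phi> (e i) * red (f i) k) [0..<n]" by (simp add: \<phi>(3))
      qed
      also have "\<dots> = lsum C (\<lambda>i. W (\<lambda>k. \<phi> (e i) * red (f i) k)) [0..<n]"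
        unfolding W_def using c lred by (intro slice_sum[OF cC cH wc] lc) auto
      also have "\<dots> = lsum C (\<lambda>i. \<phi> (e i) \<odot>\<^sub>C W (red (f i))) [0..<n]"
        using c lred by (intro lsum_cong W_scale) auto
      finally show ?thesis using \<phi>(1) by (intro exI[of _ "\<lambda>i. \<phi> (e i)"]) simp
    qed
  qed
  then obtain \<phi>0 where \<phi>0: "lin H complex_alg \<phi>0" "\<phi>0 \<one>\<^sub>H = 0"
    and ru: "\<And>x. x \<in> J \<Longrightarrow> x \<otimes>\<^sub>C W \<phi>0 = x"
    unfolding J_def by blast
  let ?f = "W \<phi>0"
  have fJ: "?f \<in> J" by (rule JI[OF \<phi>0])
  have fc: "?f \<in> carrier C" by (rule W_closed[OF \<phi>0(1)])
  have Jc: "x \<in> carrier C" if "x \<in> J" for x using that W_closed unfolding J_def by blast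
  have lu': "star C ?f \<otimes>\<^sub>C x = x" if x: "x \<in> J" for x
  proof -
    have "star C (star C x \<otimes>\<^sub>C ?f) = star C (star C x)" by (simp only: ru[OF Jstar[OF x]])
    then show ?thesis using Jc[OF x] fc by (simp add: C.star_mult C.star_closed C.star_star)
  qed
  have fs: "star C ?f = ?f" using ru[OF Jstar[OF fJ]] lu'[OF fJ] by simp
  have lu: "?f \<otimes>\<^sub>C x = x" if "x \<in> J" for x using lu'[OF that] by (simp only: fs)
  define \<tau> where "\<tau> k = counit H k + (-1) * \<phi>0 k" for k
  have lt: "lin H complex_alg \<tau>" unfolding \<tau>_def by (intro la lc le \<phi>0)
  have t1: "\<tau> \<one>\<^sub>H = 1" by (simp add: \<tau>_def H.counit_one \<phi>0)
  have Wt: "W \<tau> = \<one>\<^sub>C \<ominus>\<^bsub>C\<^esub> ?f"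
    unfolding \<tau>_def[abs_def] using fc
    by (simp only: W_add[OF le lc[OF \<phi>0(1)]] W_scale[OF \<phi>0(1)] W_counit Cc.scale_minus a_minus_def)
  have split: "W \<phi> = \<phi> \<one>\<^sub>H \<odot>\<^sub>C \<one>\<^sub>C \<oplus>\<^bsub>C\<^esub> W (red \<phi>)" if \<phi>: "lin H complex_alg \<phi>" for \<phi>
  proof -
    have "W \<phi> = W (\<lambda>k. \<phi> \<one>\<^sub>H * counit H k + red \<phi> k)" by (rule W_cong) (simp add: red_def)
    then show ?thesis by (simp only: W_add[OF lc[OF le] lred[OF \<phi>]] W_scale[OF le] W_counit)
  qed
  have absorb: "W \<phi> \<otimes>\<^sub>C W \<tau> = \<phi> \<one>\<^sub>H \<odot>\<^sub>C W \<tau>" "W \<tau> \<otimes>\<^sub>C W \<phi> = \<phi> \<one>\<^sub>H \<odot>\<^sub>C W \<tau>"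
    if \<phi>: "lin H complex_alg \<phi>" for \<phi>
  proof -
    let ?r = "W (red \<phi>)" and ?t = "W \<tau>"
    note rc = Jc[OF redJ[OF \<phi>]] and tc = W_closed[OF lt]
    have "?r \<otimes>\<^sub>C ?t = ?r \<ominus>\<^bsub>C\<^esub> ?r \<otimes>\<^sub>C ?f"
      unfolding Wt using rc fc C.one_closed C.mult_one_right[OF rc] by algebra
    then have r0: "?r \<otimes>\<^sub>C ?t = \<zero>\<^bsub>C\<^esub>" by (simp only: ru[OF redJ[OF \<phi>]] C.sub_self[OF rc])
    have "?t \<otimes>\<^sub>C ?r = ?r \<ominus>\<^bsub>C\<^esub> ?f \<otimes>\<^sub>C ?r"
      unfolding Wt using rc fc C.one_closed by algebra
    then have r1: "?t \<otimes>\<^sub>C ?r = \<zero>\<^bsub>C\<^esub>" by (simp only: lu[OF redJ[OF \<phi>]] C.sub_self[OF rc])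
    have oc: "\<phi> \<one>\<^sub>H \<odot>\<^sub>C \<one>\<^sub>C \<in> carrier C" by (rule Cc.scale_closed[OF C.one_closed])
    show "W \<phi> \<otimes>\<^sub>C ?t = \<phi> \<one>\<^sub>H \<odot>\<^sub>C ?t"
      unfolding split[OF \<phi>] C.mult_add_left[OF oc rc tc] r0 C.smult_mult_left[OF C.one_closed tc]
        C.mult_one_left[OF tc] by (rule C.add_zero_right[OF Cc.scale_closed[OF tc]])
    show "?t \<otimes>\<^sub>C W \<phi> = \<phi> \<one>\<^sub>H \<odot>\<^sub>C ?t"
      unfolding split[OF \<phi>] C.mult_add_right[OF oc rc tc] r1 C.smult_mult_right[OF tc C.one_closed]
        C.mult_one_right[OF tc] by (rule C.add_zero_right[OF Cc.scale_closed[OF tc]])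
  qed
  have inj: "\<phi> h = \<psi> h" if \<phi>: "lin H complex_alg \<phi>" and \<psi>: "lin H complex_alg \<psi>" and e: "W \<phi> = W \<psi>"
    and h: "h \<in> carrier H" for \<phi> \<psi> h
  proof -
    have "W (\<lambda>k. \<phi> k + (-1) * \<psi> k) = W \<psi> \<ominus>\<^bsub>C\<^esub> W \<psi>"
      using W_closed[OF \<psi>] by (simp only: W_add[OF \<phi> lc[OF \<psi>]] W_scale[OF \<psi>] e Cc.scale_minus a_minus_def)
    then have "W (\<lambda>k. \<phi> k + (-1) * \<psi> k) = \<zero>\<^bsub>C\<^esub>" using C.sub_self[OF W_closed[OF \<psi>]] by simp
    from W_inj[OF ne la[OF \<phi> lc[OF \<psi>]] this h] show ?thesis by simp
  qed
  have "H.haar \<tau>"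
  proof (rule H.haarI[OF lt t1])
    fix \<phi> h assume \<phi>: "lin H complex_alg \<phi>" and h: "h \<in> carrier H"
    show "H.conv \<phi> \<tau> h = \<phi> \<one>\<^sub>H * \<tau> h"
      by (rule inj[OF H.lin_conv[OF \<phi> lt] lc[OF lt] _ h])
        (simp only: W_mult[OF \<phi> lt, symmetric] absorb[OF \<phi>] W_scale[OF lt])
    show "H.conv \<tau> \<phi> h = \<phi> \<one>\<^sub>H * \<tau> h"
      by (rule inj[OF H.lin_conv[OF lt \<phi>] lc[OF lt] _ h])
        (simp only: W_mult[OF lt \<phi>, symmetric] absorb[OF \<phi>] W_scale[OF lt])
  qed
  then show ?thesis by blast
qed

end

section \<open>Casimir sums in algebras with representations of \<open>K\<close>\<close>

definition casimir_sum ::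
  "nat \<Rightarrow> (nat \<Rightarrow> 'k) \<Rightarrow> (nat \<Rightarrow> 'k) \<Rightarrow> ('b, 'n) star_alg_scheme \<Rightarrow> ('k \<Rightarrow> 'b) \<Rightarrow> ('k \<Rightarrow> 'b) \<Rightarrow> 'b \<Rightarrow> 'b" where
  "casimir_sum n e e' M f g b = lsum M (\<lambda>i. f (e i) \<otimes>\<^bsub>M\<^esub> (b \<otimes>\<^bsub>M\<^esub> g (e' i))) [0..<n]"

context cstar_hopf_algebra
begin

definition algebra_rep :: "('b, 'n) star_alg_scheme \<Rightarrow> ('k \<Rightarrow> 'b) \<Rightarrow> bool" where
  "algebra_rep M f \<longleftrightarrow> lin K M f \<and> f \<one> = \<one>\<^bsub>M\<^esub> \<and>
    (\<forall>h\<in>carrier K. \<forall>g\<in>carrier K. f (h \<otimes> g) = f h \<otimes>\<^bsub>M\<^esub> f g)"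

context
  fixes \<tau> :: "'k \<Rightarrow> complex" and n :: nat and e e' :: "nat \<Rightarrow> 'k"
    and M :: "('b, 'n) star_alg_scheme"
  assumes haar: "haar \<tau>" and db: "dual_bases \<tau> n e e'" and M: "star_algebra M"
begin

interpretation M: star_algebra M by (rule M)

lemmas cM = cspace_star_algebra[OF M]

abbreviation csum where "csum \<equiv> casimir_sum n e e' M"

lemma ec: "i < n \<Longrightarrow> e i \<in> carrier K" "i < n \<Longrightarrow> e' i \<in> carrier K"
  using db by (auto simp: dual_bases_def)

lemma algebra_repD:
  assumes "algebra_rep M f"
  shows "lin K M f" "f \<one> = \<one>\<^bsub>M\<^esub>" "h \<in> carrier K \<Longrightarrow> f h \<in> carrier M"
    "h \<in> carrier K \<Longrightarrow> g \<in> carrier K \<Longrightarrow> f (h \<otimes> g) = f h \<otimes>\<^bsub>M\<^esub> f g"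
  using assms by (auto simp: algebra_rep_def lin_def)

lemma casimir_sum_closed:
  "lin K M f \<Longrightarrow> lin K M g \<Longrightarrow> b \<in> carrier M \<Longrightarrow> csum f g b \<in> carrier M"
  unfolding casimir_sum_def using ec by (intro cspace.lsum_closed[OF cM]) (auto intro!: M.mult_closed dest: linD(1))

text \<open>The factor \<open>f(h)\<close> is moved across the Casimir tensor.\<close>

lemma casimir_sum_intertwines:
  assumes f: "algebra_rep M f" and g: "algebra_rep M g" and b: "b \<in> carrier M" and h: "h \<in> carrier K"
  shows "f h \<otimes>\<^bsub>M\<^esub> csum f g b = csum f g b \<otimes>\<^bsub>M\<^esub> g h"
proof -
  note F = algebra_repD[OF f] and G = algebra_repD[OF g]
  have cl: "f (e i) \<otimes>\<^bsub>M\<^esub> (b \<otimes>\<^bsub>M\<^esub> g (e' i)) \<in> carrier M" if "i < n" for i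
    using that ec b F(3) G(3) by (intro M.mult_closed) auto
  have bi: "bil K K M (\<lambda>x y. f x \<otimes>\<^bsub>M\<^esub> (b \<otimes>\<^bsub>M\<^esub> g y))"
    by (intro bilI lin_mult_left[OF M] lin_mult_right[OF M] F(1,3) G(1,3) M.mult_closed b; assumption)
  have "f h \<otimes>\<^bsub>M\<^esub> csum f g b = lsum M (\<lambda>i. f h \<otimes>\<^bsub>M\<^esub> (f (e i) \<otimes>\<^bsub>M\<^esub> (b \<otimes>\<^bsub>M\<^esub> g (e' i)))) [0..<n]"
    unfolding casimir_sum_def using cl by (intro lin_lsum_apply[OF cM cM lin_mult_left[OF M F(3)[OF h] lin_id]]) auto
  also have "\<dots> = lsum M (\<lambda>i. f (h \<otimes> e i) \<otimes>\<^bsub>M\<^esub> (b \<otimes>\<^bsub>M\<^esub> g (e' i))) [0..<n]"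
    using h ec b F(3) G(3) by (intro lsum_cong) (simp add: F(4) M.mult_assoc M.mult_closed)
  also have "\<dots> = lsum M (\<lambda>i. f (e i) \<otimes>\<^bsub>M\<^esub> (b \<otimes>\<^bsub>M\<^esub> g (e' i \<otimes> h))) [0..<n]"
    by (rule casimir[OF haar db cM bi h])
  also have "\<dots> = lsum M (\<lambda>i. f (e i) \<otimes>\<^bsub>M\<^esub> (b \<otimes>\<^bsub>M\<^esub> g (e' i)) \<otimes>\<^bsub>M\<^esub> g h) [0..<n]"
    using h ec b F(3) G(3) by (intro lsum_cong) (simp add: G(4) M.mult_assoc M.mult_closed)
  also have "\<dots> = csum f g b \<otimes>\<^bsub>M\<^esub> g h"
    unfolding casimir_sum_def using cl
    by (intro lin_lsum_apply[OF cM cM lin_mult_right[OF M G(3)[OF h] lin_id], symmetric]) auto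
  finally show ?thesis .
qed

lemma casimir_sum_left:
  assumes f: "lin K M f" and f': "lin K M f'" and g: "lin K M g" and b: "b \<in> carrier M" and y: "y \<in> carrier M"
    and c: "\<And>h. h \<in> carrier K \<Longrightarrow> y \<otimes>\<^bsub>M\<^esub> f h = f' h \<otimes>\<^bsub>M\<^esub> y"
  shows "y \<otimes>\<^bsub>M\<^esub> csum f g b = csum f' g (y \<otimes>\<^bsub>M\<^esub> b)"
proof -
  note cl = linD(1)[OF f] linD(1)[OF f'] linD(1)[OF g]
  have "y \<otimes>\<^bsub>M\<^esub> csum f g b = lsum M (\<lambda>i. y \<otimes>\<^bsub>M\<^esub> (f (e i) \<otimes>\<^bsub>M\<^esub> (b \<otimes>\<^bsub>M\<^esub> g (e' i)))) [0..<n]"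
    unfolding casimir_sum_def using ec b cl
    by (intro lin_lsum_apply[OF cM cM lin_mult_left[OF M y lin_id]]) (auto intro!: M.mult_closed)
  also have "\<dots> = csum f' g (y \<otimes>\<^bsub>M\<^esub> b)"
    unfolding casimir_sum_def using ec b y cl
    by (intro lsum_cong) (simp add: M.mult_assoc[symmetric] M.mult_closed c)
  finally show ?thesis .
qed

text \<open>
  Let \<open>x\<close> be the sum.  The dual bases at \<open>1\<close> give \<open>xp = p = px\<close>.  As \<open>x\<^sup>*x\<close> commutes with \<open>g\<close>, it equals
  \<open>\<Sum> g(e\<^sub>k) x\<^sup>*xp g(e'\<^sub>k) = \<Sum> g(e\<^sub>k) p g(e'\<^sub>k) = 1\<close>; and the sum with \<open>f\<close> and \<open>g\<close> exchanged is a right inverse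
  of \<open>x\<close>.
\<close>

lemma casimir_sum_unitary:
  assumes f: "algebra_rep M f" and g: "algebra_rep M g"
    and p: "p \<in> carrier M" "star M p = p"
    and pf: "\<And>h. h \<in> carrier K \<Longrightarrow> p \<otimes>\<^bsub>M\<^esub> (f h \<otimes>\<^bsub>M\<^esub> p) = \<tau> h \<odot>\<^bsub>M\<^esub> p"
    and pg: "\<And>h. h \<in> carrier K \<Longrightarrow> p \<otimes>\<^bsub>M\<^esub> (g h \<otimes>\<^bsub>M\<^esub> p) = \<tau> h \<odot>\<^bsub>M\<^esub> p"
    and sf: "csum f f p = \<one>\<^bsub>M\<^esub>" and sg: "csum g g p = \<one>\<^bsub>M\<^esub>"
    and inv: "\<And>h. h \<in> carrier K \<Longrightarrow> star M (csum f g p) \<otimes>\<^bsub>M\<^esub> csum f g p \<otimes>\<^bsub>M\<^esub> g h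
      = g h \<otimes>\<^bsub>M\<^esub> (star M (csum f g p) \<otimes>\<^bsub>M\<^esub> csum f g p)"
  shows "unitary M (csum f g p)"
proof -
  note F = algebra_repD[OF f] and G = algebra_repD[OF g]
  let ?x = "csum f g p" and ?y = "csum g f p"
  have x: "?x \<in> carrier M" by (rule casimir_sum_closed[OF F(1) G(1) p(1)])
  have y: "?y \<in> carrier M" by (rule casimir_sum_closed[OF G(1) F(1) p(1)])
  have s: "star M ?x \<in> carrier M" by (rule M.star_closed[OF x])
  have cl: "f (e i) \<in> carrier M" "g (e' i) \<in> carrier M" if "i < n" for i
    using that ec F(3) G(3) by auto
  have lr: "lin K M (\<lambda>h. f h \<otimes>\<^bsub>M\<^esub> p)" "lin K M (\<lambda>h. p \<otimes>\<^bsub>M\<^esub> g h)"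
    by (intro lin_mult_right[OF M] lin_mult_left[OF M] p F G)+
  have "?x \<otimes>\<^bsub>M\<^esub> p = lsum M (\<lambda>i. f (e i) \<otimes>\<^bsub>M\<^esub> (p \<otimes>\<^bsub>M\<^esub> g (e' i)) \<otimes>\<^bsub>M\<^esub> p) [0..<n]"
    unfolding casimir_sum_def using cl p
    by (intro lin_lsum_apply[OF cM cM lin_mult_right[OF M p(1) lin_id]]) (auto intro!: M.mult_closed)
  also have "\<dots> = lsum M (\<lambda>i. \<tau> (e' i \<otimes> \<one>) \<odot>\<^bsub>M\<^esub> (f (e i) \<otimes>\<^bsub>M\<^esub> p)) [0..<n]"
    using cl ec p by (intro lsum_cong)
      (simp add: M.mult_assoc M.mult_closed pg M.smult_mult_right mult_one_right)
  also have "\<dots> = f \<one> \<otimes>\<^bsub>M\<^esub> p" by (rule lin_basis_expansion(1)[OF haar db cM lr(1) one_closed])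
  finally have xp: "?x \<otimes>\<^bsub>M\<^esub> p = p" by (simp add: F(2) M.mult_one_left p)
  have "p \<otimes>\<^bsub>M\<^esub> ?x = lsum M (\<lambda>i. p \<otimes>\<^bsub>M\<^esub> (f (e i) \<otimes>\<^bsub>M\<^esub> (p \<otimes>\<^bsub>M\<^esub> g (e' i)))) [0..<n]"
    unfolding casimir_sum_def using cl p
    by (intro lin_lsum_apply[OF cM cM lin_mult_left[OF M p(1) lin_id]]) (auto intro!: M.mult_closed)
  also have "\<dots> = lsum M (\<lambda>i. \<tau> (\<one> \<otimes> e i) \<odot>\<^bsub>M\<^esub> (p \<otimes>\<^bsub>M\<^esub> g (e' i))) [0..<n]"
  proof (rule lsum_cong_upt)
    fix i assume i: "i < n"
    note c = cl[OF i]
    have "p \<otimes>\<^bsub>M\<^esub> (f (e i) \<otimes>\<^bsub>M\<^esub> (p \<otimes>\<^bsub>M\<^esub> g (e' i))) = p \<otimes>\<^bsub>M\<^esub> (f (e i) \<otimes>\<^bsub>M\<^esub> p) \<otimes>\<^bsub>M\<^esub> g (e' i)"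
      using c p by (simp add: M.mult_assoc M.mult_closed)
    then show "p \<otimes>\<^bsub>M\<^esub> (f (e i) \<otimes>\<^bsub>M\<^esub> (p \<otimes>\<^bsub>M\<^esub> g (e' i))) = \<tau> (\<one> \<otimes> e i) \<odot>\<^bsub>M\<^esub> (p \<otimes>\<^bsub>M\<^esub> g (e' i))"
      using c p ec(1)[OF i] by (simp add: pf M.smult_mult_left mult_one_left)
  qed
  also have "\<dots> = p \<otimes>\<^bsub>M\<^esub> g \<one>" by (rule lin_basis_expansion(2)[OF haar db cM lr(2) one_closed])
  finally have px: "p \<otimes>\<^bsub>M\<^esub> ?x = p" by (simp add: G(2) M.mult_one_right p)
  then have "star M (p \<otimes>\<^bsub>M\<^esub> ?x) = p" by (simp only: p(2))
  then have xsp: "star M ?x \<otimes>\<^bsub>M\<^esub> p = p" by (simp only: M.star_mult[OF p(1) x] p(2))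
  have "star M ?x \<otimes>\<^bsub>M\<^esub> ?x = star M ?x \<otimes>\<^bsub>M\<^esub> ?x \<otimes>\<^bsub>M\<^esub> csum g g p"
    by (simp add: sg M.mult_one_right M.mult_closed s x)
  also have "\<dots> = csum g g (star M ?x \<otimes>\<^bsub>M\<^esub> ?x \<otimes>\<^bsub>M\<^esub> p)"
    by (rule casimir_sum_left[OF G(1) G(1) G(1) p(1) M.mult_closed[OF s x] inv])
  finally have l: "star M ?x \<otimes>\<^bsub>M\<^esub> ?x = \<one>\<^bsub>M\<^esub>"
    by (simp only: M.mult_assoc[OF s x p(1)] xp xsp sg)
  have r: "?x \<otimes>\<^bsub>M\<^esub> ?y = \<one>\<^bsub>M\<^esub>"
    using casimir_sum_left[OF G(1) F(1) F(1) p(1) x casimir_sum_intertwines[OF f g p(1), symmetric]] by (simp only: xp sf)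
  have "star M ?x = star M ?x \<otimes>\<^bsub>M\<^esub> (?x \<otimes>\<^bsub>M\<^esub> ?y)" by (simp add: r M.mult_one_right s)
  also have "\<dots> = ?y" by (simp only: M.mult_assoc[OF s x y, symmetric] l M.mult_one_left[OF y])
  finally show ?thesis unfolding unitary_def using x l r by simp
qed

end

end

context coaction_of_dual
begin

lemma cocycleD: "cocycle v \<Longrightarrow> v \<in> carrier AD"
  by (simp add: cocycle_def)

lemma algebra_rep_rep: "cocycle v \<Longrightarrow> H.algebra_rep B (rep v)"
  by (simp add: H.algebra_rep_def lin_rep cocycleD rep_one rep_mult)

text \<open>As \<open>R(h) a (1 \<rtimes> g) = (v \<rho>(a))(h\<^sub>1) \<rtimes> h\<^sub>2 g\<close>, this is the collapse of \<open>\<Sum> e\<^sub>i\<^sub>1 \<otimes> e\<^sub>i\<^sub>2 e'\<^sub>i\<close>.\<close>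

lemma casimir_sum_ja:
  assumes \<tau>: "H.haar \<tau>" and db: "H.dual_bases \<tau> n e e'" and v: "v \<in> carrier AD" and a: "a \<in> carrier A"
  shows "casimir_sum n e e' B (rep v) (rep \<one>\<^sub>A\<^sub>D) (ja a) = ja (coef (v \<otimes>\<^sub>A\<^sub>D \<rho> a) (H.integral n e e'))"
proof -
  let ?t = "v \<otimes>\<^sub>A\<^sub>D \<rho> a"
  have t: "?t \<in> carrier AD" by (rule star_algebra.mult_closed[OF sAD v rho_closed[OF a]])
  have c: "e i \<in> carrier H" "e' i \<in> carrier H" if "i < n" for i
    using db that by (auto simp: H.dual_bases_def)
  have "casimir_sum n e e' B (rep v) (rep \<one>\<^sub>A\<^sub>D) (ja a)
      = lsum B (\<lambda>i. sw H B (\<lambda>x y. tens A H (coef ?t x) (y \<otimes>\<^sub>H e' i)) (e i)) [0..<n]"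
    unfolding casimir_sum_def
  proof (rule lsum_cong_upt)
    fix i assume "i < n"
    then have ei: "e i \<in> carrier H" "e' i \<in> carrier H" using c by auto
    have "rep v (e i) \<otimes>\<^sub>B (ja a \<otimes>\<^sub>B rep \<one>\<^sub>A\<^sub>D (e' i)) = sw H B (\<lambda>x y.
        tens A H (sw H A (\<lambda>c d. coef v c \<otimes>\<^sub>A act d a) x) (y \<otimes>\<^sub>H e' i)) (e i)"
      by (simp only: rep_unit[OF ei(2)] ja_ih[OF a ei(2)] rep_mult_tens[OF v ei(1) a ei(2)])
    also have "\<dots> = sw H B (\<lambda>x y. tens A H (coef ?t x) (y \<otimes>\<^sub>H e' i)) (e i)"
      by (rule H.sw_cong[OF ei(1)]) (simp only: coef_mult[OF v rho_closed[OF a]] act_eq)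
    finally show "rep v (e i) \<otimes>\<^sub>B (ja a \<otimes>\<^sub>B rep \<one>\<^sub>A\<^sub>D (e' i))
        = sw H B (\<lambda>x y. tens A H (coef ?t x) (y \<otimes>\<^sub>H e' i)) (e i)" .
  qed
  also have "\<dots> = ja (coef ?t (H.integral n e e'))"
    unfolding ja_def by (rule H.casimir_integral[OF \<tau> db cB bil_rep[OF t]])
  finally show ?thesis .
qed

end

section \<open>The projection of the Haar functional\<close>

context coaction_of_dual
begin

lemma intertwiner_iff':
  assumes v: "v \<in> carrier AD" and z: "z \<in> carrier A"
  shows "(\<forall>h\<in>carrier H. rep v h \<otimes>\<^sub>B ja z = ja z \<otimes>\<^sub>B rep \<one>\<^sub>A\<^sub>D h) \<longleftrightarrow>
    v \<otimes>\<^sub>A\<^sub>D \<rho> z = tens A D z \<one>\<^sub>D"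
  using intertwiner_iff[OF v z] by (simp only: rep_unit cong: ball_cong)

lemma lin_tens_one: "lin A AD (\<lambda>a. tens A D a \<one>\<^sub>D)"
  by (rule lin_tens_left[OF cA cD one_D lin_id])

lemma tens_one_mult:
  "a \<in> carrier A \<Longrightarrow> b \<in> carrier A \<Longrightarrow>
    tens A D a \<one>\<^sub>D \<otimes>\<^sub>A\<^sub>D tens A D b \<one>\<^sub>D = tens A D (a \<otimes>\<^sub>A b) \<one>\<^sub>D"
  by (simp only: tmult_tens[OF sA sD] one_D star_algebra.mult_one_left[OF sD one_D])

lemma tens_one_star:
  "a \<in> carrier A \<Longrightarrow> star AD (tens A D a \<one>\<^sub>D) = tens A D (star A a) \<one>\<^sub>D"
  by (simp only: tstar_tens[OF sA sD] one_D star_algebra.star_one[OF sD])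

text \<open>Here \<open>\<rho>(z\<^sup>*z) = \<rho>(z)\<^sup>* v\<^sup>* v \<rho>(z)\<close>.\<close>

lemma rho_square:
  assumes v: "unitary AD v" and z: "z \<in> carrier A" and e: "v \<otimes>\<^sub>A\<^sub>D \<rho> z = tens A D z \<one>\<^sub>D"
  shows "\<rho> (star A z \<otimes>\<^sub>A z) = tens A D (star A z \<otimes>\<^sub>A z) \<one>\<^sub>D"
proof -
  interpret AD: star_algebra AD by (rule sAD)
  let ?r = "\<rho> z"
  have vc: "v \<in> carrier AD" and vl: "star AD v \<otimes>\<^sub>A\<^sub>D v = \<one>\<^sub>A\<^sub>D" using v by (auto simp: unitary_def)
  note r = rho_closed[OF z]
  note cl = AD.star_closed[OF vc] AD.star_closed[OF r] AD.mult_closed[OF vc r] vc r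
  have "\<rho> (star A z \<otimes>\<^sub>A z) = star AD ?r \<otimes>\<^sub>A\<^sub>D (star AD v \<otimes>\<^sub>A\<^sub>D v \<otimes>\<^sub>A\<^sub>D ?r)"
    by (simp only: rho_mult[OF A.star_closed[OF z] z] rho_star[OF z] vl AD.mult_one_left[OF r])
  also have "\<dots> = star AD (v \<otimes>\<^sub>A\<^sub>D ?r) \<otimes>\<^sub>A\<^sub>D (v \<otimes>\<^sub>A\<^sub>D ?r)"
    by (simp only: AD.star_mult[OF vc r] AD.mult_assoc[OF cl(1,4,5)] AD.mult_assoc[OF cl(2,1,3)])
  also have "\<dots> = tens A D (star A z \<otimes>\<^sub>A z) \<one>\<^sub>D"
    by (simp only: e tens_one_star[OF z] tens_one_mult[OF A.star_closed[OF z] z])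
  finally show ?thesis .
qed

end

context rohlin_coaction
begin

definition R :: "('a \<times> ('h \<Rightarrow> complex)) list set \<Rightarrow> 'h \<Rightarrow> (nat \<Rightarrow> ('a \<times> 'h) list set) set" where
  "R u h = const (rep u h)"

lemma lin_R: "u \<in> carrier AD \<Longrightarrow> lin H C (R u)"
  unfolding R_def[abs_def] by (rule lin_comp[OF lin_const lin_rep])

lemma R_closed: "u \<in> carrier AD \<Longrightarrow> h \<in> carrier H \<Longrightarrow> R u h \<in> carrier C"
  by (rule linD(1)[OF lin_R])

lemma R_one: "cocycle u \<Longrightarrow> R u \<one>\<^sub>H = \<one>\<^sub>C"
  by (simp add: R_def rep_one N.const_one)

lemma R_mult: "cocycle u \<Longrightarrow> h \<in> carrier H \<Longrightarrow> g \<in> carrier H \<Longrightarrow> R u (h \<otimes>\<^sub>H g) = R u h \<otimes>\<^sub>C R u g"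
  by (simp add: R_def rep_mult N.const_mult rep_closed cocycleD)

lemma algebra_rep_R: "cocycle u \<Longrightarrow> H.algebra_rep C (R u)"
  by (simp add: H.algebra_rep_def lin_R cocycleD R_one R_mult)

context
  fixes \<tau> :: "'h \<Rightarrow> complex" and n :: nat and e e' :: "nat \<Rightarrow> 'h"
  assumes haar: "H.haar \<tau>" and db: "H.dual_bases \<tau> n e e'"
begin

lemmas lt = H.lin_tau[OF haar] and pc = W_closed[OF H.lin_tau[OF haar]]

lemma basis_closed: "i < n \<Longrightarrow> e i \<in> carrier H" "i < n \<Longrightarrow> e' i \<in> carrier H"
  using db by (auto simp: H.dual_bases_def)

lemma p_absorbs:
  assumes \<phi>: "lin H complex_alg \<phi>"
  shows "W \<phi> \<otimes>\<^sub>C W \<tau> = \<phi> \<one>\<^sub>H \<odot>\<^sub>C W \<tau>" "W \<tau> \<otimes>\<^sub>C W \<phi> = \<phi> \<one>\<^sub>H \<odot>\<^sub>C W \<tau>"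
  unfolding W_mult[OF \<phi> lt] W_mult[OF lt \<phi>] W_scale[OF lt, symmetric]
  by (rule W_cong, rule H.conv_haar[OF haar \<phi>], assumption)+

text \<open>Absorption gives \<open>pp\<^sup>* = p\<close>.\<close>

lemma p_star: "star C (W \<tau>) = W \<tau>"
proof -
  have "W \<tau> \<otimes>\<^sub>C star C (W \<tau>) = H.fstar \<tau> \<one>\<^sub>H \<odot>\<^sub>C W \<tau>"
    unfolding W_star[OF lt] by (rule p_absorbs(2)[OF H.lin_fstar[OF lt]])
  also have "\<dots> = W \<tau>"
    by (simp add: H.fstar_def H.antipode_one H.star_one H.tau_one[OF haar] cspace.scale_one[OF cC pc])
  finally have pp: "W \<tau> \<otimes>\<^sub>C star C (W \<tau>) = W \<tau>" .
  then have "star C (W \<tau>) = star C (W \<tau> \<otimes>\<^sub>C star C (W \<tau>))" by (simp only: pp)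
  also have "\<dots> = W \<tau> \<otimes>\<^sub>C star C (W \<tau>)" by (simp only: C.star_mult[OF pc C.star_closed[OF pc]] C.star_star[OF pc])
  also note pp
  finally show ?thesis .
qed

text \<open>Covariance turns \<open>p R(h) p\<close> into \<open>R(h\<^sub>1) W(\<tau>(h\<^sub>2 \<cdot>)) p = R(h\<^sub>1 \<tau>(h\<^sub>2)) p\<close>.\<close>

lemma p_rep_p:
  assumes u: "cocycle u" and h: "h \<in> carrier H"
  shows "W \<tau> \<otimes>\<^sub>C (R u h \<otimes>\<^sub>C W \<tau>) = \<tau> h \<odot>\<^sub>C W \<tau>"
proof -
  note uc = cocycleD[OF u]
  let ?S = "\<lambda>y. W (\<lambda>l. \<tau> (y \<otimes>\<^sub>H l))"
  note ls = lin_W_shift[OF lt]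
  have b: "bil H H C (\<lambda>x y. R u x \<otimes>\<^sub>C ?S y)"
    by (intro bilI lin_mult_left[OF sC] lin_mult_right[OF sC] lin_R[OF uc] ls R_closed[OF uc] linD(1)[OF ls]; assumption)
  have lp: "lin H C (\<lambda>x. R u x \<otimes>\<^sub>C W \<tau>)" by (rule lin_mult_right[OF sC pc lin_R[OF uc]])
  have "W \<tau> \<otimes>\<^sub>C (R u h \<otimes>\<^sub>C W \<tau>) = sw H C (\<lambda>x y. R u x \<otimes>\<^sub>C ?S y) h \<otimes>\<^sub>C W \<tau>"
    using C.mult_assoc[OF pc R_closed[OF uc h] pc] W_rep[OF uc lt h] by (simp add: R_def)
  also have "\<dots> = sw H C (\<lambda>x y. R u x \<otimes>\<^sub>C ?S y \<otimes>\<^sub>C W \<tau>) h"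
    by (rule H.lin_sw_apply[OF cC cC lin_mult_right[OF sC pc lin_id] b h])
  also have "\<dots> = sw H C (\<lambda>x y. R u (\<tau> y \<odot>\<^sub>H x) \<otimes>\<^sub>C W \<tau>) h"
  proof (rule H.sw_cong[OF h])
    fix x y assume x: "x \<in> carrier H" and y: "y \<in> carrier H"
    have "?S y \<otimes>\<^sub>C W \<tau> = \<tau> y \<odot>\<^sub>C W \<tau>"
      using p_absorbs(1)[OF lin_shift[OF lt y]] by (simp only: H.mult_one_right[OF y])
    then show "R u x \<otimes>\<^sub>C ?S y \<otimes>\<^sub>C W \<tau> = R u (\<tau> y \<odot>\<^sub>H x) \<otimes>\<^sub>C W \<tau>"
      using R_closed[OF uc x] pc linD(1)[OF ls y]
      by (simp only: C.mult_assoc linD(3)[OF lin_R[OF uc] x] C.smult_mult_left C.smult_mult_right)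
  qed
  also have "\<dots> = R u (sw H H (\<lambda>x y. \<tau> y \<odot>\<^sub>H x) h) \<otimes>\<^sub>C W \<tau>"
    by (rule H.lin_sw_apply[OF cH cC lp H.bil_scale(1)[OF lt] h, symmetric])
  also have "\<dots> = \<tau> h \<odot>\<^sub>C W \<tau>"
    by (simp only: H.tau_right[OF haar h] linD(3)[OF lp H.one_closed] R_one[OF u] C.mult_one_left[OF pc])
  finally show ?thesis .
qed

text \<open>
  Covariance and the expansion of \<open>W(\<tau>(y \<cdot>))\<close> in coordinates \<open>d\<^sub>j, f\<^sub>j\<close> reduce the sum to
  \<open>\<Sum> R(\<epsilon>(d\<^sub>j) 1) W(f\<^sub>j) = W(\<epsilon>)\<close>.
\<close>

lemma casimir_sum_p:
  assumes u: "cocycle u"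
  shows "casimir_sum n e e' C (R u) (R u) (W \<tau>) = \<one>\<^sub>C"
proof -
  note uc = cocycleD[OF u]
  obtain m d f where co: "coordinates H m d f" using H.exists_basis by blast
  note c = coordinatesD[OF co]
  let ?g = "\<lambda>j. sw H H (\<lambda>x y. \<tau> (y \<otimes>\<^sub>H d j) \<odot>\<^sub>H x)"
  have lj: "lin H complex_alg (\<lambda>y. \<tau> (y \<otimes>\<^sub>H d j))" if "j < m" for j
    by (rule lin_comp[OF lt lin_mult_right[OF sH c(1)[OF that] lin_id]])
  note bj = H.bil_scale(1)[OF lj]
  have gc: "?g j h \<in> carrier H" if "j < m" "h \<in> carrier H" for j h
    by (rule H.sw_closed[OF cH bj[OF that(1)] that(2)])
  note Wf = W_closed[OF c(2)] and Rc = R_closed[OF uc]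
  have pR: "W \<tau> \<otimes>\<^sub>C R u h = lsum C (\<lambda>j. R u (?g j h) \<otimes>\<^sub>C W (f j)) [0..<m]" if h: "h \<in> carrier H" for h
  proof -
    have "W \<tau> \<otimes>\<^sub>C R u h = sw H C (\<lambda>x y. R u x \<otimes>\<^sub>C W (\<lambda>l. \<tau> (y \<otimes>\<^sub>H l))) h"
      unfolding R_def by (rule W_rep[OF uc lt h])
    also have "\<dots> = sw H C (\<lambda>x y. lsum C (\<lambda>j. R u (\<tau> (y \<otimes>\<^sub>H d j) \<odot>\<^sub>H x) \<otimes>\<^sub>C W (f j)) [0..<m]) h"
    proof (rule H.sw_cong[OF h])
      fix x y assume x: "x \<in> carrier H" and y: "y \<in> carrier H"
      have "R u x \<otimes>\<^sub>C W (\<lambda>l. \<tau> (y \<otimes>\<^sub>H l))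
          = R u x \<otimes>\<^sub>C lsum C (\<lambda>j. \<tau> (y \<otimes>\<^sub>H d j) \<odot>\<^sub>C W (f j)) [0..<m]"
        unfolding W_def by (simp only: slice_expand[OF cC cH co lin_shift[OF lt y] wc])
      also have "\<dots> = lsum C (\<lambda>j. R u x \<otimes>\<^sub>C (\<tau> (y \<otimes>\<^sub>H d j) \<odot>\<^sub>C W (f j))) [0..<m]"
        using Wf by (intro lin_lsum_apply[OF cC cC lin_mult_left[OF sC Rc[OF x] lin_id]])
          (auto intro: cspace.scale_closed[OF cC])
      also have "\<dots> = lsum C (\<lambda>j. R u (\<tau> (y \<otimes>\<^sub>H d j) \<odot>\<^sub>H x) \<otimes>\<^sub>C W (f j)) [0..<m]"
        using Wf Rc[OF x] by (intro lsum_cong)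
          (simp add: linD(3)[OF lin_R[OF uc] x] C.smult_mult_left C.smult_mult_right)
      finally show "R u x \<otimes>\<^sub>C W (\<lambda>l. \<tau> (y \<otimes>\<^sub>H l)) = \<dots>" .
    qed
    also have "\<dots> = lsum C (\<lambda>j. sw H C (\<lambda>x y. R u (\<tau> (y \<otimes>\<^sub>H d j) \<odot>\<^sub>H x) \<otimes>\<^sub>C W (f j)) h) [0..<m]"
      unfolding sw_def teval_def case_prod_unfold
      using terms_mem[OF cH cH H.comult_closed[OF h]] Wf
      by (intro cspace.lsum_swap[OF cC]) (auto intro!: C.mult_closed Rc cspace.scale_closed[OF cH])
    also have "\<dots> = lsum C (\<lambda>j. R u (?g j h) \<otimes>\<^sub>C W (f j)) [0..<m]"
      using Wf by (intro lsum_cong H.lin_sw_apply[OF cH cC lin_mult_right[OF sC _ lin_R[OF uc]] bj h, symmetric]) auto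
    finally show ?thesis .
  qed
  have "casimir_sum n e e' C (R u) (R u) (W \<tau>)
      = lsum C (\<lambda>i. lsum C (\<lambda>j. R u (e i \<otimes>\<^sub>H ?g j (e' i)) \<otimes>\<^sub>C W (f j)) [0..<m]) [0..<n]"
    unfolding casimir_sum_def
  proof (rule lsum_cong_upt)
    fix i assume "i < n"
    then have ei: "e i \<in> carrier H" "e' i \<in> carrier H" using basis_closed by auto
    have "R u (e i) \<otimes>\<^sub>C (W \<tau> \<otimes>\<^sub>C R u (e' i))
        = lsum C (\<lambda>j. R u (e i) \<otimes>\<^sub>C (R u (?g j (e' i)) \<otimes>\<^sub>C W (f j))) [0..<m]"
      unfolding pR[OF ei(2)] using Wf gc ei
      by (intro lin_lsum_apply[OF cC cC lin_mult_left[OF sC Rc[OF ei(1)] lin_id]]) (auto intro!: C.mult_closed Rc)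
    also have "\<dots> = lsum C (\<lambda>j. R u (e i \<otimes>\<^sub>H ?g j (e' i)) \<otimes>\<^sub>C W (f j)) [0..<m]"
      using Wf gc ei by (intro lsum_cong) (simp add: R_mult[OF u] C.mult_assoc Rc)
    finally show "R u (e i) \<otimes>\<^sub>C (W \<tau> \<otimes>\<^sub>C R u (e' i)) = \<dots>" .
  qed
  also have "\<dots> = lsum C (\<lambda>j. lsum C (\<lambda>i. R u (e i \<otimes>\<^sub>H ?g j (e' i)) \<otimes>\<^sub>C W (f j)) [0..<n]) [0..<m]"
    using Wf gc basis_closed by (intro cspace.lsum_swap[OF cC]) (auto intro!: C.mult_closed Rc H.mult_closed)
  also have "\<dots> = lsum C (\<lambda>j. counit H (d j) \<odot>\<^sub>C W (f j)) [0..<m]"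
  proof (rule lsum_cong_upt)
    fix j assume j: "j < m"
    note l = lin_mult_right[OF sC Wf[OF j] lin_R[OF uc]]
    have "lsum C (\<lambda>i. R u (e i \<otimes>\<^sub>H ?g j (e' i)) \<otimes>\<^sub>C W (f j)) [0..<n]
        = R u (lsum H (\<lambda>i. e i \<otimes>\<^sub>H ?g j (e' i)) [0..<n]) \<otimes>\<^sub>C W (f j)"
      using gc[OF j] basis_closed by (intro lin_lsum_apply[OF cH cC l, symmetric]) (auto intro!: H.mult_closed)
    also have "\<dots> = counit H (d j) \<odot>\<^sub>C W (f j)"
      by (simp only: H.casimir_counit[OF haar db c(1)[OF j]] linD(3)[OF l H.one_closed] R_one[OF u]
          C.mult_one_left[OF Wf[OF j]])
    finally show "lsum C (\<lambda>i. R u (e i \<otimes>\<^sub>H ?g j (e' i)) \<otimes>\<^sub>C W (f j)) [0..<n] = \<dots>" .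
  qed
  also have "\<dots> = \<one>\<^sub>C"
    unfolding W_counit[symmetric] W_def by (rule slice_expand[OF cC cH co H.lin_counit wc, symmetric])
  finally show ?thesis .
qed

text \<open>The second cocycle identity of \<open>w\<close> makes \<open>p\<close> invariant, so that it lies in the sequence algebra of \<open>A\<close>.\<close>

lemma p_sequence:
  obtains a where "\<And>m. a m \<in> carrier A" "(\<lambda>m. ja (a m)) \<in> carrier LB" "W \<tau> = cls (\<lambda>m. ja (a m))"
proof -
  obtain k d f where co: "coordinates H k d f" using H.exists_basis by blast
  note c = coordinatesD[OF co]
  let ?p = "tens C H (W \<tau>) \<one>\<^sub>H"
  have tp: "?p \<in> carrier CH" by (rule tens_closed[OF pc H.one_closed])
  obtain s where s: "s \<in> carrier LB" "W \<tau> = cls s" using N.cls_surj[OF pc] by blast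
  have sp: "sco (W \<tau>) \<in> carrier CH" unfolding s(2) by (rule sco_slice(1)[OF s(1)])
  have "sco (W \<tau>) \<otimes>\<^sub>C\<^sub>H w = ?p \<otimes>\<^sub>C\<^sub>H w"
  proof (rule slices_separate[OF cC cH co CH.mult_closed[OF sp wc] CH.mult_closed[OF tp wc]])
    fix i assume i: "i < k"
    note fi = c(2)[OF i]
    have "slice C (f i) (sco (W \<tau>) \<otimes>\<^sub>C\<^sub>H w) = f i \<one>\<^sub>H \<odot>\<^sub>C W \<tau>"
      by (simp only: sco_W[OF fi lt] W_mult[OF fi lt, symmetric] p_absorbs[OF fi])
    also have "\<dots> = W \<tau> \<otimes>\<^sub>C slice C (\<lambda>l. f i (\<one>\<^sub>H \<otimes>\<^sub>H l)) w"
      unfolding p_absorbs(2)[OF fi, symmetric] W_def[of "f i"]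
      by (rule arg_cong[OF slice_cong[OF cC cH wc]]) (simp only: H.mult_one_left)
    also have "\<dots> = slice C (f i) (?p \<otimes>\<^sub>C\<^sub>H w)"
      by (rule slice_tens_mult_left[OF sC sH fi pc H.one_closed wc, symmetric])
    finally show "slice C (f i) (sco (W \<tau>) \<otimes>\<^sub>C\<^sub>H w) = slice C (f i) (?p \<otimes>\<^sub>C\<^sub>H w)" .
  qed
  then have "sco (W \<tau>) \<otimes>\<^sub>C\<^sub>H w \<otimes>\<^sub>C\<^sub>H star CH w = ?p \<otimes>\<^sub>C\<^sub>H w \<otimes>\<^sub>C\<^sub>H star CH w" by simp
  then have sco: "sco (W \<tau>) = ?p"
    by (simp only: CH.mult_assoc[OF sp wc CH.star_closed[OF wc]] CH.mult_assoc[OF tp wc CH.star_closed[OF wc]]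
        w_right CH.mult_one_right[OF sp] CH.mult_one_right[OF tp])
  have sm: "s m \<in> carrier B" for m using s(1) by auto
  let ?a = "\<lambda>m. slice A \<tau> (s m)"
  have ac: "?a m \<in> carrier A" for m by (rule linD(1)[OF lin_slice_B[OF lt] sm])
  have ce: "(\<lambda>m. cexp \<tau> (s m)) = (\<lambda>m. ja (?a m))" by (rule ext) (rule cexp_haar[OF haar sm])
  have "W \<tau> = slice C \<tau> ?p"
    by (simp only: slice_tens[OF cC cH lt pc H.one_closed] H.tau_one[OF haar] cspace.scale_one[OF cC pc])
  also have "\<dots> = slice C \<tau> (sco (cls s))" by (simp only: sco[symmetric] s(2)[symmetric])
  also have "\<dots> = cls (\<lambda>m. ja (?a m))" unfolding sco_slice(2)[OF s(1) lt] ce ..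
  finally have "W \<tau> = cls (\<lambda>m. ja (?a m))" .
  with N.bounded_map_L[OF cexp_bounded[OF lt] s(1)] ac show thesis
    unfolding ce by (rule_tac that[of ?a]) auto
qed

end

end

section \<open>Intertwining unitaries\<close>

context coaction_of_dual
begin

text \<open>An exact solution \<open>z\<close> of \<open>v \<rho>(z) = z \<otimes> 1\<close>, embedded in the crossed product as \<open>b\<close>.\<close>

definition trivializes :: "('a \<times> ('h \<Rightarrow> complex)) list set \<Rightarrow> ('a \<times> 'h) list set \<Rightarrow> bool" where
  "trivializes v b \<longleftrightarrow> (\<exists>z\<in>carrier A. b = ja z \<and> v \<otimes>\<^sub>A\<^sub>D \<rho> z = tens A D z \<one>\<^sub>D)"

lemma trivializes_closed: "trivializes v b \<Longrightarrow> b \<in> carrier B"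
  by (auto simp: trivializes_def ja_closed)

lemma trivializes_intertwines:
  "v \<in> carrier AD \<Longrightarrow> trivializes v b \<Longrightarrow> h \<in> carrier H \<Longrightarrow>
    rep v h \<otimes>\<^sub>B b = b \<otimes>\<^sub>B rep \<one>\<^sub>A\<^sub>D h"
  using intertwiner_iff' by (auto simp: trivializes_def)

lemma ja_square: "z \<in> carrier A \<Longrightarrow> star B (ja z) \<otimes>\<^sub>B ja z = ja (star A z \<otimes>\<^sub>A z)"
  by (simp only: ja_star ja_mult A.star_closed)

lemma trivializes_square_commutes:
  assumes v: "unitary AD v" and b: "trivializes v b" and h: "h \<in> carrier H"
  shows "rep \<one>\<^sub>A\<^sub>D h \<otimes>\<^sub>B (star B b \<otimes>\<^sub>B b) = star B b \<otimes>\<^sub>B b \<otimes>\<^sub>B rep \<one>\<^sub>A\<^sub>D h"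
proof -
  interpret AD: star_algebra AD by (rule sAD)
  obtain z where z: "z \<in> carrier A" "b = ja z" "v \<otimes>\<^sub>A\<^sub>D \<rho> z = tens A D z \<one>\<^sub>D"
    using b by (auto simp: trivializes_def)
  have c: "star A z \<otimes>\<^sub>A z \<in> carrier A" by (intro A.mult_closed A.star_closed z)
  have "\<one>\<^sub>A\<^sub>D \<otimes>\<^sub>A\<^sub>D \<rho> (star A z \<otimes>\<^sub>A z) = tens A D (star A z \<otimes>\<^sub>A z) \<one>\<^sub>D"
    by (simp only: rho_square[OF v z(1,3)] AD.mult_one_left[OF tens_closed[OF c one_D]])
  then show ?thesis
    using intertwiner_iff'[OF one_AD c] h by (simp only: z(2) ja_square[OF z(1)]) blast
qed

end

context rohlin_coaction
begin

text \<open>The correcting factor is a polynomial in \<open>z\<^sup>*z\<close>, hence fixed by \<open>\<rho>\<close>.\<close>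

lemma trivializes_newton:
  assumes v: "unitary AD v" and b: "trivializes v b"
  shows "trivializes v (N.newton b)"
proof -
  interpret AD: star_algebra AD by (rule sAD)
  interpret As: cspace A by (rule cA)
  obtain z where z: "z \<in> carrier A" "b = ja z" "v \<otimes>\<^sub>A\<^sub>D \<rho> z = tens A D z \<one>\<^sub>D"
    using b by (auto simp: trivializes_def)
  have vc: "v \<in> carrier AD" using v by (simp add: unitary_def)
  let ?q = "star A z \<otimes>\<^sub>A z"
  let ?c = "\<one>\<^sub>A \<oplus>\<^bsub>A\<^esub> (1/2) \<odot>\<^sub>A (\<one>\<^sub>A \<oplus>\<^bsub>A\<^esub> (-1) \<odot>\<^sub>A ?q)"
  have q: "?q \<in> carrier A" by (intro A.mult_closed A.star_closed z)
  note cl = q A.one_closed As.scale_closed A.add_closed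
  have c: "?c \<in> carrier A" by (intro cl)
  have f: "f ?c = f \<one>\<^sub>A \<oplus>\<^bsub>M\<^esub> (1/2) \<odot>\<^bsub>M\<^esub> (f \<one>\<^sub>A \<oplus>\<^bsub>M\<^esub> (-1) \<odot>\<^bsub>M\<^esub> f ?q)" if f: "lin A M f"
    for M :: "('x, 'y) star_alg_scheme" and f
    by (simp only: linD(2,3)[OF f] cl)
  have rc: "\<rho> ?c = tens A D ?c \<one>\<^sub>D"
    unfolding f[OF lin_rho] f[OF lin_tens_one] rho_square[OF v z(1,3)] rho_one tensor_sel(3) ..
  have "N.newton b = ja z \<otimes>\<^sub>B ja ?c"
    unfolding N.newton_def z(2) ja_square[OF z(1)] f[OF lin_ja] ja_one
      N.sub_eq[OF B.one_closed ja_closed[OF q]] ..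
  then have e: "N.newton b = ja (z \<otimes>\<^sub>A ?c)" by (simp only: ja_mult[OF z(1) c])
  have "v \<otimes>\<^sub>A\<^sub>D \<rho> (z \<otimes>\<^sub>A ?c) = v \<otimes>\<^sub>A\<^sub>D \<rho> z \<otimes>\<^sub>A\<^sub>D \<rho> ?c"
    unfolding rho_mult[OF z(1) c] by (rule AD.mult_assoc[OF vc rho_closed[OF z(1)] rho_closed[OF c], symmetric])
  also have "\<dots> = tens A D (z \<otimes>\<^sub>A ?c) \<one>\<^sub>D" unfolding z(3) rc by (rule tens_one_mult[OF z(1) c])
  finally show ?thesis unfolding trivializes_def using e A.mult_closed[OF z(1) c] by blast
qed

lemma casimir_sum_cls:
  assumes v: "v \<in> carrier AD" and s: "s \<in> carrier LB"
    and ee: "\<And>i. i < n \<Longrightarrow> e i \<in> carrier H \<and> e' i \<in> carrier H"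
  defines "S \<equiv> \<lambda>m. casimir_sum n e e' B (rep v) (rep \<one>\<^sub>A\<^sub>D) (s m)"
  shows "S \<in> carrier LB" "casimir_sum n e e' C (R v) (R \<one>\<^sub>A\<^sub>D) (cls s) = cls S"
proof -
  let ?f = "\<lambda>i m. rep v (e i) \<otimes>\<^sub>B (s m \<otimes>\<^sub>B rep \<one>\<^sub>A\<^sub>D (e' i))"
  have L: "(\<lambda>m. rep v (e i)) \<in> carrier LB" "(\<lambda>m. rep \<one>\<^sub>A\<^sub>D (e' i)) \<in> carrier LB" if "i < n" for i
    using ee[OF that] by (intro N.L_const rep_closed v one_AD; blast)+
  have gL: "?f i \<in> carrier LB" if "i < n" for i by (intro N.L_mult L that s)
  have S: "S = lsum LB ?f [0..<n]"
    by (rule ext) (simp add: S_def casimir_sum_def list_sum_L)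
  show "S \<in> carrier LB" unfolding S using gL by (intro cspace.lsum_closed[OF cL]) auto
  have "casimir_sum n e e' C (R v) (R \<one>\<^sub>A\<^sub>D) (cls s) = lsum C (\<lambda>i. cls (?f i)) [0..<n]"
    unfolding casimir_sum_def
  proof (rule lsum_cong_upt)
    fix i assume i: "i < n"
    show "R v (e i) \<otimes>\<^sub>C (cls s \<otimes>\<^sub>C R \<one>\<^sub>A\<^sub>D (e' i)) = cls (?f i)"
      by (simp only: R_def N.const_def N.cls_mult[OF s L(2)[OF i]] N.cls_mult[OF L(1)[OF i] N.L_mult[OF s L(2)[OF i]]])
  qed
  also have "\<dots> = cls S"
    unfolding S using gL by (intro lin_lsum_apply[OF cL cC N.lin_cls, symmetric]) auto
  finally show "casimir_sum n e e' C (R v) (R \<one>\<^sub>A\<^sub>D) (cls s) = cls S" .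
qed

text \<open>
  A unitary of the sequence algebra that is represented by elements of \<open>A\<close> trivializing \<open>v\<close> can be
  replaced by a unitary of \<open>A\<close>: the unitary part of a sufficiently late term of the sequence.
\<close>

lemma unitary_from_sequence:
  assumes \<tau>: "H.haar \<tau>" and v: "unitary AD v" and b: "\<And>m. trivializes v (b m)"
    and bL: "b \<in> carrier LB" and u: "unitary C (cls b)"
  shows "\<exists>x. unitary A x \<and> v \<otimes>\<^sub>A\<^sub>D \<rho> x = tens A D x \<one>\<^sub>D"
proof -
  note lt = H.lin_tau[OF \<tau>]
  have vc: "v \<in> carrier AD" using v by (simp add: unitary_def)
  have bc: "b m \<in> carrier B" for m by (rule trivializes_closed[OF b])
  note sL = N.L_star[OF bL]
  have "cls (\<lambda>m. star B (b m) \<otimes>\<^sub>B b m) = cls (\<lambda>m. \<one>\<^sub>B)" "cls (\<lambda>m. b m \<otimes>\<^sub>B star B (b m)) = cls (\<lambda>m. \<one>\<^sub>B)"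
    using u by (simp_all only: unitary_def N.cls_mult[OF sL bL] N.cls_mult[OF bL sL] N.cls_star[OF bL] N.cls_one)
  then have "(\<lambda>m. nrmB (\<one>\<^sub>B \<ominus>\<^bsub>B\<^esub> star B (b m) \<otimes>\<^sub>B b m)) \<longlonglongrightarrow> 0"
    "(\<lambda>m. nrmB (\<one>\<^sub>B \<ominus>\<^bsub>B\<^esub> b m \<otimes>\<^sub>B star B (b m))) \<longlonglongrightarrow> 0"
    using N.cls_eq_iff[OF N.L_mult[OF sL bL] N.L_const[OF B.one_closed]]
      N.cls_eq_iff[OF N.L_mult[OF bL sL] N.L_const[OF B.one_closed]] by auto
  from eventually_conj[OF order_tendstoD(2)[OF this(1), of "1/2"] order_tendstoD(2)[OF this(2), of "1/2"]]
  obtain m where "nrmB (\<one>\<^sub>B \<ominus>\<^bsub>B\<^esub> star B (b m) \<otimes>\<^sub>B b m) < 1/2" "nrmB (\<one>\<^sub>B \<ominus>\<^bsub>B\<^esub> b m \<otimes>\<^sub>B star B (b m)) < 1/2"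
    by (auto dest: eventually_happens)
  from N.newton_limit[OF bc[of m] less_imp_le[OF this(1)] less_imp_le[OF this(2)]]
  obtain X where X: "unitary B X" and itL: "(\<lambda>k. (N.newton ^^ k) (b m)) \<in> carrier LB"
    and lim: "cls (\<lambda>k. (N.newton ^^ k) (b m)) = const X" by blast
  define s where "s k = (N.newton ^^ k) (b m)" for k
  have sL: "s \<in> carrier LB" and lim: "cls s = const X" using itL lim by (simp_all add: s_def[abs_def])
  have st: "trivializes v (s k)" for k
    unfolding s_def by (induction k) (simp_all add: b trivializes_newton[OF v])
  have Xc: "X \<in> carrier B" using X by (simp add: unitary_def)
  \<comment> \<open>The iterates, and with them \<open>X\<close>, are fixed by the expectation onto \<open>A\<close>.\<close>
  have "cexp \<tau> (s k) = s k" for k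
    using st[of k] by (auto simp: trivializes_def cexp_ja[OF lt] H.tau_one[OF \<tau>] cspace.scale_one[OF cB] ja_closed)
  then have "const (cexp \<tau> X) = const X"
    using N.bounded_map_cls[OF cexp_bounded[OF lt] sL N.L_const[OF Xc]] lim by (simp add: N.const_def)
  then have "cexp \<tau> X = X" by (rule N.const_inj[OF cexp_closed[OF lt Xc] Xc])
  then have Xj: "X = ja (slice A \<tau> X)" by (simp only: cexp_haar[OF \<tau> Xc])
  let ?x = "slice A \<tau> X"
  have x: "?x \<in> carrier A" by (rule linD(1)[OF lin_slice_B[OF lt] Xc])
  note xs = A.star_closed[OF x]
  have "rep v h \<otimes>\<^sub>B X = X \<otimes>\<^sub>B rep \<one>\<^sub>A\<^sub>D h" if h: "h \<in> carrier H" for h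
  proof -
    note rc = rep_closed[OF vc h] and ic = rep_closed[OF one_AD h]
    have "const (rep v h \<otimes>\<^sub>B X) = cls (\<lambda>k. rep v h \<otimes>\<^sub>B s k)"
      by (simp only: N.const_mult[OF rc Xc] lim[symmetric] N.const_def[of "rep v h"] N.cls_mult[OF N.L_const[OF rc] sL])
    also have "\<dots> = cls (\<lambda>k. s k \<otimes>\<^sub>B rep \<one>\<^sub>A\<^sub>D h)"
      by (simp only: trivializes_intertwines[OF vc st h])
    also have "\<dots> = const (X \<otimes>\<^sub>B rep \<one>\<^sub>A\<^sub>D h)"
      by (simp only: N.const_mult[OF Xc ic] lim[symmetric] N.const_def[of "rep \<one>\<^sub>A\<^sub>D h"] N.cls_mult[OF sL N.L_const[OF ic]])
    finally show ?thesis
      by (rule N.const_inj[OF B.mult_closed[OF rc Xc] B.mult_closed[OF Xc ic]])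
  qed
  then have "v \<otimes>\<^sub>A\<^sub>D \<rho> ?x = tens A D ?x \<one>\<^sub>D"
    using intertwiner_iff'[OF vc x] by (simp only: Xj[symmetric]) blast
  moreover have "ja (star A ?x \<otimes>\<^sub>A ?x) = ja \<one>\<^sub>A" "ja (?x \<otimes>\<^sub>A star A ?x) = ja \<one>\<^sub>A"
    using X by (simp_all only: unitary_def ja_mult[OF xs x] ja_mult[OF x xs] ja_star[OF x, symmetric] Xj[symmetric] ja_one)
  then have "unitary A ?x"
    unfolding unitary_def using x xs by (auto intro!: ja_inj A.mult_closed A.one_closed)
  ultimately show ?thesis by blast
qed

lemma exists_trivializing_unitary_nonzero:
  assumes ne: "\<one>\<^sub>C \<noteq> \<zero>\<^bsub>C\<^esub>" and v: "unitary AD v" and co: "cocycle v"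
  shows "\<exists>x. unitary A x \<and> v \<otimes>\<^sub>A\<^sub>D \<rho> x = tens A D x \<one>\<^sub>D"
proof -
  obtain \<tau> where \<tau>: "H.haar \<tau>" using exists_haar[OF ne] by blast
  obtain n e e' where db: "H.dual_bases \<tau> n e e'" using H.exists_dual_bases[OF \<tau>] by blast
  note bc = basis_closed[OF \<tau> db]
  note vc = cocycleD[OF co] and c1 = cocycle_one
  obtain a where a: "\<And>m. a m \<in> carrier A" and aL: "(\<lambda>m. ja (a m)) \<in> carrier LB"
    and p: "W \<tau> = cls (\<lambda>m. ja (a m))" using p_sequence[OF \<tau> db] by blast
  let ?x = "casimir_sum n e e' C (R v) (R \<one>\<^sub>A\<^sub>D) (W \<tau>)"
  define b where "b m = casimir_sum n e e' B (rep v) (rep \<one>\<^sub>A\<^sub>D) (ja (a m))" for m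
  have bL: "b \<in> carrier LB" and xb: "?x = cls b"
    using casimir_sum_cls[OF vc aL, of n e e'] bc by (simp_all add: p b_def[abs_def])
  have tb: "trivializes v (b m)" for m
  proof -
    let ?z = "coef (v \<otimes>\<^sub>A\<^sub>D \<rho> (a m)) (H.integral n e e')"
    have z: "?z \<in> carrier A"
      by (intro coef_closed star_algebra.mult_closed[OF sAD vc] rho_closed a H.integral_closed[OF \<tau> db])
    have bz: "b m = ja ?z" unfolding b_def by (rule casimir_sum_ja[OF \<tau> db vc a])
    have "rep v h \<otimes>\<^sub>B b m = b m \<otimes>\<^sub>B rep \<one>\<^sub>A\<^sub>D h" if "h \<in> carrier H" for h
      unfolding b_def
      by (rule H.casimir_sum_intertwines[OF \<tau> db sB algebra_rep_rep[OF co] algebra_rep_rep[OF c1] ja_closed[OF a] that])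
    then have "v \<otimes>\<^sub>A\<^sub>D \<rho> ?z = tens A D ?z \<one>\<^sub>D"
      using intertwiner_iff'[OF vc z] by (simp only: bz) blast
    then show ?thesis unfolding trivializes_def using z bz by blast
  qed
  have "unitary C ?x"
  proof (rule H.casimir_sum_unitary[OF \<tau> db sC algebra_rep_R[OF co] algebra_rep_R[OF c1]
        W_closed[OF H.lin_tau[OF \<tau>]] p_star[OF \<tau> db] p_rep_p[OF \<tau> db co] p_rep_p[OF \<tau> db c1]
        casimir_sum_p[OF \<tau> db co] casimir_sum_p[OF \<tau> db c1]])
    fix h assume h: "h \<in> carrier H"
    let ?i = "rep \<one>\<^sub>A\<^sub>D h"
    have iL: "(\<lambda>m. ?i) \<in> carrier LB" by (rule N.L_const[OF rep_closed[OF one_AD h]])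
    note sL = N.L_mult[OF N.L_star[OF bL] bL]
    have "star C ?x \<otimes>\<^sub>C ?x = cls (\<lambda>m. star B (b m) \<otimes>\<^sub>B b m)"
      by (simp only: xb N.cls_star[OF bL, symmetric] N.cls_mult[OF N.L_star[OF bL] bL, symmetric])
    then show "star C ?x \<otimes>\<^sub>C ?x \<otimes>\<^sub>C R \<one>\<^sub>A\<^sub>D h = R \<one>\<^sub>A\<^sub>D h \<otimes>\<^sub>C (star C ?x \<otimes>\<^sub>C ?x)"
      by (simp only: R_def N.const_def N.cls_mult[OF sL iL, symmetric] N.cls_mult[OF iL sL, symmetric]
          trivializes_square_commutes[OF v tb h])
  qed
  then show ?thesis unfolding xb by (rule unitary_from_sequence[OF \<tau> v tb bL])
qed

end

section \<open>Exterior equivalence\<close>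

context coaction_of_dual
begin

text \<open>The slice at \<open>(h, g)\<close> of the identity for \<open>v\<close>; at \<open>(1, 1)\<close> it shows that the invertible element
  \<open>v(1)\<close> is idempotent.\<close>

lemma cocycleI:
  assumes v: "unitary AD v"
    and e: "tassoc A D D (tens AD D v \<one>\<^sub>D \<otimes>\<^bsub>tensor AD D\<^esub> tmap AD D \<rho> id v)
      = tmap A (tensor D D) id (comult D) v"
  shows "cocycle v"
proof -
  interpret AD: star_algebra AD by (rule sAD)
  have vc: "v \<in> carrier AD" and vr: "v \<otimes>\<^sub>A\<^sub>D star AD v = \<one>\<^sub>A\<^sub>D" using v by (auto simp: unitary_def)
  let ?Y = "tmap AD D \<rho> id v"
  have Y: "?Y \<in> carrier (tensor AD D)" by (rule linD(1)[OF lin_tmap[OF cA cD cAD cD lin_rho lin_id'] vc])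
  have X: "tens AD D v \<one>\<^sub>D \<otimes>\<^bsub>tensor AD D\<^esub> ?Y \<in> carrier (tensor AD D)"
    by (rule star_algebra.mult_closed[OF star_algebra_tensor[OF sAD sD] tens_closed[OF vc one_D] Y])
  have mult: "sw H A (\<lambda>h1 h2. coef v h1 \<otimes>\<^sub>A act h2 (coef v g)) h = coef v (h \<otimes>\<^sub>H g)"
    if h: "h \<in> carrier H" and g: "g \<in> carrier H" for h g
  proof -
    note eh = H.lin_eval[OF h] and eg = H.lin_eval[OF g]
    have "coef v (h \<otimes>\<^sub>H g) = slice A (tpair (ev h) (ev g)) (tassoc A D D (tens AD D v \<one>\<^sub>D \<otimes>\<^bsub>tensor AD D\<^esub> ?Y))"
      unfolding e by (rule slice_dual_comult[OF vc h g, symmetric])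
    also have "\<dots> = slice A (ev h) (slice AD (ev g) (tens AD D v \<one>\<^sub>D \<otimes>\<^bsub>tensor AD D\<^esub> ?Y))"
      by (rule slice_tassoc[OF cA cD cD eh eg X])
    also have "slice AD (ev g) (tens AD D v \<one>\<^sub>D \<otimes>\<^bsub>tensor AD D\<^esub> ?Y)
        = v \<otimes>\<^sub>A\<^sub>D slice AD (\<lambda>l. ev g (\<one>\<^sub>D \<otimes>\<^sub>D l)) ?Y"
      by (rule slice_tens_mult_left[OF sAD sD eg vc one_D Y])
    also have "slice AD (\<lambda>l. ev g (\<one>\<^sub>D \<otimes>\<^sub>D l)) ?Y = slice AD (ev g) ?Y"
      by (rule slice_cong[OF cAD cD Y]) (simp only: star_algebra.mult_one_left[OF sD])
    also have "\<dots> = \<rho> (coef v g)"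
      by (simp add: slice_tmap[OF cA cD cAD cD lin_rho lin_id' eg vc] coef_def)
    also have "slice A (ev h) (v \<otimes>\<^sub>A\<^sub>D \<rho> (coef v g)) = coef (v \<otimes>\<^sub>A\<^sub>D \<rho> (coef v g)) h"
      by (simp only: coef_def)
    also have "\<dots> = sw H A (\<lambda>h1 h2. coef v h1 \<otimes>\<^sub>A act h2 (coef v g)) h"
      unfolding act_eq by (rule coef_mult[OF vc rho_closed[OF coef_closed[OF vc g]] h])
    finally show ?thesis ..
  qed
  let ?c = "coef v \<one>\<^sub>H" and ?d = "coef (star AD v) \<one>\<^sub>H"
  have vs: "star AD v \<in> carrier AD" by (rule AD.star_closed[OF vc])
  have c: "?c \<in> carrier A" and d: "?d \<in> carrier A" by (intro coef_closed vc vs H.one_closed)+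
  have "?c \<otimes>\<^sub>A ?d = coef \<one>\<^sub>A\<^sub>D \<one>\<^sub>H"
    unfolding vr[symmetric] coef_mult[OF vc vs H.one_closed]
    by (rule H.sw_one[OF cA bil_A[OF lin_coef_right[OF vc] lin_coef_right[OF vs]], symmetric])
  then have cd: "?c \<otimes>\<^sub>A ?d = \<one>\<^sub>A"
    by (simp only: coef_unit[OF H.one_closed] H.counit_one cspace.scale_one[OF cA A.one_closed])
  have "?c \<otimes>\<^sub>A act \<one>\<^sub>H ?c = coef v (\<one>\<^sub>H \<otimes>\<^sub>H \<one>\<^sub>H)"
    unfolding mult[OF H.one_closed H.one_closed, symmetric]
    by (rule H.sw_one[OF cA bil_A[OF lin_coef_right[OF vc] lin_act_left[OF c]], symmetric])
  then have cc: "?c \<otimes>\<^sub>A ?c = ?c" by (simp only: act_one[OF c] H.mult_one_left[OF H.one_closed])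
  have "?c = ?c \<otimes>\<^sub>A (?c \<otimes>\<^sub>A ?d)" by (simp only: cd A.mult_one_right[OF c])
  also have "\<dots> = \<one>\<^sub>A" unfolding A.mult_assoc[OF c c d, symmetric] cc by (rule cd)
  finally show ?thesis unfolding cocycle_def using vc mult by blast
qed

text \<open>From \<open>v \<rho>(x) = x \<otimes> 1\<close> one reads off \<open>v = (x \<otimes> 1) \<rho>(x\<^sup>*)\<close>.\<close>

lemma Ad_trivialized:
  assumes v: "v \<in> carrier AD" and x: "unitary A x" and e: "v \<otimes>\<^sub>A\<^sub>D \<rho> x = tens A D x \<one>\<^sub>D"
    and a: "a \<in> carrier A"
  shows "Ad AD v (\<rho> a) = Ad AD (tens A D x \<one>\<^sub>D) (\<rho> (Ad A (star A x) a))"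
proof -
  interpret AD: star_algebra AD by (rule sAD)
  have xc: "x \<in> carrier A" and xr: "x \<otimes>\<^sub>A star A x = \<one>\<^sub>A" using x by (auto simp: unitary_def)
  note xs = A.star_closed[OF xc]
  let ?t = "tens A D x \<one>\<^sub>D"
  have t: "?t \<in> carrier AD" by (rule tens_closed[OF xc one_D])
  note r = rho_closed[OF xc] rho_closed[OF xs] rho_closed[OF a]
  have "v = v \<otimes>\<^sub>A\<^sub>D \<rho> (x \<otimes>\<^sub>A star A x)" by (simp only: xr rho_one AD.mult_one_right[OF v])
  also have "\<dots> = ?t \<otimes>\<^sub>A\<^sub>D \<rho> (star A x)"
    by (simp only: rho_mult[OF xc xs] AD.mult_assoc[OF v r(1,2), symmetric] e)
  finally have ve: "v = ?t \<otimes>\<^sub>A\<^sub>D \<rho> (star A x)" .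
  have s: "star AD v = \<rho> x \<otimes>\<^sub>A\<^sub>D star AD ?t"
    unfolding ve AD.star_mult[OF t r(2)] rho_star[OF xs, symmetric] A.star_star[OF xc] ..
  have "Ad A (star A x) a = star A x \<otimes>\<^sub>A a \<otimes>\<^sub>A x" by (simp only: Ad_def A.star_star[OF xc])
  then have ra: "\<rho> (Ad A (star A x) a) = \<rho> (star A x) \<otimes>\<^sub>A\<^sub>D \<rho> a \<otimes>\<^sub>A\<^sub>D \<rho> x"
    by (simp only: rho_mult[OF A.mult_closed[OF xs a] xc] rho_mult[OF xs a])
  note cl = r t AD.star_closed[OF t] AD.mult_closed
  show ?thesis unfolding Ad_def[of AD] s ra unfolding ve by (simp only: AD.mult_assoc cl)
qed

end

lemma (in star_algebra) zero_algebra: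
  assumes "\<one> = \<zero>" "x \<in> carrier A"
  shows "x = \<zero>"
  using assms ring.ring_simprules(24)[OF is_ring, of x] mult_one_left[of x] by simp

lemma (in rohlin_coaction) exists_trivializing_unitary:
  assumes v: "unitary AD v" and co: "cocycle v"
  shows "\<exists>x. unitary A x \<and> v \<otimes>\<^sub>A\<^sub>D \<rho> x = tens A D x \<one>\<^sub>D"
proof (cases "\<one>\<^sub>C = \<zero>\<^bsub>C\<^esub>")
  case True
  \<comment> \<open>Then \<open>A = 0\<close>, and any element will do.\<close>
  interpret AD: star_algebra AD by (rule sAD)
  note z = B.zero_closed
  have "const \<one>\<^sub>B = const \<zero>\<^bsub>B\<^esub>" using True by (simp only: N.const_one N.const_def[of "\<zero>\<^bsub>B\<^esub>"] N.cls_zero)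
  then have "\<one>\<^sub>B = \<zero>\<^bsub>B\<^esub>" by (rule N.const_inj[OF B.one_closed z])
  then have "ja \<one>\<^sub>A = ja \<zero>\<^bsub>A\<^esub>" by (simp only: ja_one lin_zero[OF cA cB lin_ja])
  then have 0: "\<one>\<^sub>A = \<zero>\<^bsub>A\<^esub>" by (rule ja_inj[OF A.one_closed A.zero_closed])
  have "\<one>\<^sub>A\<^sub>D = \<zero>\<^bsub>AD\<^esub>" unfolding tensor_sel(3) 0 by (rule lin_zero[OF cA cAD lin_tens_one])
  then have "v \<otimes>\<^sub>A\<^sub>D \<rho> \<one>\<^sub>A = tens A D \<one>\<^sub>A \<one>\<^sub>D"
    using AD.zero_algebra AD.mult_closed[OF cocycleD[OF co] rho_closed[OF A.one_closed]]
      tens_closed[OF A.one_closed one_D] by metis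
  moreover have "unitary A \<one>\<^sub>A"
    by (simp add: unitary_def A.star_one A.one_closed A.mult_one_left)
  ultimately show ?thesis by blast
next
  case False
  then show ?thesis by (rule exists_trivializing_unitary_nonzero[OF _ v co])
qed

theorem theorem8p3:
  fixes A :: "'a star_alg" and nrmA :: "'a \<Rightarrow> real"
    and H :: "'h hopf" and nrmH :: "'h \<Rightarrow> real"
    and \<rho> \<sigma> :: "'a \<Rightarrow> ('a \<times> ('h \<Rightarrow> complex)) list set"
  assumes "cstar_algebra A nrmA"
    and "cstar_hopf_algebra H nrmH"
    and "coaction A (dual H) \<rho>"
    and "coaction A (dual H) \<sigma>"
    and "exterior_equivalent A (dual H) \<rho> \<sigma>"
    and "rohlin_property A H \<rho>"
  shows "\<exists>x. unitary A x \<and>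
    (\<forall>a\<in>carrier A. \<sigma> a =
       Ad (tensor A (dual H)) (tens A (dual H) x \<one>\<^bsub>dual H\<^esub>) (\<rho> (Ad A (star A x) a)))"
proof -
  let ?D = "dual H" and ?B = "crossed_product A H \<rho>"
  obtain nrmB where nB: "cstar_algebra ?B nrmB"
    and ar: "approximately_representable ?B nrmB H (dual_coaction A H \<rho>)"
    using assms(6) by (auto simp: rohlin_property_def)
  obtain v where v: "unitary (tensor A ?D) v"
    and \<sigma>: "\<And>a. a \<in> carrier A \<Longrightarrow> \<sigma> a = Ad (tensor A ?D) v (\<rho> a)"
    and vco: "tassoc A ?D ?D (tens (tensor A ?D) ?D v \<one>\<^bsub>?D\<^esub>
      \<otimes>\<^bsub>tensor (tensor A ?D) ?D\<^esub> tmap (tensor A ?D) ?D \<rho> id v) = tmap A (tensor ?D ?D) id (comult ?D) v"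
    using assms(5) by (auto simp: exterior_equivalent_def)
  interpret coaction_of_dual A H nrmH \<rho>
    using assms(1-3) nB unfolding coaction_of_dual_def coaction_of_dual_axioms_def cstar_algebra_def by blast
  interpret N: cstar_algebra ?B nrmB by (rule nB)
  have const: "N.const = (\<lambda>b. seq_class ?B nrmB (\<lambda>n. b))" by (rule ext) (rule N.const_def)
  obtain w where "rohlin_coaction A H nrmH \<rho> nrmB w"
    using ar unfolding approximately_representable_def Let_def const[symmetric]
    unfolding rohlin_coaction_def rohlin_coaction_axioms_def
    using coaction_of_dual_axioms nB by blast
  then interpret rohlin_coaction A H nrmH \<rho> nrmB w .
  obtain x where x: "unitary A x" and e: "v \<otimes>\<^bsub>AD\<^esub> \<rho> x = tens A D x \<one>\<^bsub>D\<^esub>"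
    using exists_trivializing_unitary[OF v cocycleI[OF v vco]] by blast
  have vc: "v \<in> carrier AD" using v by (simp add: unitary_def)
  show ?thesis using x \<sigma> Ad_trivialized[OF vc x e] by auto
qed

end
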